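(* Let $\tilde G$ denote the special fiber $\underline{G}\otimes_A\kappa$ of the smooth integral model $\underline{G}$, and let $G^\circ$ be the identity component of $G$. Let $M'=\mathrm{End}_B(L)$ and $H'=\{f: f \text{ a hermitian form on } L\}$; then $M'/\tilde T(A)$ and $H'/\tilde H(A)$ are finite (finitely generated torsion A-modules), and define the integer $N$ by $$q^N=\frac{\#(H'/\tilde H(A))}{\#(M'/\tilde T(A))}.$$ Then the local density of $(L,h)$ is $$\beta_L=\frac{1}{[G:G^\circ]}\, q^{N}\cdot q^{-\dim G}\cdot \#\tilde G(\kappa).$$
   Context: Setting. $F$ is a non-Archimedean local field with ring of integers $A$, uniformizer $\pi$, residue field $\kappa$ of cardinality $q$, residue characteristic $p$. $(K,\sigma)$ is one of: $K=F$ with $\mathrm{char}\,F\neq 2$ and $\sigma=\mathrm{id}$; $K=E$ a separable quadratic field extension of $F$ with $\sigma$ its nontrivial $F$-automorphism; $K=F\oplus F$ with $\sigma(x,y)=(y,x)$; $K=D$ the quaternion division algebra over $F$ with its standard involution. $B$ is the maximal $A$-order of $K$; $\epsilon\in\{1,-1\}$ is fixed. If $(K,\epsilon,p)\neq(F,1,2)$, $L$ is a free right $B$-module of rank $n$ with a $(\sigma,\epsilon)$-hermitian form $h:L\times L\to B$ ($h(va,wb)=\sigma(a)h(v,w)b$, $h(w,v)=\epsilon\sigma(h(v,w))$), and "hermitian form" means such a form. If $(K,\epsilon,p)=(F,1,2)$, $L$ is a free $A$-module of rank $n$ with a quadratic form $h:L\to A$, with $h(v,w)=\frac12(h(v+w)-h(v)-h(w))$,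 and "hermitian form" means quadratic form (conditions and formulas on forms are expressed via the associated bilinear form). $V=L\otimes_A F$ is nondegenerate. The dual lattice is $L^{\#}=\{x\in V: h(x,L)\subset B\}$, and it is assumed that $(L^{\#})^{\#}=L$. $G$ is the (smooth) algebraic group over $F$ with $G(E)=\mathrm{Aut}_{K\otimes_F E}(V\otimes_F E,h\otimes_F E)$. Tensor products are over $A$. For an $A$-algebra $R$ and $X\in\mathrm{End}_{B\otimes R}(L\otimes R)$, the adjoint $X^{ad}$ satisfies $h(X(v),w)=h(v,X^{ad}(w))$. Construction. For a flat $A$-algebra $R$: $T^0(R)=\{X\in\mathrm{End}_{B\otimes R}(L\otimes R): X(L^{\#}\otimes R)\subset L^{\#}\otimes R\}$; $H^0(R)$ is the set of hermitian forms $f$ on $L\otimes R$ with $f(L\otimes R,L^{\#}\otimes R)\subset B\otimes R$; $\varphi_{0,R}(X)=h\circ X$, $(h\circ X)(v,w)=h(X(v),X(w))$; $\psi_{0,R}(X)(v,w)=h(v,X(w))+h(X(v),w)$. Recursively, given $T^m(A)\subset T^0(A)$, let $\overline{\varphi_{m,A}}:T^m(A)\to H^0(A)/\psi_{0,A}(T^m(A))$ be $\varphi_{0,A}$ followed by the quotient map, and $T^{m+1}(A)=\{X\in T^m(A):\overline{\varphi_{m,A}}(X)=0=\overline{\varphi_{m,A}}(X^{ad})\}$; for flat $R$, $T^m(R)=R\otimes_A T^m(A)$. Let $\alpha\ge0$ be the smallest integer with $T^m(A)=T^\alpha(A)$ for all $m\ge\alpha$ (it exists). Put $\tilde T=T^\alpha$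 and $\tilde H(R)=\psi_{0,R}(\tilde T(R))$. For flat $R$ put $\underline M(R)=\{1+X:X\in\tilde T(R)\}$, $\underline H(R)=\{h+f:f\in\tilde H(R)\}$ (both represented by affine spaces over $A$); $\underline M^*$ is the open subgroup scheme of $\underline M$ of elements invertible in $\underline M$; $\underline M^*$ acts on $\underline H$ by $(h',m)\mapsto h'\circ m$; $\underline G$ is the stabilizer of $h$ in $\underline M^*$ (a smooth affine group scheme over $A$ with generic fiber $G$ and $\underline G(R)=\mathrm{Aut}_{B\otimes R}(L\otimes R,h\otimes R)$ for étale $R$). Local density. Let $\underline G'$ be the affine group scheme over $A$ with $\underline G'(R)=\mathrm{Aut}_{B\otimes R}(L\otimes R,h\otimes R)$. The local density of $(L,h)$ is $\beta_L=\frac{1}{[G:G^\circ]}\lim_{N\to\infty}q^{-N\dim G}\,\#\underline G'(A/\pi^NA)$.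
   Formalization: The case where K is the quaternion division algebra D and char F = 2 is excluded: there, for every n > 0, H'/H̃(A) is infinite (values ψ(X)(v,v) lie in F, while f(v,v) only has trace zero), so the integer N is undefined. *)

theory Defs
  imports
    "HOL-Analysis.Abstract_Topology_2"
    "HOL-Algebra.Algebraic_Closure_Type"
    "HOL-Library.Function_Algebras"
    "HOL-Library.Set_Algebras"
    "Jordan_Normal_Form.Matrix"
begin

(* Quotients of abelian groups as sets of cosets.  Maps and forms are added pointwise
   (HOL-Library.Function_Algebras). *)
definition quot :: "'a::ab_group_add set \<Rightarrow> 'a set \<Rightarrow> 'a set set" where
  "quot M N = (\<lambda>x. x +o N) ` M"

definition lin_comb :: "('r \<Rightarrow> 'w \<Rightarrow> 'w) \<Rightarrow> 'r list \<Rightarrow> 'w list \<Rightarrow> 'w::ab_group_add" where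
  "lin_comb s cs bs = sum_list (map2 s cs bs)"

definition is_basis :: "('r \<Rightarrow> 'w \<Rightarrow> 'w) \<Rightarrow> 'w::ab_group_add list \<Rightarrow> bool" where
  "is_basis s bs \<longleftrightarrow> (\<forall>x. \<exists>!cs. length cs = length bs \<and> x = lin_comb s cs bs)"

definition coords :: "('r \<Rightarrow> 'w \<Rightarrow> 'w) \<Rightarrow> 'w::ab_group_add list \<Rightarrow> 'w \<Rightarrow> 'r list" where
  "coords s bs x = (THE cs. length cs = length bs \<and> x = lin_comb s cs bs)"


section \<open>The data\<close>

(* F, K, V are the types 'f, 'k, 'v.  The lattice L and the ring B are subsets of V and K.
   A form on L, and a B-linear endomorphism of L, is represented by its unique
   extension to V. *)
record ('f, 'k, 'v) herm_data =
  val :: "'f \<Rightarrow> int"                  (* normalised valuation of F; irrelevant at 0 *)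
  unif :: "'f"                        (* the uniformizer pi *)
  emb :: "'f \<Rightarrow> 'k"                   (* structure map of the F-algebra K *)
  invol :: "'k \<Rightarrow> 'k"                 (* sigma *)
  intring :: "'k set"                 (* B *)
  eps :: "int"
  rmul :: "'v \<Rightarrow> 'k \<Rightarrow> 'v"             (* right scalar multiplication *)
  lat :: "'v set"                     (* L *)
  form :: "'v \<Rightarrow> 'v \<Rightarrow> 'k"             (* h *)

definition fmulK :: "('f, 'k::ring_1, 'v) herm_data \<Rightarrow> 'f \<Rightarrow> 'k \<Rightarrow> 'k" where
  "fmulK D a x = emb D a * x"

definition fmulV :: "('f, 'k, 'v) herm_data \<Rightarrow> 'f \<Rightarrow> 'v \<Rightarrow> 'v" where
  "fmulV D a x = rmul D x (emb D a)"

definition kmulV :: "('f, 'k, 'v) herm_data \<Rightarrow> 'k \<Rightarrow> 'v \<Rightarrow> 'v" where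
  "kmulV D c x = rmul D x c"

definition val_ring :: "('f::field, 'k, 'v) herm_data \<Rightarrow> 'f set" where
  "val_ring D = {x. x = 0 \<or> 0 \<le> val D x}"

definition max_ideal :: "('f::field, 'k, 'v) herm_data \<Rightarrow> 'f set" where
  "max_ideal D = (\<lambda>a. unif D * a) ` val_ring D"

definition residue_field :: "('f::field, 'k, 'v) herm_data \<Rightarrow> 'f set set" where
  "residue_field D = quot (val_ring D) (max_ideal D)"

definition residue_card :: "('f::field, 'k, 'v) herm_data \<Rightarrow> nat" where
  "residue_card D = card (residue_field D)"

definition residue_char :: "('f::field, 'k, 'v) herm_data \<Rightarrow> nat" where
  "residue_char D = (LEAST p. p > 0 \<and> of_nat p \<in> max_ideal D)"

definition nonarch_local_field :: "('f::field, 'k, 'v) herm_data \<Rightarrow> bool" where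
  "nonarch_local_field D \<longleftrightarrow>
     (\<forall>x y. x \<noteq> 0 \<longrightarrow> y \<noteq> 0 \<longrightarrow> val D (x * y) = val D x + val D y) \<and>
     (\<forall>x y. x \<noteq> 0 \<longrightarrow> y \<noteq> 0 \<longrightarrow> x + y \<noteq> 0 \<longrightarrow> min (val D x) (val D y) \<le> val D (x + y)) \<and>
     unif D \<noteq> 0 \<and> val D (unif D) = 1 \<and>
     finite (residue_field D) \<and>
     (\<forall>s :: nat \<Rightarrow> 'f.
        (\<forall>k. \<exists>N. \<forall>i\<ge>N. \<forall>j\<ge>N. s i = s j \<or> k \<le> val D (s i - s j)) \<longrightarrow>
        (\<exists>l. \<forall>k. \<exists>N. \<forall>i\<ge>N. s i = l \<or> k \<le> val D (s i - l)))"

definition F_algebra :: "('f::field, 'k::ring_1, 'v) herm_data \<Rightarrow> bool" where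
  "F_algebra D \<longleftrightarrow>
     (\<forall>a b. emb D (a + b) = emb D a + emb D b) \<and>
     (\<forall>a b. emb D (a * b) = emb D a * emb D b) \<and> emb D 1 = 1 \<and>
     (\<forall>a x. emb D a * x = x * emb D a)"

definition base_case :: "('f::field, 'k::ring_1, 'v) herm_data \<Rightarrow> bool" where
  "base_case D \<longleftrightarrow> surj (emb D) \<and> CHAR('f) \<noteq> 2 \<and> invol D = id"

(* Separability of K/F follows from the existence of a nontrivial F-automorphism. *)
definition quadratic_case :: "('f::field, 'k::ring_1, 'v) herm_data \<Rightarrow> bool" where
  "quadratic_case D \<longleftrightarrow>
     (\<forall>x y :: 'k. x * y = y * x) \<and> (\<forall>x :: 'k. x \<noteq> 0 \<longrightarrow> (\<exists>y. x * y = 1)) \<and>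
     (\<exists>bs. is_basis (fmulK D) bs \<and> length bs = 2) \<and>
     bij (invol D) \<and>
     (\<forall>x y. invol D (x + y) = invol D x + invol D y) \<and>
     (\<forall>x y. invol D (x * y) = invol D x * invol D y) \<and>
     (\<forall>a. invol D (emb D a) = emb D a) \<and> invol D \<noteq> id"

definition split_case :: "('f::field, 'k::ring_1, 'v) herm_data \<Rightarrow> bool" where
  "split_case D \<longleftrightarrow> (\<exists>u :: 'k \<Rightarrow> 'f \<times> 'f. bij u \<and>
     (\<forall>x y. u (x + y) = (fst (u x) + fst (u y), snd (u x) + snd (u y))) \<and>
     (\<forall>x y. u (x * y) = (fst (u x) * fst (u y), snd (u x) * snd (u y))) \<and>
     (\<forall>a. u (emb D a) = (a, a)) \<and>
     (\<forall>x. u (invol D x) = (snd (u x), fst (u x))))"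

(* A quaternion division algebra is a central division algebra of dimension 4; its
   standard involution is the F-linear involution with x + sigma x and x * sigma x
   in F for all x.  Pitfall: if char F = 2 and n > 0, the diagonal values psi(Y)(v, v) lie in
   F, whereas f(v, v) only has trace zero, so H' / H_tilde is infinite. *)
definition quaternion_case :: "('f::field, 'k::ring_1, 'v) herm_data \<Rightarrow> bool" where
  "quaternion_case D \<longleftrightarrow>
     (\<forall>x :: 'k. x \<noteq> 0 \<longrightarrow> (\<exists>y. x * y = 1 \<and> y * x = 1)) \<and>
     {x :: 'k. \<forall>y. x * y = y * x} = range (emb D) \<and>
     (\<exists>bs. is_basis (fmulK D) bs \<and> length bs = 4) \<and>
     (\<forall>x y. invol D (x + y) = invol D x + invol D y) \<and>
     (\<forall>x y. invol D (x * y) = invol D y * invol D x) \<and>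
     (\<forall>a. invol D (emb D a) = emb D a) \<and>
     (\<forall>x. invol D (invol D x) = x) \<and>
     (\<forall>x. x + invol D x \<in> range (emb D)) \<and>
     (\<forall>x. x * invol D x \<in> range (emb D))"

definition is_order :: "('f::field, 'k::ring_1, 'v) herm_data \<Rightarrow> 'k set \<Rightarrow> bool" where
  "is_order D R \<longleftrightarrow>
     1 \<in> R \<and> (\<forall>x\<in>R. \<forall>y\<in>R. x - y \<in> R \<and> x * y \<in> R) \<and>
     (\<exists>bs. R = {lin_comb (fmulK D) cs bs | cs. length cs = length bs \<and> set cs \<subseteq> val_ring D}) \<and>
     (\<forall>x. \<exists>a. a \<noteq> 0 \<and> emb D a * x \<in> R)"

definition maximal_order :: "('f::field, 'k::ring_1, 'v) herm_data \<Rightarrow> 'k set \<Rightarrow> bool" where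
  "maximal_order D R \<longleftrightarrow> is_order D R \<and> (\<forall>R'. is_order D R' \<longrightarrow> R \<subseteq> R' \<longrightarrow> R' = R)"

definition right_module :: "('f, 'k::ring_1, 'v::ab_group_add) herm_data \<Rightarrow> bool" where
  "right_module D \<longleftrightarrow>
     (\<forall>v w a. rmul D (v + w) a = rmul D v a + rmul D w a) \<and>
     (\<forall>v a b. rmul D v (a + b) = rmul D v a + rmul D v b) \<and>
     (\<forall>v a b. rmul D v (a * b) = rmul D (rmul D v a) b) \<and>
     (\<forall>v. rmul D v 1 = v)"

(* A B-basis of L is the same as a K-basis of V (= the F-span of L) whose B-span is L. *)
definition free_lattice :: "('f, 'k::ring_1, 'v::ab_group_add) herm_data \<Rightarrow> nat \<Rightarrow> bool" where
  "free_lattice D n \<longleftrightarrow> (\<exists>es. length es = n \<and> is_basis (kmulV D) es \<and>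
     lat D = {lin_comb (kmulV D) cs es | cs. length cs = n \<and> set cs \<subseteq> intring D})"


section \<open>Hermitian forms\<close>

(* (K, eps, p) = (F, 1, 2) *)
definition exceptional :: "('f::field, 'k::ring_1, 'v) herm_data \<Rightarrow> bool" where
  "exceptional D \<longleftrightarrow> surj (emb D) \<and> eps D = 1 \<and> residue_char D = 2"

definition eps_hermitian ::
  "('f, 'k::ring_1, 'v::ab_group_add) herm_data \<Rightarrow> ('v \<Rightarrow> 'v \<Rightarrow> 'k) \<Rightarrow> bool" where
  "eps_hermitian D f \<longleftrightarrow>
     (\<forall>u v w. f (u + v) w = f u w + f v w) \<and>
     (\<forall>u v w. f u (v + w) = f u v + f u w) \<and>
     (\<forall>v w a b. f (rmul D v a) (rmul D w b) = invol D a * f v w * b) \<and>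
     (\<forall>v w. f w v = of_int (eps D) * invol D (f v w))"

definition assoc_bilinear ::
  "('f::field, 'k::ring_1, 'v::ab_group_add) herm_data \<Rightarrow> ('v \<Rightarrow> 'f) \<Rightarrow> 'v \<Rightarrow> 'v \<Rightarrow> 'k" where
  "assoc_bilinear D Q v w = emb D ((Q (v + w) - Q v - Q w) / 2)"

definition quadratic_form ::
  "('f::field, 'k::ring_1, 'v::ab_group_add) herm_data \<Rightarrow> ('v \<Rightarrow> 'f) \<Rightarrow> bool" where
  "quadratic_form D Q \<longleftrightarrow>
     (\<forall>a v. Q (fmulV D a v) = a\<^sup>2 * Q v) \<and>
     (\<forall>u v w. assoc_bilinear D Q (u + v) w = assoc_bilinear D Q u w + assoc_bilinear D Q v w) \<and>
     (\<forall>a v w. assoc_bilinear D Q (fmulV D a v) w = emb D a * assoc_bilinear D Q v w)"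

(* The module H' of hermitian forms on L.  In the exceptional case these are the A-valued
   quadratic forms Q on L, each represented by its associated bilinear form f, so that
   Q v is recovered as f v v. *)
definition herm_forms ::
  "('f::field, 'k::ring_1, 'v::ab_group_add) herm_data \<Rightarrow> ('v \<Rightarrow> 'v \<Rightarrow> 'k) set" where
  "herm_forms D =
     (if exceptional D
      then {assoc_bilinear D Q | Q. quadratic_form D Q \<and> Q ` lat D \<subseteq> val_ring D}
      else {f. eps_hermitian D f \<and> (\<forall>v\<in>lat D. \<forall>w\<in>lat D. f v w \<in> intring D)})"

definition dual :: "('f, 'k, 'v) herm_data \<Rightarrow> 'v set \<Rightarrow> 'v set" where
  "dual D M = {x. \<forall>y\<in>M. form D x y \<in> intring D}"

definition hermitian_lattice ::
  "('f::field, 'k::ring_1, 'v::ab_group_add) herm_data \<Rightarrow> nat \<Rightarrow> bool" where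
  "hermitian_lattice D n \<longleftrightarrow>
     nonarch_local_field D \<and> F_algebra D \<and>
     (base_case D \<or> quadratic_case D \<or> split_case D \<or> quaternion_case D) \<and>
     maximal_order D (intring D) \<and> eps D \<in> {1, -1} \<and>
     right_module D \<and> free_lattice D n \<and>
     form D \<in> herm_forms D \<and>
     (\<forall>v. (\<forall>w. form D v w = 0) \<longrightarrow> v = 0) \<and>
     dual D (dual D (lat D)) = lat D"


section \<open>The filtration and the smooth integral model\<close>

definition K_linear :: "('f, 'k, 'v::ab_group_add) herm_data \<Rightarrow> ('v \<Rightarrow> 'v) \<Rightarrow> bool" where
  "K_linear D Y \<longleftrightarrow> (\<forall>v w. Y (v + w) = Y v + Y w) \<and> (\<forall>v a. Y (rmul D v a) = rmul D (Y v) a)"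

definition endos :: "('f, 'k, 'v::ab_group_add) herm_data \<Rightarrow> ('v \<Rightarrow> 'v) set" where
  "endos D = {Y. K_linear D Y \<and> Y ` lat D \<subseteq> lat D}"

definition pullback :: "('v \<Rightarrow> 'v \<Rightarrow> 'k) \<Rightarrow> ('v \<Rightarrow> 'v) \<Rightarrow> 'v \<Rightarrow> 'v \<Rightarrow> 'k" where
  "pullback f Y v w = f (Y v) (Y w)"

definition adj :: "('f, 'k, 'v::ab_group_add) herm_data \<Rightarrow> ('v \<Rightarrow> 'v) \<Rightarrow> 'v \<Rightarrow> 'v" where
  "adj D Y = (THE Z. K_linear D Z \<and> (\<forall>v w. form D (Y v) w = form D v (Z w)))"

definition phi :: "('f, 'k, 'v) herm_data \<Rightarrow> ('v \<Rightarrow> 'v) \<Rightarrow> 'v \<Rightarrow> 'v \<Rightarrow> 'k" where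
  "phi D Y = pullback (form D) Y"

definition psi :: "('f, 'k::ring_1, 'v) herm_data \<Rightarrow> ('v \<Rightarrow> 'v) \<Rightarrow> 'v \<Rightarrow> 'v \<Rightarrow> 'k" where
  "psi D Y v w = form D v (Y w) + form D (Y v) w"

definition T_zero :: "('f, 'k, 'v::ab_group_add) herm_data \<Rightarrow> ('v \<Rightarrow> 'v) set" where
  "T_zero D = {Y \<in> endos D. Y ` dual D (lat D) \<subseteq> dual D (lat D)}"

definition H_zero ::
  "('f::field, 'k::ring_1, 'v::ab_group_add) herm_data \<Rightarrow> ('v \<Rightarrow> 'v \<Rightarrow> 'k) set" where
  "H_zero D = {f \<in> herm_forms D. \<forall>v\<in>lat D. \<forall>w\<in>dual D (lat D). f v w \<in> intring D}"

(* phi followed by H_zero -> H_zero / psi(T); the class of phi(Y) is a coset of psi(T) *)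
definition phi_bar ::
  "('f, 'k::ring_1, 'v) herm_data \<Rightarrow> ('v \<Rightarrow> 'v) set \<Rightarrow> ('v \<Rightarrow> 'v) \<Rightarrow> ('v \<Rightarrow> 'v \<Rightarrow> 'k) set" where
  "phi_bar D T Y = phi D Y +o psi D ` T"

primrec T_filt ::
  "('f::field, 'k::ring_1, 'v::ab_group_add) herm_data \<Rightarrow> nat \<Rightarrow> ('v \<Rightarrow> 'v) set" where
  "T_filt D 0 = T_zero D"
| "T_filt D (Suc m) = {Y \<in> T_filt D m.
     phi_bar D (T_filt D m) Y = 0 +o psi D ` T_filt D m \<and>
     phi_bar D (T_filt D m) (adj D Y) = 0 +o psi D ` T_filt D m}"

definition alpha :: "('f::field, 'k::ring_1, 'v::ab_group_add) herm_data \<Rightarrow> nat" where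
  "alpha D = (LEAST a. \<forall>m\<ge>a. T_filt D m = T_filt D a)"

definition T_tilde ::
  "('f::field, 'k::ring_1, 'v::ab_group_add) herm_data \<Rightarrow> ('v \<Rightarrow> 'v) set" where
  "T_tilde D = T_filt D (alpha D)"

definition H_tilde ::
  "('f::field, 'k::ring_1, 'v::ab_group_add) herm_data \<Rightarrow> ('v \<Rightarrow> 'v \<Rightarrow> 'k) set" where
  "H_tilde D = psi D ` T_tilde D"

(* The schemes M and H are the affine spaces R \<mapsto> 1 + T_tilde \<otimes> R and R \<mapsto> h + H_tilde \<otimes> R.
   For R = kappa = A / pi A these tensor products are T_tilde / pi T_tilde and
   H_tilde / pi H_tilde, so kappa-points are cosets in 1 + T_tilde and h + H_tilde;
   the composition of M and its action on H are computed on representatives. *)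
definition pi_T :: "('f::field, 'k::ring_1, 'v::ab_group_add) herm_data \<Rightarrow> ('v \<Rightarrow> 'v) set" where
  "pi_T D = (\<lambda>Y v. fmulV D (unif D) (Y v)) ` T_tilde D"

definition pi_H ::
  "('f::field, 'k::ring_1, 'v::ab_group_add) herm_data \<Rightarrow> ('v \<Rightarrow> 'v \<Rightarrow> 'k) set" where
  "pi_H D = (\<lambda>f v w. fmulK D (unif D) (f v w)) ` H_tilde D"

definition M_kappa ::
  "('f::field, 'k::ring_1, 'v::ab_group_add) herm_data \<Rightarrow> ('v \<Rightarrow> 'v) set monoid" where
  "M_kappa D = \<lparr> carrier = quot (id +o T_tilde D) (pi_T D),
     monoid.mult = (\<lambda>C C'. \<Union>m\<in>C. \<Union>m'\<in>C'. (m \<circ> m') +o pi_T D),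
     one = id +o pi_T D \<rparr>"

definition act_kappa ::
  "('f::field, 'k::ring_1, 'v::ab_group_add) herm_data \<Rightarrow>
     ('v \<Rightarrow> 'v \<Rightarrow> 'k) set \<Rightarrow> ('v \<Rightarrow> 'v) set \<Rightarrow> ('v \<Rightarrow> 'v \<Rightarrow> 'k) set" where
  "act_kappa D E C = (\<Union>f\<in>E. \<Union>m\<in>C. pullback f m +o pi_H D)"

definition special_fiber_points ::
  "('f::field, 'k::ring_1, 'v::ab_group_add) herm_data \<Rightarrow> ('v \<Rightarrow> 'v) set set" where
  "special_fiber_points D =
     {C \<in> Units (M_kappa D). act_kappa D (form D +o pi_H D) C = form D +o pi_H D}"


section \<open>The generic fiber\<close>

(* G being smooth over F, its dimension and [G : G^0] are those of the group of points
   over an algebraic closure of F with its Zariski topology. *)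

inductive_set polynomial_functions :: "nat \<Rightarrow> ('s::comm_ring_1 mat \<Rightarrow> 's) set" for N where
  pf_const: "(\<lambda>g. c) \<in> polynomial_functions N"
| pf_entry: "i < N \<Longrightarrow> j < N \<Longrightarrow> (\<lambda>g. g $$ (i, j)) \<in> polynomial_functions N"
| pf_add: "p \<in> polynomial_functions N \<Longrightarrow> r \<in> polynomial_functions N \<Longrightarrow>
            (\<lambda>g. p g + r g) \<in> polynomial_functions N"
| pf_mult: "p \<in> polynomial_functions N \<Longrightarrow> r \<in> polynomial_functions N \<Longrightarrow>
            (\<lambda>g. p g * r g) \<in> polynomial_functions N"

definition zariski :: "nat \<Rightarrow> 's::comm_ring_1 mat set \<Rightarrow> 's mat topology" where
  "zariski N Y = topology (\<lambda>U. \<exists>P \<subseteq> polynomial_functions N. U = {x \<in> Y. \<exists>p\<in>P. p x \<noteq> 0})"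

definition irreducible_closed :: "'a topology \<Rightarrow> 'a set \<Rightarrow> bool" where
  "irreducible_closed T Z \<longleftrightarrow> closedin T Z \<and> Z \<noteq> {} \<and>
     (\<forall>C C'. closedin T C \<longrightarrow> closedin T C' \<longrightarrow> Z \<subseteq> C \<union> C' \<longrightarrow> Z \<subseteq> C \<or> Z \<subseteq> C')"

definition krull_dim :: "'a topology \<Rightarrow> nat" where
  "krull_dim T = Sup {m. \<exists>Z :: nat \<Rightarrow> 'a set.
     (\<forall>i\<le>m. irreducible_closed T (Z i)) \<and> (\<forall>i<m. Z i \<subset> Z (Suc i))}"

(* Auxiliary F-bases of V and K; nothing below depends on the choice. *)
definition basisV :: "('f::field, 'k::ring_1, 'v::ab_group_add) herm_data \<Rightarrow> 'v list" where
  "basisV D = (SOME bs. is_basis (fmulV D) bs)"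

definition basisK :: "('f::field, 'k::ring_1, 'v::ab_group_add) herm_data \<Rightarrow> 'k list" where
  "basisK D = (SOME bs. is_basis (fmulK D) bs)"

definition rmul_mat ::
  "('f::field, 'k::ring_1, 'v::ab_group_add) herm_data \<Rightarrow> 'k \<Rightarrow> 'f mat" where
  "rmul_mat D a = mat (length (basisV D)) (length (basisV D))
     (\<lambda>(i, j). coords (fmulV D) (basisV D) (rmul D (basisV D ! j) a) ! i)"

(* the l-th coordinate of h, an F-bilinear form on V *)
definition gram_mat ::
  "('f::field, 'k::ring_1, 'v::ab_group_add) herm_data \<Rightarrow> nat \<Rightarrow> 'f mat" where
  "gram_mat D l = mat (length (basisV D)) (length (basisV D))
     (\<lambda>(i, j). coords (fmulK D) (basisK D) (form D (basisV D ! i) (basisV D ! j)) ! l)"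

(* The group of points of G over the algebraic closure S of F: the S-linear automorphisms of
   V \<otimes> S commuting with K and preserving every coordinate of h \<otimes> S. *)
definition G_bar ::
  "('f::field, 'k::ring_1, 'v::ab_group_add) herm_data \<Rightarrow> 'f alg_closure mat set" where
  "G_bar D = {g \<in> carrier_mat (length (basisV D)) (length (basisV D)). invertible_mat g \<and>
     (\<forall>a. g * map_mat to_ac (rmul_mat D a) = map_mat to_ac (rmul_mat D a) * g) \<and>
     (\<forall>l < length (basisK D).
        transpose_mat g * map_mat to_ac (gram_mat D l) * g = map_mat to_ac (gram_mat D l))}"

definition G_topology ::
  "('f::field, 'k::ring_1, 'v::ab_group_add) herm_data \<Rightarrow> 'f alg_closure mat topology" where
  "G_topology D = zariski (length (basisV D)) (G_bar D)"

definition G_dim :: "('f::field, 'k::ring_1, 'v::ab_group_add) herm_data \<Rightarrow> nat" where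
  "G_dim D = krull_dim (G_topology D)"

definition G_identity_component ::
  "('f::field, 'k::ring_1, 'v::ab_group_add) herm_data \<Rightarrow> 'f alg_closure mat set" where
  "G_identity_component D =
     connected_component_of_set (G_topology D) (1\<^sub>m (length (basisV D)))"

definition G_component_index :: "('f::field, 'k::ring_1, 'v::ab_group_add) herm_data \<Rightarrow> nat" where
  "G_component_index D = card ((\<lambda>g. (\<lambda>x. g * x) ` G_identity_component D) ` G_bar D)"


section \<open>Local density\<close>

definition pi_pow_lat :: "('f::field, 'k, 'v) herm_data \<Rightarrow> nat \<Rightarrow> 'v set" where
  "pi_pow_lat D k = fmulV D (unif D ^ k) ` lat D"

definition pi_pow_B :: "('f::field, 'k::ring_1, 'v) herm_data \<Rightarrow> nat \<Rightarrow> 'k set" where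
  "pi_pow_B D k = fmulK D (unif D ^ k) ` intring D"

(* Aut of (L \<otimes> R, h \<otimes> R) for R = A / pi^k A, with L \<otimes> R = L / pi^k L.  In the exceptional case
   the form preserved is the quadratic form v \<mapsto> h v v. *)
definition Aut_mod ::
  "('f::field, 'k::ring_1, 'v::ab_group_add) herm_data \<Rightarrow> nat \<Rightarrow> ('v set \<Rightarrow> 'v set) set" where
  "Aut_mod D k =
     (let red = (\<lambda>v. v +o pi_pow_lat D k); LR = quot (lat D) (pi_pow_lat D k) in
      {\<theta> \<in> extensional LR. bij_betw \<theta> LR LR \<and>
        (\<forall>v\<in>lat D. \<forall>w\<in>lat D. \<forall>v'\<in>\<theta> (red v). \<forall>w'\<in>\<theta> (red w). \<theta> (red (v + w)) = red (v' + w')) \<and>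
        (\<forall>v\<in>lat D. \<forall>b\<in>intring D. \<forall>v'\<in>\<theta> (red v). \<theta> (red (rmul D v b)) = red (rmul D v' b)) \<and>
        (if exceptional D
         then \<forall>v\<in>lat D. \<forall>v'\<in>\<theta> (red v). form D v' v' - form D v v \<in> pi_pow_B D k
         else \<forall>v\<in>lat D. \<forall>w\<in>lat D. \<forall>v'\<in>\<theta> (red v). \<forall>w'\<in>\<theta> (red w).
                form D v' w' - form D v w \<in> pi_pow_B D k)})"

definition density_seq ::
  "('f::field, 'k::ring_1, 'v::ab_group_add) herm_data \<Rightarrow> nat \<Rightarrow> real" where
  "density_seq D k =
     real (residue_card D) powi (- (int k * int (G_dim D))) * real (card (Aut_mod D k))"

definition local_density :: "('f::field, 'k::ring_1, 'v::ab_group_add) herm_data \<Rightarrow> real" where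
  "local_density D = 1 / real (G_component_index D) * lim (density_seq D)"

end

theory Submission
  imports Defs "HOL-Computational_Algebra.Polynomial" "Jordan_Normal_Form.Determinant"
begin

text \<open>For large \<open>k\<close> every isometry of \<open>L\<close> modulo \<open>\<pi>\<^sup>k\<close> lies in \<open>1 + T\<close>. There the map
  \<open>U \<mapsto> h \<circ> U - h\<close> is a cocycle whose values modulo \<open>\<pi>\<^sup>j\<close> are all attained, so isometries
  for a finer congruence are counted by cosets of forms: replacing \<open>\<pi>\<^sup>k H'\<close> by \<open>\<pi>\<^sup>k H\<close> costs
  the index of \<open>H\<close> in \<open>H'\<close>, and passing from \<open>\<pi>\<^sup>j\<close> to \<open>\<pi>\<^bsup>j+1\<^esup>\<close> contributes
  \<open>[T : \<pi>T] / [H : \<pi>H] = q\<^sup>d\<close>, where \<open>d\<close> is the rank of the kernel of \<open>\<psi>\<close> on \<open>T\<close>. So the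
  normalised counts are eventually constant. That \<open>d\<close> is the dimension of \<open>G\<close> follows from the
  Cayley transform \<open>Z \<mapsto> 1 + Z\<^bsup>-1\<^esup>\<close>, a birational map from the affine space of all \<open>Z\<close> with
  \<open>\<psi>(Z) = -h\<close>. This space has a rational point because \<open>K\<close> contains a central element of trace
  \<open>1\<close>, also in characteristic two.\<close>


section \<open>Counting cosets\<close>

text \<open>The stable term \<open>T_tilde\<close> of the filtration is never computed. Of each
  stage only two facts are used: it is a ring stable under adjoints, and it contains one fixed
  multiple of \<open>T_zero\<close>. The second holds because a self-adjoint Z is represented by
  \<open>psi\<close> applied to Z times a scalar of trace one, and that scalar has bounded
  denominators. An approximate isometry 1 + Y satisfies phi(Y) + psi(Y) = h o (1 + Y) - h, which is
  small; if Y lies in one stage, then phi(Y) lies in the image of \<open>psi\<close> on it, and the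
  same for the adjoint puts Y in the next stage. Applied to \<pi>^j Y, with phi(Y) in
  \<open>H_tilde\<close> by stability, the identity leaves a quadratic error of order 2 j, harmless
  for j >= 1; so the cocycle attains every value. For the dimension, chains of irreducible closed
  sets are bounded from above by comparing the growth of two spaces of polynomials, and from below
  by the closures of the images of coordinate subspaces.\<close>

definition add_subgroup :: "'a::ab_group_add set \<Rightarrow> bool" where
  "add_subgroup N \<longleftrightarrow> 0 \<in> N \<and> (\<forall>x\<in>N. \<forall>y\<in>N. x - y \<in> N)"

lemma add_subgroupD:
  assumes "add_subgroup N"
  shows "0 \<in> N" "x \<in> N \<Longrightarrow> y \<in> N \<Longrightarrow> x - y \<in> N" "x \<in> N \<Longrightarrow> - x \<in> N"
    "x \<in> N \<Longrightarrow> y \<in> N \<Longrightarrow> x + y \<in> N"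
proof -
  show 0: "0 \<in> N" and d: "x \<in> N \<Longrightarrow> y \<in> N \<Longrightarrow> x - y \<in> N" for x y
    using assms by (auto simp: add_subgroup_def)
  show u: "x \<in> N \<Longrightarrow> - x \<in> N" for x
    using d[OF 0, of x] by simp
  show "x \<in> N \<Longrightarrow> y \<in> N \<Longrightarrow> x + y \<in> N"
    using d[of x "- y"] u[of y] by simp
qed

lemma elt_coset_iff: "x \<in> y +o N \<longleftrightarrow> x - y \<in> (N :: 'a::ab_group_add set)"
  by (auto simp: elt_set_plus_def algebra_simps intro: bexI[of _ "x - y"])

lemma coset_eq_iff:
  assumes "add_subgroup N"
  shows "x +o N = y +o N \<longleftrightarrow> x - y \<in> N"
proof
  assume "x +o N = y +o N"
  moreover have "x \<in> x +o N" using add_subgroupD(1)[OF assms] by (simp add: elt_coset_iff)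
  ultimately show "x - y \<in> N" by (simp add: elt_coset_iff)
next
  assume xy: "x - y \<in> N"
  have "z - x \<in> N \<longleftrightarrow> z - y \<in> N" for z
  proof
    assume "z - x \<in> N"
    from add_subgroupD(4)[OF assms this xy] show "z - y \<in> N" by simp
  next
    assume "z - y \<in> N"
    from add_subgroupD(2)[OF assms this xy] show "z - x \<in> N" by simp
  qed
  then show "x +o N = y +o N" by (auto simp: elt_coset_iff set_eq_iff)
qed

text \<open>The coset counts rest on this comparison of fibres; a bijection, rather than an equation
  of cardinalities, transfers finiteness as well.\<close>

lemma bij_betw_images:
  assumes "\<And>x y. x \<in> S \<Longrightarrow> y \<in> S \<Longrightarrow> f x = f y \<longleftrightarrow> g x = g y"
  shows "\<exists>h. bij_betw h (f ` S) (g ` S)"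
proof -
  define h where "h = (\<lambda>c. g (SOME x. x \<in> S \<and> f x = c))"
  have h: "h (f x) = g x" if "x \<in> S" for x
  proof -
    have "(SOME y. y \<in> S \<and> f y = f x) \<in> S \<and> f (SOME y. y \<in> S \<and> f y = f x) = f x"
      by (rule someI[of _ x]) (use that in simp)
    then show ?thesis using assms that unfolding h_def by blast
  qed
  have "bij_betw h (f ` S) (g ` S)"
    unfolding bij_betw_def inj_on_def using h assms by (auto simp: image_iff)
  then show ?thesis by blast
qed

lemma card_images_eq:
  assumes "\<And>x y. x \<in> S \<Longrightarrow> y \<in> S \<Longrightarrow> f x = f y \<longleftrightarrow> g x = g y"
  shows "card (f ` S) = card (g ` S)" "finite (f ` S) \<longleftrightarrow> finite (g ` S)"
  using bij_betw_images[of S f g] assms bij_betw_same_card bij_betw_finite by blast+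

lemma card_image_quot:
  assumes "add_subgroup N" "\<And>x y. x \<in> S \<Longrightarrow> y \<in> S \<Longrightarrow> g x = g y \<longleftrightarrow> x - y \<in> N"
  shows "card (g ` S) = card (quot S N)" "finite (g ` S) \<longleftrightarrow> finite (quot S N)"
  using card_images_eq[of S g "\<lambda>x. x +o N"] assms by (auto simp: quot_def coset_eq_iff)

text \<open>Counting by representatives: the class of \<open>s\<close> together with the index
  \<open>i\<close> is a complete invariant of the class of \<open>f s i\<close>. It serves both for
  additive towers and for cosets in a group of isometries, where \<open>f\<close> is
  composition.\<close>

lemma card_image_prod:
  assumes f: "\<And>s i. s \<in> S \<Longrightarrow> i \<in> I \<Longrightarrow> f s i \<in> T"
    and inj: "\<And>s i s' i'. s \<in> S \<Longrightarrow> i \<in> I \<Longrightarrow> s' \<in> S \<Longrightarrow> i' \<in> I \<Longrightarrow>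
      g (f s i) = g (f s' i') \<longleftrightarrow> k s = k s' \<and> i = i'"
    and surj: "\<And>t. t \<in> T \<Longrightarrow> \<exists>s\<in>S. \<exists>i\<in>I. g (f s i) = g t"
  shows "card (g ` T) = card (k ` S) * card I"
    "finite (k ` S) \<Longrightarrow> finite I \<Longrightarrow> finite (g ` T)"
proof -
  have eq: "g ` T = (\<lambda>(s, i). g (f s i)) ` (S \<times> I)"
  proof
    show "g ` T \<subseteq> (\<lambda>(s, i). g (f s i)) ` (S \<times> I)"
    proof
      fix x assume "x \<in> g ` T"
      then obtain t where t: "t \<in> T" "x = g t" by blast
      from surj[OF t(1)] obtain s i where si: "s \<in> S" "i \<in> I" "g (f s i) = g t" by blast
      then show "x \<in> (\<lambda>(s, i). g (f s i)) ` (S \<times> I)"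
        unfolding t(2) by (intro image_eqI[of _ _ "(s, i)"]) simp_all
    qed
  qed (use f in auto)
  have eq2: "(k ` S) \<times> I = (\<lambda>(s, i). (k s, i)) ` (S \<times> I)" by auto
  obtain h where h: "bij_betw h ((\<lambda>(s, i). g (f s i)) ` (S \<times> I)) ((\<lambda>(s, i). (k s, i)) ` (S \<times> I))"
    using bij_betw_images[of "S \<times> I" "\<lambda>(s, i). g (f s i)" "\<lambda>(s, i). (k s, i)"] inj
    by (auto split: prod.splits)
  show "card (g ` T) = card (k ` S) * card I"
    unfolding eq bij_betw_same_card[OF h] eq2[symmetric] by (rule card_cartesian_product)
  show "finite (k ` S) \<Longrightarrow> finite I \<Longrightarrow> finite (g ` T)"
    unfolding eq bij_betw_finite[OF h] eq2[symmetric] by (rule finite_cartesian_product)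
qed

text \<open>\<open>S\<close> only has to be stable under translation by \<open>M\<close>: it will
  also be a set of approximate isometries, which is no additive group.\<close>

lemma quot_tower:
  assumes M: "add_subgroup M" and N: "add_subgroup N" and NM: "N \<subseteq> M"
    and S: "\<And>x m. x \<in> S \<Longrightarrow> m \<in> M \<Longrightarrow> x + m \<in> S"
  shows "card (quot S N) = card (quot S M) * card (quot M N)"
    "finite (quot S M) \<Longrightarrow> finite (quot M N) \<Longrightarrow> finite (quot S N)"
proof -
  define r where "r = (\<lambda>C. SOME x. x \<in> S \<and> C = x +o M)"
  have r: "r C \<in> S" "C = r C +o M" if "C \<in> quot S M" for C
  proof -
    have "\<exists>x. x \<in> S \<and> C = x +o M" using that by (auto simp: quot_def)
    from someI_ex[OF this] show "r C \<in> S" "C = r C +o M" by (auto simp: r_def)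
  qed
  have inj: "((r i + s) +o N = (r i' + s') +o N) \<longleftrightarrow> (s +o N = s' +o N \<and> i = i')"
    if "s \<in> M" "i \<in> quot S M" "s' \<in> M" "i' \<in> quot S M" for s i s' i'
  proof
    assume "(r i + s) +o N = (r i' + s') +o N"
    then have n: "(r i + s) - (r i' + s') \<in> N" using coset_eq_iff[OF N] by blast
    moreover have "s - s' \<in> M" using add_subgroupD(2)[OF M] that by blast
    ultimately have "((r i + s) - (r i' + s')) - (s - s') \<in> M"
      using NM add_subgroupD(2)[OF M] by blast
    then have "r i - r i' \<in> M" by simp
    then have "i = i'" using coset_eq_iff[OF M] r(2)[OF that(2)] r(2)[OF that(4)] by metis
    then show "s +o N = s' +o N \<and> i = i'" using n coset_eq_iff[OF N] by auto
  qed (auto simp: coset_eq_iff[OF N])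
  have surj: "\<exists>s\<in>M. \<exists>i\<in>quot S M. (r i + s) +o N = t +o N" if "t \<in> S" for t
  proof -
    have i: "t +o M \<in> quot S M" using that by (auto simp: quot_def)
    have "t - r (t +o M) \<in> M" using r(2)[OF i] coset_eq_iff[OF M] by blast
    then show ?thesis using i by (intro bexI[of _ "t - r (t +o M)"] bexI[of _ "t +o M"]) simp_all
  qed
  note * = card_image_prod[of M "quot S M" "\<lambda>s i. r i + s" S "\<lambda>x. x +o N" "\<lambda>x. x +o N",
      OF _ inj surj]
  show "card (quot S N) = card (quot S M) * card (quot M N)"
    "finite (quot S M) \<Longrightarrow> finite (quot M N) \<Longrightarrow> finite (quot S N)"
    using * S r(1) by (auto simp: quot_def)
qed

lemma finite_quot_mono:
  assumes N: "add_subgroup N" "add_subgroup N'" and sub: "N \<subseteq> N'" "S \<subseteq> T"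
    and fin: "finite (quot T N)"
  shows "finite (quot S N')"
proof -
  have "finite (quot S N)"
    unfolding quot_def
    by (rule finite_subset[OF image_mono[OF sub(2)] fin[unfolded quot_def]])
  \<comment> \<open>A coset of \<open>N'\<close> is recovered from any coset of \<open>N\<close>
    inside it.\<close>
  moreover have "quot S N' = (\<lambda>C. \<Union>x\<in>C. x +o N') ` quot S N"
  proof -
    have "(\<Union>x\<in>y +o N. x +o N') = y +o N'" for y
    proof -
      have "x +o N' = y +o N'" if "x \<in> y +o N" for x
        using that sub coset_eq_iff[OF N(2)] elt_coset_iff by blast
      moreover have "y \<in> y +o N" using add_subgroupD(1)[OF N(1)] by (simp add: elt_coset_iff)
      ultimately show ?thesis by blast
    qed
    then show ?thesis by (auto simp: quot_def image_image)
  qed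
  ultimately show ?thesis by simp
qed

lemma quot_image_additive:
  assumes N: "add_subgroup N" and N': "add_subgroup N'"
    and add: "\<And>x y. x \<in> M \<Longrightarrow> y \<in> M \<Longrightarrow> g x - g y \<in> N' \<longleftrightarrow> x - y \<in> N"
  shows "card (quot (g ` M) N') = card (quot M N)"
    "finite (quot (g ` M) N') \<longleftrightarrow> finite (quot M N)"
proof -
  have eq: "quot (g ` M) N' = (\<lambda>x. g x +o N') ` M" by (auto simp: quot_def)
  show "card (quot (g ` M) N') = card (quot M N)"
    "finite (quot (g ` M) N') \<longleftrightarrow> finite (quot M N)"
    using card_image_quot[OF N, of M "\<lambda>x. g x +o N'"] add coset_eq_iff[OF N'] by (auto simp: eq)
qed

lemma quot_self: "add_subgroup N \<Longrightarrow> quot N N = {N}"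
proof -
  assume N: "add_subgroup N"
  have "x +o N = N" if "x \<in> N" for x
    using coset_eq_iff[OF N, of x 0] that by simp
  then show ?thesis using add_subgroupD(1)[OF N] by (auto simp: quot_def)
qed


section \<open>Modules over the valuation ring\<close>

locale local_field =
  fixes D :: "('f::field, 'k, 'v) herm_data"
  assumes nonarch: "nonarch_local_field D"
begin

abbreviation A where "A \<equiv> val_ring D"
abbreviation \<pi> where "\<pi> \<equiv> unif D"
abbreviation q where "q \<equiv> residue_card D"

lemma val_mult: "x \<noteq> 0 \<Longrightarrow> y \<noteq> 0 \<Longrightarrow> val D (x * y) = val D x + val D y"
  and val_add: "x \<noteq> 0 \<Longrightarrow> y \<noteq> 0 \<Longrightarrow> x + y \<noteq> 0 \<Longrightarrow> min (val D x) (val D y) \<le> val D (x + y)"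
  and pi_nz: "\<pi> \<noteq> 0" and val_pi: "val D \<pi> = 1"
  and finite_residue: "finite (residue_field D)"
  using nonarch by (auto simp: nonarch_local_field_def)

lemma val_1: "val D 1 = 0"
  using val_mult[of 1 1] by simp

lemma val_uminus_1: "val D (-1) = 0"
  using val_mult[of "-1" "-1"] val_1 by simp

lemma val_uminus: "x \<noteq> 0 \<Longrightarrow> val D (- x) = val D x"
  using val_mult[of "-1" x] val_uminus_1 by simp

lemma val_inverse: "x \<noteq> 0 \<Longrightarrow> val D (inverse x) = - val D x"
  using val_mult[of x "inverse x"] val_1 by simp

lemma val_power: "x \<noteq> 0 \<Longrightarrow> val D (x ^ k) = int k * val D x"
  by (induction k) (auto simp: val_1 val_mult algebra_simps)

lemma val_pi_power: "val D (\<pi> ^ k) = int k"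
  using val_power[OF pi_nz] val_pi by simp

lemma A_0 [simp]: "0 \<in> A" and A_1 [simp]: "1 \<in> A" and A_pi [simp]: "\<pi> \<in> A"
  by (auto simp: val_ring_def val_1 val_pi)

lemma A_mult [simp]: "x \<in> A \<Longrightarrow> y \<in> A \<Longrightarrow> x * y \<in> A"
  by (cases "x = 0 \<or> y = 0") (auto simp: val_ring_def val_mult)

lemma A_uminus [simp]: "x \<in> A \<Longrightarrow> - x \<in> A"
  by (cases "x = 0") (auto simp: val_ring_def val_uminus)

lemma A_add [simp]: "x \<in> A \<Longrightarrow> y \<in> A \<Longrightarrow> x + y \<in> A"
proof (cases "x = 0 \<or> y = 0 \<or> x + y = 0")
  case False
  assume "x \<in> A" "y \<in> A"
  then show ?thesis using val_add[of x y] False by (auto simp: val_ring_def)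
qed auto

lemma A_diff [simp]: "x \<in> A \<Longrightarrow> y \<in> A \<Longrightarrow> x - y \<in> A"
  using A_add[of x "- y"] by simp

lemma A_power [simp]: "x \<in> A \<Longrightarrow> x ^ k \<in> A"
  by (induction k) auto

lemma max_ideal_iff: "x \<in> max_ideal D \<longleftrightarrow> x = 0 \<or> 1 \<le> val D x"
proof
  assume "x \<in> max_ideal D"
  then show "x = 0 \<or> 1 \<le> val D x"
    using val_mult[OF pi_nz] val_pi by (auto simp: max_ideal_def val_ring_def)
next
  assume x: "x = 0 \<or> 1 \<le> val D x"
  have "x = \<pi> * (inverse \<pi> * x)" using pi_nz by simp
  moreover have "inverse \<pi> * x \<in> A"
    using x val_mult[of "inverse \<pi>" x] val_inverse[OF pi_nz] val_pi pi_nz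
    by (cases "x = 0") (auto simp: val_ring_def)
  ultimately show "x \<in> max_ideal D" unfolding max_ideal_def by blast
qed

lemma A_inverse: "x \<in> A \<Longrightarrow> x \<notin> max_ideal D \<Longrightarrow> inverse x \<in> A"
  using val_inverse[of x] by (auto simp: max_ideal_iff val_ring_def)

lemma add_subgroup_max_ideal: "add_subgroup (max_ideal D)"
proof -
  have "\<pi> * a - \<pi> * b \<in> max_ideal D" if "a \<in> A" "b \<in> A" for a b
    using A_diff[OF that] by (auto simp: max_ideal_def simp flip: right_diff_distrib)
  moreover have "0 \<in> max_ideal D" by (simp add: max_ideal_iff)
  ultimately show ?thesis by (auto simp: add_subgroup_def max_ideal_def)
qed

lemma q_gt_1: "q > 1"
proof -
  have "0 +o max_ideal D \<noteq> 1 +o max_ideal D"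
    unfolding coset_eq_iff[OF add_subgroup_max_ideal] by (simp add: max_ideal_iff val_uminus_1)
  moreover have "{0 +o max_ideal D, 1 +o max_ideal D} \<subseteq> residue_field D"
    unfolding residue_field_def quot_def using A_0 A_1 by blast
  ultimately have "2 \<le> card (residue_field D)"
    using card_mono[OF finite_residue, of "{0 +o max_ideal D, 1 +o max_ideal D}"] by simp
  then show ?thesis by (simp add: residue_card_def)
qed

lemma scale_into_A: "\<exists>s. \<forall>k\<ge>s. \<pi> ^ k * x \<in> A"
proof (cases "x = 0")
  case False
  have "\<pi> ^ k * x \<in> A" if "k \<ge> nat (- val D x)" for k
    using that False val_mult[of "\<pi> ^ k" x] val_pi_power[of k] pi_nz by (auto simp: val_ring_def)
  then show ?thesis by blast
qed auto

text \<open>With this unit, a congruence between two multiples \<pi>^i x and \<pi>^j x modulo a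
  submodule forces \<pi>^i x itself into the submodule.\<close>

lemma one_minus_pi_power_unit: "0 < k \<Longrightarrow> inverse (1 - \<pi> ^ k) \<in> A"
proof (rule A_inverse)
  assume k: "0 < k"
  have pk: "\<pi> ^ k \<in> max_ideal D" using k by (simp add: max_ideal_iff val_pi_power)
  have "1 \<notin> max_ideal D" by (simp add: max_ideal_iff val_1)
  then show "1 - \<pi> ^ k \<notin> max_ideal D"
    using add_subgroupD(4)[OF add_subgroup_max_ideal _ pk, of "1 - \<pi> ^ k"] by auto
qed simp

end

section \<open>Submodules of a vector space over the valuation ring, and their indices\<close>

locale lattice_space = local_field D + vector_space scale
  for D :: "('f::field, 'k, 'v) herm_data" and scale :: "'f \<Rightarrow> 'w::ab_group_add \<Rightarrow> 'w"
begin

definition submod :: "'w set \<Rightarrow> bool" where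
  "submod \<Lambda> \<longleftrightarrow> 0 \<in> \<Lambda> \<and> (\<forall>x\<in>\<Lambda>. \<forall>y\<in>\<Lambda>. x + y \<in> \<Lambda>) \<and> (\<forall>a\<in>A. \<forall>x\<in>\<Lambda>. scale a x \<in> \<Lambda>)"

lemma submodD:
  assumes "submod \<Lambda>"
  shows "0 \<in> \<Lambda>" "x \<in> \<Lambda> \<Longrightarrow> y \<in> \<Lambda> \<Longrightarrow> x + y \<in> \<Lambda>" "a \<in> A \<Longrightarrow> x \<in> \<Lambda> \<Longrightarrow> scale a x \<in> \<Lambda>"
    "x \<in> \<Lambda> \<Longrightarrow> - x \<in> \<Lambda>" "x \<in> \<Lambda> \<Longrightarrow> y \<in> \<Lambda> \<Longrightarrow> x - y \<in> \<Lambda>"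
proof -
  show "0 \<in> \<Lambda>" and add: "x \<in> \<Lambda> \<Longrightarrow> y \<in> \<Lambda> \<Longrightarrow> x + y \<in> \<Lambda>"
    and sc: "a \<in> A \<Longrightarrow> x \<in> \<Lambda> \<Longrightarrow> scale a x \<in> \<Lambda>" for x y a
    using assms by (auto simp: submod_def)
  show u: "x \<in> \<Lambda> \<Longrightarrow> - x \<in> \<Lambda>" for x using sc[of "-1" x] by simp
  show "x \<in> \<Lambda> \<Longrightarrow> y \<in> \<Lambda> \<Longrightarrow> x - y \<in> \<Lambda>" using add[of x "- y"] u[of y] by simp
qed

lemma submod_subgroup: "submod \<Lambda> \<Longrightarrow> add_subgroup \<Lambda>"
  using submodD(1,5) by (auto simp: add_subgroup_def)

lemma submod_sum: "submod \<Lambda> \<Longrightarrow> (\<And>i. i \<in> I \<Longrightarrow> f i \<in> \<Lambda>) \<Longrightarrow> sum f I \<in> \<Lambda>"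
  by (induction I rule: infinite_finite_induct) (auto simp: submodD)

lemma submod_scale_image: "submod \<Lambda> \<Longrightarrow> submod (scale c ` \<Lambda>)"
  unfolding submod_def
proof (intro conjI ballI)
  assume L: "0 \<in> \<Lambda> \<and> (\<forall>x\<in>\<Lambda>. \<forall>y\<in>\<Lambda>. x + y \<in> \<Lambda>) \<and> (\<forall>a\<in>A. \<forall>x\<in>\<Lambda>. scale a x \<in> \<Lambda>)"
  show "0 \<in> scale c ` \<Lambda>" using L by (auto intro: image_eqI[of _ _ 0])
  fix x y assume "x \<in> scale c ` \<Lambda>" "y \<in> scale c ` \<Lambda>"
  then show "x + y \<in> scale c ` \<Lambda>" using L by (auto simp flip: scale_right_distrib)
next
  fix a x assume L: "0 \<in> \<Lambda> \<and> (\<forall>x\<in>\<Lambda>. \<forall>y\<in>\<Lambda>. x + y \<in> \<Lambda>) \<and> (\<forall>a\<in>A. \<forall>x\<in>\<Lambda>. scale a x \<in> \<Lambda>)"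
    and a: "a \<in> A" and "x \<in> scale c ` \<Lambda>"
  then obtain y where y: "y \<in> \<Lambda>" "x = scale c y" by blast
  then have "scale a x = scale c (scale a y)" by (simp add: mult.commute)
  then show "scale a x \<in> scale c ` \<Lambda>" using L a y by blast
qed

lemma scale_image_iff: "c \<noteq> 0 \<Longrightarrow> x \<in> scale c ` \<Lambda> \<longleftrightarrow> scale (inverse c) x \<in> \<Lambda>"
  by (auto simp: image_iff intro: bexI[of _ "scale (inverse c) x"])

lemma scale_image_subset: "submod \<Lambda> \<Longrightarrow> c \<in> A \<Longrightarrow> scale c ` \<Lambda> \<subseteq> \<Lambda>"
  by (auto simp: submodD)

lemma scale_quot:
  assumes "c \<noteq> 0" "submod N"
  shows "card (quot (scale c ` M) (scale c ` N)) = card (quot M N)"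
    "finite (quot (scale c ` M) (scale c ` N)) \<longleftrightarrow> finite (quot M N)"
proof -
  have "scale c x - scale c y \<in> scale c ` N \<longleftrightarrow> x - y \<in> N" for x y
    using assms(1) by (simp add: scale_image_iff flip: scale_right_diff_distrib)
  then show "card (quot (scale c ` M) (scale c ` N)) = card (quot M N)"
    "finite (quot (scale c ` M) (scale c ` N)) \<longleftrightarrow> finite (quot M N)"
    using quot_image_additive[of N "scale c ` N" M "scale c"]
      submod_subgroup submod_scale_image assms by auto
qed

definition genA :: "'w set \<Rightarrow> 'w set" where
  "genA G = {\<Sum>g\<in>G. scale (c g) g | c. \<forall>g\<in>G. c g \<in> A}"

lemma submod_genA: "submod (genA G)"
  unfolding submod_def
proof (intro conjI ballI)
  show "0 \<in> genA G" unfolding genA_def by (rule CollectI, rule exI[of _ "\<lambda>_. 0"]) simp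
  fix x y assume "x \<in> genA G" "y \<in> genA G"
  then obtain c d where "\<forall>g\<in>G. c g \<in> A" "x = (\<Sum>g\<in>G. scale (c g) g)"
    "\<forall>g\<in>G. d g \<in> A" "y = (\<Sum>g\<in>G. scale (d g) g)" unfolding genA_def by auto
  then show "x + y \<in> genA G" unfolding genA_def
    by (intro CollectI exI[of _ "\<lambda>g. c g + d g"]) (simp add: scale_left_distrib sum.distrib)
next
  fix a x assume a: "a \<in> A" and "x \<in> genA G"
  then obtain c where "\<forall>g\<in>G. c g \<in> A" "x = (\<Sum>g\<in>G. scale (c g) g)" unfolding genA_def by auto
  then show "scale a x \<in> genA G" unfolding genA_def
    using a by (intro CollectI exI[of _ "\<lambda>g. a * c g"]) (simp add: scale_sum_right)
qed

lemma genA_mem: "finite G \<Longrightarrow> g \<in> G \<Longrightarrow> g \<in> genA G"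
  unfolding genA_def
  by (rule CollectI, rule exI[of _ "\<lambda>x. if x = g then 1 else 0"])
     (simp add: if_distrib[of "\<lambda>c. scale c _"] cong: if_cong)

lemma genA_subset: "submod \<Lambda> \<Longrightarrow> G \<subseteq> \<Lambda> \<Longrightarrow> genA G \<subseteq> \<Lambda>"
  unfolding genA_def using submod_sum submodD(3) by (auto intro!: submod_sum simp: submodD subset_iff)

text \<open>By independence the coefficients modulo the maximal ideal are a complete invariant of a
  class, so the quotient has \<open>card B\<close> coordinates in the residue field.\<close>

lemma card_quot_genA:
  assumes "finite B" "independent B"
  shows "card (quot (genA B) (scale \<pi> ` genA B)) = q ^ card B"
    "finite (quot (genA B) (scale \<pi> ` genA B))"
proof -
  let ?S = "B \<rightarrow>\<^sub>E A"
  let ?f = "\<lambda>c. (\<Sum>g\<in>B. scale (c g) g)"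
  let ?g = "\<lambda>c. \<lambda>b\<in>B. c b +o max_ideal D"
  have im: "quot (genA B) (scale \<pi> ` genA B) = (\<lambda>c. ?f c +o scale \<pi> ` genA B) ` ?S"
  proof -
    have "genA B = ?f ` ?S"
    proof
      show "genA B \<subseteq> ?f ` ?S"
      proof
        fix x assume "x \<in> genA B"
        then obtain c where "\<forall>g\<in>B. c g \<in> A" "x = ?f c" unfolding genA_def by auto
        then show "x \<in> ?f ` ?S" by (intro image_eqI[of _ _ "restrict c B"]) auto
      qed
    qed (auto simp: genA_def)
    then show ?thesis by (auto simp: quot_def)
  qed
  have g: "?g ` ?S = B \<rightarrow>\<^sub>E residue_field D"
  proof
    show "B \<rightarrow>\<^sub>E residue_field D \<subseteq> ?g ` ?S"
    proof
      fix r assume r: "r \<in> B \<rightarrow>\<^sub>E residue_field D"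
      then have "\<forall>b\<in>B. \<exists>a\<in>A. r b = a +o max_ideal D" by (auto simp: residue_field_def quot_def PiE_iff)
      then obtain a where a: "\<forall>b\<in>B. a b \<in> A \<and> r b = a b +o max_ideal D" by metis
      have "r = ?g (restrict a B)"
        using a r by (intro ext) (auto simp: PiE_iff extensional_def)
      then show "r \<in> ?g ` ?S" using a by auto
    qed
  qed (auto simp: residue_field_def quot_def)
  have fg: "?f c +o scale \<pi> ` genA B = ?f d +o scale \<pi> ` genA B \<longleftrightarrow> ?g c = ?g d"
    if c: "c \<in> ?S" and d: "d \<in> ?S" for c d
  proof -
    have "?f c +o scale \<pi> ` genA B = ?f d +o scale \<pi> ` genA B \<longleftrightarrow>
      ?f c - ?f d \<in> scale \<pi> ` genA B"
      by (rule coset_eq_iff) (intro submod_subgroup submod_scale_image submod_genA)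
    also have "?f c - ?f d = ?f (\<lambda>g. c g - d g)"
      by (simp add: scale_left_diff_distrib sum_subtractf)
    also have "\<dots> \<in> scale \<pi> ` genA B \<longleftrightarrow> (\<forall>b\<in>B. c b - d b \<in> max_ideal D)"
    proof
      assume "?f (\<lambda>g. c g - d g) \<in> scale \<pi> ` genA B"
      then obtain e where e: "\<forall>g\<in>B. e g \<in> A" "?f (\<lambda>g. c g - d g) = scale \<pi> (?f e)"
        unfolding genA_def by auto
      then have "(\<Sum>g\<in>B. scale (c g - d g - \<pi> * e g) g) = 0"
        by (simp add: scale_left_diff_distrib sum_subtractf scale_sum_right)
      then have "c g - d g - \<pi> * e g = 0" if "g \<in> B" for g
        using independentD[OF assms(2) assms(1) subset_refl, of "\<lambda>g. c g - d g - \<pi> * e g" g] that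
        by simp
      then show "\<forall>b\<in>B. c b - d b \<in> max_ideal D" using e(1) by (auto simp: max_ideal_def)
    next
      assume "\<forall>b\<in>B. c b - d b \<in> max_ideal D"
      then have "\<forall>b\<in>B. \<exists>a\<in>A. c b - d b = \<pi> * a" by (auto simp: max_ideal_def)
      then obtain a where a: "\<forall>b\<in>B. a b \<in> A \<and> c b - d b = \<pi> * a b" by metis
      have "?f (\<lambda>g. c g - d g) = scale \<pi> (?f a)"
        using a by (auto simp: scale_sum_right intro!: sum.cong)
      moreover have "?f a \<in> genA B" using a by (auto simp: genA_def)
      ultimately show "?f (\<lambda>g. c g - d g) \<in> scale \<pi> ` genA B" by blast
    qed
    also have "\<dots> \<longleftrightarrow> ?g c = ?g d"
      using coset_eq_iff[OF add_subgroup_max_ideal] by (auto simp: fun_eq_iff restrict_def)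
    finally show ?thesis .
  qed
  have "card (quot (genA B) (scale \<pi> ` genA B)) = card (?g ` ?S)"
    unfolding im by (rule card_images_eq(1)) (rule fg)
  then show "card (quot (genA B) (scale \<pi> ` genA B)) = q ^ card B"
    unfolding g using card_PiE[OF assms(1), of "\<lambda>_. residue_field D"] by (simp add: residue_card_def)
  have "finite (quot (genA B) (scale \<pi> ` genA B)) \<longleftrightarrow> finite (?g ` ?S)"
    unfolding im by (rule card_images_eq(2)) (rule fg)
  then show "finite (quot (genA B) (scale \<pi> ` genA B))"
    unfolding g using finite_PiE[OF assms(1), of "\<lambda>_. residue_field D"] finite_residue by blast
qed

text \<open>The generators may be dependent, so coefficients give only a surjection: each is
  replaced by a chosen representative of its residue class.\<close>

lemma finite_quot_genA_1:
  assumes "finite G"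
  shows "finite (quot (genA G) (scale \<pi> ` genA G))"
proof -
  let ?f = "\<lambda>c. (\<Sum>g\<in>G. scale (c g) g)"
  define r where "r = (\<lambda>C. SOME a. a \<in> A \<and> C = a +o max_ideal D)"
  have r: "r C \<in> A \<and> C = r C +o max_ideal D" if "C \<in> residue_field D" for C
    unfolding r_def by (rule someI_ex) (use that in \<open>auto simp: residue_field_def quot_def\<close>)
  have "quot (genA G) (scale \<pi> ` genA G) \<subseteq>
    (\<lambda>c. ?f c +o scale \<pi> ` genA G) ` (G \<rightarrow>\<^sub>E r ` residue_field D)"
  proof
    fix C assume "C \<in> quot (genA G) (scale \<pi> ` genA G)"
    then obtain c where c: "\<forall>g\<in>G. c g \<in> A" "C = ?f c +o scale \<pi> ` genA G"
      by (auto simp: quot_def genA_def)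
    define e where "e = (\<lambda>g\<in>G. r (c g +o max_ideal D))"
    have rc: "c g +o max_ideal D \<in> residue_field D" if "g \<in> G" for g
      using c that by (auto simp: residue_field_def quot_def)
    have "c g - e g \<in> max_ideal D" if "g \<in> G" for g
      using r[OF rc[OF that]] coset_eq_iff[OF add_subgroup_max_ideal] that unfolding e_def by simp
    then have "\<forall>g\<in>G. \<exists>a\<in>A. c g - e g = \<pi> * a" by (auto simp: max_ideal_def)
    then obtain a where a: "\<forall>g\<in>G. a g \<in> A \<and> c g - e g = \<pi> * a g" by metis
    have "?f c - ?f e = ?f (\<lambda>g. c g - e g)"
      by (simp add: scale_left_diff_distrib sum_subtractf)
    also have "\<dots> = scale \<pi> (?f a)" using a by (auto simp: scale_sum_right intro!: sum.cong)
    finally have "?f c - ?f e \<in> scale \<pi> ` genA G" using a by (auto simp: genA_def)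
    then have "C = ?f e +o scale \<pi> ` genA G"
      using c(2) coset_eq_iff[OF submod_subgroup[OF submod_scale_image[OF submod_genA]]] by blast
    moreover have "e \<in> G \<rightarrow>\<^sub>E r ` residue_field D" using rc by (auto simp: e_def)
    ultimately show "C \<in> (\<lambda>c. ?f c +o scale \<pi> ` genA G) ` (G \<rightarrow>\<^sub>E r ` residue_field D)" by blast
  qed
  then show ?thesis using finite_residue assms by (rule_tac finite_subset) (auto intro!: finite_PiE)
qed

lemma pi_power_scale_image: "scale (\<pi> ^ Suc s) ` \<Lambda> = scale (\<pi> ^ s) ` scale \<pi> ` \<Lambda>"
  by (auto simp: image_image mult.commute)

lemma quot_pi_power:
  assumes "submod \<Lambda>" "finite (quot \<Lambda> (scale \<pi> ` \<Lambda>))"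
  shows "finite (quot \<Lambda> (scale (\<pi> ^ s) ` \<Lambda>))"
proof (induction s)
  case 0
  then show ?case using quot_self[OF submod_subgroup[OF assms(1)]] by (simp add: image_def)
next
  case (Suc s)
  let ?M = "scale (\<pi> ^ s) ` \<Lambda>" and ?N = "scale (\<pi> ^ Suc s) ` \<Lambda>"
  have "finite (quot ?M ?N)"
    unfolding pi_power_scale_image using scale_quot(2)[of "\<pi> ^ s" "scale \<pi> ` \<Lambda>" \<Lambda>] pi_nz assms submod_scale_image
    by simp
  moreover have "?N \<subseteq> ?M"
    unfolding pi_power_scale_image using scale_image_subset[OF assms(1) A_pi] by (intro image_mono)
  moreover have "?M \<subseteq> \<Lambda>" using scale_image_subset[OF assms(1)] by simp
  ultimately show ?case
    using quot_tower(2)[of ?M ?N \<Lambda>] Suc assms(1) submod_subgroup submod_scale_image submodD(2)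
    by (meson subset_iff)
qed

lemma finite_quot_genA: "finite G \<Longrightarrow> finite (quot (genA G) (scale (\<pi> ^ s) ` genA G))"
  using quot_pi_power[OF submod_genA finite_quot_genA_1] by blast

text \<open>No A-basis of \<Lambda> is at hand, only the free sublattice M spanned by
  \<open>B\<close>. The index of \<pi>M in \<Lambda> is computed once through M and once through
  \<pi>\<Lambda>; multiplication by \<pi> shows that the index of \<pi>M in \<pi>\<Lambda> is that
  of M in \<Lambda>, which cancels.\<close>

lemma card_quot_lattice:
  assumes L: "submod \<Lambda>" and B: "finite B" "independent B" "B \<subseteq> \<Lambda>"
    and s: "scale (\<pi> ^ s) ` \<Lambda> \<subseteq> genA B"
  shows "card (quot \<Lambda> (scale \<pi> ` \<Lambda>)) = q ^ card B"
proof -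
  let ?M = "genA B"
  have BL: "?M \<subseteq> \<Lambda>" by (rule genA_subset[OF L B(3)])
  have sg: "add_subgroup \<Lambda>" "add_subgroup ?M" "add_subgroup (scale \<pi> ` \<Lambda>)" "add_subgroup (scale \<pi> ` ?M)"
    using L submod_genA submod_scale_image submod_subgroup by blast+
  have fin: "finite (quot \<Lambda> ?M)"
  proof -
    \<comment> \<open>Multiplication by \<pi>^s carries the quotient of \<Lambda> by M into the
      quotient of M by \<pi>^s M, which is finite.\<close>
    have "finite (quot (scale (\<pi> ^ s) ` \<Lambda>) (scale (\<pi> ^ s) ` ?M))"
      by (rule finite_quot_mono[OF _ _ subset_refl s finite_quot_genA[OF B(1), of s]])
        (intro submod_subgroup submod_scale_image submod_genA)+
    then show ?thesis using scale_quot(2)[of "\<pi> ^ s" ?M \<Lambda>] pi_nz submod_genA by simp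
  qed
  have c: "card (quot \<Lambda> ?M) > 0" using fin submodD(1)[OF L] by (auto simp: card_gt_0_iff quot_def)
  have "card (quot \<Lambda> (scale \<pi> ` ?M)) = card (quot \<Lambda> ?M) * card (quot ?M (scale \<pi> ` ?M))"
    using BL submodD(2)[OF L] scale_image_subset[OF submod_genA A_pi, of B]
    by (intro quot_tower(1) sg) blast+
  moreover have "card (quot \<Lambda> (scale \<pi> ` ?M)) =
      card (quot \<Lambda> (scale \<pi> ` \<Lambda>)) * card (quot (scale \<pi> ` \<Lambda>) (scale \<pi> ` ?M))"
    using BL submodD(2)[OF L] scale_image_subset[OF L A_pi]
    by (intro quot_tower(1) sg) blast+
  ultimately show ?thesis
    using c scale_quot(1)[of \<pi> ?M \<Lambda>] pi_nz submod_genA card_quot_genA[OF B(1,2)] by simp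
qed

text \<open>Induction on the index: enlarging \<open>N\<close> by one element y outside it with
  \<pi> y in \<open>N\<close> divides the index by q.\<close>

lemma card_quot_power:
  assumes "submod M" "submod N" "N \<subseteq> M" "finite (quot M N)"
  shows "\<exists>e. card (quot M N) = q ^ e"
  using assms(2-)
proof (induction "card (quot M N)" arbitrary: N rule: less_induct)
  case less
  note N = less.prems(1)
  show ?case
  proof (cases "M = N")
    case True
    then have "card (quot M N) = q ^ 0" using quot_self[OF submod_subgroup[OF N]] by simp
    then show ?thesis by blast
  next
    case False
    then obtain x where x: "x \<in> M" "x \<notin> N" using less.prems by blast
    \<comment> \<open>Pigeonhole on the multiples \<pi>^i x, together with the unit 1 - \<pi>^(j -
      i), yields a power of \<pi> that carries x into \<open>N\<close>.\<close>
    have "\<not> inj_on (\<lambda>i. scale (\<pi> ^ i) x +o N) (UNIV :: nat set)"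
    proof
      assume "inj_on (\<lambda>i. scale (\<pi> ^ i) x +o N) (UNIV :: nat set)"
      moreover have "range (\<lambda>i. scale (\<pi> ^ i) x +o N) \<subseteq> quot M N"
        using submodD(3)[OF assms(1) _ x(1)] by (auto simp: quot_def)
      ultimately show False using less.prems(3) finite_subset infinite_UNIV_nat finite_imageD by metis
    qed
    then obtain i j where ij: "i < j" "scale (\<pi> ^ i) x +o N = scale (\<pi> ^ j) x +o N"
      unfolding inj_on_def by (metis linorder_neqE_nat)
    then have "scale (\<pi> ^ i) x - scale (\<pi> ^ j) x \<in> N"
      using coset_eq_iff[OF submod_subgroup[OF N]] by blast
    also have "scale (\<pi> ^ i) x - scale (\<pi> ^ j) x = scale ((1 - \<pi> ^ (j - i)) * \<pi> ^ i) x"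
      using ij(1) by (simp add: left_diff_distrib scale_left_diff_distrib flip: power_add)
    finally have "scale (inverse (1 - \<pi> ^ (j - i))) (scale ((1 - \<pi> ^ (j - i)) * \<pi> ^ i) x) \<in> N"
      using submodD(3)[OF N one_minus_pi_power_unit] ij(1) zero_less_diff by blast
    moreover have nz: "1 - \<pi> ^ (j - i) \<noteq> 0"
    proof
      assume "1 - \<pi> ^ (j - i) = 0"
      then have "\<pi> ^ (j - i) = 1" by simp
      then show False using val_pi_power[of "j - i"] val_1 ij(1) by simp
    qed
    ultimately have ex: "scale (\<pi> ^ i) x \<in> N"
      by (simp only: scale_scale mult.assoc[symmetric] left_inverse[OF nz] mult_1_left)
    define s where "s = (LEAST s. scale (\<pi> ^ s) x \<in> N)"
    have s: "scale (\<pi> ^ s) x \<in> N"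
      using LeastI[of "\<lambda>s. scale (\<pi> ^ s) x \<in> N" i] ex unfolding s_def by simp
    have "s \<noteq> 0" using s x(2) by (cases "s = 0") auto
    then obtain s' where s': "s = Suc s'" by (cases s) auto
    \<comment> \<open>The last multiple of x by a power of \<pi> that is still outside
      \<open>N\<close>.\<close>
    define y where "y = scale (\<pi> ^ s') x"
    have yN: "y \<notin> N" using not_less_Least[of s' "\<lambda>s. scale (\<pi> ^ s) x \<in> N"] s' unfolding s_def y_def by simp
    have yM: "y \<in> M" using submodD(3)[OF assms(1) _ x(1)] by (simp add: y_def)
    have piy: "scale \<pi> y \<in> N" using s by (simp add: y_def s')
    define N' where "N' = {scale a y + z | a z. a \<in> A \<and> z \<in> N}"
    have NN': "N \<subseteq> N'" unfolding N'_def
    proof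
      fix z assume "z \<in> N"
      then show "z \<in> {scale a y + z |a z. a \<in> A \<and> z \<in> N}"
        by (intro CollectI exI[of _ 0] exI[of _ z]) simp
    qed
    have N': "submod N'"
      unfolding submod_def
    proof (intro conjI ballI)
      show "0 \<in> N'" using NN' submodD(1)[OF N] by blast
      fix u v assume "u \<in> N'" "v \<in> N'"
      then obtain a z b w where "a \<in> A" "b \<in> A" "z \<in> N" "w \<in> N" "u = scale a y + z" "v = scale b y + w"
        unfolding N'_def by blast
      then show "u + v \<in> N'" unfolding N'_def
        by (intro CollectI exI[of _ "a + b"] exI[of _ "z + w"]) (simp add: scale_left_distrib submodD[OF N])
    next
      fix b u assume b: "b \<in> A" and "u \<in> N'"
      then obtain a z where "a \<in> A" "z \<in> N" "u = scale a y + z" unfolding N'_def by blast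
      then show "scale b u \<in> N'" unfolding N'_def using b
        by (intro CollectI exI[of _ "b * a"] exI[of _ "scale b z"]) (simp add: scale_right_distrib submodD[OF N])
    qed
    have N'M: "N' \<subseteq> M" using yM less.prems(2) submodD[OF assms(1)] unfolding N'_def by auto
    have "quot N' N = (\<lambda>a. scale a y +o N) ` A"
    proof
      show "quot N' N \<subseteq> (\<lambda>a. scale a y +o N) ` A"
      proof
        fix C assume "C \<in> quot N' N"
        then obtain a z where a: "a \<in> A" "z \<in> N" "C = (scale a y + z) +o N" by (auto simp: quot_def N'_def)
        then have "C = scale a y +o N" using coset_eq_iff[OF submod_subgroup[OF N]] by simp
        then show "C \<in> (\<lambda>a. scale a y +o N) ` A" using a by blast
      qed
      show "(\<lambda>a. scale a y +o N) ` A \<subseteq> quot N' N"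
      proof
        fix C assume "C \<in> (\<lambda>a. scale a y +o N) ` A"
        then obtain a where "a \<in> A" "C = scale a y +o N" by blast
        moreover from this have "scale a y \<in> N'" unfolding N'_def using submodD(1)[OF N]
          by (intro CollectI exI[of _ a] exI[of _ 0]) simp
        ultimately show "C \<in> quot N' N" by (auto simp: quot_def)
      qed
    qed
    \<comment> \<open>The annihilator of y modulo \<open>N\<close> is the maximal ideal: any other
      element of A is a unit and would bring y into \<open>N\<close>.\<close>
    also have "card \<dots> = card (quot A (max_ideal D))"
    proof (rule card_image_quot(1)[OF add_subgroup_max_ideal])
      fix a b assume ab: "a \<in> A" "b \<in> A"
      have "(scale a y +o N = scale b y +o N) \<longleftrightarrow> scale (a - b) y \<in> N"
        using coset_eq_iff[OF submod_subgroup[OF N]] by (simp add: scale_left_diff_distrib)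
      also have "\<dots> \<longleftrightarrow> a - b \<in> max_ideal D"
      proof
        assume *: "scale (a - b) y \<in> N"
        show "a - b \<in> max_ideal D"
        proof (rule ccontr)
          assume **: "a - b \<notin> max_ideal D"
          then have "scale (inverse (a - b)) (scale (a - b) y) \<in> N"
            by (intro submodD(3)[OF N _ *] A_inverse A_diff ab)
          moreover have nz: "a - b \<noteq> 0" using ** by (auto simp: max_ideal_iff)
          ultimately show False using yN by (simp only: scale_scale left_inverse[OF nz] scale_one)
        qed
      next
        assume "a - b \<in> max_ideal D"
        then obtain e where "e \<in> A" "a - b = e * \<pi>" by (auto simp: max_ideal_def mult.commute)
        then show "scale (a - b) y \<in> N" using submodD(3)[OF N _ piy, of e] by simp
      qed
      finally show "(scale a y +o N = scale b y +o N) \<longleftrightarrow> a - b \<in> max_ideal D" .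
    qed
    finally have q: "card (quot N' N) = q" by (simp add: residue_card_def residue_field_def)
    have t: "card (quot M N) = card (quot M N') * q"
      using quot_tower(1)[OF submod_subgroup[OF N'] submod_subgroup[OF N] NN', of M] q N'M
        submodD(2)[OF assms(1)] by (metis subsetD)
    have fin: "finite (quot M N')"
      by (rule finite_quot_mono[OF _ _ NN' subset_refl less.prems(3)]) (use N N' submod_subgroup in blast)+
    have "card (quot M N') > 0" using fin submodD(1)[OF assms(1)] by (auto simp: card_gt_0_iff quot_def)
    then have "card (quot M N') < card (quot M N)" using t q_gt_1 by simp
    from less.hyps[OF this N' N'M fin] obtain e where "card (quot M N') = q ^ e" by blast
    then have "card (quot M N) = q ^ Suc e" using t by simp
    then show ?thesis by blast
  qed
qed

end


section \<open>Algebras of functions and the Zariski topology\<close>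

lemma sum_fun_apply: "(\<Sum>i\<in>I. f i) x = (\<Sum>i\<in>I. f i x)"
  by (induction I rule: infinite_finite_induct) auto

text \<open>Interpreted twice, for polynomial functions of a matrix and for polynomial functions on
  affine space; in both, determinants and adjugates of matrices with entries in the algebra are
  needed.\<close>

locale fun_alg =
  fixes C :: "('x \<Rightarrow> 's::comm_ring_1) set"
  assumes const: "(\<lambda>_. c) \<in> C"
    and add: "f \<in> C \<Longrightarrow> g \<in> C \<Longrightarrow> (\<lambda>x. f x + g x) \<in> C"
    and mult: "f \<in> C \<Longrightarrow> g \<in> C \<Longrightarrow> (\<lambda>x. f x * g x) \<in> C"
begin

lemma uminus: "f \<in> C \<Longrightarrow> (\<lambda>x. - f x) \<in> C"
  using mult[OF const[of "-1"]] by simp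

lemma diff: "f \<in> C \<Longrightarrow> g \<in> C \<Longrightarrow> (\<lambda>x. f x - g x) \<in> C"
  using add[OF _ uminus, of f g] by simp

lemma sum: "(\<And>i. i \<in> I \<Longrightarrow> f i \<in> C) \<Longrightarrow> (\<lambda>x. \<Sum>i\<in>I. f i x) \<in> C"
  by (induction I rule: infinite_finite_induct) (auto intro: const add)

lemma prod: "(\<And>i. i \<in> I \<Longrightarrow> f i \<in> C) \<Longrightarrow> (\<lambda>x. \<Prod>i\<in>I. f i x) \<in> C"
  by (induction I rule: infinite_finite_induct) (auto intro: const mult)

lemma power: "f \<in> C \<Longrightarrow> (\<lambda>x. f x ^ k) \<in> C"
  by (induction k) (auto intro: const mult)

lemma det:
  assumes "\<And>x. M x \<in> carrier_mat N N"
    and "\<And>i j. i < N \<Longrightarrow> j < N \<Longrightarrow> (\<lambda>x. M x $$ (i, j)) \<in> C"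
  shows "(\<lambda>x. det (M x)) \<in> C"
proof -
  have "(\<lambda>x. \<Sum>p | p permutes {0..<N}. signof p * (\<Prod>i = 0..<N. M x $$ (i, p i))) \<in> C"
    by (intro sum mult const prod assms(2)) (auto dest: permutes_in_image)
  then show ?thesis using det_def'[OF assms(1)] by simp
qed

lemma adj_mat_entry:
  assumes M: "\<And>x. M x \<in> carrier_mat N N"
    and e: "\<And>i j. i < N \<Longrightarrow> j < N \<Longrightarrow> (\<lambda>x. M x $$ (i, j)) \<in> C"
    and ij: "i < N" "j < N"
  shows "(\<lambda>x. adj_mat (M x) $$ (i, j)) \<in> C"
proof -
  have "(\<lambda>x. (-1) ^ (j + i) * det (mat_delete (M x) j i)) \<in> C"
  proof (rule mult[OF const det])
    show "mat_delete (M x) j i \<in> carrier_mat (N - 1) (N - 1)" for x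
      using M[of x] by (simp add: mat_delete_def)
    fix a b assume "a < N - 1" "b < N - 1"
    then show "(\<lambda>x. mat_delete (M x) j i $$ (a, b)) \<in> C"
      using e[of a b] e[of a "Suc b"] e[of "Suc a" b] e[of "Suc a" "Suc b"]
      by (simp add: mat_delete_def carrier_matD[OF M])
  qed
  then show ?thesis using ij by (simp add: adj_mat_def cofactor_def carrier_matD[OF M])
qed

end

interpretation pf: fun_alg "polynomial_functions N"
  by unfold_locales (auto intro: polynomial_functions.intros)

text \<open>Intersections are described by pairwise products of the given functions, where the
  absence of zero divisors enters, and unions by the union of the families.\<close>

lemma istopology_zariski:
  fixes Y :: "'s::idom mat set"
  shows "istopology (\<lambda>U. \<exists>P \<subseteq> polynomial_functions N. U = {x \<in> Y. \<exists>p\<in>P. p x \<noteq> 0})"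
  unfolding istopology_def
proof (intro conjI allI impI)
  fix S T :: "'s mat set"
  assume "\<exists>P \<subseteq> polynomial_functions N. S = {x \<in> Y. \<exists>p\<in>P. p x \<noteq> 0}"
    and "\<exists>P \<subseteq> polynomial_functions N. T = {x \<in> Y. \<exists>p\<in>P. p x \<noteq> 0}"
  then obtain P Q where P: "P \<subseteq> polynomial_functions N" "S = {x \<in> Y. \<exists>p\<in>P. p x \<noteq> 0}"
    and Q: "Q \<subseteq> polynomial_functions N" "T = {x \<in> Y. \<exists>p\<in>Q. p x \<noteq> 0}" by blast
  have "(\<lambda>(p, q) x. p x * q x) ` (P \<times> Q) \<subseteq> polynomial_functions N"
    using P(1) Q(1) by (auto intro!: pf.mult)
  moreover have "S \<inter> T = {x \<in> Y. \<exists>r\<in>(\<lambda>(p, q) x. p x * q x) ` (P \<times> Q). r x \<noteq> 0}"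
    unfolding P(2) Q(2) by auto
  ultimately show "\<exists>P \<subseteq> polynomial_functions N. S \<inter> T = {x \<in> Y. \<exists>p\<in>P. p x \<noteq> 0}" by blast
next
  fix K :: "'s mat set set"
  assume "\<forall>U\<in>K. \<exists>P \<subseteq> polynomial_functions N. U = {x \<in> Y. \<exists>p\<in>P. p x \<noteq> 0}"
  from bchoice[OF this] obtain P where
    P': "\<forall>U\<in>K. P U \<subseteq> polynomial_functions N \<and> U = {x \<in> Y. \<exists>p\<in>P U. p x \<noteq> 0}" ..
  have P: "P U \<subseteq> polynomial_functions N" "U = {x \<in> Y. \<exists>p\<in>P U. p x \<noteq> 0}" if "U \<in> K" for U
    using bspec[OF P' that] by - (erule conjunct1, erule conjunct2)
  have eq: "\<Union>K = {x \<in> Y. \<exists>p\<in>(\<Union>U\<in>K. P U). p x \<noteq> 0}"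
  proof (intro equalityI subsetI)
    fix x assume "x \<in> \<Union>K"
    then obtain U where U: "U \<in> K" "x \<in> U" by blast
    have "x \<in> {x \<in> Y. \<exists>p\<in>P U. p x \<noteq> 0}" by (rule subst[where P = "\<lambda>V. x \<in> V", OF P(2)[OF U(1)] U(2)])
    then show "x \<in> {x \<in> Y. \<exists>p\<in>(\<Union>U\<in>K. P U). p x \<noteq> 0}" using U(1) by blast
  next
    fix x assume "x \<in> {x \<in> Y. \<exists>p\<in>(\<Union>U\<in>K. P U). p x \<noteq> 0}"
    then obtain U p where U: "U \<in> K" "p \<in> P U" "p x \<noteq> 0" "x \<in> Y" by blast
    then have "x \<in> {x \<in> Y. \<exists>p\<in>P U. p x \<noteq> 0}" by blast
    then have "x \<in> U" by (rule subst[where P = "\<lambda>V. x \<in> V", OF P(2)[OF U(1), symmetric]])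
    then show "x \<in> \<Union>K" using U(1) by blast
  qed
  have sub: "(\<Union>U\<in>K. P U) \<subseteq> polynomial_functions N" using P(1) by (rule UN_least)
  show "\<exists>P \<subseteq> polynomial_functions N. \<Union>K = {x \<in> Y. \<exists>p\<in>P. p x \<noteq> 0}"
    by (rule exI[of _ "\<Union>U\<in>K. P U"]) (intro conjI sub eq)
qed

lemma openin_zariski:
  fixes Y :: "'s::idom mat set"
  shows "openin (zariski N Y) U \<longleftrightarrow> (\<exists>P \<subseteq> polynomial_functions N. U = {x \<in> Y. \<exists>p\<in>P. p x \<noteq> 0})"
  unfolding zariski_def topology_inverse'[OF istopology_zariski] ..

lemma topspace_zariski [simp]:
  fixes Y :: "'s::idom mat set"
  shows "topspace (zariski N Y) = Y"
proof -
  have "openin (zariski N Y) Y"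
    unfolding openin_zariski
    by (rule exI[of _ "{\<lambda>_. 1}"]) (auto intro: pf.const)
  then show ?thesis
    unfolding topspace_def openin_zariski by fast
qed

lemma closedin_zariski:
  fixes Y :: "'s::idom mat set"
  shows "closedin (zariski N Y) Z \<longleftrightarrow>
    (\<exists>P \<subseteq> polynomial_functions N. Z = {x \<in> Y. \<forall>p\<in>P. p x = 0})"
proof -
  have eq: "Z \<subseteq> Y \<and> Y - Z = {x \<in> Y. \<exists>p\<in>P. p x \<noteq> 0} \<longleftrightarrow> Z = {x \<in> Y. \<forall>p\<in>P. p x = 0}" for P
  proof -
    have "{x \<in> Y. \<exists>p\<in>P. p x \<noteq> 0} = Y - {x \<in> Y. \<forall>p\<in>P. p x = 0}" by auto
    moreover have "W \<subseteq> Y \<Longrightarrow> (Z \<subseteq> Y \<and> Y - Z = Y - W) \<longleftrightarrow> Z = W" for W by blast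
    ultimately show ?thesis by (simp only: Collect_restrict)
  qed
  have ex_rot: "(a \<and> (\<exists>P. A P \<and> B P)) \<longleftrightarrow> (\<exists>P. A P \<and> (a \<and> B P))"
    for a and A B :: "('s mat \<Rightarrow> 's) set \<Rightarrow> bool" by blast
  have "closedin (zariski N Y) Z \<longleftrightarrow>
    (\<exists>P. P \<subseteq> polynomial_functions N \<and> (Z \<subseteq> Y \<and> Y - Z = {x \<in> Y. \<exists>p\<in>P. p x \<noteq> 0}))"
    unfolding closedin_def openin_zariski topspace_zariski
    by (rule ex_rot)
  then show ?thesis unfolding eq .
qed

text \<open>Irreducibility makes the ideal of functions vanishing on \<open>Z\<close> prime.\<close>

lemma irreducible_closed_mult:
  fixes Y :: "'s::idom mat set"
  assumes Z: "irreducible_closed (zariski N Y) Z"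
    and p: "p \<in> polynomial_functions N" and r: "r \<in> polynomial_functions N"
    and pr: "\<And>x. x \<in> Z \<Longrightarrow> p x * r x = 0"
  shows "(\<forall>x\<in>Z. p x = 0) \<or> (\<forall>x\<in>Z. r x = 0)"
proof -
  have c: "closedin (zariski N Y) {x \<in> Y. f x = 0}" if "f \<in> polynomial_functions N" for f
    unfolding closedin_zariski by (rule exI[of _ "{f}"]) (use that in auto)
  have "Z \<subseteq> Y" using Z closedin_subset unfolding irreducible_closed_def by fastforce
  then have "Z \<subseteq> {x \<in> Y. p x = 0} \<union> {x \<in> Y. r x = 0}" using pr by auto
  then have "Z \<subseteq> {x \<in> Y. p x = 0} \<or> Z \<subseteq> {x \<in> Y. r x = 0}"
    using Z c[OF p] c[OF r] unfolding irreducible_closed_def by blast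
  then show ?thesis by auto
qed

section \<open>Monomials in functions that separate a chain of irreducible closed sets\<close>

primrec list_monom :: "(nat \<Rightarrow> 'x \<Rightarrow> 's::comm_ring_1) \<Rightarrow> nat list \<Rightarrow> 'x \<Rightarrow> 's" where
  "list_monom f [] x = 1"
| "list_monom f (k # l) x = f (length l) x ^ k * list_monom f l x"

definition exponents :: "nat \<Rightarrow> nat \<Rightarrow> nat list set" where
  "exponents m n = {l. length l = m \<and> set l \<subseteq> {..n}}"

lemma finite_exponents: "finite (exponents m n)"
  using finite_lists_length_eq[of "{..n}" m] by (simp add: exponents_def conj_commute)

lemma card_exponents: "card (exponents m n) = (n + 1) ^ m"
  using card_lists_length_eq[of "{..n}" m] by (simp add: exponents_def conj_commute)

lemma exponents_Suc: "exponents (Suc m) n = (\<lambda>(k, l). k # l) ` ({..n} \<times> exponents m n)"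
  by (auto simp: exponents_def length_Suc_conv image_iff)

lemma list_monom_polynomial:
  "(\<And>i. i < length l \<Longrightarrow> f i \<in> polynomial_functions N) \<Longrightarrow> list_monom f l \<in> polynomial_functions N"
proof (induction l)
  case (Cons k l)
  then have "(\<lambda>x. f (length l) x ^ k * list_monom f l x) \<in> polynomial_functions N"
    by (intro pf.mult pf.power) auto
  then show ?case by simp
next
  case Nil
  have "list_monom f [] = (\<lambda>_. 1)" by (simp add: fun_eq_iff)
  then show ?case by (simp add: pf.const)
qed

text \<open>Functions separating the members of a chain of irreducible closed sets are algebraically
  independent on its largest member: on \<open>Z (Suc m)\<close> one may divide by \<open>f m\<close>, and on \<open>Z m\<close> only
  the terms without \<open>f m\<close> remain.\<close>

lemma chain_independent:
  fixes Y :: "'s::idom mat set"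
  assumes irr: "\<And>i. i \<le> m \<Longrightarrow> irreducible_closed (zariski N Y) (Z i)"
    and sub: "\<And>i. i < m \<Longrightarrow> Z i \<subseteq> Z (Suc i)"
    and f: "\<And>i. i < m \<Longrightarrow> f i \<in> polynomial_functions N"
    and f0: "\<And>i x. i < m \<Longrightarrow> x \<in> Z i \<Longrightarrow> f i x = 0"
    and f1: "\<And>i. i < m \<Longrightarrow> \<exists>x\<in>Z (Suc i). f i x \<noteq> 0"
    and c: "\<And>x. x \<in> Z m \<Longrightarrow> (\<Sum>l\<in>exponents m n. c l * list_monom f l x) = 0"
    and l: "l \<in> exponents m n"
  shows "c l = 0"
  using assms
proof (induction m arbitrary: c l)
  case 0
  obtain x where "x \<in> Z 0" using 0(1)[of 0] by (auto simp: irreducible_closed_def)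
  moreover have "exponents 0 n = {[]}" by (auto simp: exponents_def)
  ultimately show ?case using 0(6)[of x] 0(7) by simp
next
  case (Suc m)
  let ?S = "\<lambda>k x. \<Sum>l\<in>exponents m n. c (k # l) * list_monom f l x"
  have S_pf: "?S k \<in> polynomial_functions N" for k
    using Suc.prems(3) by (intro pf.sum pf.mult pf.const list_monom_polynomial) (auto simp: exponents_def)
  have sum: "(\<Sum>l\<in>exponents (Suc m) n. c l * list_monom f l x) = (\<Sum>k\<le>n. f m x ^ k * ?S k x)" for x
  proof -
    have "(\<Sum>l\<in>exponents (Suc m) n. c l * list_monom f l x) =
      (\<Sum>(k, l)\<in>{..n} \<times> exponents m n. c (k # l) * list_monom f (k # l) x)"
      unfolding exponents_Suc
      by (subst sum.reindex) (auto intro!: inj_onI sum.cong)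
    also have "\<dots> = (\<Sum>k\<le>n. \<Sum>l\<in>exponents m n. c (k # l) * list_monom f (k # l) x)"
      by (simp add: sum.cartesian_product)
    also have "\<dots> = (\<Sum>k\<le>n. f m x ^ k * ?S k x)"
      unfolding sum_distrib_left by (intro sum.cong refl) (auto simp: exponents_def algebra_simps)
    finally show ?thesis .
  qed
  have "\<forall>l\<in>exponents m n. c (k # l) = 0" if "k \<le> n" for k
    using that
  proof (induction k rule: less_induct)
    case (less k)
    \<comment> \<open>Powers of \<open>f m\<close> below k have vanishing coefficients by the inner
      induction, so the relation is \<open>f m ^ k\<close> times \<open>?R\<close>; the first factor
      is not identically zero and cancels by primality.\<close>
    let ?R = "\<lambda>x. \<Sum>j\<in>{k..n}. f m x ^ (j - k) * ?S j x"
    have R_pf: "?R \<in> polynomial_functions N"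
      by (intro pf.sum pf.mult[OF pf.power S_pf] Suc.prems(3)) simp
    have "f m x ^ k * ?R x = 0" if "x \<in> Z (Suc m)" for x
    proof -
      have "f m x ^ k * ?R x = (\<Sum>j\<in>{k..n}. f m x ^ j * ?S j x)"
        unfolding sum_distrib_left[of "f m x ^ k"]
        by (intro sum.cong refl) (simp add: mult.assoc[symmetric] flip: power_add)
      also have "\<dots> = (\<Sum>j\<le>n. f m x ^ j * ?S j x)"
        using less by (intro sum.mono_neutral_left) auto
      also have "\<dots> = 0" using Suc.prems(6)[OF that] sum by simp
      finally show ?thesis .
    qed
    moreover have "(\<lambda>x. f m x ^ k) \<in> polynomial_functions N" using Suc.prems(3) by (intro pf.power) auto
    ultimately have "(\<forall>x\<in>Z (Suc m). f m x ^ k = 0) \<or> (\<forall>x\<in>Z (Suc m). ?R x = 0)"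
      using irreducible_closed_mult[OF Suc.prems(1)[of "Suc m"] _ R_pf] by blast
    moreover have "\<not> (\<forall>x\<in>Z (Suc m). f m x ^ k = 0)" using Suc.prems(5)[of m] by auto
    ultimately have R: "?R x = 0" if "x \<in> Z (Suc m)" for x using that by blast
    have "?S k x = 0" if x: "x \<in> Z m" for x
    proof -
      have "?R x = (\<Sum>j\<in>{k..n}. if j = k then ?S k x else 0)"
        using Suc.prems(4)[of m x] x by (intro sum.cong) auto
      also have "\<dots> = ?S k x" using less.prems by simp
      finally show ?thesis using R Suc.prems(2)[of m] x by auto
    qed
    then show ?case using Suc.IH[of "\<lambda>l. c (k # l)"] Suc.prems by auto
  qed
  then show ?case using Suc.prems(7) by (auto simp: exponents_Suc)
qed


section \<open>Polynomial functions on affine space\<close>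

global_interpretation fs: vector_space "\<lambda>(c::'s::field) (f :: 'x \<Rightarrow> 's) x. c * f x"
  by unfold_locales (auto simp: fun_eq_iff algebra_simps)

definition monom_fun :: "nat \<Rightarrow> (nat \<Rightarrow> nat) \<Rightarrow> (nat \<Rightarrow> 's::field) \<Rightarrow> 's" where
  "monom_fun d a w = (\<Prod>i<d. w i ^ a i)"

text \<open>\<open>e\<close> bounds every single exponent, not the total degree, so that the
  spanning monomials are indexed by exactly (e + 1)^d tuples, a count of the same shape as
  \<open>card_exponents\<close>.\<close>

definition poly_deg :: "nat \<Rightarrow> nat \<Rightarrow> ((nat \<Rightarrow> 's::field) \<Rightarrow> 's) set" where
  "poly_deg d e = fs.span (monom_fun d ` ({..<d} \<rightarrow>\<^sub>E {..e}))"

lemma monom_fun_poly_deg: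
  assumes "\<And>i. i < d \<Longrightarrow> a i \<le> e"
  shows "(monom_fun d a :: (nat \<Rightarrow> 's::field) \<Rightarrow> 's) \<in> poly_deg d e"
proof -
  have "(monom_fun d a :: (nat \<Rightarrow> 's) \<Rightarrow> 's) = monom_fun d (restrict a {..<d})"
    by (auto simp: monom_fun_def fun_eq_iff)
  moreover have "restrict a {..<d} \<in> {..<d} \<rightarrow>\<^sub>E {..e}" using assms by auto
  ultimately show ?thesis unfolding poly_deg_def by (simp only: fs.span_base imageI)
qed

lemma poly_deg_mult:
  assumes "f \<in> poly_deg d e" "g \<in> poly_deg d e'"
  shows "(\<lambda>w. f w * g w) \<in> poly_deg d (e + e')"
proof -
  have mono: "(\<lambda>w. monom_fun d a w * g w) \<in> poly_deg d (e + e')" if a: "a \<in> {..<d} \<rightarrow>\<^sub>E {..e}" for a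
    using assms(2) unfolding poly_deg_def[of d e']
  proof (induction rule: fs.span_induct_alt)
    case base
    show ?case using fs.span_zero unfolding poly_deg_def by (simp add: zero_fun_def)
  next
    case (step c x y)
    then obtain b where b: "b \<in> {..<d} \<rightarrow>\<^sub>E {..e'}" "x = monom_fun d b" by blast
    have "(\<lambda>w. monom_fun d a w * x w) = monom_fun d (\<lambda>i. a i + b i)"
      by (auto simp: b(2) monom_fun_def fun_eq_iff power_add prod.distrib)
    moreover have "monom_fun d (\<lambda>i. a i + b i) \<in> poly_deg d (e + e')"
      using a b(1) by (intro monom_fun_poly_deg) (auto simp: PiE_iff intro: add_mono)
    ultimately have "(\<lambda>w. c * (monom_fun d a w * x w)) + (\<lambda>w. monom_fun d a w * y w) \<in> poly_deg d (e + e')"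
      using step unfolding poly_deg_def by (intro fs.span_add fs.span_scale) auto
    then show ?case by (simp add: plus_fun_def algebra_simps)
  qed
  show ?thesis
    using assms(1) unfolding poly_deg_def[of d e]
  proof (induction rule: fs.span_induct_alt)
    case base
    show ?case using fs.span_zero unfolding poly_deg_def by (simp add: zero_fun_def)
  next
    case (step c x y)
    then have "(\<lambda>w. c * (x w * g w)) + (\<lambda>w. y w * g w) \<in> poly_deg d (e + e')"
      using mono unfolding poly_deg_def by (intro fs.span_add fs.span_scale) auto
    then show ?case by (simp add: plus_fun_def algebra_simps)
  qed
qed

lemma poly_deg_mono: "e \<le> e' \<Longrightarrow> poly_deg d e \<subseteq> poly_deg d e'"
  unfolding poly_deg_def by (intro fs.span_mono image_mono PiE_mono) auto

lemma poly_deg_const: "(\<lambda>_. c) \<in> poly_deg d e"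
proof -
  have "monom_fun d (\<lambda>_. 0) \<in> poly_deg d e" by (rule monom_fun_poly_deg) simp
  then have "(\<lambda>w. c * monom_fun d (\<lambda>_. 0) w) \<in> poly_deg d e"
    unfolding poly_deg_def by (rule fs.span_scale)
  then show ?thesis by (simp add: monom_fun_def)
qed

lemma poly_deg_add: "f \<in> poly_deg d e \<Longrightarrow> g \<in> poly_deg d e \<Longrightarrow> (\<lambda>w. f w + g w) \<in> poly_deg d e"
  using fs.span_add[of f _ g] by (simp add: poly_deg_def plus_fun_def)

lemma poly_deg_power: "f \<in> poly_deg d e \<Longrightarrow> (\<lambda>w. f w ^ k) \<in> poly_deg d (k * e)"
proof (induction k)
  case (Suc k)
  then show ?case using poly_deg_mult[OF Suc.prems, of "\<lambda>w. f w ^ k" "k * e"] by simp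
qed (simp add: poly_deg_const)

lemma poly_deg_coord:
  assumes "i < d"
  shows "(\<lambda>w. w i :: 's::field) \<in> poly_deg d 1"
proof -
  have "monom_fun d (\<lambda>j. if j = i then 1 else 0) = (\<lambda>w :: nat \<Rightarrow> 's. w i)"
  proof
    fix w :: "nat \<Rightarrow> 's"
    have "monom_fun d (\<lambda>j. if j = i then 1 else 0) w = (\<Prod>j<d. if j = i then w j else 1)"
      unfolding monom_fun_def by (intro prod.cong) auto
    then show "monom_fun d (\<lambda>j. if j = i then 1 else 0) w = w i" using assms by simp
  qed
  moreover have "(monom_fun d (\<lambda>j. if j = i then 1 else 0) :: (nat \<Rightarrow> 's) \<Rightarrow> 's) \<in> poly_deg d 1"
    by (rule monom_fun_poly_deg) simp
  ultimately show ?thesis by simp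
qed

definition affine_polys :: "nat \<Rightarrow> ((nat \<Rightarrow> 's::field) \<Rightarrow> 's) set" where
  "affine_polys d = (\<Union>e. poly_deg d e)"

interpretation ap: fun_alg "affine_polys d :: ((nat \<Rightarrow> 's::field) \<Rightarrow> 's) set"
proof
  show "(\<lambda>_. c) \<in> affine_polys d" for c :: 's
    unfolding affine_polys_def using poly_deg_const by blast
  fix f g :: "(nat \<Rightarrow> 's) \<Rightarrow> 's" assume "f \<in> affine_polys d" "g \<in> affine_polys d"
  then obtain e e' where e: "f \<in> poly_deg d e" "g \<in> poly_deg d e'" by (auto simp: affine_polys_def)
  then have "f \<in> poly_deg d (max e e')" "g \<in> poly_deg d (max e e')"
    using poly_deg_mono[of e "max e e'" d] poly_deg_mono[of e' "max e e'" d] by auto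
  then show "(\<lambda>x. f x + g x) \<in> affine_polys d" unfolding affine_polys_def using poly_deg_add by blast
  show "(\<lambda>x. f x * g x) \<in> affine_polys d" unfolding affine_polys_def using poly_deg_mult[OF e] by blast
qed

lemma affine_polys_coord: "i < d \<Longrightarrow> (\<lambda>w. w i) \<in> affine_polys d"
  unfolding affine_polys_def using poly_deg_coord by blast

text \<open>Restriction to a line reduces nonvanishing on affine space to polynomials in one
  variable, which have finitely many roots.\<close>

lemma affine_polys_line:
  fixes f :: "(nat \<Rightarrow> 's::field) \<Rightarrow> 's"
  assumes "f \<in> affine_polys d"
  shows "\<exists>p. \<forall>t. f (\<lambda>i. u i + t * v i) = poly p t"
proof -
  obtain e where "f \<in> poly_deg d e" using assms by (auto simp: affine_polys_def)
  then show ?thesis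
    unfolding poly_deg_def
  proof (induction rule: fs.span_induct_alt)
    case base
    show ?case by (rule exI[of _ 0]) simp
  next
    case (step c x y)
    then obtain a p where "x = monom_fun d a" and p: "\<forall>t. y (\<lambda>i. u i + t * v i) = poly p t" by blast
    then have "(\<lambda>i. u i + t * v i) = (\<lambda>i. u i + t * v i) \<and>
      x (\<lambda>i. u i + t * v i) = poly (\<Prod>i<d. [:u i, v i:] ^ a i) t" for t
      by (simp add: monom_fun_def poly_prod mult.commute)
    then show ?case using p
      by (intro exI[of _ "smult c (\<Prod>i<d. [:u i, v i:] ^ a i) + p"]) (simp add: plus_fun_def)
  qed
qed

text \<open>Independence is asked of the indexed family, which also rules out repeated members; the
  index set is then bounded by the dimension of \<open>poly_deg d e\<close>.\<close>

lemma card_independent_le: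
  fixes F :: "'j \<Rightarrow> (nat \<Rightarrow> 's::field) \<Rightarrow> 's"
  assumes J: "finite J" and F: "\<And>j. j \<in> J \<Longrightarrow> F j \<in> poly_deg d e"
    and ind: "\<And>c. (\<And>w. (\<Sum>j\<in>J. c j * F j w) = 0) \<Longrightarrow> \<forall>j\<in>J. c j = 0"
  shows "card J \<le> (e + 1) ^ d"
proof -
  have inj: "inj_on F J"
  proof (rule inj_onI, rule ccontr)
    fix i j assume ij: "i \<in> J" "j \<in> J" "F i = F j" "i \<noteq> j"
    let ?c = "\<lambda>k. (if k = i then 1 else 0) - (if k = j then 1 else 0)"
    have "(\<Sum>k\<in>J. ?c k * F k w) = 0" for w
      using ij J by (simp add: left_diff_distrib sum_subtractf if_distrib[of "\<lambda>c. c * _"] cong: if_cong)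
    from ind[OF this] ij show False by auto
  qed
  have "fs.independent (F ` J)"
  proof
    assume "fs.dependent (F ` J)"
    then obtain u where u: "\<exists>v\<in>F ` J. u v \<noteq> 0" "(\<Sum>v\<in>F ` J. (\<lambda>x. u v * v x)) = 0"
      using fs.dependent_finite[of "F ` J"] J by auto
    have "(\<Sum>j\<in>J. u (F j) * F j w) = 0" for w
    proof -
      have "(\<Sum>v\<in>F ` J. (\<lambda>x. u v * v x)) w = 0" using u(2) by simp
      then show ?thesis by (simp add: sum_fun_apply sum.reindex[OF inj])
    qed
    from ind[OF this] u(1) show False by auto
  qed
  moreover have "finite (monom_fun d ` ({..<d} \<rightarrow>\<^sub>E {..e}) :: ((nat \<Rightarrow> 's) \<Rightarrow> 's) set)"
    by (intro finite_imageI finite_PiE) auto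
  moreover have "F ` J \<subseteq> fs.span (monom_fun d ` ({..<d} \<rightarrow>\<^sub>E {..e}))" using F by (auto simp: poly_deg_def)
  ultimately have "card (F ` J) \<le> card (monom_fun d ` ({..<d} \<rightarrow>\<^sub>E {..e}) :: ((nat \<Rightarrow> 's) \<Rightarrow> 's) set)"
    using fs.independent_span_bound by blast
  also have "\<dots> \<le> card ({..<d} \<rightarrow>\<^sub>E {..e})" by (intro card_image_le finite_PiE) auto
  also have "\<dots> = (e + 1) ^ d" by (simp add: card_PiE)
  finally show ?thesis using card_image[OF inj] by simp
qed

text \<open>This takes the place of transcendence degree: m algebraically independent polynomials in
  d variables have (n + 1)^m independent monomials, while the available space grows only like
  n^d.\<close>

lemma exponent_le_of_growth:
  fixes C m d :: nat
  assumes "\<And>n. (n + 1) ^ m \<le> (C * n + 1) ^ d"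
  shows "m \<le> d"
proof (rule ccontr)
  assume "\<not> m \<le> d"
  then have m: "m \<ge> Suc d" by simp
  \<comment> \<open>Chosen so that (C + 1)^d (n + 1)^d is n (n + 1)^d, which is less than (n + 1)^(d
    + 1).\<close>
  define n where "n = (C + 1) ^ d"
  have "C * n + 1 \<le> (C + 1) * (n + 1)" by (simp add: distrib_left distrib_right)
  then have "(n + 1) ^ m \<le> ((C + 1) * (n + 1)) ^ d"
    using assms[of n] power_mono[of "C * n + 1" "(C + 1) * (n + 1)" d] by linarith
  also have "\<dots> = n * (n + 1) ^ d" by (simp only: n_def power_mult_distrib)
  also have "\<dots> < (n + 1) ^ Suc d" by simp
  also have "\<dots> \<le> (n + 1) ^ m" using m by (intro power_increasing) auto
  finally show False by simp
qed


section \<open>Dimension of isometry groups by the Cayley transform\<close>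

text \<open>Written with the adjugate so that \<open>det Z\<close> is the only denominator and the
  numerators are polynomial in the entries. At a singular \<open>Z\<close> the value is the zero
  matrix.\<close>

definition minv :: "'s::field mat \<Rightarrow> 's mat" where
  "minv Z = inverse (det Z) \<cdot>\<^sub>m adj_mat Z"

lemma minv:
  assumes "Z \<in> carrier_mat N N"
  shows minv_carrier: "minv Z \<in> carrier_mat N N"
    and "det Z \<noteq> 0 \<Longrightarrow> Z * minv Z = 1\<^sub>m N" "det Z \<noteq> 0 \<Longrightarrow> minv Z * Z = 1\<^sub>m N"
    and "det Z \<noteq> 0 \<Longrightarrow> det (minv Z) \<noteq> 0"
proof -
  note adj = adj_mat[OF assms]
  show c: "minv Z \<in> carrier_mat N N" using adj by (simp add: minv_def)
  have one: "inverse x \<cdot>\<^sub>m (x \<cdot>\<^sub>m 1\<^sub>m N) = (1\<^sub>m N :: 'a mat)" if "x \<noteq> 0" for x :: 'a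
    using that by (intro eq_matI) auto
  show 1: "det Z \<noteq> 0 \<Longrightarrow> Z * minv Z = 1\<^sub>m N"
    using mult_smult_distrib[OF assms adj(1)] adj one by (simp add: minv_def)
  show "det Z \<noteq> 0 \<Longrightarrow> minv Z * Z = 1\<^sub>m N"
    using mult_smult_assoc_mat[OF adj(1) assms] adj one by (simp add: minv_def)
  assume "det Z \<noteq> 0"
  then have "det Z * det (minv Z) = 1" using det_mult[OF assms c] 1 by simp
  then show "det (minv Z) \<noteq> 0" by auto
qed

lemma minv_unique:
  assumes Z: "Z \<in> carrier_mat N N" and Y: "Y \<in> carrier_mat N N" and ZY: "Z * Y = 1\<^sub>m N"
  shows "minv Z = Y"
proof -
  have "det Z * det Y = 1" using det_mult[OF Z Y] ZY by simp
  then have d: "det Z \<noteq> 0" by auto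
  have "minv Z = minv Z * (Z * Y)" using minv[OF Z] ZY by simp
  also have "\<dots> = (minv Z * Z) * Y" using minv(1)[OF Z] Z Y by simp
  also have "\<dots> = Y" using minv(3)[OF Z d] Y by simp
  finally show ?thesis .
qed

lemma invertible_mat_iff_det:
  assumes Z: "(Z :: 's::field mat) \<in> carrier_mat N N"
  shows "invertible_mat Z \<longleftrightarrow> det Z \<noteq> 0"
proof
  assume "invertible_mat Z"
  then obtain B where B: "Z * B = 1\<^sub>m (dim_row Z)" "B * Z = 1\<^sub>m (dim_row B)"
    unfolding invertible_mat_def inverts_mat_def by blast
  have "dim_col B = N" using B(1) Z by (metis carrier_matD(1) index_mult_mat(3) index_one_mat(3))
  moreover have "dim_row B = N" using B(2) Z by (metis carrier_matD(2) index_mult_mat(3) index_one_mat(3))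
  ultimately have Bc: "B \<in> carrier_mat N N" by auto
  have "det Z * det B = 1" using det_mult[OF Z Bc] B(1) Z by simp
  then show "det Z \<noteq> 0" by auto
next
  assume "det Z \<noteq> 0"
  then show "invertible_mat Z"
    unfolding invertible_mat_def inverts_mat_def using minv[OF Z] Z by auto
qed

text \<open>The scalars \<open>\<Lambda>\<close> provide linear functionals recovering the coordinates \<open>w\<close> of \<open>Zw w\<close>.\<close>

locale cayley =
  fixes N d :: nat and RR JJ :: "'s::field mat set"
    and Zw :: "(nat \<Rightarrow> 's) \<Rightarrow> 's mat" and W \<Lambda> :: "nat \<Rightarrow> nat \<Rightarrow> nat \<Rightarrow> 's" and cay G :: "'s mat set"
  defines "cay \<equiv> {Z \<in> carrier_mat N N. (\<forall>R\<in>RR. Z * R = R * Z) \<and>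
      (\<forall>J\<in>JJ. transpose_mat Z * J + J * Z + J = 0\<^sub>m N N)}"
    and "G \<equiv> {g \<in> carrier_mat N N. invertible_mat g \<and> (\<forall>R\<in>RR. g * R = R * g) \<and>
      (\<forall>J\<in>JJ. transpose_mat g * J * g = J)}"
  assumes inf: "infinite (UNIV :: 's set)"
    and RR: "RR \<subseteq> carrier_mat N N" and JJ: "JJ \<subseteq> carrier_mat N N"
    and Zw: "Zw w \<in> cay"
    and Zw_surj: "Z \<in> cay \<Longrightarrow> \<exists>w. Z = Zw w"
    and Zw_entry: "a < N \<Longrightarrow> b < N \<Longrightarrow> Zw w $$ (a, b) = Zw (\<lambda>_. 0) $$ (a, b) + (\<Sum>i<d. w i * W i a b)"
    and \<Lambda>: "i < d \<Longrightarrow> (\<Sum>a<N. \<Sum>b<N. \<Lambda> i a b * (Zw w $$ (a, b) - Zw (\<lambda>_. 0) $$ (a, b))) = w i"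
    and det0: "det (Zw (\<lambda>_. 0)) \<noteq> 0" "det (Zw (\<lambda>_. 0) + 1\<^sub>m N) \<noteq> 0"
begin

lemmas ring_simps = add_mult_distrib_mat[of _ N N _ _ N] mult_add_distrib_mat[of _ N N _ N]
  assoc_mult_mat[of _ N N _ N _ N] assoc_add_mat[of _ N N]

lemma isometry_expand:
  assumes "J \<in> carrier_mat N N" "(Y :: 's mat) \<in> carrier_mat N N"
  shows "transpose_mat (1\<^sub>m N + Y) * J * (1\<^sub>m N + Y) =
    J + (J * Y + transpose_mat Y * J + transpose_mat Y * (J * Y))"
proof -
  have tY: "transpose_mat Y \<in> carrier_mat N N" using assms by simp
  have perm: "(P + Q) + (R + S) = P + (R + Q + S)"
    if "P \<in> carrier_mat N N" "Q \<in> carrier_mat N N" "R \<in> carrier_mat N N" "S \<in> carrier_mat N N"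
    for P Q R S :: "'s mat"
    using that by (intro eq_matI) auto
  have "transpose_mat (1\<^sub>m N + Y) * J = J + transpose_mat Y * J"
    using transpose_add[of "1\<^sub>m N" N N Y] assms tY
    by (simp add: transpose_one add_mult_distrib_mat[of _ N N _ _ N])
  then have "transpose_mat (1\<^sub>m N + Y) * J * (1\<^sub>m N + Y) =
    (J + transpose_mat Y * J) + (J * Y + transpose_mat Y * J * Y)"
    using assms tY mult_add_distrib_mat[of "J + transpose_mat Y * J" N N "1\<^sub>m N" N Y]
    by (simp add: add_mult_distrib_mat[of _ N N _ _ N])
  also have "\<dots> = J + (J * Y + transpose_mat Y * J + transpose_mat Y * J * Y)"
    using assms tY by (intro perm) auto
  finally show ?thesis using assms tY by (simp add: assoc_mult_mat[of _ N N _ N _ N])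
qed

lemma Zw_carrier: "Zw w \<in> carrier_mat N N"
  using Zw by (simp add: cay_def)

lemma G_carrier: "g \<in> G \<Longrightarrow> g \<in> carrier_mat N N"
  by (simp add: G_def)

text \<open>For Y = Z^(-1), multiplying Z^T J + J Z + J = 0 by Y^T on the left and by Y on the right
  gives J Y + Y^T J + Y^T J Y = 0, the isometry condition for 1 + Y. Invertibility comes from 1 + Y
  = (Z + 1) Y.\<close>

lemma cay_to_G:
  assumes Z: "Z \<in> cay" and d1: "det Z \<noteq> 0" and d2: "det (Z + 1\<^sub>m N) \<noteq> 0"
  shows "1\<^sub>m N + minv Z \<in> G"
proof -
  have Zc: "Z \<in> carrier_mat N N" using Z by (simp add: cay_def)
  define Y where "Y = minv Z"
  have Yc: "Y \<in> carrier_mat N N" and ZY: "Z * Y = 1\<^sub>m N" and YZ: "Y * Z = 1\<^sub>m N" and dY: "det Y \<noteq> 0"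
    using minv[OF Zc] d1 by (auto simp: Y_def)
  have tYc: "transpose_mat Y \<in> carrier_mat N N" and tZc: "transpose_mat Z \<in> carrier_mat N N"
    using Yc Zc by auto
  have tYZ: "transpose_mat Y * transpose_mat Z = 1\<^sub>m N"
    using transpose_mult[OF Zc Yc] ZY by (simp add: transpose_one)
  have "1\<^sub>m N + Y = (Z + 1\<^sub>m N) * Y"
    using Zc Yc ZY by (simp add: add_mult_distrib_mat[of _ N N])
  then have inv: "invertible_mat (1\<^sub>m N + Y)"
    using d2 dY Zc Yc by (subst invertible_mat_iff_det[of _ N]) (auto simp: det_mult[of _ N])
  have comm: "(1\<^sub>m N + Y) * R = R * (1\<^sub>m N + Y)" if "R \<in> RR" for R
  proof -
    have R: "R \<in> carrier_mat N N" and ZR: "Z * R = R * Z" using that RR Z by (auto simp: cay_def)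
    have "Y * R = Y * (R * Z) * Y" using R Yc Zc ZY by (simp add: ring_simps)
    also have "\<dots> = (Y * Z) * (R * Y)" using R Yc Zc by (simp add: ring_simps flip: ZR)
    also have "\<dots> = R * Y" using R Yc YZ by simp
    finally show ?thesis using R Yc by (simp add: ring_simps)
  qed
  have iso: "transpose_mat (1\<^sub>m N + Y) * J * (1\<^sub>m N + Y) = J" if "J \<in> JJ" for J
  proof -
    have J: "J \<in> carrier_mat N N" and E: "transpose_mat Z * J + J * Z + J = 0\<^sub>m N N"
      using that JJ Z by (auto simp: cay_def)
    have 1: "transpose_mat Y * (transpose_mat Z * J * Y) = J * Y"
    proof -
      have "transpose_mat Y * (transpose_mat Z * J * Y) = (transpose_mat Y * transpose_mat Z) * (J * Y)"
        using J Yc tYc tZc by (simp add: ring_simps)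
      then show ?thesis using tYZ J Yc by simp
    qed
    have 2: "transpose_mat Y * (J * Z * Y) = transpose_mat Y * J"
      using J Yc Zc tYc ZY by (simp add: ring_simps)
    have "transpose_mat Y * ((transpose_mat Z * J + J * Z + J) * Y) = 0\<^sub>m N N"
      unfolding E using Yc tYc by simp
    moreover have "transpose_mat Y * ((transpose_mat Z * J + J * Z + J) * Y) =
       transpose_mat Y * (transpose_mat Z * J * Y) + transpose_mat Y * (J * Z * Y) + transpose_mat Y * (J * Y)"
      using J Yc Zc tYc tZc
      by (simp add: add_mult_distrib_mat[of _ N N _ _ N] mult_add_distrib_mat[of _ N N _ N])
    ultimately have 3: "J * Y + transpose_mat Y * J + transpose_mat Y * (J * Y) = 0\<^sub>m N N"
      using 1 2 by simp
    show ?thesis unfolding isometry_expand[OF J Yc] 3 using J by simp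
  qed
  show ?thesis unfolding G_def Y_def[symmetric] using inv comm iso Yc by auto
qed

text \<open>The computation of \<open>cay_to_G\<close> reversed: the isometry condition is quadratic
  in Y = g - 1 but affine linear in Z = Y^(-1), which is why the chart is part of an affine
  space.\<close>

lemma G_to_cay:
  assumes g: "g \<in> G" and d1: "det (g - 1\<^sub>m N) \<noteq> 0"
  shows "minv (g - 1\<^sub>m N) \<in> cay"
proof -
  define Y where "Y = g - 1\<^sub>m N"
  define Z where "Z = minv Y"
  have gc: "g \<in> carrier_mat N N" using g by (simp add: G_def)
  then have Yc: "Y \<in> carrier_mat N N" by (auto simp: Y_def intro!: carrier_matI)
  have gY: "g = 1\<^sub>m N + Y" using gc unfolding Y_def by (intro eq_matI) auto
  have Zc: "Z \<in> carrier_mat N N" and YZ: "Y * Z = 1\<^sub>m N" and ZY: "Z * Y = 1\<^sub>m N"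
    using minv[OF Yc] d1 by (auto simp: Z_def Y_def)
  have tYc: "transpose_mat Y \<in> carrier_mat N N" and tZc: "transpose_mat Z \<in> carrier_mat N N"
    using Yc Zc by auto
  have tZY: "transpose_mat Z * transpose_mat Y = 1\<^sub>m N"
    using transpose_mult[OF Yc Zc] YZ by (simp add: transpose_one)
  have comm: "Z * R = R * Z" if "R \<in> RR" for R
  proof -
    have R: "R \<in> carrier_mat N N" and gR: "g * R = R * g" using that RR g by (auto simp: G_def)
    have YR: "Y * R = R * Y" unfolding Y_def using gc R gR
      by (simp add: minus_mult_distrib_mat[of _ N N] mult_minus_distrib_mat[of _ N N])
    have "Z * R = Z * (R * Y) * Z" using R Yc Zc YZ by (simp add: ring_simps)
    also have "\<dots> = (Z * Y) * (R * Z)" using R Yc Zc by (simp add: ring_simps flip: YR)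
    also have "\<dots> = R * Z" using R Zc ZY by simp
    finally show ?thesis .
  qed
  have iso: "transpose_mat Z * J + J * Z + J = 0\<^sub>m N N" if "J \<in> JJ" for J
  proof -
    have J: "J \<in> carrier_mat N N" and E: "transpose_mat g * J * g = J"
      using that JJ g by (auto simp: G_def)
    have "J + (J * Y + transpose_mat Y * J + transpose_mat Y * (J * Y)) = J"
      using E unfolding gY isometry_expand[OF J Yc] .
    moreover have "E = 0\<^sub>m N N" if "E \<in> carrier_mat N N" "J + E = J" for E
    proof (rule eq_matI)
      fix i j assume "i < dim_row (0\<^sub>m N N :: 's mat)" "j < dim_col (0\<^sub>m N N :: 's mat)"
      then have "(J + E) $$ (i, j) = J $$ (i, j) + E $$ (i, j)" "i < N" "j < N" using that(1) by auto
      then show "E $$ (i, j) = 0\<^sub>m N N $$ (i, j)" using that(2) by simp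
    qed (use that in auto)
    ultimately have 3: "J * Y + transpose_mat Y * J + transpose_mat Y * (J * Y) = 0\<^sub>m N N"
      using J Yc tYc by simp
    have 1: "transpose_mat Z * (J * Y * Z) = transpose_mat Z * J"
      using J Yc Zc tZc YZ by (simp add: ring_simps)
    have 2: "transpose_mat Z * (transpose_mat Y * U) = U" if "U \<in> carrier_mat N N" for U
    proof -
      have "transpose_mat Z * (transpose_mat Y * U) = (transpose_mat Z * transpose_mat Y) * U"
        using that tYc tZc by simp
      then show ?thesis using tZY that by simp
    qed
    have "transpose_mat Z * ((J * Y + transpose_mat Y * J + transpose_mat Y * (J * Y)) * Z) = 0\<^sub>m N N"
      unfolding 3 using Zc tZc by simp
    moreover have "transpose_mat Z * ((J * Y + transpose_mat Y * J + transpose_mat Y * (J * Y)) * Z) =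
      transpose_mat Z * (J * Y * Z) + transpose_mat Z * (transpose_mat Y * (J * Z)) +
      transpose_mat Z * (transpose_mat Y * (J * (Y * Z)))"
      using J Yc Zc tYc tZc by (simp add: ring_simps)
    ultimately have "transpose_mat Z * J + J * Z + J = 0\<^sub>m N N"
      using 1 2 J Zc YZ by simp
    then show ?thesis .
  qed
  show ?thesis unfolding cay_def Y_def[symmetric] Z_def[symmetric] using Zc comm iso by auto
qed

lemma minv_Cayley:
  assumes "Z \<in> carrier_mat N N" "det Z \<noteq> 0"
  shows "1\<^sub>m N + minv Z - 1\<^sub>m N = minv Z" "minv (minv Z) = Z"
proof -
  show "1\<^sub>m N + minv Z - 1\<^sub>m N = minv Z" using minv(1)[OF assms(1)] by (intro eq_matI) auto
  show "minv (minv Z) = Z" using minv(1,3)[OF assms(1)] assms by (intro minv_unique) auto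
qed

lemma one_plus_minus_one: "Z \<in> carrier_mat N N \<Longrightarrow> 1\<^sub>m N + (Z - 1\<^sub>m N) = (Z :: 's mat)"
  by (intro eq_matI) auto

lemma G_mult:
  assumes g: "g \<in> G" and g': "g' \<in> G"
  shows "g * g' \<in> G"
proof -
  have c: "g \<in> carrier_mat N N" "g' \<in> carrier_mat N N" using assms by (auto simp: G_def)
  have "invertible_mat (g * g')"
    using assms c by (auto simp: G_def invertible_mat_iff_det[of _ N] det_mult[OF c])
  moreover have "g * g' * R = R * (g * g')" if "R \<in> RR" for R
  proof -
    have R: "R \<in> carrier_mat N N" "g * R = R * g" "g' * R = R * g'" using that RR assms by (auto simp: G_def)
    have "g * g' * R = g * (R * g')" using c R by simp
    also have "\<dots> = (g * R) * g'" using c R(1) by simp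
    also have "\<dots> = R * (g * g')" unfolding R(2) using c R(1) by simp
    finally show ?thesis .
  qed
  moreover have "transpose_mat (g * g') * J * (g * g') = J" if "J \<in> JJ" for J
  proof -
    have J: "J \<in> carrier_mat N N" "transpose_mat g * J * g = J" "transpose_mat g' * J * g' = J"
      using that JJ assms by (auto simp: G_def)
    have t: "transpose_mat g \<in> carrier_mat N N" "transpose_mat g' \<in> carrier_mat N N" using c by auto
    have "transpose_mat (g * g') * J * (g * g') = transpose_mat g' * (transpose_mat g * J * g) * g'"
      unfolding transpose_mult[OF c] using c t J(1) by (simp add: ring_simps)
    then show ?thesis using J by simp
  qed
  ultimately show ?thesis using c by (auto simp: G_def)
qed

lemma G_inverse:
  assumes g: "g \<in> G"
  shows "minv g \<in> G"
proof -
  have c: "g \<in> carrier_mat N N" using assms by (auto simp: G_def)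
  have d: "det g \<noteq> 0" using g c by (auto simp: G_def invertible_mat_iff_det)
  note i = minv[OF c]
  have t: "transpose_mat g \<in> carrier_mat N N" "transpose_mat (minv g) \<in> carrier_mat N N"
    using c i by auto
  have "invertible_mat (minv g)" using i d by (auto simp: invertible_mat_iff_det[of _ N])
  moreover have "minv g * R = R * minv g" if "R \<in> RR" for R
  proof -
    have R: "R \<in> carrier_mat N N" and gR: "g * R = R * g" using that RR g by (auto simp: G_def)
    have "minv g * R = minv g * (R * g) * minv g" using R c i d by (simp add: ring_simps)
    also have "\<dots> = (minv g * g) * (R * minv g)" using R c i by (simp add: ring_simps flip: gR)
    also have "\<dots> = R * minv g" using R i d by simp
    finally show ?thesis .
  qed
  moreover have "transpose_mat (minv g) * J * minv g = J" if "J \<in> JJ" for J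
  proof -
    have J: "J \<in> carrier_mat N N" and E: "transpose_mat g * J * g = J"
      using that JJ g by (auto simp: G_def)
    have "transpose_mat (minv g) * J * minv g = transpose_mat (minv g) * (transpose_mat g * J * g) * minv g"
      using E by simp
    also have "\<dots> = (transpose_mat (minv g) * transpose_mat g) * (J * (g * minv g))"
      using c t i(1) J by (simp add: ring_simps)
    also have "transpose_mat (minv g) * transpose_mat g = 1\<^sub>m N"
      using transpose_mult[OF c i(1)] i(2) d by (simp add: transpose_one)
    finally show ?thesis using i d J by simp
  qed
  ultimately show ?thesis using i by (auto simp: G_def)
qed

section \<open>The Cayley parametrization in coordinates and the upper bound for the
  dimension\<close>

definition \<Delta> :: "(nat \<Rightarrow> 's) \<Rightarrow> 's" where "\<Delta> w = det (Zw w)"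

lemma Zw_entry_poly: "a < N \<Longrightarrow> b < N \<Longrightarrow> (\<lambda>w. Zw w $$ (a, b)) \<in> affine_polys d"
  by (subst Zw_entry) (auto intro!: ap.add ap.sum ap.mult ap.const affine_polys_coord)

lemma \<Delta>_poly: "\<Delta> \<in> affine_polys d"
  unfolding \<Delta>_def[abs_def] by (rule ap.det[OF Zw_carrier Zw_entry_poly])

text \<open>Clearing denominators: \<open>minv (Zw w)\<close> has the single denominator
  \<open>\<Delta> w\<close>, so some power of it makes every polynomial function of the matrix
  polynomial in w. The factor \<open>\<gamma>\<close> lets the chart be moved to any point of the
  group.\<close>

lemma pullback_poly:
  assumes g: "\<gamma> \<in> carrier_mat N N" and p: "p \<in> polynomial_functions N"
  shows "\<exists>e. \<exists>f\<in>affine_polys d. \<forall>w. \<Delta> w \<noteq> 0 \<longrightarrow> f w = p (\<gamma> * (1\<^sub>m N + minv (Zw w))) * \<Delta> w ^ e"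
  using p
proof induction
  case (pf_const c)
  show ?case by (rule exI[of _ 0], rule bexI[of _ "\<lambda>_. c"]) (auto intro: ap.const)
next
  case (pf_entry i j)
  let ?f = "\<lambda>w. \<Sum>k = 0..<N. \<gamma> $$ (i, k) * ((if k = j then \<Delta> w else 0) + adj_mat (Zw w) $$ (k, j))"
  have "(\<lambda>w. if k = j then \<Delta> w else 0) \<in> affine_polys d" for k
    using \<Delta>_poly ap.const by (cases "k = j") auto
  then have f: "?f \<in> affine_polys d"
    using pf_entry
    by (intro ap.sum ap.mult[OF ap.const] ap.add ap.adj_mat_entry[OF Zw_carrier Zw_entry_poly]) auto
  have "?f w = (\<gamma> * (1\<^sub>m N + minv (Zw w))) $$ (i, j) * \<Delta> w ^ 1" if w: "\<Delta> w \<noteq> 0" for w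
  proof -
    note a = adj_mat(1)[OF Zw_carrier[of w]]
    have "(\<gamma> * (1\<^sub>m N + minv (Zw w))) $$ (i, j) =
      (\<Sum>k = 0..<N. \<gamma> $$ (i, k) * ((if k = j then 1 else 0) + inverse (\<Delta> w) * adj_mat (Zw w) $$ (k, j)))"
      using pf_entry g a by (auto simp: scalar_prod_def minv_def \<Delta>_def intro!: sum.cong)
    moreover have "?f w = (\<Sum>k = 0..<N. \<gamma> $$ (i, k) *
      ((if k = j then 1 else 0) + inverse (\<Delta> w) * adj_mat (Zw w) $$ (k, j))) * \<Delta> w"
      unfolding sum_distrib_right using w by (intro sum.cong refl) (simp add: distrib_left distrib_right)
    ultimately show ?thesis by simp
  qed
  then show ?case by (intro exI[of _ 1] bexI[of _ ?f] f) simp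
next
  case (pf_add p r)
  then obtain e f e' f' where *: "f \<in> affine_polys d" "f' \<in> affine_polys d"
    "\<forall>w. \<Delta> w \<noteq> 0 \<longrightarrow> f w = p (\<gamma> * (1\<^sub>m N + minv (Zw w))) * \<Delta> w ^ e"
    "\<forall>w. \<Delta> w \<noteq> 0 \<longrightarrow> f' w = r (\<gamma> * (1\<^sub>m N + minv (Zw w))) * \<Delta> w ^ e'" by blast
  show ?case
    by (rule exI[of _ "e + e'"], rule bexI[of _ "\<lambda>w. f w * \<Delta> w ^ e' + f' w * \<Delta> w ^ e"])
      (use * in \<open>auto simp: power_add algebra_simps intro!: ap.add ap.mult ap.power \<Delta>_poly\<close>)
next
  case (pf_mult p r)
  then obtain e f e' f' where *: "f \<in> affine_polys d" "f' \<in> affine_polys d"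
    "\<forall>w. \<Delta> w \<noteq> 0 \<longrightarrow> f w = p (\<gamma> * (1\<^sub>m N + minv (Zw w))) * \<Delta> w ^ e"
    "\<forall>w. \<Delta> w \<noteq> 0 \<longrightarrow> f' w = r (\<gamma> * (1\<^sub>m N + minv (Zw w))) * \<Delta> w ^ e'" by blast
  show ?case
    by (rule exI[of _ "e + e'"], rule bexI[of _ "\<lambda>w. f w * f' w"])
      (use * in \<open>auto simp: power_add algebra_simps intro!: ap.mult\<close>)
qed

lemma Zw_0_in_G: "1\<^sub>m N + minv (Zw (\<lambda>_. 0)) \<in> G"
  by (rule cay_to_G[OF Zw det0])

text \<open>The chart is translated so as to contain a point of the smallest member
  \<open>Z 0\<close>. It then meets every member, and by irreducibility an identity on the chart
  extends to all of \<open>Z m\<close>. Functions separating the members pull back to quotients of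
  polynomials in \<open>d\<close> variables with independent monomials, and counting these bounds
  \<open>m\<close>.\<close>

lemma chain_length_le:
  assumes irr: "\<And>i. i \<le> m \<Longrightarrow> irreducible_closed (zariski N G) (Z i)"
    and sub: "\<And>i. i < m \<Longrightarrow> Z i \<subset> Z (Suc i)"
  shows "m \<le> d"
proof -
  have ZG: "Z i \<subseteq> G" if "i \<le> m" for i
    using irr[OF that] closedin_subset unfolding irreducible_closed_def by fastforce
  have "\<exists>f. f \<in> polynomial_functions N \<and> (\<forall>x\<in>Z i. f x = 0) \<and> (\<exists>x\<in>Z (Suc i). f x \<noteq> 0)" if i: "i < m" for i
  proof -
    have "closedin (zariski N G) (Z i)" using irr[of i] i by (simp add: irreducible_closed_def)
    then obtain P where P: "P \<subseteq> polynomial_functions N" "Z i = {x \<in> G. \<forall>p\<in>P. p x = 0}"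
      unfolding closedin_zariski by blast
    obtain x where x: "x \<in> Z (Suc i)" "x \<notin> Z i" using sub[OF i] by blast
    have "x \<in> G" using ZG[of "Suc i"] x i by auto
    then obtain p where "p \<in> P" "p x \<noteq> 0" using x(2) unfolding P(2) by blast
    then show ?thesis using P x by (intro exI[of _ p]) auto
  qed
  then obtain f where f: "\<And>i. i < m \<Longrightarrow> f i \<in> polynomial_functions N"
    "\<And>i x. i < m \<Longrightarrow> x \<in> Z i \<Longrightarrow> f i x = 0" "\<And>i. i < m \<Longrightarrow> \<exists>x\<in>Z (Suc i). f i x \<noteq> 0"
    by metis
  obtain g0 where g0: "g0 \<in> Z 0" using irr[of 0] by (auto simp: irreducible_closed_def)
  have mono: "Z 0 \<subseteq> Z i" if "i \<le> m" for i
    using that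
  proof (induction i)
    case (Suc i)
    then show ?case using sub[of i] by auto
  qed simp
  have g0m: "g0 \<in> Z m" using mono[of m] g0 by auto
  have g0G: "g0 \<in> G" using ZG[of m] g0m by auto
  define u0 where "u0 = 1\<^sub>m N + minv (Zw (\<lambda>_. 0))"
  have u0G: "u0 \<in> G" using Zw_0_in_G by (simp add: u0_def)
  \<comment> \<open>\<open>\<gamma>i\<close> carries \<open>g0\<close> to \<open>u0\<close>, the
    Cayley image of the base point, where subtracting the identity leaves an invertible matrix;
    \<open>\<gamma>\<close> undoes this translation.\<close>
  define \<gamma>i where "\<gamma>i = u0 * minv g0"
  define \<gamma> where "\<gamma> = g0 * minv u0"
  have \<gamma>iG: "\<gamma>i \<in> G" and \<gamma>G: "\<gamma> \<in> G" unfolding \<gamma>i_def \<gamma>_def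
    by (intro G_mult G_inverse u0G g0G)+
  note c = G_carrier[OF \<gamma>iG] G_carrier[OF \<gamma>G] G_carrier[OF g0G] G_carrier[OF u0G]
  have dg0: "det g0 \<noteq> 0" and du0: "det u0 \<noteq> 0"
    using g0G u0G by (auto simp: G_def invertible_mat_iff_det)
  have \<gamma>\<gamma>i: "\<gamma> * (\<gamma>i * U) = U" if U: "U \<in> carrier_mat N N" for U
  proof -
    have "\<gamma> * (\<gamma>i * U) = g0 * ((minv u0 * u0) * (minv g0 * U))"
      unfolding \<gamma>_def \<gamma>i_def using c(3,4) U minv(1)[OF c(3)] minv(1)[OF c(4)] by (simp add: ring_simps)
    also have "\<dots> = (g0 * minv g0) * U"
      using c(3,4) U minv[OF c(3)] minv[OF c(4)] du0 by (simp add: ring_simps)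
    also have "\<dots> = U" using minv(2)[OF c(3) dg0] U by simp
    finally show ?thesis .
  qed
  define \<delta> where "\<delta> = (\<lambda>g. det (\<gamma>i * g - 1\<^sub>m N))"
  \<comment> \<open>The function \<open>\<delta>\<close> spelled out in entries, which makes it a
    polynomial function; the two agree on matrices of size \<open>N\<close>.\<close>
  let ?\<delta> = "\<lambda>g. det (mat N N (\<lambda>(i, j). (\<Sum>k = 0..<N. \<gamma>i $$ (i, k) * g $$ (k, j)) - (if i = j then 1 else 0)))"
  have \<delta>_eq: "\<delta> g = ?\<delta> g" if "g \<in> carrier_mat N N" for g
  proof -
    have "\<gamma>i * g - 1\<^sub>m N = mat N N (\<lambda>(i, j). (\<Sum>k = 0..<N. \<gamma>i $$ (i, k) * g $$ (k, j)) - (if i = j then 1 else 0))"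
      using that c(1) by (intro eq_matI) (auto simp: scalar_prod_def)
    then show ?thesis by (simp add: \<delta>_def)
  qed
  have \<delta>_pf: "?\<delta> \<in> polynomial_functions N"
    by (rule pf.det) (auto intro!: pf.diff pf.sum pf.mult pf.const pf_entry)
  have "\<gamma>i * g0 = u0" unfolding \<gamma>i_def using minv[OF c(3)] c dg0 by simp
  then have "\<gamma>i * g0 - 1\<^sub>m N = minv (Zw (\<lambda>_. 0))"
    using minv_Cayley(1)[OF Zw_carrier det0(1)] by (simp add: u0_def)
  then have \<delta>0: "\<delta> g0 \<noteq> 0" using minv(4)[OF Zw_carrier det0(1)] by (simp add: \<delta>_def)
  have param: "\<exists>w. \<Delta> w \<noteq> 0 \<and> g = \<gamma> * (1\<^sub>m N + minv (Zw w))" if g: "g \<in> G" "\<delta> g \<noteq> 0" for g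
  proof -
    have gc: "g \<in> carrier_mat N N" using g by (simp add: G_def)
    have h: "\<gamma>i * g \<in> G" using G_mult[OF \<gamma>iG g(1)] .
    have hc: "\<gamma>i * g \<in> carrier_mat N N" "\<gamma>i * g - 1\<^sub>m N \<in> carrier_mat N N" using G_carrier[OF h] by auto
    obtain w where w: "minv (\<gamma>i * g - 1\<^sub>m N) = Zw w"
      using Zw_surj[OF G_to_cay[OF h]] g(2) by (auto simp: \<delta>_def)
    have d: "det (\<gamma>i * g - 1\<^sub>m N) \<noteq> 0" using g(2) by (simp add: \<delta>_def)
    have "minv (Zw w) = \<gamma>i * g - 1\<^sub>m N" using minv_Cayley(2)[OF hc(2) d] w by simp
    then have "1\<^sub>m N + minv (Zw w) = \<gamma>i * g" using one_plus_minus_one[OF hc(1)] by simp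
    then have "g = \<gamma> * (1\<^sub>m N + minv (Zw w))" using \<gamma>\<gamma>i[OF gc] by simp
    moreover have "\<Delta> w \<noteq> 0" using minv(4)[OF hc(2) d] w by (simp add: \<Delta>_def)
    ultimately show ?thesis by blast
  qed
  have "\<forall>i. \<exists>e F. i < m \<longrightarrow> F \<in> affine_polys d \<and>
    (\<forall>w. \<Delta> w \<noteq> 0 \<longrightarrow> F w = f i (\<gamma> * (1\<^sub>m N + minv (Zw w))) * \<Delta> w ^ e)"
    using pullback_poly[OF c(2) f(1)] by blast
  then obtain e F where eF: "\<And>i. i < m \<Longrightarrow> F i \<in> affine_polys d"
    "\<And>i w. i < m \<Longrightarrow> \<Delta> w \<noteq> 0 \<Longrightarrow> F i w = f i (\<gamma> * (1\<^sub>m N + minv (Zw w))) * \<Delta> w ^ e i" by metis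
  have "\<forall>i. \<exists>a. i < m \<longrightarrow> F i \<in> poly_deg d a" using eF(1) by (auto simp: affine_polys_def)
  then obtain a where a: "\<And>i. i < m \<Longrightarrow> F i \<in> poly_deg d (a i)" by metis
  obtain b where b: "\<Delta> \<in> poly_deg d b" using \<Delta>_poly by (auto simp: affine_polys_def)
  \<comment> \<open>Degree per unit of n: \<open>a i\<close> for the numerator \<open>F i\<close>,
    and \<open>e i * b\<close> for the powers of \<open>\<Delta>\<close> that equalize the
    denominators.\<close>
  define C where "C = (\<Sum>i<m. a i + e i * b)"
  have growth: "(n + 1) ^ m \<le> (C * n + 1) ^ d" for n
  proof -
    \<comment> \<open>Numerators over a common denominator: a factor with exponent k receives the
      power of \<open>\<Delta>\<close> that raises its denominator exponent from
      \<open>e i * k\<close> to \<open>e i * n\<close>, whatever k is.\<close>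
    define H where "H = rec_list (\<lambda>w. 1)
      (\<lambda>k l H w. F (length l) w ^ k * \<Delta> w ^ (e (length l) * (n - k)) * H w)"
    have H_simps: "H [] = (\<lambda>w. 1)"
      "H (k # l) = (\<lambda>w. F (length l) w ^ k * \<Delta> w ^ (e (length l) * (n - k)) * H l w)" for k l
      by (simp_all add: H_def)
    have H_eq: "H l w = list_monom f l (\<gamma> * (1\<^sub>m N + minv (Zw w))) * \<Delta> w ^ (n * (\<Sum>i<length l. e i))"
      if "length l \<le> m" "set l \<subseteq> {..n}" "\<Delta> w \<noteq> 0" for l w
      using that
    proof (induction l)
      case (Cons k l)
      have "\<Delta> w ^ (e (length l) * n) = (\<Delta> w ^ e (length l)) ^ k * \<Delta> w ^ (e (length l) * (n - k))"
        using Cons.prems(2) by (simp flip: power_mult power_add distrib_left)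
      then show ?case using Cons eF(2)[of "length l" w]
        by (simp add: H_simps power_mult_distrib distrib_left power_add mult_ac)
    qed (simp add: H_simps)
    have H_deg: "H l \<in> poly_deg d (n * (\<Sum>i<length l. a i + e i * b))"
      if "length l \<le> m" "set l \<subseteq> {..n}" for l
      using that
    proof (induction l)
      case (Cons k l)
      let ?i = "length l"
      have "(\<lambda>w. F ?i w ^ k) \<in> poly_deg d (k * a ?i)" using a[of ?i] Cons.prems by (intro poly_deg_power) auto
      moreover have "(\<lambda>w. \<Delta> w ^ (e ?i * (n - k))) \<in> poly_deg d ((e ?i * (n - k)) * b)"
        by (rule poly_deg_power[OF b])
      moreover have "H l \<in> poly_deg d (n * (\<Sum>i<length l. a i + e i * b))" using Cons by auto
      ultimately have "H (k # l) \<in> poly_deg d (k * a ?i + (e ?i * (n - k)) * b + n * (\<Sum>i<length l. a i + e i * b))"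
        unfolding H_simps by (intro poly_deg_mult)
      moreover have "k * a ?i + (e ?i * (n - k)) * b \<le> n * a ?i + n * (e ?i * b)"
      proof (rule add_mono)
        show "k * a ?i \<le> n * a ?i" using Cons.prems(2) by (intro mult_le_mono1) simp
        have "(n - k) * (e ?i * b) \<le> n * (e ?i * b)" by (intro mult_le_mono1) simp
        then show "(e ?i * (n - k)) * b \<le> n * (e ?i * b)" by (simp only: mult_ac)
      qed
      then have "k * a ?i + (e ?i * (n - k)) * b + n * (\<Sum>i<length l. a i + e i * b)
        \<le> n * (\<Sum>i<length (k # l). a i + e i * b)"
        by (simp add: distrib_left)
      ultimately show ?case using poly_deg_mono by blast
    qed (simp add: H_simps poly_deg_const)
    have "card (exponents m n) \<le> (C * n + 1) ^ d"
    proof (rule card_independent_le[OF finite_exponents, where F = H])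
      fix l assume "l \<in> exponents m n"
      then show "H l \<in> poly_deg d (C * n)"
        using H_deg[of l] by (auto simp: exponents_def C_def mult.commute)
    next
      fix c assume c0: "\<And>w. (\<Sum>l\<in>exponents m n. c l * H l w) = 0"
      let ?S = "\<lambda>g. \<Sum>l\<in>exponents m n. c l * list_monom f l g"
      \<comment> \<open>Off the translated chart \<open>?\<delta>\<close> vanishes, on the chart
        \<open>?S\<close> does. Primality then makes \<open>?S\<close> vanish on all of
        \<open>Z m\<close>, because \<open>?\<delta>\<close> is nonzero at
        \<open>g0\<close>.\<close>
      have "?S g * ?\<delta> g = 0" if g: "g \<in> Z m" for g
      proof (cases "\<delta> g = 0")
        case True
        then show ?thesis using \<delta>_eq ZG[of m] g G_carrier by auto
      next
        case False
        then obtain w where w: "\<Delta> w \<noteq> 0" "g = \<gamma> * (1\<^sub>m N + minv (Zw w))" using param ZG[of m] g by blast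
        have "?S g * \<Delta> w ^ (n * (\<Sum>i<m. e i)) = (\<Sum>l\<in>exponents m n. c l * H l w)"
          unfolding sum_distrib_right using w H_eq by (intro sum.cong) (auto simp: exponents_def)
        then show ?thesis using c0 w(1) by simp
      qed
      moreover have "?S \<in> polynomial_functions N"
        using f(1) by (intro pf.sum pf.mult pf.const list_monom_polynomial) (auto simp: exponents_def)
      ultimately have "(\<forall>g\<in>Z m. ?S g = 0) \<or> (\<forall>g\<in>Z m. ?\<delta> g = 0)"
        using irreducible_closed_mult[OF irr[OF order_refl] _ \<delta>_pf] by blast
      moreover have "?\<delta> g0 \<noteq> 0" using \<delta>0 \<delta>_eq[OF c(3)] by simp
      ultimately have S0: "?S g = 0" if "g \<in> Z m" for g using that g0m by blast
      show "\<forall>l\<in>exponents m n. c l = 0"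
      proof
        fix l assume l: "l \<in> exponents m n"
        show "c l = 0"
          by (rule chain_independent[where m = m and Z = Z and f = f and N = N and Y = G and n = n, OF irr _ f S0 l])
            (use sub in auto)
      qed
    qed
    then show ?thesis by (simp add: card_exponents)
  qed
  show ?thesis by (rule exponent_le_of_growth[OF growth])
qed

section \<open>The lower bound for the dimension\<close>

definition good :: "(nat \<Rightarrow> 's) \<Rightarrow> bool" where
  "good w \<longleftrightarrow> \<Delta> w \<noteq> 0 \<and> det (Zw w + 1\<^sub>m N) \<noteq> 0"

definition \<Phi> :: "(nat \<Rightarrow> 's) \<Rightarrow> 's mat" where
  "\<Phi> w = 1\<^sub>m N + minv (Zw w)"

definition flag :: "nat \<Rightarrow> (nat \<Rightarrow> 's) set" where
  "flag i = {w. \<forall>j\<ge>i. w j = 0}"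

text \<open>The Zariski closure, inside the group, of the Cayley image of a coordinate
  subspace.\<close>

definition flag_closure :: "nat \<Rightarrow> 's mat set" where
  "flag_closure i = {g \<in> G. \<forall>p\<in>polynomial_functions N.
    (\<forall>w\<in>flag i. good w \<longrightarrow> p (\<Phi> w) = 0) \<longrightarrow> p g = 0}"

lemma \<Phi>_in_closure: "w \<in> flag i \<Longrightarrow> good w \<Longrightarrow> \<Phi> w \<in> flag_closure i"
  unfolding flag_closure_def \<Phi>_def using cay_to_G[OF Zw, of w] by (auto simp: good_def \<Delta>_def)

lemma good_0: "good (\<lambda>_. 0)"
  using det0 by (simp add: good_def \<Delta>_def)

lemma good_poly: "(\<lambda>w. \<Delta> w * det (Zw w + 1\<^sub>m N)) \<in> affine_polys d"
proof (intro ap.mult \<Delta>_poly ap.det)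
  show "Zw w + 1\<^sub>m N \<in> carrier_mat N N" for w using Zw_carrier by simp
  fix i j assume "i < N" "j < N"
  then have "(\<lambda>w. (Zw w + 1\<^sub>m N) $$ (i, j)) = (\<lambda>w. Zw w $$ (i, j) + (if i = j then 1 else 0))"
    by (auto simp: fun_eq_iff)
  moreover have "(\<lambda>w. Zw w $$ (i, j) + (if i = j then 1 else 0)) \<in> affine_polys d"
    by (intro ap.add Zw_entry_poly ap.const) fact+
  ultimately show "(\<lambda>w. (Zw w + 1\<^sub>m N) $$ (i, j)) \<in> affine_polys d" by simp
qed

lemma poly_common_nonroot:
  assumes "finite P" "0 \<notin> P"
  shows "\<exists>t::'s. \<forall>p\<in>P. poly p t \<noteq> 0"
proof -
  have "finite {t. poly (\<Prod>p\<in>P. p) t = 0}" using assms by (intro poly_roots_finite) (simp add: prod_zero_iff)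
  then obtain t where "poly (\<Prod>p\<in>P. p) t \<noteq> 0" using inf by (metis (mono_tags) ex_new_if_finite mem_Collect_eq)
  then show ?thesis using assms by (auto simp: poly_prod prod_zero_iff)
qed

text \<open>Irreducibility is inherited from the parameter space: if neither closed set contains the
  closure, two witnesses are joined by a line, on which the two functions and the condition
  \<open>good\<close> are nonzero polynomials with a common nonroot.\<close>

lemma flag_closure_irreducible: "irreducible_closed (zariski N G) (flag_closure i)"
  unfolding irreducible_closed_def
proof (intro conjI allI impI)
  show "closedin (zariski N G) (flag_closure i)"
    unfolding closedin_zariski
    by (rule exI[of _ "{p \<in> polynomial_functions N. \<forall>w\<in>flag i. good w \<longrightarrow> p (\<Phi> w) = 0}"])
      (auto simp: flag_closure_def)
  show "flag_closure i \<noteq> {}" using \<Phi>_in_closure[OF _ good_0, of i] by (auto simp: flag_def)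
  fix U U' assume "closedin (zariski N G) U" "closedin (zariski N G) U'" and sub: "flag_closure i \<subseteq> U \<union> U'"
  then obtain P P' where P: "P \<subseteq> polynomial_functions N" "U = {x \<in> G. \<forall>p\<in>P. p x = 0}"
    and P': "P' \<subseteq> polynomial_functions N" "U' = {x \<in> G. \<forall>p\<in>P'. p x = 0}"
    unfolding closedin_zariski by blast
  have witness: "\<exists>p w. p \<in> Q \<and> w \<in> flag i \<and> good w \<and> p (\<Phi> w) \<noteq> 0"
    if Q: "\<not> flag_closure i \<subseteq> {x \<in> G. \<forall>p\<in>Q. p x = 0}" "Q \<subseteq> polynomial_functions N" for Q
  proof -
    obtain g where "g \<in> flag_closure i" "g \<notin> {x \<in> G. \<forall>p\<in>Q. p x = 0}" using Q(1) by blast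
    then obtain p where "p \<in> Q" "p g \<noteq> 0" by (auto simp: flag_closure_def)
    moreover have "p \<in> polynomial_functions N" using \<open>p \<in> Q\<close> Q(2) by blast
    ultimately have "\<exists>w\<in>flag i. good w \<and> p (\<Phi> w) \<noteq> 0"
      using \<open>g \<in> flag_closure i\<close> unfolding flag_closure_def by blast
    then show ?thesis using \<open>p \<in> Q\<close> by blast
  qed
  show "flag_closure i \<subseteq> U \<or> flag_closure i \<subseteq> U'"
  proof (rule ccontr)
    assume *: "\<not> (flag_closure i \<subseteq> U \<or> flag_closure i \<subseteq> U')"
    obtain p w1 where p: "p \<in> P" "w1 \<in> flag i" "good w1" "p (\<Phi> w1) \<noteq> 0"
      using witness[of P] * P by blast
    obtain p' w2 where p': "p' \<in> P'" "w2 \<in> flag i" "good w2" "p' (\<Phi> w2) \<noteq> 0"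
      using witness[of P'] * P' by blast
    define w where "w = (\<lambda>t i. w1 i + t * (w2 i - w1 i))"
    have line: "\<exists>r. \<forall>t. f (w t) = poly r t" if "f \<in> affine_polys d" for f
      using affine_polys_line[OF that, of w1 "\<lambda>i. w2 i - w1 i"] by (simp add: w_def)
    have one: "1\<^sub>m N * (1\<^sub>m N + minv (Zw v)) = \<Phi> v" for v
      using minv(1)[OF Zw_carrier[of v]] by (simp add: \<Phi>_def)
    have w01: "w 0 = w1" "w 1 = w2" by (auto simp: w_def)
    obtain e f where f: "f \<in> affine_polys d" "\<And>v. \<Delta> v \<noteq> 0 \<Longrightarrow> f v = p (\<Phi> v) * \<Delta> v ^ e"
      using pullback_poly[of "1\<^sub>m N" p] p(1) P(1) one by auto
    obtain e' f' where f': "f' \<in> affine_polys d" "\<And>v. \<Delta> v \<noteq> 0 \<Longrightarrow> f' v = p' (\<Phi> v) * \<Delta> v ^ e'"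
      using pullback_poly[of "1\<^sub>m N" p'] p'(1) P'(1) one by auto
    obtain r where r: "\<And>t. f (w t) = poly r t" using line[OF f(1)] by blast
    obtain r' where r': "\<And>t. f' (w t) = poly r' t" using line[OF f'(1)] by blast
    obtain s where s: "\<And>t. \<Delta> (w t) * det (Zw (w t) + 1\<^sub>m N) = poly s t" using line[OF good_poly] by blast
    have "poly r 0 \<noteq> 0" "poly r' 1 \<noteq> 0" "poly s 0 \<noteq> 0"
      using r[of 0] r'[of 1] s[of 0] f(2)[of w1] f'(2)[of w2] p p' w01 by (auto simp: good_def)
    then have "0 \<notin> {r, r', s}" by auto
    from poly_common_nonroot[OF _ this] obtain t where t: "poly r t \<noteq> 0" "poly r' t \<noteq> 0" "poly s t \<noteq> 0" by auto
    have g: "good (w t)" using t(3) s[of t] by (auto simp: good_def)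
    have "w t \<in> flag i" using p(2) p'(2) by (auto simp: flag_def w_def)
    then have "\<Phi> (w t) \<in> U \<union> U'" using sub \<Phi>_in_closure g by blast
    then have "p (\<Phi> (w t)) = 0 \<or> p' (\<Phi> (w t)) = 0" using P P' p(1) p'(1) by auto
    then show False using t r[of t] r'[of t] f(2)[of "w t"] f'(2)[of "w t"] g by (auto simp: good_def)
  qed
qed

text \<open>The coordinate i of the inverse Cayley transform, with its denominator cleared, vanishes
  on the smaller closure but not on the larger one.\<close>

lemma flag_closure_strict:
  assumes i: "i < d"
  shows "flag_closure i \<subset> flag_closure (Suc i)"
proof
  have "flag i \<subseteq> flag (Suc i)" by (auto simp: flag_def)
  then show "flag_closure i \<subseteq> flag_closure (Suc i)" unfolding flag_closure_def by blast
  define M where "M = (\<lambda>g. mat N N (\<lambda>(a, b). g $$ (a, b) - (if a = b then 1 else 0)) :: 's mat)"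
  \<comment> \<open>On the Cayley image (g - 1)^(-1) is \<open>Zw w\<close>, so this is the
    coordinate \<open>w i\<close> times det(g - 1); the determinant clears the denominator of the
    inverse.\<close>
  define p where "p = (\<lambda>g. \<Sum>a<N. \<Sum>b<N. \<Lambda> i a b *
    (adj_mat (M g) $$ (a, b) - Zw (\<lambda>_. 0) $$ (a, b) * det (M g)))"
  have Mc: "M g \<in> carrier_mat N N" for g by (simp add: M_def)
  have Me: "(\<lambda>g. M g $$ (a, b)) \<in> polynomial_functions N" if "a < N" "b < N" for a b
    using that unfolding M_def by (auto intro!: pf.diff pf_entry pf.const)
  have p: "p \<in> polynomial_functions N"
    unfolding p_def by (intro pf.sum pf.mult pf.diff pf.const pf.adj_mat_entry[OF Mc Me] pf.det[OF Mc Me]) auto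
  have pw: "p (\<Phi> w) = w i * det (minv (Zw w))" if w: "\<Delta> w \<noteq> 0" for w
  proof -
    have d: "det (Zw w) \<noteq> 0" using w by (simp add: \<Delta>_def)
    note mi = minv[OF Zw_carrier[of w]]
    have M: "M (\<Phi> w) = minv (Zw w)"
      unfolding M_def \<Phi>_def using mi(1) by (intro eq_matI) auto
    have "Zw w = minv (minv (Zw w))" using minv_Cayley(2)[OF Zw_carrier d] by simp
    then have "Zw w $$ (a, b) = inverse (det (minv (Zw w))) * adj_mat (minv (Zw w)) $$ (a, b)"
      if "a < N" "b < N" for a b
      using that adj_mat(1)[OF mi(1)] unfolding minv_def[of "minv (Zw w)"]
      by (metis carrier_matD index_smult_mat(1))
    then have e: "adj_mat (minv (Zw w)) $$ (a, b) = det (minv (Zw w)) * Zw w $$ (a, b)"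
      if "a < N" "b < N" for a b
      using that mi(4)[OF d] by simp
    have "p (\<Phi> w) = (\<Sum>a<N. \<Sum>b<N. \<Lambda> i a b * (Zw w $$ (a, b) - Zw (\<lambda>_. 0) $$ (a, b))) * det (minv (Zw w))"
      unfolding p_def M sum_distrib_right using e by (intro sum.cong refl) (simp add: algebra_simps)
    then show ?thesis using \<Lambda>[OF i] by simp
  qed
  define w where "w = (\<lambda>t j. 0 + t * (if j = i then 1 else 0 :: 's))"
  obtain s where s: "\<And>t. \<Delta> (w t) * det (Zw (w t) + 1\<^sub>m N) = poly s t"
    using affine_polys_line[OF good_poly, of "\<lambda>_. 0" "\<lambda>j. if j = i then 1 else 0"] by (auto simp: w_def)
  have "w 0 = (\<lambda>_. 0)" by (simp add: w_def)
  then have "poly s 0 \<noteq> 0" using s[of 0] good_0 unfolding good_def by (metis mult_eq_0_iff)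
  then have "0 \<notin> {s, [:0, 1:]}" by auto
  from poly_common_nonroot[OF _ this] obtain t where t: "poly s t \<noteq> 0" "t \<noteq> 0" by auto
  have g: "good (w t)" using t(1) s[of t] by (auto simp: good_def)
  have "w t \<in> flag (Suc i)" by (auto simp: flag_def w_def)
  then have 1: "\<Phi> (w t) \<in> flag_closure (Suc i)" by (rule \<Phi>_in_closure[OF _ g])
  have "p (\<Phi> v) = 0" if "v \<in> flag i" "good v" for v
    using pw[of v] that by (auto simp: flag_def good_def)
  moreover have "p (\<Phi> (w t)) \<noteq> 0"
    using pw[of "w t"] g t(2) minv(4)[OF Zw_carrier[of "w t"]] by (auto simp: good_def \<Delta>_def w_def)
  ultimately have "\<Phi> (w t) \<notin> flag_closure i" using p unfolding flag_closure_def by blast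
  then show "flag_closure i \<noteq> flag_closure (Suc i)" using 1 by blast
qed

theorem krull_dim_eq: "krull_dim (zariski N G) = d"
  unfolding krull_dim_def
proof (rule cSup_eq_maximum)
  show "d \<in> {m. \<exists>Z. (\<forall>i\<le>m. irreducible_closed (zariski N G) (Z i)) \<and> (\<forall>i<m. Z i \<subset> Z (Suc i))}"
    using flag_closure_irreducible flag_closure_strict by blast
  fix m assume "m \<in> {m. \<exists>Z. (\<forall>i\<le>m. irreducible_closed (zariski N G) (Z i)) \<and> (\<forall>i<m. Z i \<subset> Z (Suc i))}"
  then show "m \<le> d" using chain_length_le by blast
qed

end


section \<open>Descent from the algebraic closure\<close>

text \<open>Entrywise, on coefficient functions instead of matrices, so that the equations can be
  read over both fields and passed through linear functionals one coefficient at a time.\<close>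

definition mat_commutes :: "nat \<Rightarrow> (nat \<Rightarrow> nat \<Rightarrow> 's::comm_ring_1) \<Rightarrow> 's mat \<Rightarrow> bool" where
  "mat_commutes N W R \<longleftrightarrow> (\<forall>a<N. \<forall>b<N. (\<Sum>k<N. W a k * R $$ (k, b)) = (\<Sum>k<N. R $$ (a, k) * W k b))"

text \<open>For \<open>c = 1\<close> the affine condition on Cayley parameters, for
  \<open>c = 0\<close> its homogeneous part, which cuts out the Lie algebra.\<close>

definition mat_skew :: "nat \<Rightarrow> 's::comm_ring_1 \<Rightarrow> (nat \<Rightarrow> nat \<Rightarrow> 's) \<Rightarrow> 's mat \<Rightarrow> bool" where
  "mat_skew N c W J \<longleftrightarrow> (\<forall>a<N. \<forall>b<N.
    (\<Sum>k<N. W k a * J $$ (k, b)) + (\<Sum>k<N. J $$ (a, k) * W k b) + c * J $$ (a, b) = 0)"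

lemma mat_commutes_iff:
  assumes "Z \<in> carrier_mat N N" "R \<in> carrier_mat N N"
  shows "Z * R = R * Z \<longleftrightarrow> mat_commutes N (\<lambda>a b. Z $$ (a, b)) R"
proof -
  have "Z * R = R * Z \<longleftrightarrow> (\<forall>a<N. \<forall>b<N. (Z * R) $$ (a, b) = (R * Z) $$ (a, b))"
    using assms by (auto simp: mat_eq_iff)
  then show ?thesis using assms
    by (simp add: mat_commutes_def scalar_prod_def atLeast0LessThan)
qed

lemma mat_skew_iff:
  assumes "Z \<in> carrier_mat N N" "J \<in> carrier_mat N N"
  shows "transpose_mat Z * J + J * Z + J = 0\<^sub>m N N \<longleftrightarrow> mat_skew N 1 (\<lambda>a b. Z $$ (a, b)) J"
proof -
  have "transpose_mat Z * J + J * Z + J = 0\<^sub>m N N \<longleftrightarrow>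
    (\<forall>a<N. \<forall>b<N. (transpose_mat Z * J + J * Z + J) $$ (a, b) = 0)"
    using assms by (auto simp: mat_eq_iff)
  then show ?thesis using assms
    by (simp add: mat_skew_def scalar_prod_def atLeast0LessThan)
qed

text \<open>A nonzero element is independent over F, so a functional with value 1 on it extends to
  the whole closure.\<close>

lemma linear_functional_nonzero:
  assumes "s \<noteq> (0 :: 'f::field alg_closure)"
  shows "\<exists>\<phi> :: 'f alg_closure \<Rightarrow> 'f. (\<forall>x y. \<phi> (x + y) = \<phi> x + \<phi> y) \<and>
    (\<forall>a x. \<phi> (to_ac a * x) = a * \<phi> x) \<and> \<phi> s \<noteq> 0"
proof -
  interpret p: vector_space_pair "\<lambda>(a :: 'f) (x :: 'f alg_closure). to_ac a * x" "\<lambda>(a :: 'f) (x :: 'f). a * x"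
    by unfold_locales (auto simp: algebra_simps)
  have "p.vs1.independent {s}"
    using assms p.vs1.dependent_single[of s] by simp
  from p.linear_independent_extend[OF this, of "\<lambda>_. 1"]
  obtain g where g: "Vector_Spaces.linear (\<lambda>(a :: 'f) (x :: 'f alg_closure). to_ac a * x) (\<lambda>(a :: 'f) (x :: 'f). a * x) g" "g s = 1" by auto
  interpret g: Vector_Spaces.linear "\<lambda>(a :: 'f) (x :: 'f alg_closure). to_ac a * x" "\<lambda>(a :: 'f) (x :: 'f). a * x" g
    by (rule g(1))
  show ?thesis using g.add g.scale g(2) by (intro exI[of _ g]) auto
qed

text \<open>A system of linear equations over \<open>F\<close> with only the trivial solution over \<open>F\<close> has only
  the trivial solution over the algebraic closure: apply \<open>F\<close>-linear functionals to a solution.\<close>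

theorem krull_dim_isometry_group:
  fixes RR JJ :: "'f::field mat set" and W \<Lambda> :: "nat \<Rightarrow> nat \<Rightarrow> nat \<Rightarrow> 'f" and Z0 :: "nat \<Rightarrow> nat \<Rightarrow> 'f"
  assumes inf: "infinite (UNIV :: 'f set)"
    and RR: "RR \<subseteq> carrier_mat N N" and JJ: "JJ \<subseteq> carrier_mat N N"
    and W: "\<And>i R. i < d \<Longrightarrow> R \<in> RR \<Longrightarrow> mat_commutes N (W i) R"
      "\<And>i J. i < d \<Longrightarrow> J \<in> JJ \<Longrightarrow> mat_skew N 0 (W i) J"
    and \<Lambda>: "\<And>i j. i < d \<Longrightarrow> j < d \<Longrightarrow> (\<Sum>a<N. \<Sum>b<N. \<Lambda> i a b * W j a b) = (if i = j then 1 else 0)"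
    and triv: "\<And>V. (\<forall>R\<in>RR. mat_commutes N V R) \<Longrightarrow> (\<forall>J\<in>JJ. mat_skew N 0 V J) \<Longrightarrow>
      (\<forall>i<d. (\<Sum>a<N. \<Sum>b<N. \<Lambda> i a b * V a b) = 0) \<Longrightarrow> (\<forall>a<N. \<forall>b<N. V a b = 0)"
    and Z0: "\<And>R. R \<in> RR \<Longrightarrow> mat_commutes N Z0 R" "\<And>J. J \<in> JJ \<Longrightarrow> mat_skew N 1 Z0 J"
    and det: "det (mat N N (\<lambda>(a, b). Z0 a b)) \<noteq> 0" "det (mat N N (\<lambda>(a, b). Z0 a b) + 1\<^sub>m N) \<noteq> 0"
  shows "krull_dim (zariski N {g \<in> carrier_mat N N. invertible_mat g \<and>
      (\<forall>R\<in>map_mat to_ac ` RR. g * R = R * g) \<and>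
      (\<forall>J\<in>map_mat to_ac ` JJ. transpose_mat g * J * g = J)}) = d"
proof -
  let ?RR = "map_mat to_ac ` RR :: 'f alg_closure mat set"
  let ?JJ = "map_mat to_ac ` JJ :: 'f alg_closure mat set"
  \<comment> \<open>The base point and the directions stay over F; only the parameters
    \<open>w\<close> run through the closure.\<close>
  define Ze :: "(nat \<Rightarrow> 'f alg_closure) \<Rightarrow> nat \<Rightarrow> nat \<Rightarrow> 'f alg_closure" where
    "Ze = (\<lambda>w a b. to_ac (Z0 a b) + (\<Sum>i<d. w i * to_ac (W i a b)))"
  define Zw where "Zw = (\<lambda>w. mat N N (\<lambda>(a, b). Ze w a b))"
  let ?\<Lambda> = "\<lambda>i a b. to_ac (\<Lambda> i a b) :: 'f alg_closure"
  have Zwc: "Zw w \<in> carrier_mat N N" for w by (simp add: Zw_def)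
  have RRc: "?RR \<subseteq> carrier_mat N N" and JJc: "?JJ \<subseteq> carrier_mat N N" using RR JJ by auto
  have R_ent: "map_mat to_ac R $$ (a, b) = to_ac (R $$ (a, b))" if "R \<in> RR" "a < N" "b < N" for R a b
    using that RR by auto
  have J_ent: "map_mat to_ac J $$ (a, b) = to_ac (J $$ (a, b))" if "J \<in> JJ" "a < N" "b < N" for J a b
    using that JJ by auto
  have Ze0: "mat_commutes N (Ze w) (map_mat to_ac R)" if R: "R \<in> RR" for R w
    unfolding mat_commutes_def
  proof (intro allI impI)
    fix a b assume ab: "a < N" "b < N"
    have "(\<Sum>k<N. Ze w a k * map_mat to_ac R $$ (k, b)) = to_ac (\<Sum>k<N. Z0 a k * R $$ (k, b)) +
      (\<Sum>i<d. w i * to_ac (\<Sum>k<N. W i a k * R $$ (k, b)))"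
      using ab R by (simp add: R_ent Ze_def to_ac_sum distrib_right sum.distrib sum_distrib_left
          sum_distrib_right mult.assoc sum.swap[of _ "{..<d}"])
    also have "(\<Sum>k<N. Z0 a k * R $$ (k, b)) = (\<Sum>k<N. R $$ (a, k) * Z0 k b)"
      using Z0(1)[OF R] ab by (simp add: mat_commutes_def)
    also have "(\<Sum>i<d. w i * to_ac (\<Sum>k<N. W i a k * R $$ (k, b))) =
      (\<Sum>i<d. w i * to_ac (\<Sum>k<N. R $$ (a, k) * W i k b))"
      using W(1)[OF _ R] ab by (intro sum.cong refl) (simp add: mat_commutes_def)
    also have "to_ac (\<Sum>k<N. R $$ (a, k) * Z0 k b) + \<dots> = (\<Sum>k<N. map_mat to_ac R $$ (a, k) * Ze w k b)"
      using ab R by (simp add: R_ent Ze_def to_ac_sum distrib_left sum.distrib sum_distrib_left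
          mult.left_commute sum.swap[of _ "{..<d}"])
    finally show "(\<Sum>k<N. Ze w a k * map_mat to_ac R $$ (k, b)) = (\<Sum>k<N. map_mat to_ac R $$ (a, k) * Ze w k b)" .
  qed
  have Ze1: "mat_skew N 1 (Ze w) (map_mat to_ac J)" if J: "J \<in> JJ" for J w
    unfolding mat_skew_def
  proof (intro allI impI)
    fix a b assume ab: "a < N" "b < N"
    have 1: "(\<Sum>k<N. Ze w k a * map_mat to_ac J $$ (k, b)) = to_ac (\<Sum>k<N. Z0 k a * J $$ (k, b)) +
      (\<Sum>i<d. w i * to_ac (\<Sum>k<N. W i k a * J $$ (k, b)))"
      using ab J by (simp add: J_ent Ze_def to_ac_sum distrib_right sum.distrib sum_distrib_left
          sum_distrib_right mult.assoc sum.swap[of _ "{..<d}"])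
    have 2: "(\<Sum>k<N. map_mat to_ac J $$ (a, k) * Ze w k b) = to_ac (\<Sum>k<N. J $$ (a, k) * Z0 k b) +
      (\<Sum>i<d. w i * to_ac (\<Sum>k<N. J $$ (a, k) * W i k b))"
      using ab J by (simp add: J_ent Ze_def to_ac_sum distrib_left sum.distrib sum_distrib_left
          mult.left_commute sum.swap[of _ "{..<d}"])
    have 3: "(\<Sum>k<N. Z0 k a * J $$ (k, b)) + (\<Sum>k<N. J $$ (a, k) * Z0 k b) + 1 * J $$ (a, b) = 0"
      using Z0(2)[OF J] ab by (simp add: mat_skew_def)
    have "(\<Sum>i<d. w i * to_ac (\<Sum>k<N. W i k a * J $$ (k, b))) +
      (\<Sum>i<d. w i * to_ac (\<Sum>k<N. J $$ (a, k) * W i k b)) =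
      (\<Sum>i<d. w i * to_ac ((\<Sum>k<N. W i k a * J $$ (k, b)) + (\<Sum>k<N. J $$ (a, k) * W i k b) + 0 * J $$ (a, b)))"
      by (simp add: sum.distrib distrib_left)
    also have "\<dots> = 0"
      using W(2)[OF _ J] ab by (intro sum.neutral) (simp add: mat_skew_def)
    finally have 4: "(\<Sum>i<d. w i * to_ac (\<Sum>k<N. W i k a * J $$ (k, b))) +
      (\<Sum>i<d. w i * to_ac (\<Sum>k<N. J $$ (a, k) * W i k b)) = 0" .
    have "to_ac ((\<Sum>k<N. Z0 k a * J $$ (k, b)) + (\<Sum>k<N. J $$ (a, k) * Z0 k b) + 1 * J $$ (a, b)) = 0"
      unfolding 3 by simp
    then have 5: "to_ac (\<Sum>k<N. Z0 k a * J $$ (k, b)) + to_ac (\<Sum>k<N. J $$ (a, k) * Z0 k b) + 1 * to_ac (J $$ (a, b)) = 0"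
      by (simp only: to_ac_add to_ac_mult to_ac_1)
    have rearr: "(p + x) + (p' + y) + z = (p + p' + z) + (x + y)" for p x p' y z :: "'f alg_closure"
      by (simp add: algebra_simps)
    show "(\<Sum>k<N. Ze w k a * map_mat to_ac J $$ (k, b)) + (\<Sum>k<N. map_mat to_ac J $$ (a, k) * Ze w k b) +
      1 * map_mat to_ac J $$ (a, b) = 0"
      unfolding 1 2 J_ent[OF J ab] rearr 5 4 by simp
  qed
  have cong: "mat_commutes N (\<lambda>a b. Zw w $$ (a, b)) R = mat_commutes N (Ze w) R"
    "mat_skew N c (\<lambda>a b. Zw w $$ (a, b)) R = mat_skew N c (Ze w) R" for w c R
    by (auto simp: mat_commutes_def mat_skew_def Zw_def)
  interpret cayley N d ?RR ?JJ Zw "\<lambda>i a b. to_ac (W i a b)" ?\<Lambda>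
    "{Z \<in> carrier_mat N N. (\<forall>R\<in>?RR. Z * R = R * Z) \<and>
      (\<forall>J\<in>?JJ. transpose_mat Z * J + J * Z + J = 0\<^sub>m N N)}"
    "{g \<in> carrier_mat N N. invertible_mat g \<and> (\<forall>R\<in>?RR. g * R = R * g) \<and>
      (\<forall>J\<in>?JJ. transpose_mat g * J * g = J)}"
  proof unfold_locales
    show "infinite (UNIV :: 'f alg_closure set)"
    proof
      assume "finite (UNIV :: 'f alg_closure set)"
      then have "finite (range (to_ac :: 'f \<Rightarrow> _))" by (rule finite_subset[OF subset_UNIV])
      then show False using finite_imageD[OF _ inj_to_ac] inf by blast
    qed
    show "?RR \<subseteq> carrier_mat N N" "?JJ \<subseteq> carrier_mat N N" by (fact RRc, fact JJc)
    show "Zw w \<in> {Z \<in> carrier_mat N N. (\<forall>R\<in>?RR. Z * R = R * Z) \<and>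
      (\<forall>J\<in>?JJ. transpose_mat Z * J + J * Z + J = 0\<^sub>m N N)}" for w
      using Zwc Ze0 Ze1 mat_commutes_iff[OF Zwc] mat_skew_iff[OF Zwc] RR JJ by (auto simp: cong)
    show ent: "Zw w $$ (a, b) = Zw (\<lambda>_. 0) $$ (a, b) + (\<Sum>i<d. w i * to_ac (W i a b))"
      if "a < N" "b < N" for a b w
      using that by (simp add: Zw_def Ze_def)
    have \<Lambda>W: "(\<Sum>a<N. \<Sum>b<N. ?\<Lambda> i a b * (\<Sum>j<d. w j * to_ac (W j a b))) = w i" if i: "i < d" for w i
    proof -
      have "(\<Sum>a<N. \<Sum>b<N. ?\<Lambda> i a b * (\<Sum>j<d. w j * to_ac (W j a b))) =
        (\<Sum>a<N. \<Sum>j<d. \<Sum>b<N. w j * to_ac (\<Lambda> i a b * W j a b))"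
        by (simp add: sum_distrib_left mult.left_commute sum.swap[of _ "{..<d}"])
      also have "\<dots> = (\<Sum>j<d. w j * to_ac (\<Sum>a<N. \<Sum>b<N. \<Lambda> i a b * W j a b))"
        unfolding to_ac_sum sum_distrib_left by (rule sum.swap)
      also have "\<dots> = (\<Sum>j<d. if i = j then w j else 0)"
        using i by (intro sum.cong) (auto simp: \<Lambda>)
      also have "\<dots> = w i" using i by simp
      finally show ?thesis .
    qed
    show "(\<Sum>a<N. \<Sum>b<N. ?\<Lambda> i a b * (Zw w $$ (a, b) - Zw (\<lambda>_. 0) $$ (a, b))) = w i" if "i < d" for i w
    proof -
      have "(\<Sum>a<N. \<Sum>b<N. ?\<Lambda> i a b * (Zw w $$ (a, b) - Zw (\<lambda>_. 0) $$ (a, b))) =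
        (\<Sum>a<N. \<Sum>b<N. ?\<Lambda> i a b * (\<Sum>j<d. w j * to_ac (W j a b)))"
        by (intro sum.cong refl) (simp add: Zw_def Ze_def)
      then show ?thesis using \<Lambda>W[OF that] by simp
    qed
    have Zw0: "Zw (\<lambda>_. 0) = map_mat to_ac (mat N N (\<lambda>(a, b). Z0 a b))"
      by (intro eq_matI) (auto simp: Zw_def Ze_def)
    have hom: "comm_ring_hom (to_ac :: 'f \<Rightarrow> 'f alg_closure)" by unfold_locales auto
    show "det (Zw (\<lambda>_. 0)) \<noteq> 0"
      unfolding Zw0 comm_ring_hom.hom_det[OF hom] using det(1) by simp
    have "Zw (\<lambda>_. 0) + 1\<^sub>m N = map_mat to_ac (mat N N (\<lambda>(a, b). Z0 a b) + 1\<^sub>m N)"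
      unfolding Zw0 by (intro eq_matI) auto
    then show "det (Zw (\<lambda>_. 0) + 1\<^sub>m N) \<noteq> 0"
      using comm_ring_hom.hom_det[OF hom] det(2) by simp
    fix Z assume "Z \<in> {Z \<in> carrier_mat N N. (\<forall>R\<in>?RR. Z * R = R * Z) \<and>
      (\<forall>J\<in>?JJ. transpose_mat Z * J + J * Z + J = 0\<^sub>m N N)}"
    then have Zc: "Z \<in> carrier_mat N N"
      and Z': "\<And>R. R \<in> ?RR \<Longrightarrow> Z * R = R * Z"
        "\<And>J. J \<in> ?JJ \<Longrightarrow> transpose_mat Z * J + J * Z + J = 0\<^sub>m N N" by auto
    have Zcomm: "\<And>R. R \<in> RR \<Longrightarrow> mat_commutes N (\<lambda>a b. Z $$ (a, b)) (map_mat to_ac R)"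
      and Zskew: "\<And>J. J \<in> JJ \<Longrightarrow> mat_skew N 1 (\<lambda>a b. Z $$ (a, b)) (map_mat to_ac J)"
      using Z' RRc JJc mat_commutes_iff[OF Zc] mat_skew_iff[OF Zc] by blast+
    \<comment> \<open>The parameters prescribed by the functionals \<open>\<Lambda>\<close>. The
      discrepancy \<open>E\<close> then solves the homogeneous system and is annihilated by all
      these functionals.\<close>
    define w where "w = (\<lambda>i. \<Sum>a<N. \<Sum>b<N. ?\<Lambda> i a b * (Z $$ (a, b) - to_ac (Z0 a b)))"
    define E where "E = (\<lambda>a b. Z $$ (a, b) - Ze w a b)"
    have Ecomm: "mat_commutes N E (map_mat to_ac R)" if "R \<in> RR" for R
      using Zcomm[OF that] Ze0[OF that, of w]
      by (simp add: E_def mat_commutes_def left_diff_distrib right_diff_distrib sum_subtractf)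
    have Eskew: "mat_skew N 0 E (map_mat to_ac J)" if "J \<in> JJ" for J
      unfolding mat_skew_def
    proof (intro allI impI)
      fix a b assume "a < N" "b < N"
      then have e: "(\<Sum>k<N. Z $$ (k, a) * map_mat to_ac J $$ (k, b)) + (\<Sum>k<N. map_mat to_ac J $$ (a, k) * Z $$ (k, b)) +
         1 * map_mat to_ac J $$ (a, b) = 0"
        "(\<Sum>k<N. Ze w k a * map_mat to_ac J $$ (k, b)) + (\<Sum>k<N. map_mat to_ac J $$ (a, k) * Ze w k b) +
         1 * map_mat to_ac J $$ (a, b) = 0"
        using Zskew[OF that] Ze1[OF that, of w] by (auto simp: mat_skew_def)
      have sub: "p + p' + z = 0 \<Longrightarrow> x + y + z = 0 \<Longrightarrow> (p - x) + (p' - y) + 0 * z = 0" for p x p' y z :: "'f alg_closure"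
        using add_right_imp_eq[of "p + p'" z "x + y"] by (simp add: algebra_simps)
      show "(\<Sum>k<N. E k a * map_mat to_ac J $$ (k, b)) + (\<Sum>k<N. map_mat to_ac J $$ (a, k) * E k b) +
         0 * map_mat to_ac J $$ (a, b) = 0"
        unfolding E_def left_diff_distrib right_diff_distrib sum_subtractf by (rule sub[OF e[unfolded mult_1_left]])
    qed
    have E\<Lambda>: "(\<Sum>a<N. \<Sum>b<N. ?\<Lambda> i a b * E a b) = 0" if "i < d" for i
    proof -
      have "(\<Sum>a<N. \<Sum>b<N. ?\<Lambda> i a b * E a b) = w i - (\<Sum>a<N. \<Sum>b<N. ?\<Lambda> i a b * (\<Sum>j<d. w j * to_ac (W j a b)))"
        unfolding w_def E_def Ze_def sum_subtractf[symmetric]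
        by (intro sum.cong refl) (simp add: right_diff_distrib distrib_left)
      then show ?thesis using \<Lambda>W[OF that] by simp
    qed
    have E0: "E a b = 0" if ab: "a < N" "b < N" for a b
    proof (rule ccontr)
      assume "E a b \<noteq> 0"
      then obtain \<phi> :: "'f alg_closure \<Rightarrow> 'f" where add: "\<And>x y. \<phi> (x + y) = \<phi> x + \<phi> y"
        and sc: "\<And>a x. \<phi> (to_ac a * x) = a * \<phi> x" and nz: "\<phi> (E a b) \<noteq> 0"
        using linear_functional_nonzero by blast
      have \<phi>0: "\<phi> 0 = 0" using sc[of 0 0] by simp
      have sum: "\<phi> (\<Sum>i\<in>I. f i) = (\<Sum>i\<in>I. \<phi> (f i))" for f and I :: "nat set"
        by (induction I rule: infinite_finite_induct) (auto simp: add \<phi>0)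
      have sc': "\<phi> (x * to_ac a) = \<phi> x * a" for a x using sc[of a x] by (simp add: mult.commute)
      have "\<forall>R\<in>RR. mat_commutes N (\<lambda>a b. \<phi> (E a b)) R"
        unfolding mat_commutes_def
      proof (intro ballI allI impI)
        fix R a b assume R: "R \<in> RR" and ab: "a < N" "b < N"
        then have "\<phi> (\<Sum>k<N. E a k * map_mat to_ac R $$ (k, b)) = \<phi> (\<Sum>k<N. map_mat to_ac R $$ (a, k) * E k b)"
          using Ecomm[OF R] by (simp add: mat_commutes_def)
        then show "(\<Sum>k<N. \<phi> (E a k) * R $$ (k, b)) = (\<Sum>k<N. R $$ (a, k) * \<phi> (E k b))"
          using R ab by (simp add: sum R_ent sc sc')
      qed
      moreover have "\<forall>J\<in>JJ. mat_skew N 0 (\<lambda>a b. \<phi> (E a b)) J"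
        unfolding mat_skew_def
      proof (intro ballI allI impI)
        fix J a b assume J: "J \<in> JJ" and ab: "a < N" "b < N"
        then have "\<phi> ((\<Sum>k<N. E k a * map_mat to_ac J $$ (k, b)) + (\<Sum>k<N. map_mat to_ac J $$ (a, k) * E k b)) = 0"
          using Eskew[OF J] \<phi>0 by (simp add: mat_skew_def)
        then show "(\<Sum>k<N. \<phi> (E k a) * J $$ (k, b)) + (\<Sum>k<N. J $$ (a, k) * \<phi> (E k b)) + 0 * J $$ (a, b) = 0"
          using J ab by (simp add: sum add J_ent sc sc')
      qed
      moreover have "\<forall>i<d. (\<Sum>a<N. \<Sum>b<N. \<Lambda> i a b * \<phi> (E a b)) = 0"
      proof (intro allI impI)
        fix i assume i: "i < d"
        have "(\<Sum>a<N. \<Sum>b<N. \<Lambda> i a b * \<phi> (E a b)) = \<phi> (\<Sum>a<N. \<Sum>b<N. ?\<Lambda> i a b * E a b)"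
          by (simp add: sum sc)
        then show "(\<Sum>a<N. \<Sum>b<N. \<Lambda> i a b * \<phi> (E a b)) = 0" using E\<Lambda>[OF i] \<phi>0 by simp
      qed
      ultimately have "\<phi> (E a b) = 0" using triv[of "\<lambda>a b. \<phi> (E a b)"] ab by blast
      then show False using nz by simp
    qed
    have "Z = Zw w" using Zc E0 by (intro eq_matI) (auto simp: Zw_def E_def)
    then show "\<exists>w. Z = Zw w" by auto
  qed auto
  show ?thesis by (rule krull_dim_eq)
qed


section \<open>Lattices in vector spaces over a local field\<close>

context local_field
begin

lemma val_ring_dvd_pi_power: "a \<noteq> 0 \<Longrightarrow> nat (val D a) \<le> k \<Longrightarrow> \<pi> ^ k / a \<in> A"
  using val_mult[of "\<pi> ^ k" "inverse a"] val_inverse[of a] val_pi_power[of k] pi_nz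
  by (auto simp: val_ring_def divide_inverse)

text \<open>A non-integral element has powers with arbitrarily large denominators. This is the
  integrality criterion used for elements of F inside \<open>B\<close> and for norms.\<close>

lemma power_bounded_in_A:
  assumes "\<And>k. \<pi> ^ s * a ^ k \<in> A"
  shows "a \<in> A"
proof (rule ccontr)
  assume a: "a \<notin> A"
  then have a0: "a \<noteq> 0" and v: "val D a \<le> -1" by (auto simp: val_ring_def)
  \<comment> \<open>The power \<open>Suc s\<close> already fails, its valuation being at most s - (s
    + 1).\<close>
  have "val D (\<pi> ^ s * a ^ Suc s) = int s + int (Suc s) * val D a"
    using a0 pi_nz val_mult[of "\<pi> ^ s" "a ^ Suc s"] val_pi_power[of s] val_power[OF a0, of "Suc s"] by simp
  moreover have "int (Suc s) * val D a \<le> int (Suc s) * (-1)" by (rule mult_left_mono) (use v in auto)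
  ultimately have "val D (\<pi> ^ s * a ^ Suc s) < 0" by simp
  moreover have "\<pi> ^ s * a ^ Suc s \<noteq> 0" using a0 pi_nz by simp
  ultimately show False using assms[of "Suc s"] unfolding val_ring_def by auto
qed

lemma pi_divisible_zero:
  assumes "\<And>j. \<exists>a\<in>A. x = \<pi> ^ j * a"
  shows "x = 0"
proof (rule ccontr)
  assume x: "x \<noteq> 0"
  obtain a where a: "a \<in> A" "x = \<pi> ^ Suc (nat (val D x)) * a" using assms by blast
  then have "a \<noteq> 0" "val D a \<ge> 0" using x by (auto simp: val_ring_def)
  then have "val D x = int (Suc (nat (val D x))) + val D a"
    using val_mult[of "\<pi> ^ Suc (nat (val D x))" a] val_pi_power[of "Suc (nat (val D x))"] pi_nz a(2) by simp
  then show False using \<open>val D a \<ge> 0\<close> by linarith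
qed

lemma infinite_field: "infinite (UNIV :: 'f set)"
proof
  assume "finite (UNIV :: 'f set)"
  then have "finite (range (\<lambda>k. \<pi> ^ k))" by (rule finite_subset[OF subset_UNIV])
  moreover have "inj (\<lambda>k. \<pi> ^ k)"
    by (rule injI) (metis val_pi_power of_nat_eq_iff)
  ultimately show False using finite_imageD infinite_UNIV_nat by blast
qed

end

context lattice_space
begin

lemma pi_power_mono:
  assumes "submod \<Lambda>" "scale (\<pi> ^ s) x \<in> \<Lambda>" "s \<le> k"
  shows "scale (\<pi> ^ k) x \<in> \<Lambda>"
proof -
  have "\<pi> ^ k = \<pi> ^ (k - s) * \<pi> ^ s" using assms(3) by (simp flip: power_add)
  then have eq: "scale (\<pi> ^ k) x = scale (\<pi> ^ (k - s)) (scale (\<pi> ^ s) x)" by (simp only: scale_scale)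
  show ?thesis unfolding eq by (rule submodD(3)[OF assms(1) _ assms(2)]) simp
qed

text \<open>Turns exponents depending on the element into a single one. \<open>P s x\<close> stands
  for a statement such as: \<pi>^s x lies in a given lattice. The sum of the exponents of the
  finitely many generators bounds each of them.\<close>

lemma genA_uniform:
  assumes G: "finite G" and z: "\<And>s. P s 0"
    and add: "\<And>s x y. x \<in> genA G \<Longrightarrow> y \<in> genA G \<Longrightarrow> P s x \<Longrightarrow> P s y \<Longrightarrow> P s (x + y)"
    and sc: "\<And>s a x. x \<in> genA G \<Longrightarrow> a \<in> A \<Longrightarrow> P s x \<Longrightarrow> P s (scale a x)"
    and mono: "\<And>s s' x. x \<in> genA G \<Longrightarrow> P s x \<Longrightarrow> s \<le> s' \<Longrightarrow> P s' x"
    and ex: "\<And>g. g \<in> G \<Longrightarrow> \<exists>s. P s g"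
  shows "\<exists>s :: nat. \<forall>x\<in>genA G. P s x"
proof -
  from ex obtain s where s: "\<And>g. g \<in> G \<Longrightarrow> P (s g) g" by metis
  define m where "m = (\<Sum>g\<in>G. s g)"
  have m: "P m g" if "g \<in> G" for g
    using mono[OF genA_mem[OF G that] s[OF that], of m] member_le_sum[OF that, of s] G unfolding m_def by auto
  have "P m x" if x: "x \<in> genA G" for x
  proof -
    obtain c where c: "\<forall>g\<in>G. c g \<in> A" and x_eq: "x = (\<Sum>g\<in>G. scale (c g) g)"
      using x unfolding genA_def by auto
    have "(\<Sum>g\<in>I. scale (c g) g) \<in> genA G \<and> P m (\<Sum>g\<in>I. scale (c g) g)" if "I \<subseteq> G" for I
      using finite_subset[OF that G] that
    proof (induction I)
      case empty
      then show ?case using z submodD(1)[OF submod_genA] by simp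
    next
      case (insert g I)
      then have g: "g \<in> G" and I: "(\<Sum>g\<in>I. scale (c g) g) \<in> genA G" "P m (\<Sum>g\<in>I. scale (c g) g)" by auto
      have g': "scale (c g) g \<in> genA G" "P m (scale (c g) g)"
        using submodD(3)[OF submod_genA _ genA_mem[OF G g]] sc[OF genA_mem[OF G g] _ m[OF g]] c g by auto
      show ?case using insert(1,2) add[OF g'(1) I(1) g'(2) I(2)] submodD(2)[OF submod_genA g'(1) I(1)] by simp
    qed
    then show ?thesis using x_eq by blast
  qed
  then show ?thesis by blast
qed

lemma span_bounded:
  assumes G: "finite G" and x: "x \<in> span G"
  shows "\<exists>s. scale (\<pi> ^ s) x \<in> genA G"
proof -
  obtain u where u: "x = (\<Sum>v\<in>G. scale (u v) v)" using x span_finite[OF G] by auto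
  have "\<forall>v. \<exists>s. \<forall>k\<ge>s. \<pi> ^ k * u v \<in> A" using scale_into_A by blast
  then obtain s where s: "\<And>v k. k \<ge> s v \<Longrightarrow> \<pi> ^ k * u v \<in> A" by metis
  define m where "m = (\<Sum>g\<in>G. s g)"
  have "\<pi> ^ m * u v \<in> A" if "v \<in> G" for v
    using s[of v m] member_le_sum[OF that, of s] G unfolding m_def by auto
  then show ?thesis
    unfolding u genA_def
    by (intro exI[of _ m] CollectI exI[of _ "\<lambda>v. \<pi> ^ m * u v"]) (simp add: scale_sum_right)
qed

lemma genA_bounded:
  assumes G: "finite G" and B: "finite B" "G \<subseteq> span B"
  shows "\<exists>s. scale (\<pi> ^ s) ` genA G \<subseteq> genA B"
proof -
  have "\<exists>s. \<forall>x\<in>genA G. scale (\<pi> ^ s) x \<in> genA B"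
  proof (rule genA_uniform[OF G])
    show "scale (\<pi> ^ s) 0 \<in> genA B" for s using submodD(1)[OF submod_genA] by simp
    show "scale (\<pi> ^ s) (x + y) \<in> genA B" if "scale (\<pi> ^ s) x \<in> genA B" "scale (\<pi> ^ s) y \<in> genA B" for s x y
      using submodD(2)[OF submod_genA that] by (simp add: scale_right_distrib)
    show "scale (\<pi> ^ s) (scale a x) \<in> genA B" if "a \<in> A" "scale (\<pi> ^ s) x \<in> genA B" for s a x
      using submodD(3)[OF submod_genA that] by (simp add: mult.commute)
    show "scale (\<pi> ^ s') x \<in> genA B" if "scale (\<pi> ^ s) x \<in> genA B" "s \<le> s'" for s s' x
      by (rule pi_power_mono[OF submod_genA that])
    show "\<exists>s. scale (\<pi> ^ s) g \<in> genA B" if "g \<in> G" for g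
      using span_bounded[OF B(1)] B(2) that by blast
  qed
  then show ?thesis by auto
qed

lemma finite_independent_subset:
  assumes "finite G" "independent B" "B \<subseteq> span G"
  shows "finite B"
  using independent_span_bound[OF assms] by simp

lemma independent_coeff:
  assumes "finite B" "independent B" "(\<Sum>b\<in>B. scale (c b) b) = (\<Sum>b\<in>B. scale (c' b) b)" "b \<in> B"
  shows "c b = c' b"
proof -
  have "(\<Sum>b\<in>B. scale (c b - c' b) b) = 0"
    using assms(3) by (simp add: scale_left_diff_distrib sum_subtractf)
  from independentD[OF assms(2,1) subset_refl this assms(4)] show ?thesis by simp
qed

text \<open>After multiplication by one fixed power of \<pi> everything is expressed in a basis,
  where a coefficient divisible by all powers of \<pi> is zero.\<close>

lemma genA_separated:
  assumes G: "finite G" and x: "\<And>j. x \<in> scale (\<pi> ^ j) ` genA G"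
  shows "x = 0"
proof -
  obtain B where B: "B \<subseteq> G" "independent B" "G \<subseteq> span B" by (rule maximal_independent_subset)
  have fB: "finite B" using B(1) G finite_subset by blast
  obtain s where s: "scale (\<pi> ^ s) ` genA G \<subseteq> genA B" using genA_bounded[OF G fB B(3)] by blast
  have x': "\<exists>c. (\<forall>b\<in>B. c b \<in> A) \<and> scale (\<pi> ^ s) x = (\<Sum>b\<in>B. scale (\<pi> ^ j * c b) b)" for j
  proof -
    obtain y where y: "y \<in> genA G" "x = scale (\<pi> ^ j) y" using x by blast
    have "scale (\<pi> ^ s) y \<in> genA B" using s y by blast
    then obtain c where c: "\<forall>b\<in>B. c b \<in> A" "scale (\<pi> ^ s) y = (\<Sum>b\<in>B. scale (c b) b)" unfolding genA_def by auto
    have "scale (\<pi> ^ s) x = scale (\<pi> ^ j) (scale (\<pi> ^ s) y)" using y by (simp add: mult.commute)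
    then show ?thesis using c by (intro exI[of _ c]) (simp add: scale_sum_right)
  qed
  obtain c0 where c0: "scale (\<pi> ^ s) x = (\<Sum>b\<in>B. scale (c0 b) b)" using x'[of 0] by auto
  have "c0 b = 0" if b: "b \<in> B" for b
  proof (rule pi_divisible_zero)
    fix j
    obtain c where c: "\<forall>b\<in>B. c b \<in> A" "scale (\<pi> ^ s) x = (\<Sum>b\<in>B. scale (\<pi> ^ j * c b) b)" using x'[of j] by blast
    have "c0 b = \<pi> ^ j * c b" using independent_coeff[OF fB B(2) _ b] c(2) c0 by auto
    then show "\<exists>a\<in>A. c0 b = \<pi> ^ j * a" using c(1) b by blast
  qed
  then have "scale (\<pi> ^ s) x = 0" using c0 by (simp add: sum.neutral)
  then show ?thesis using pi_nz by simp
qed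

text \<open>\<open>B\<close> is extended to a basis of the ambient span. There the coefficients of
  \<pi>^s x are integral, and by independence those along \<open>B\<close> are the coefficients of
  \<pi>^s x in \<open>span B\<close>.\<close>

lemma lattice_in_span:
  assumes G: "finite G" and B: "B \<subseteq> genA G" "independent B" and \<Lambda>: "\<Lambda> \<subseteq> genA G" "\<Lambda> \<subseteq> span B"
  shows "finite B" "\<exists>s. scale (\<pi> ^ s) ` \<Lambda> \<subseteq> genA B"
proof -
  have genA_span: "genA G \<subseteq> span G" unfolding genA_def by (auto intro: span_sum span_scale span_base)
  show fB: "finite B" using finite_independent_subset[OF G B(2)] B(1) genA_span by blast
  obtain B' where B': "B \<subseteq> B'" "B' \<subseteq> B \<union> G" "independent B'" "B \<union> G \<subseteq> span B'"
    using maximal_independent_subset_extend[of B "B \<union> G"] B(2) by blast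
  have fB': "finite B'" using B'(2) fB G finite_subset by blast
  obtain s where s: "scale (\<pi> ^ s) ` genA G \<subseteq> genA B'" using genA_bounded[OF G fB'] B'(4) by blast
  have "scale (\<pi> ^ s) x \<in> genA B" if x: "x \<in> \<Lambda>" for x
  proof -
    obtain c where c: "\<forall>b\<in>B'. c b \<in> A" "scale (\<pi> ^ s) x = (\<Sum>b\<in>B'. scale (c b) b)"
      using subsetD[OF s imageI[OF subsetD[OF \<Lambda>(1) x]]] unfolding genA_def by auto
    have "scale (\<pi> ^ s) x \<in> span B" using \<Lambda>(2) x by (auto intro: span_scale)
    then obtain u where u: "scale (\<pi> ^ s) x = (\<Sum>b\<in>B. scale (u b) b)" using span_finite[OF fB] by auto
    have "(\<Sum>b\<in>B. scale (u b) b) = (\<Sum>b\<in>B'. scale (if b \<in> B then u b else 0) b)"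
      using B'(1) fB' by (intro sum.mono_neutral_cong_left) auto
    then have cu: "c b = u b" if "b \<in> B" for b
      using independent_coeff[OF fB' B'(3), of c "\<lambda>b. if b \<in> B then u b else 0" b] c(2) u that B'(1) by auto
    have "\<forall>b\<in>B. u b \<in> A" using c(1) B'(1) cu by (metis subsetD)
    then show ?thesis unfolding genA_def u by blast
  qed
  then show "\<exists>s. scale (\<pi> ^ s) ` \<Lambda> \<subseteq> genA B" by auto
qed

lemma linear_inj_imp_bij:
  assumes G: "finite G" "span G = UNIV" and f: "Vector_Spaces.linear scale scale f" and inj: "inj f"
  shows "bij f"
proof -
  obtain B where B: "B \<subseteq> G" "independent B" "G \<subseteq> span B" by (rule maximal_independent_subset)
  have "span B = UNIV" using G(2) span_minimal[OF B(3) subspace_span] by auto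
  then interpret finite_dimensional_vector_space scale B
    using B finite_subset[OF B(1) G(1)] by unfold_locales auto
  show ?thesis using linear_inj_imp_surj[OF f inj] inj by (simp add: bij_def)
qed

end

lemma lin_comb_eq_sum:
  "length cs = length bs \<Longrightarrow> lin_comb s cs bs = (\<Sum>i<length bs. s (cs ! i) (bs ! i))"
  by (simp add: lin_comb_def sum_list_sum_nth atLeast0LessThan)

lemma coords_basis:
  assumes "is_basis s bs"
  shows coords_expand: "x = (\<Sum>i<length bs. s (coords s bs x ! i) (bs ! i))"
    and coords_eqI: "\<And>c. x = (\<Sum>i<length bs. s (c i) (bs ! i)) \<Longrightarrow> i < length bs \<Longrightarrow> coords s bs x ! i = c i"
proof -
  have c: "length (coords s bs x) = length bs \<and> x = lin_comb s (coords s bs x) bs"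
    using theI'[of "\<lambda>cs. length cs = length bs \<and> x = lin_comb s cs bs"] assms
    unfolding is_basis_def coords_def by auto
  then show "x = (\<Sum>i<length bs. s (coords s bs x ! i) (bs ! i))" using lin_comb_eq_sum by metis
  fix c assume x: "x = (\<Sum>i<length bs. s (c i) (bs ! i))" and i: "i < length bs"
  have "x = lin_comb s (map c [0..<length bs]) bs" using x by (simp add: lin_comb_eq_sum)
  then have "coords s bs x = map c [0..<length bs]"
    using c assms unfolding is_basis_def by (metis length_map length_upt diff_zero)
  then show "coords s bs x ! i = c i" using i by simp
qed


section \<open>The algebra with involution\<close>

text \<open>The excluded case has no central element of trace one: its centre is F, where the trace
  is multiplication by 2. Such an element is what makes self-adjoint maps representable through
  \<open>psi\<close>.\<close>

locale hermitian =
  fixes D :: "('f::field, 'k::ring_1, 'v::ab_group_add) herm_data" and n :: nat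
  assumes hermitian_lattice: "hermitian_lattice D n"
    and not_quaternion_2: "\<not> (quaternion_case D \<and> CHAR('f) = 2)"

sublocale hermitian \<subseteq> local_field D
  using hermitian_lattice by unfold_locales (simp add: hermitian_lattice_def)

context hermitian
begin

abbreviation e where "e \<equiv> emb D"
abbreviation \<sigma> where "\<sigma> \<equiv> invol D"
abbreviation B where "B \<equiv> intring D"
abbreviation L where "L \<equiv> lat D"
abbreviation h where "h \<equiv> form D"
abbreviation r where "r \<equiv> rmul D"

lemma e_add: "e (a + b) = e a + e b" and e_mult: "e (a * b) = e a * e b" and e_1: "e 1 = 1"
  and e_central: "e a * x = x * e a"
proof -
  have "F_algebra D" using hermitian_lattice by (simp add: hermitian_lattice_def)
  then show "e (a + b) = e a + e b" "e (a * b) = e a * e b" "e 1 = 1" "e a * x = x * e a"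
    unfolding F_algebra_def by blast+
qed

lemma e_0: "e 0 = 0" using e_add[of 0 0] by simp
lemma e_uminus: "e (- a) = - e a" using e_add[of a "- a"] e_0 by (simp add: eq_neg_iff_add_eq_0 add.commute)
lemma e_diff: "e (a - b) = e a - e b" using e_add[of a "- b"] e_uminus by simp

lemma e_eq_0: "e a = 0 \<longleftrightarrow> a = 0"
proof
  assume a: "e a = 0"
  show "a = 0"
  proof (rule ccontr)
    assume "a \<noteq> 0"
    then have "e a * e (inverse a) = 1" using e_mult[of a "inverse a"] e_1 by simp
    then show False using a by simp
  qed
qed (simp add: e_0)

lemma e_inj: "e a = e b \<longleftrightarrow> a = b"
  using e_eq_0[of "a - b"] e_diff[of a b] by simp

lemma e_inverse: "a \<noteq> 0 \<Longrightarrow> e (inverse a) * e a = 1" "a \<noteq> 0 \<Longrightarrow> e a * e (inverse a) = 1"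
  using e_mult[of "inverse a" a] e_mult[of a "inverse a"] e_1 by auto

lemma cases: "base_case D \<or> quadratic_case D \<or> split_case D \<or> quaternion_case D"
  and max_order: "maximal_order D B"
  using hermitian_lattice by (auto simp: hermitian_lattice_def)

end

sublocale hermitian \<subseteq> K: lattice_space D "fmulK D"
proof
  show "fmulK D a (x + y) = fmulK D a x + fmulK D a y" "fmulK D (a + b) x = fmulK D a x + fmulK D b x"
    "fmulK D a (fmulK D b x) = fmulK D (a * b) x" "fmulK D 1 x = x" for a b x y
    by (auto simp: fmulK_def e_add e_mult e_1 algebra_simps)
qed

context hermitian
begin

lemma fmulK_mult: "fmulK D a x * y = fmulK D a (x * y)" "x * fmulK D a y = fmulK D a (x * y)"
proof -
  show "fmulK D a x * y = fmulK D a (x * y)" by (simp add: fmulK_def mult.assoc)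
  have "x * (e a * y) = (e a * x) * y" unfolding e_central[of a x] by (simp add: mult.assoc)
  then show "x * fmulK D a y = fmulK D a (x * y)" by (simp add: fmulK_def mult.assoc)
qed

lemma order_B: "is_order D B"
  using max_order by (simp add: maximal_order_def)

lemma B_1: "1 \<in> B" and B_diff: "x \<in> B \<Longrightarrow> y \<in> B \<Longrightarrow> x - y \<in> B" and B_mult: "x \<in> B \<Longrightarrow> y \<in> B \<Longrightarrow> x * y \<in> B"
  and B_scale: "\<exists>a. a \<noteq> 0 \<and> e a * x \<in> B"
  using order_B by (auto simp: is_order_def)

lemma B_0: "0 \<in> B" using B_diff[OF B_1 B_1] by simp
lemma B_uminus: "x \<in> B \<Longrightarrow> - x \<in> B" using B_diff[OF B_0] by simp
lemma B_add: "x \<in> B \<Longrightarrow> y \<in> B \<Longrightarrow> x + y \<in> B" using B_diff[OF _ B_uminus] by fastforce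
lemma B_power: "x \<in> B \<Longrightarrow> x ^ k \<in> B" by (induction k) (auto simp: B_1 B_mult)
lemma B_generated: "\<exists>G. finite G \<and> B = K.genA G"
proof -
  obtain bs where bs: "B = {lin_comb (fmulK D) cs bs | cs. length cs = length bs \<and> set cs \<subseteq> A}"
    using order_B by (auto simp: is_order_def)
  have "K.submod B" unfolding K.submod_def
  proof (intro conjI ballI)
    show "0 \<in> B" by (rule B_0)
    show "x + y \<in> B" if "x \<in> B" "y \<in> B" for x y by (rule B_add[OF that])
    fix a x assume a: "a \<in> A" and "x \<in> B"
    then obtain cs where cs: "length cs = length bs" "set cs \<subseteq> A" "x = lin_comb (fmulK D) cs bs"
      using bs by blast
    have "fmulK D a x = lin_comb (fmulK D) (map (\<lambda>c. a * c) cs) bs"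
      using cs by (simp add: lin_comb_eq_sum K.scale_sum_right)
    moreover have "set (map (\<lambda>c. a * c) cs) \<subseteq> A" using cs a by auto
    ultimately show "fmulK D a x \<in> B" unfolding bs using cs(1) by (intro CollectI exI[of _ "map (\<lambda>c. a * c) cs"]) simp
  qed
  moreover have "set bs \<subseteq> B"
  proof
    fix b assume "b \<in> set bs"
    then obtain i where i: "i < length bs" "b = bs ! i" by (auto simp: in_set_conv_nth)
    define cs where "cs = map (\<lambda>j. if j = i then 1 else (0::'f)) [0..<length bs]"
    have "lin_comb (fmulK D) cs bs = (\<Sum>j<length bs. if j = i then bs ! j else 0)"
    proof -
      have "lin_comb (fmulK D) cs bs = (\<Sum>j<length bs. fmulK D (cs ! j) (bs ! j))"
        by (rule lin_comb_eq_sum) (simp add: cs_def)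
      also have "\<dots> = (\<Sum>j<length bs. if j = i then bs ! j else 0)"
        by (intro sum.cong) (auto simp: cs_def)
      finally show ?thesis .
    qed
    then have "lin_comb (fmulK D) cs bs = b" using i by simp
    moreover have "length cs = length bs" "set cs \<subseteq> A" by (auto simp: cs_def)
    ultimately show "b \<in> B" unfolding bs by blast
  qed
  ultimately have "K.genA (set bs) \<subseteq> B" by (rule K.genA_subset)
  moreover have "B \<subseteq> K.genA (set bs)"
  proof
    fix x assume "x \<in> B"
    then obtain cs where cs: "length cs = length bs" "set cs \<subseteq> A" "x = lin_comb (fmulK D) cs bs"
      using bs by blast
    have "fmulK D (cs ! i) (bs ! i) \<in> K.genA (set bs)" if "i < length bs" for i
      by (rule K.submodD(3)[OF K.submod_genA _ K.genA_mem]) (use that cs in auto)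
    then have "(\<Sum>i<length bs. fmulK D (cs ! i) (bs ! i)) \<in> K.genA (set bs)"
      by (intro K.submod_sum[OF K.submod_genA]) auto
    then show "x \<in> K.genA (set bs)" using cs by (simp add: lin_comb_eq_sum)
  qed
  ultimately show ?thesis by blast
qed

definition GB :: "'k set" where "GB = (SOME G. finite G \<and> B = K.genA G)"

lemma GB: "finite GB" "B = K.genA GB"
  using someI_ex[OF B_generated] by (auto simp: GB_def)

lemma submod_B: "K.submod B" using GB(2) K.submod_genA by simp

lemma pi_power_into_B: "\<exists>s. fmulK D (\<pi> ^ s) x \<in> B"
proof -
  obtain a where a: "a \<noteq> 0" "fmulK D a x \<in> B" using B_scale[of x] by (auto simp: fmulK_def)
  let ?s = "nat (val D a)"
  have "fmulK D (\<pi> ^ ?s) x = fmulK D (\<pi> ^ ?s / a) (fmulK D a x)" using a(1) by simp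
  then show ?thesis using K.submodD(3)[OF submod_B val_ring_dvd_pi_power[OF a(1) order_refl] a(2)] by metis
qed

lemma span_GB: "K.span GB = UNIV"
proof -
  have "x \<in> K.span GB" for x
  proof -
    obtain s where "fmulK D (\<pi> ^ s) x \<in> B" using pi_power_into_B by blast
    then have "fmulK D (\<pi> ^ s) x \<in> K.span GB"
      unfolding GB(2) K.genA_def using K.span_sum[of GB _ GB] K.span_scale K.span_base by force
    then have "fmulK D (inverse (\<pi> ^ s)) (fmulK D (\<pi> ^ s) x) \<in> K.span GB" by (rule K.span_scale)
    then show ?thesis using pi_nz by simp
  qed
  then show ?thesis by blast
qed

text \<open>The powers of an element of \<open>B\<close> stay in \<open>B\<close>. In a basis
  containing 1, the coefficients of the powers of \<open>a\<close> therefore have bounded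
  denominators, and \<open>power_bounded_in_A\<close> applies.\<close>

lemma e_in_B: "e a \<in> B \<longleftrightarrow> a \<in> A"
proof
  assume "a \<in> A"
  then show "e a \<in> B" using K.submodD(3)[OF submod_B _ B_1, of a] by (simp add: fmulK_def)
next
  assume a: "e a \<in> B"
  have i1: "K.independent {1}" using K.dependent_single[of 1] by simp
  obtain B' where B': "{1} \<subseteq> B'" "B' \<subseteq> insert 1 GB" "K.independent B'" "insert 1 GB \<subseteq> K.span B'"
    using K.maximal_independent_subset_extend[of "{1}" "insert 1 GB"] i1 by blast
  have fB': "finite B'" using B'(2) GB(1) finite_subset by blast
  obtain s where s: "fmulK D (\<pi> ^ s) ` K.genA GB \<subseteq> K.genA B'"
    using K.genA_bounded[OF GB(1) fB'] B'(4) by blast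
  show "a \<in> A"
  proof (rule power_bounded_in_A)
    fix k
    have ek: "e (a ^ k) = e a ^ k" by (induction k) (auto simp: e_1 e_mult)
    have "e (a ^ k) \<in> B" unfolding ek by (rule B_power[OF a])
    then have "fmulK D (\<pi> ^ s) (e (a ^ k)) \<in> K.genA B'" using s GB(2) by blast
    then obtain c where c: "\<forall>b\<in>B'. c b \<in> A" "fmulK D (\<pi> ^ s) (e (a ^ k)) = (\<Sum>b\<in>B'. fmulK D (c b) b)"
      unfolding K.genA_def by auto
    have "fmulK D (\<pi> ^ s) (e (a ^ k)) = (\<Sum>b\<in>B'. fmulK D (if b = 1 then \<pi> ^ s * a ^ k else 0) b)"
    proof -
      have "(\<Sum>b\<in>B'. fmulK D (if b = 1 then \<pi> ^ s * a ^ k else 0) b) =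
        (\<Sum>b\<in>B'. if b = 1 then fmulK D (\<pi> ^ s * a ^ k) 1 else 0)"
        by (intro sum.cong) auto
      then show ?thesis using B'(1) fB' by (simp add: fmulK_def e_mult)
    qed
    then have "c 1 = \<pi> ^ s * a ^ k"
      using K.independent_coeff[OF fB' B'(3), of c "\<lambda>b. if b = 1 then \<pi> ^ s * a ^ k else 0" 1] c(2) B'(1) by auto
    then show "\<pi> ^ s * a ^ k \<in> A" using c(1) B'(1) by auto
  qed
qed

lemma two_nz: "base_case D \<or> quaternion_case D \<Longrightarrow> (2 :: 'f) \<noteq> 0"
proof
  assume "base_case D \<or> quaternion_case D" and 2: "(2 :: 'f) = 0"
  then have "CHAR('f) \<noteq> 2" using not_quaternion_2 by (auto simp: base_case_def)
  have "of_nat 2 = (0 :: 'f)" using 2 by simp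
  then have "CHAR('f) dvd 2" by (simp only: of_nat_eq_0_iff_char_dvd)
  then have "CHAR('f) \<le> 2" by (rule dvd_imp_le) simp
  moreover have "CHAR('f) \<noteq> 1" by simp
  moreover have "CHAR('f) \<noteq> 0" using \<open>CHAR('f) dvd 2\<close> by (metis dvd_0_left_iff zero_neq_numeral)
  ultimately show False using \<open>CHAR('f) \<noteq> 2\<close> by linarith
qed

text \<open>The common ground of the quadratic, split and quaternion cases: an involution reversing
  products, with trace and norm in F.\<close>

definition std_invol :: bool where
  "std_invol \<longleftrightarrow> (\<forall>x y. \<sigma> (x + y) = \<sigma> x + \<sigma> y) \<and> (\<forall>x y. \<sigma> (x * y) = \<sigma> y * \<sigma> x) \<and>
    (\<forall>a. \<sigma> (e a) = e a) \<and> (\<forall>x. \<sigma> (\<sigma> x) = x) \<and>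
    (\<forall>x. x + \<sigma> x \<in> range e) \<and> (\<forall>x. x * \<sigma> x \<in> range e)"

text \<open>That \<sigma> has order two and that traces and norms lie in F has to be derived. An
  element x0 moved by \<sigma> generates K together with 1; x0 and its image are distinct roots of
  the same quadratic polynomial, so their sum is the coefficient p.\<close>

lemma quadratic_std: "quadratic_case D \<Longrightarrow> std_invol"
proof -
  assume q: "quadratic_case D"
  have comm: "x * y = y * x" for x y :: 'k using q by (simp add: quadratic_case_def)
  have inv: "x \<noteq> 0 \<Longrightarrow> \<exists>y. x * y = 1" for x :: 'k using q unfolding quadratic_case_def by blast
  have add: "\<sigma> (x + y) = \<sigma> x + \<sigma> y" and mult: "\<sigma> (x * y) = \<sigma> x * \<sigma> y" and fixF: "\<sigma> (e a) = e a" for x y a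
    using q by (auto simp: quadratic_case_def)
  obtain bs where bs: "is_basis (fmulK D) bs" "length bs = 2" using q by (auto simp: quadratic_case_def)
  obtain x0 where x0: "\<sigma> x0 \<noteq> x0" using q unfolding quadratic_case_def by (auto simp: fun_eq_iff)
  have x0F: "x0 \<noteq> e a" for a using x0 fixF by auto
  have span_bs: "K.span (set bs) = UNIV"
  proof -
    have "x \<in> K.span (set bs)" for x
    proof -
      obtain cs where "length cs = length bs" "x = lin_comb (fmulK D) cs bs"
        using bs(1) unfolding is_basis_def by blast
      moreover have "(\<Sum>i<length bs. fmulK D (cs ! i) (bs ! i)) \<in> K.span (set bs)"
        by (intro K.span_sum K.span_scale) (simp add: K.span_base)
      ultimately show ?thesis by (simp add: lin_comb_eq_sum)
    qed
    then show ?thesis by blast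
  qed
  have rep: "\<exists>a b. z = e a + e b * x0" for z
  proof -
    have i1: "K.independent {1}" using K.dependent_single[of 1] by simp
    have s1: "K.span {1} = range e" by (simp add: K.span_singleton fmulK_def image_def)
    have i2: "K.independent (insert x0 {1})"
      using K.independent_insertI[OF _ i1] s1 x0F by auto
    have "z \<in> K.span {x0, 1}"
    proof (rule ccontr)
      assume z: "z \<notin> K.span {x0, 1}"
      then have i3: "K.independent (insert z {x0, 1})" using K.independent_insertI[OF _ i2] by blast
      have "card {z, x0, 1} \<le> card (set bs)"
        using K.independent_span_bound[OF _ i3, of "set bs"] span_bs by auto
      also have "\<dots> \<le> 2" using card_length[of bs] bs(2) by simp
      finally have "card {z, x0, 1} \<le> 2" .
      moreover have "x0 \<noteq> 1" using x0F[of 1] e_1 by simp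
      moreover have "z \<noteq> x0" "z \<noteq> 1" using z K.span_base[of _ "{x0, 1}"] by auto
      ultimately show False by simp
    qed
    then show ?thesis
      by (simp add: K.span_insert K.span_singleton fmulK_def) (metis add.commute diff_add_cancel e_1 mult.right_neutral)
  qed
  define y where "y = \<sigma> x0"
  obtain p t where pt: "x0 * x0 = e t + e p * x0" using rep by blast
  have "\<sigma> (x0 * x0) = \<sigma> (e t + e p * x0)" using pt by simp
  then have pty: "y * y = e t + e p * y" by (simp add: mult add fixF y_def)
  have "(x0 - y) * (x0 + y - e p) = x0 * x0 - y * y - e p * x0 + e p * y"
    using comm[of y x0] comm[of _ "e p"] by (simp add: algebra_simps)
  then have "(x0 - y) * (x0 + y - e p) = 0" using pt pty by (simp add: algebra_simps)
  moreover obtain u where "(x0 - y) * u = 1" using inv[of "x0 - y"] x0 by (auto simp: y_def)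
  ultimately have "x0 + y - e p = 0" using comm by (metis mult.assoc mult.left_neutral mult_zero_right)
  then have y: "y = e p - x0" by (simp add: algebra_simps)
  have \<sigma>z: "\<sigma> (e a + e b * x0) = e a + e b * y" for a b by (simp add: mult add fixF y_def)
  have \<sigma>y: "\<sigma> y = x0"
  proof -
    have "\<sigma> (e p) = \<sigma> (y + x0)" using y by simp
    then have "e p = \<sigma> y + y" using fixF add by (simp add: y_def)
    then have "\<sigma> y = e p - y" by simp
    also have "e p - y = x0" using y by simp
    finally show ?thesis .
  qed
  show ?thesis unfolding std_invol_def
  proof (intro conjI allI)
    fix x z a
    show "\<sigma> (x + z) = \<sigma> x + \<sigma> z" "\<sigma> (x * z) = \<sigma> z * \<sigma> x" "\<sigma> (e a) = e a"
      using add mult fixF comm by auto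
    obtain a b where x: "x = e a + e b * x0" using rep by blast
    show "\<sigma> (\<sigma> x) = x" by (simp add: x mult add fixF \<sigma>y flip: y_def)
    have "x + \<sigma> x = e (a + a + b * p)"
      unfolding x \<sigma>z y e_add e_mult by (simp add: algebra_simps)
    then show "x + \<sigma> x \<in> range e" by blast
    have xy: "x0 * y = - e t" using pt comm[of x0 "e p"] by (simp add: y algebra_simps)
    have "x * \<sigma> x = e a * e a + e a * e b * (x0 + y) + e b * e b * (x0 * y)"
      unfolding x \<sigma>z
    proof -
      have lc: "u * (v * w) = v * (u * w)" for u v w :: 'k
        using comm[of u v] by (simp only: mult.assoc[symmetric])
      show "(e a + e b * x0) * (e a + e b * y) = e a * e a + e a * e b * (x0 + y) + e b * e b * (x0 * y)"
        by (simp only: distrib_left distrib_right mult.assoc lc comm add_ac)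
    qed
    also have "\<dots> = e (a * a + a * b * p - b * b * t)"
      unfolding xy by (simp add: y e_add e_mult e_diff)
    finally show "x * \<sigma> x \<in> range e" by blast
  qed
qed

lemma split_std: "split_case D \<Longrightarrow> std_invol"
proof -
  assume "split_case D"
  then obtain u :: "'k \<Rightarrow> 'f \<times> 'f" where bij: "bij u"
    and add: "\<And>x y. u (x + y) = (fst (u x) + fst (u y), snd (u x) + snd (u y))"
    and mult: "\<And>x y. u (x * y) = (fst (u x) * fst (u y), snd (u x) * snd (u y))"
    and emb: "\<And>a. u (e a) = (a, a)" and inv: "\<And>x. u (\<sigma> x) = (snd (u x), fst (u x))"
    unfolding split_case_def by blast
  have inj: "u x = u y \<Longrightarrow> x = y" for x y using bij by (auto simp: bij_def inj_def)
  show ?thesis unfolding std_invol_def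
  proof (intro conjI allI)
    fix x y a
    show "\<sigma> (x + y) = \<sigma> x + \<sigma> y" "\<sigma> (x * y) = \<sigma> y * \<sigma> x" "\<sigma> (e a) = e a" "\<sigma> (\<sigma> x) = x"
      by (rule inj; simp add: add mult emb inv mult.commute)+
    have "x + \<sigma> x = e (fst (u x) + snd (u x))" by (rule inj) (simp add: add emb inv)
    then show "x + \<sigma> x \<in> range e" by blast
    have "x * \<sigma> x = e (fst (u x) * snd (u x))" by (rule inj) (simp add: mult emb inv)
    then show "x * \<sigma> x \<in> range e" by blast
  qed
qed

lemma base_or_std: "base_case D \<or> std_invol"
proof -
  have "quaternion_case D \<Longrightarrow> std_invol" unfolding quaternion_case_def std_invol_def by blast
  then show ?thesis using cases quadratic_std split_std by blast
qed

lemma base_comm: "base_case D \<Longrightarrow> x * y = y * (x :: 'k)"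
  unfolding base_case_def using e_central by (metis surjD)

lemma \<sigma>_add: "\<sigma> (x + y) = \<sigma> x + \<sigma> y" and \<sigma>_mult: "\<sigma> (x * y) = \<sigma> y * \<sigma> x" and \<sigma>_e: "\<sigma> (e a) = e a"
  and \<sigma>_\<sigma>: "\<sigma> (\<sigma> x) = x"
  using base_or_std base_comm[of x y] by (auto simp: std_invol_def base_case_def)

lemma \<sigma>_0: "\<sigma> 0 = 0" using \<sigma>_e[of 0] e_0 by simp
lemma \<sigma>_1: "\<sigma> 1 = 1" using \<sigma>_e[of 1] e_1 by simp
lemma \<sigma>_uminus: "\<sigma> (- x) = - \<sigma> x" using \<sigma>_add[of x "- x"] \<sigma>_0 by (simp add: eq_neg_iff_add_eq_0 add.commute)
lemma \<sigma>_diff: "\<sigma> (x - y) = \<sigma> x - \<sigma> y" using \<sigma>_add[of x "- y"] \<sigma>_uminus by simp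
lemma \<sigma>_fmulK: "\<sigma> (fmulK D a x) = fmulK D a (\<sigma> x)" by (simp add: fmulK_def \<sigma>_mult \<sigma>_e e_central)
lemma \<sigma>_sum: "\<sigma> (sum f I) = (\<Sum>i\<in>I. \<sigma> (f i))"
  by (induction I rule: infinite_finite_induct) (auto simp: \<sigma>_0 \<sigma>_add)

text \<open>Norms of elements of \<open>B\<close> are integral because the norms of all their powers are uniformly
  bounded; the trace is then integral by \<open>N(x + 1) = N(x) + Tr(x) + 1\<close>.\<close>

lemma \<sigma>_B: "x \<in> B \<Longrightarrow> \<sigma> x \<in> B"
proof (cases "base_case D")
  case True
  assume "x \<in> B"
  then show ?thesis using True by (simp add: base_case_def)
next
  case False
  then have std: "std_invol" using base_or_std by blast
  assume x: "x \<in> B"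
  have "\<forall>z. \<exists>a. z * \<sigma> z = e a" "\<forall>z. \<exists>a. z + \<sigma> z = e a" using std unfolding std_invol_def by blast+
  then obtain nm tr where nm: "\<And>z. z * \<sigma> z = e (nm z)" and tr: "\<And>z. z + \<sigma> z = e (tr z)" by metis
  have nm_mult: "nm (y * z) = nm y * nm z" for y z
  proof -
    have "e (nm (y * z)) = (y * z) * \<sigma> (y * z)" by (rule nm[symmetric])
    also have "\<dots> = y * (z * \<sigma> z) * \<sigma> y" by (simp only: \<sigma>_mult mult.assoc)
    also have "\<dots> = (y * e (nm z)) * \<sigma> y" by (simp only: nm)
    also have "y * e (nm z) = e (nm z) * y" by (rule e_central[symmetric])
    also have "e (nm z) * y * \<sigma> y = e (nm z) * e (nm y)" by (simp only: mult.assoc nm)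
    also have "\<dots> = e (nm y * nm z)" by (simp only: e_mult[symmetric] mult.commute[of "nm z"])
    finally show ?thesis by (simp only: e_inj)
  qed
  have "e (nm 1) = e 1" using nm[of 1] by (simp add: \<sigma>_1 e_1)
  then have nm_1: "nm 1 = 1" by (simp only: e_inj)
  have nm_power: "nm (z ^ k) = nm z ^ k" for z k by (induction k) (auto simp: nm_1 nm_mult)
  have "\<forall>z. \<exists>s. fmulK D (\<pi> ^ s) z \<in> B" using pi_power_into_B by blast
  then obtain s where s: "\<And>z. fmulK D (\<pi> ^ s z) z \<in> B" by metis
  define m where "m = (\<Sum>(g, g')\<in>GB \<times> GB. s (g * \<sigma> g'))"
  have m: "fmulK D (\<pi> ^ m) (g * \<sigma> g') \<in> B" if "g \<in> GB" "g' \<in> GB" for g g'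
  proof -
    have "s (g * \<sigma> g') \<le> m"
      using member_le_sum[of "(g, g')" "GB \<times> GB" "\<lambda>(g, g'). s (g * \<sigma> g')"] GB(1) that by (simp add: m_def)
    then show ?thesis by (rule K.pi_power_mono[OF submod_B s])
  qed
  have nm_bd: "\<pi> ^ m * nm z \<in> A" if "z \<in> B" for z
  proof -
    have "z \<in> K.genA GB" using that GB(2) by simp
    then obtain c where c: "\<forall>g\<in>GB. c g \<in> A" "z = (\<Sum>g\<in>GB. fmulK D (c g) g)" unfolding K.genA_def by auto
    have "e (\<pi> ^ m * nm z) = fmulK D (\<pi> ^ m) (z * \<sigma> z)" by (simp add: nm fmulK_def e_mult)
    also have "z * \<sigma> z = (\<Sum>g\<in>GB. \<Sum>g'\<in>GB. fmulK D (c g * c g') (g * \<sigma> g'))"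
      unfolding c(2) \<sigma>_sum sum_product by (simp add: \<sigma>_fmulK fmulK_mult mult.commute)
    also have "fmulK D (\<pi> ^ m) \<dots> = (\<Sum>g\<in>GB. \<Sum>g'\<in>GB. fmulK D (c g * c g') (fmulK D (\<pi> ^ m) (g * \<sigma> g')))"
      by (simp add: K.scale_sum_right mult.commute)
    also have "\<dots> \<in> B"
    proof (intro K.submod_sum[OF submod_B])
      fix g g' assume g: "g \<in> GB" "g' \<in> GB"
      have "c g * c g' \<in> A" using c(1) g by auto
      then show "fmulK D (c g * c g') (fmulK D (\<pi> ^ m) (g * \<sigma> g')) \<in> B"
        by (rule K.submodD(3)[OF submod_B _ m[OF g]])
    qed
    finally show ?thesis using e_in_B by blast
  qed
  have nm_A: "nm z \<in> A" if "z \<in> B" for z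
    by (rule power_bounded_in_A[of m]) (use nm_bd[OF B_power[OF that]] nm_power in simp)
  have "e (nm (x + 1)) = e (nm x + tr x + 1)"
    by (simp add: \<sigma>_add \<sigma>_1 e_add e_1 algebra_simps flip: nm tr)
  then have "tr x = nm (x + 1) - nm x - 1" by (simp add: e_inj)
  then have "tr x \<in> A" using nm_A[OF x] nm_A[OF B_add[OF x B_1]] by simp
  then have "e (tr x) - x \<in> B" using e_in_B x by (intro B_diff) auto
  moreover have "\<sigma> x = e (tr x) - x" using tr[of x] by (simp add: algebra_simps)
  ultimately show ?thesis by simp
qed

lemma \<sigma>_B_iff: "\<sigma> x \<in> B \<longleftrightarrow> x \<in> B"
  using \<sigma>_B[of x] \<sigma>_B[of "\<sigma> x"] by (auto simp: \<sigma>_\<sigma>)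

text \<open>The element \<open>c\<close> replaces \<open>1/2\<close> in characteristic two.\<close>

lemma trace_one_ex:
  "\<exists>c c'. (\<forall>x. c * x = x * c) \<and> c + \<sigma> c = 1 \<and> c * c' = 1 \<and> c' * c = 1"
proof (cases "(2 :: 'f) = 0")
  case False
  then have h: "e (1 / 2) + e (1 / 2) = 1" by (simp add: e_1 flip: e_add)
  have i: "e (1 / 2) * e 2 = 1" "e 2 * e (1 / 2) = 1" using False e_mult[of "1/2" 2] e_mult[of 2 "1/2"] by (auto simp: e_1)
  show ?thesis
  proof (intro exI conjI allI)
    show "e (1 / 2) * x = x * e (1 / 2)" for x by (rule e_central)
    show "e (1 / 2) + \<sigma> (e (1 / 2)) = 1" unfolding \<sigma>_e by (rule h)
  qed (rule i)+
next
  case True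
  then have "quadratic_case D \<or> split_case D" using cases two_nz by blast
  then show ?thesis
  proof
    assume q: "quadratic_case D"
    then have std: std_invol and comm: "\<And>x y :: 'k. x * y = y * x"
      and inv: "\<And>x :: 'k. x \<noteq> 0 \<Longrightarrow> \<exists>y. x * y = 1"
      using quadratic_std by (auto simp: quadratic_case_def)
    obtain x where x: "\<sigma> x \<noteq> x" using q unfolding quadratic_case_def by (auto simp: fun_eq_iff)
    obtain t where t: "x + \<sigma> x = e t" using std unfolding std_invol_def by blast
    \<comment> \<open>In characteristic two, trace zero would mean \<sigma> x = x.\<close>
    have "t \<noteq> 0"
    proof
      assume "t = 0"
      then have "\<sigma> x = - x" using t by (simp add: e_0 add_eq_0_iff)
      also have "- x = x"
      proof -
        have "x + x = e 2 * x" using e_add[of 1 1] by (simp add: e_1 mult_2)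
        then have "x + x = 0" using True by (simp add: e_0)
        then show ?thesis by (rule minus_unique)
      qed
      finally show False using x by simp
    qed
    define c where "c = e (inverse t) * x"
    have "c + \<sigma> c = e (inverse t) * (x + \<sigma> x)" by (simp add: c_def \<sigma>_mult \<sigma>_e distrib_left comm)
    then have c: "c + \<sigma> c = 1" using t e_inverse(1)[OF \<open>t \<noteq> 0\<close>] by simp
    then have "c \<noteq> 0" using \<sigma>_0 by auto
    then obtain c' where "c * c' = 1" using inv by blast
    then show ?thesis using c comm by metis
  next
    assume "split_case D"
    then obtain u :: "'k \<Rightarrow> 'f \<times> 'f" where bij: "bij u"
      and add: "\<And>x y. u (x + y) = (fst (u x) + fst (u y), snd (u x) + snd (u y))"
      and mult: "\<And>x y. u (x * y) = (fst (u x) * fst (u y), snd (u x) * snd (u y))"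
      and emb: "\<And>a. u (e a) = (a, a)" and inv: "\<And>x. u (\<sigma> x) = (snd (u x), fst (u x))"
      unfolding split_case_def by blast
    have inj: "u x = u y \<Longrightarrow> x = y" for x y using bij by (auto simp: bij_def inj_def)
    have surj: "\<exists>x. u x = z" for z using bij by (metis bij_pointE)
    have u1: "u 1 = (1, 1)" using emb[of 1] e_1 by simp
    \<comment> \<open>The idempotent (1, 0) also has trace one but is not invertible, as the Cayley
      base point requires.\<close>
    obtain c where c: "u c = (\<pi>, 1 - \<pi>)" using surj by blast
    obtain c' where c': "u c' = (inverse \<pi>, inverse (1 - \<pi>))" using surj by blast
    have "1 - \<pi> \<noteq> 0" using val_pi val_1 by auto
    then show ?thesis using pi_nz
      by (intro exI[of _ c] exI[of _ c'] conjI allI)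
        (rule inj, simp add: add mult inv u1 c c' mult.commute)+
  qed
qed

definition cc :: 'k where
  "cc = (SOME c. \<exists>c'. (\<forall>x. c * x = x * c) \<and> c + \<sigma> c = 1 \<and> c * c' = 1 \<and> c' * c = 1)"

lemma cc: "cc * x = x * cc" "cc + \<sigma> cc = 1" "\<exists>c'. cc * c' = 1 \<and> c' * cc = 1"
proof -
  from someI_ex[OF trace_one_ex] show "cc * x = x * cc" "cc + \<sigma> cc = 1" "\<exists>c'. cc * c' = 1 \<and> c' * cc = 1"
    unfolding cc_def[symmetric] by blast+
qed

text \<open>\<open>exceptional\<close> records only that F maps onto K, whereas the treatment of
  quadratic forms uses \<sigma> = id and 2 nonzero. The other cases have a nontrivial \<sigma> or a
  K too large for F to map onto.\<close>

lemma exceptional_base: "exceptional D \<Longrightarrow> base_case D"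
proof (rule ccontr)
  assume ex: "exceptional D" and nb: "\<not> base_case D"
  then have s: "surj e" by (simp add: exceptional_def)
  have fixed: "\<sigma> x = x" for x using s \<sigma>_e by (metis surjD)
  have "x * y = y * (x :: 'k)" for x y using s e_central by (metis surjD)
  from cases nb consider "quadratic_case D" | "split_case D" | "quaternion_case D" by blast
  then show False
  proof cases
    case 1
    then show False using fixed by (auto simp: quadratic_case_def fun_eq_iff)
  next
    case 2
    then obtain u :: "'k \<Rightarrow> 'f \<times> 'f" where bij: "bij u" and emb: "\<And>a. u (e a) = (a, a)"
      unfolding split_case_def by blast
    obtain x where "u x = (1, 0)" using bij by (metis bij_pointE)
    moreover obtain a where "x = e a" using s by blast
    ultimately show False using emb[of a] by auto
  next
    case 3
    then obtain bs where bs: "is_basis (fmulK D) bs" "length bs = 4" by (auto simp: quaternion_case_def)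
    obtain b0 b1 b2 b3 where b: "bs = [b0, b1, b2, b3]"
      using bs(2) by (auto simp: numeral_eq_Suc length_Suc_conv)
    obtain x y where xy: "b0 = e x" "b1 = e y" using s by blast
    have uniq: "cs = cs'" if "length cs = 4" "length cs' = 4"
      "lin_comb (fmulK D) cs bs = lin_comb (fmulK D) cs' bs" for cs cs'
      using bs that unfolding is_basis_def by metis
    \<comment> \<open>Two basis vectors e x and e y coming from F satisfy the linear relation y b0 =
      x b1.\<close>
    have "[y, - x, 0, 0] = [0, 0, 0, 0]"
      by (rule uniq) (simp_all add: b lin_comb_def fmulK_def xy e_0 e_uminus e_mult[symmetric] mult.commute)
    then have "x = 0" by simp
    then have "[1, 0, 0, 0] = [0, 0, 0, 0 :: 'f]"
      by (intro uniq) (simp_all add: b lin_comb_def fmulK_def xy e_0)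
    then show False by simp
  qed
qed

end


section \<open>The hermitian space and adjoints\<close>

context hermitian
begin

lemma right_module: "right_module D" and free: "free_lattice D n"
  and eps: "eps D \<in> {1, -1}" and form_in: "h \<in> herm_forms D"
  and nondeg: "(\<And>w. h v w = 0) \<Longrightarrow> v = 0" and dual_dual: "dual D (dual D L) = L"
  using hermitian_lattice by (auto simp: hermitian_lattice_def)

lemma r_add_l: "r (v + w) a = r v a + r w a" and r_add_r: "r v (a + b) = r v a + r v b"
  and r_mult: "r v (a * b) = r (r v a) b" and r_1: "r v 1 = v"
  using right_module by (auto simp: right_module_def)

lemma r_0_l: "r 0 a = 0" using r_add_l[of 0 0] by simp
lemma r_0_r: "r v 0 = 0" using r_add_r[of v 0 0] by simp
lemma r_uminus_l: "r (- v) a = - r v a" using r_add_l[of v "- v" a] by (simp add: r_0_l eq_neg_iff_add_eq_0 add.commute)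
lemma r_diff_l: "r (v - w) a = r v a - r w a" using r_add_l[of v "- w" a] by (simp add: r_uminus_l)
lemma r_sum_l: "r (sum f I) a = (\<Sum>i\<in>I. r (f i) a)"
  by (induction I rule: infinite_finite_induct) (auto simp: r_0_l r_add_l)
lemma r_sum_r: "r v (sum f I) = (\<Sum>i\<in>I. r v (f i))"
  by (induction I rule: infinite_finite_induct) (auto simp: r_0_r r_add_r)

lemma r_fmulK: "r v (fmulK D a x) = fmulV D a (r v x)"
  unfolding fmulK_def fmulV_def e_central r_mult ..

lemma r_fmulV: "r (fmulV D a v) x = fmulV D a (r v x)"
  unfolding fmulV_def r_mult[symmetric] e_central ..

lemma fmulV_simps: "fmulV D a (v + w) = fmulV D a v + fmulV D a w"
  "fmulV D (a + b) v = fmulV D a v + fmulV D b v"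
  "fmulV D a (fmulV D b v) = fmulV D (a * b) v" "fmulV D 1 v = v"
  by (auto simp: fmulV_def r_add_l e_add r_add_r e_1 r_1 mult.commute[of a b] e_mult r_mult)

end

sublocale hermitian \<subseteq> V: lattice_space D "fmulV D"
  by unfold_locales (simp_all add: fmulV_simps)

text \<open>The ambient vector space consists of all functions on V, linear or not; endomorphisms
  form a subspace, and finiteness is supplied by finite generating sets. Forms are treated in the
  same way.\<close>

sublocale hermitian \<subseteq> E: lattice_space D "\<lambda>a Y v. fmulV D a (Y v)"
  by unfold_locales (simp_all add: fun_eq_iff fmulV_simps)

sublocale hermitian \<subseteq> H: lattice_space D "\<lambda>a f v w. fmulK D a (f v w)"
  by unfold_locales (simp_all add: fun_eq_iff K.scale_right_distrib K.scale_left_distrib)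

context hermitian
begin

abbreviation scE :: "'f \<Rightarrow> ('v \<Rightarrow> 'v) \<Rightarrow> 'v \<Rightarrow> 'v" where "scE \<equiv> \<lambda>a Y v. fmulV D a (Y v)"
abbreviation scH :: "'f \<Rightarrow> ('v \<Rightarrow> 'v \<Rightarrow> 'k) \<Rightarrow> 'v \<Rightarrow> 'v \<Rightarrow> 'k" where "scH \<equiv> \<lambda>a f v w. fmulK D a (f v w)"

definition es :: "'v list" where
  "es = (SOME es. length es = n \<and> is_basis (kmulV D) es \<and>
     L = {lin_comb (kmulV D) cs es | cs. length cs = n \<and> set cs \<subseteq> B})"

lemma es: "length es = n" "is_basis (kmulV D) es"
  "L = {lin_comb (kmulV D) cs es | cs. length cs = n \<and> set cs \<subseteq> B}"
proof -
  have "\<exists>es. length es = n \<and> is_basis (kmulV D) es \<and>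
     L = {lin_comb (kmulV D) cs es | cs. length cs = n \<and> set cs \<subseteq> B}"
    using free by (simp add: free_lattice_def)
  from someI_ex[OF this] show "length es = n" "is_basis (kmulV D) es"
    "L = {lin_comb (kmulV D) cs es | cs. length cs = n \<and> set cs \<subseteq> B}"
    unfolding es_def[symmetric] by blast+
qed

definition eb :: "nat \<Rightarrow> 'v" where "eb i = es ! i"

definition cf :: "'v \<Rightarrow> nat \<Rightarrow> 'k" where "cf v i = coords (kmulV D) es v ! i"

lemma lin_comb_es: "length cs = n \<Longrightarrow> lin_comb (kmulV D) cs es = (\<Sum>i<n. r (eb i) (cs ! i))"
  by (simp add: lin_comb_eq_sum es(1) kmulV_def eb_def)

lemma cf_expand: "v = (\<Sum>i<n. r (eb i) (cf v i))"
  using coords_expand[OF es(2), of v] by (simp add: es(1) kmulV_def eb_def cf_def)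

lemma cf_eqI: "v = (\<Sum>i<n. r (eb i) (c i)) \<Longrightarrow> i < n \<Longrightarrow> cf v i = c i"
  using coords_eqI[OF es(2), where x = v and c = c and i = i] by (simp add: es(1) kmulV_def eb_def cf_def)

lemma cf_add: "i < n \<Longrightarrow> cf (v + w) i = cf v i + cf w i"
proof (rule cf_eqI)
  have "v + w = (\<Sum>i<n. r (eb i) (cf v i)) + (\<Sum>i<n. r (eb i) (cf w i))" using cf_expand by metis
  then show "v + w = (\<Sum>i<n. r (eb i) (cf v i + cf w i))" by (simp add: r_add_r sum.distrib)
qed

lemma cf_r: "i < n \<Longrightarrow> cf (r v a) i = cf v i * a"
proof (rule cf_eqI)
  have "r v a = r (\<Sum>i<n. r (eb i) (cf v i)) a" using cf_expand by metis
  then show "r v a = (\<Sum>i<n. r (eb i) (cf v i * a))" by (simp add: r_sum_l r_mult)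
qed

lemma cf_eb: "i < n \<Longrightarrow> j < n \<Longrightarrow> cf (eb j) i = (if i = j then 1 else 0)"
proof (rule cf_eqI)
  assume "j < n"
  have "(\<Sum>i<n. r (eb i) (if i = j then 1 else 0)) = (\<Sum>i<n. if i = j then eb i else 0)"
    by (intro sum.cong) (auto simp: r_1 r_0_r)
  then show "eb j = (\<Sum>i<n. r (eb i) (if i = j then 1 else 0))" using \<open>j < n\<close> by simp
qed

lemma L_iff: "v \<in> L \<longleftrightarrow> (\<forall>i<n. cf v i \<in> B)"
proof
  assume "v \<in> L"
  then obtain cs where cs: "length cs = n" "set cs \<subseteq> B" "v = lin_comb (kmulV D) cs es" using es(3) by blast
  then have "v = (\<Sum>i<n. r (eb i) (cs ! i))" by (simp add: lin_comb_es)
  then show "\<forall>i<n. cf v i \<in> B" using cf_eqI cs by (metis nth_mem subsetD)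
next
  assume "\<forall>i<n. cf v i \<in> B"
  then have "set (map (cf v) [0..<n]) \<subseteq> B" by auto
  moreover have "v = lin_comb (kmulV D) (map (cf v) [0..<n]) es"
    using cf_expand[of v] by (simp add: lin_comb_es)
  ultimately show "v \<in> L" unfolding es(3) by (intro CollectI exI[of _ "map (cf v) [0..<n]"]) simp
qed

lemma L_add: "v \<in> L \<Longrightarrow> w \<in> L \<Longrightarrow> v + w \<in> L" by (auto simp: L_iff cf_add B_add)
lemma L_r: "v \<in> L \<Longrightarrow> b \<in> B \<Longrightarrow> r v b \<in> L" by (auto simp: L_iff cf_r B_mult)
lemma L_0: "0 \<in> L" using cf_r[of _ 0 0] by (auto simp: L_iff r_0_l B_0)
lemma L_sum: "(\<And>i. i \<in> I \<Longrightarrow> f i \<in> L) \<Longrightarrow> sum f I \<in> L"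
  by (induction I rule: infinite_finite_induct) (auto simp: L_0 L_add)
lemma eb_L: "i < n \<Longrightarrow> eb i \<in> L" by (simp add: L_iff cf_eb B_1 B_0)

lemma submod_L: "V.submod L"
  using L_0 L_add L_r e_in_B by (auto simp: V.submod_def fmulV_def)

definition GV :: "'v set" where "GV = (\<lambda>(i, g). r (eb i) g) ` ({..<n} \<times> GB)"

lemma GV: "finite GV" "L = V.genA GV"
proof -
  show fin: "finite GV" using GB(1) by (simp add: GV_def)
  show "L = V.genA GV"
  proof
    have "GV \<subseteq> L"
      using eb_L L_r K.genA_mem[OF GB(1)] GB(2) by (auto simp: GV_def)
    then show "V.genA GV \<subseteq> L" by (rule V.genA_subset[OF submod_L])
    show "L \<subseteq> V.genA GV"
    proof
      fix v assume v: "v \<in> L"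
      have "r (eb i) (cf v i) \<in> V.genA GV" if i: "i < n" for i
      proof -
        have "cf v i \<in> K.genA GB" using v i GB(2) by (simp add: L_iff)
        then obtain c where c: "\<forall>g\<in>GB. c g \<in> A" "cf v i = (\<Sum>g\<in>GB. fmulK D (c g) g)"
          unfolding K.genA_def by auto
        have eq: "r (eb i) (cf v i) = (\<Sum>g\<in>GB. fmulV D (c g) (r (eb i) g))"
          by (simp add: c(2) r_sum_r r_fmulK)
        have "fmulV D (c g) (r (eb i) g) \<in> V.genA GV" if "g \<in> GB" for g
          by (rule V.submodD(3)[OF V.submod_genA _ V.genA_mem[OF fin]]) (use c that i in \<open>auto simp: GV_def\<close>)
        then show ?thesis unfolding eq by (intro V.submod_sum[OF V.submod_genA])
      qed
      then have "(\<Sum>i<n. r (eb i) (cf v i)) \<in> V.genA GV" by (intro V.submod_sum[OF V.submod_genA]) auto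
      then show "v \<in> V.genA GV" using cf_expand[of v] by simp
    qed
  qed
qed

lemma pi_power_into_L: "\<exists>s. fmulV D (\<pi> ^ s) v \<in> L"
proof -
  have "\<forall>i. \<exists>s. fmulK D (\<pi> ^ s) (cf v i) \<in> B" using pi_power_into_B by blast
  then obtain s where s: "\<And>i. fmulK D (\<pi> ^ s i) (cf v i) \<in> B" by metis
  have "fmulK D (\<pi> ^ (\<Sum>i<n. s i)) (cf v i) \<in> B" if "i < n" for i
    using K.pi_power_mono[OF submod_B s, of i "\<Sum>i<n. s i"] member_le_sum[of i "{..<n}" s] that by simp
  then have "fmulV D (\<pi> ^ (\<Sum>i<n. s i)) v \<in> L"
    by (simp add: L_iff fmulV_def cf_r fmulK_def e_central)
  then show ?thesis ..
qed

lemma span_GV: "V.span GV = UNIV"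
proof -
  have "v \<in> V.span GV" for v
  proof -
    obtain s where "fmulV D (\<pi> ^ s) v \<in> V.genA GV" using pi_power_into_L GV(2) by blast
    then have "fmulV D (\<pi> ^ s) v \<in> V.span GV"
      unfolding V.genA_def using V.span_sum[of GV _ GV] V.span_scale V.span_base by force
    then have "fmulV D (inverse (\<pi> ^ s)) (fmulV D (\<pi> ^ s) v) \<in> V.span GV" by (rule V.span_scale)
    then show ?thesis using pi_nz by simp
  qed
  then show ?thesis by blast
qed

abbreviation lin where "lin \<equiv> K_linear D"

lemma lin_add: "lin Y \<Longrightarrow> Y (v + w) = Y v + Y w" and lin_r: "lin Y \<Longrightarrow> Y (r v a) = r (Y v) a"
  by (auto simp: K_linear_def)
lemma lin_fmulV: "lin Y \<Longrightarrow> Y (fmulV D a v) = fmulV D a (Y v)" by (simp add: fmulV_def lin_r)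
lemma lin_0: "lin Y \<Longrightarrow> Y 0 = 0" using lin_add[of Y 0 0] by simp
lemma lin_uminus: "lin Y \<Longrightarrow> Y (- v) = - Y v"
  using lin_add[of Y v "- v"] lin_0[of Y] by (simp add: eq_neg_iff_add_eq_0 add.commute)
lemma lin_diff: "lin Y \<Longrightarrow> Y (v - w) = Y v - Y w"
  using lin_add[of Y v "- w"] lin_uminus[of Y w] by simp
lemma lin_sum: "lin Y \<Longrightarrow> Y (sum f I) = (\<Sum>i\<in>I. Y (f i))"
  by (induction I rule: infinite_finite_induct) (auto simp: lin_0 lin_add)

lemma lin_id: "lin id" "lin (\<lambda>v. v)" by (auto simp: K_linear_def)
lemma lin_comp: "lin Y \<Longrightarrow> lin Z \<Longrightarrow> lin (Y \<circ> Z)" by (auto simp: K_linear_def)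
lemma lin_plus: "lin Y \<Longrightarrow> lin Z \<Longrightarrow> lin (Y + Z)" by (auto simp: K_linear_def r_add_l)
lemma lin_scE: "lin Y \<Longrightarrow> lin (scE a Y)"
  by (auto simp: K_linear_def fmulV_simps r_fmulV)
lemma lin_minus: "lin Y \<Longrightarrow> lin Z \<Longrightarrow> lin (Y - Z)"
  by (auto simp: K_linear_def r_diff_l)
lemma lin_zero: "lin 0" by (auto simp: K_linear_def r_0_l)
lemma lin_sum_maps: "(\<And>i. i \<in> I \<Longrightarrow> lin (f i)) \<Longrightarrow> lin (sum f I)"
proof (induction I rule: infinite_finite_induct)
  case (insert i I)
  then show ?case unfolding sum.insert[OF insert(1,2)] by (intro lin_plus) auto
next
  case (infinite I)
  show ?case unfolding sum.infinite[OF infinite(1)] by (rule lin_zero)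
qed (simp only: sum.empty lin_zero)
lemma lin_central: "lin Y \<Longrightarrow> (\<And>x. a * x = x * a) \<Longrightarrow> lin (\<lambda>v. r (Y v) a)"
  unfolding K_linear_def by (simp add: r_add_l) (metis r_mult)

lemma lin_ext:
  assumes "lin Y" "lin Z" "\<And>i. i < n \<Longrightarrow> Y (eb i) = Z (eb i)"
  shows "Y = Z"
proof
  fix v
  have "Y (\<Sum>i<n. r (eb i) (cf v i)) = Z (\<Sum>i<n. r (eb i) (cf v i))"
    using assms by (simp add: lin_sum lin_r)
  then show "Y v = Z v" using cf_expand[of v] by simp
qed

definition kmap :: "(nat \<Rightarrow> 'v) \<Rightarrow> 'v \<Rightarrow> 'v" where "kmap y v = (\<Sum>i<n. r (y i) (cf v i))"

lemma lin_kmap: "lin (kmap y)"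
  by (auto simp: K_linear_def kmap_def cf_add cf_r r_add_r r_mult r_sum_l sum.distrib)

lemma kmap_eb: "i < n \<Longrightarrow> kmap y (eb i) = y i"
proof -
  assume i: "i < n"
  then have "kmap y (eb i) = (\<Sum>j<n. if j = i then y j else 0)"
    unfolding kmap_def by (intro sum.cong) (auto simp: cf_eb r_1 r_0_r)
  then show ?thesis using i by simp
qed

text \<open>K may be noncommutative or have zero divisors, so surjectivity is taken from dimension
  over F, and K-linearity of the inverse is checked afterwards.\<close>

lemma lin_inj_inverse:
  assumes Y: "lin Y" and inj: "\<And>v. Y v = 0 \<Longrightarrow> v = 0"
  shows "\<exists>Z. lin Z \<and> Y \<circ> Z = id \<and> Z \<circ> Y = id"
proof -
  have "inj Y" using inj lin_diff[OF Y] by (intro injI) (metis diff_eq_diff_eq diff_self right_minus_eq)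
  moreover have "Vector_Spaces.linear (fmulV D) (fmulV D) Y"
    by unfold_locales (auto simp: lin_add[OF Y] lin_fmulV[OF Y])
  ultimately have bij: "bij Y" using V.linear_inj_imp_bij[OF GV(1) span_GV] by blast
  let ?Z = "inv_into UNIV Y"
  have YZ: "Y (?Z v) = v" and ZY: "?Z (Y v) = v" for v
    using bij by (auto simp: bij_def surj_f_inv_f inv_f_f)
  have "lin ?Z" unfolding K_linear_def
  proof (intro conjI allI)
    show "?Z (v + w) = ?Z v + ?Z w" for v w
      using ZY[of "?Z v + ?Z w"] by (simp add: lin_add[OF Y] YZ)
    show "?Z (r v a) = r (?Z v) a" for v a
      using ZY[of "r (?Z v) a"] by (simp add: lin_r[OF Y] YZ)
  qed
  then show ?thesis using YZ ZY by (intro exI[of _ ?Z]) (auto simp: fun_eq_iff)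
qed

abbreviation herm where "herm \<equiv> eps_hermitian D"

lemma herm_add_l: "herm f \<Longrightarrow> f (u + v) w = f u w + f v w"
  and herm_add_r: "herm f \<Longrightarrow> f u (v + w) = f u v + f u w"
  and herm_r: "herm f \<Longrightarrow> f (r v a) (r w b) = \<sigma> a * f v w * b"
  and herm_sym: "herm f \<Longrightarrow> f w v = of_int (eps D) * \<sigma> (f v w)"
  unfolding eps_hermitian_def by blast+

lemma herm_r_l: "herm f \<Longrightarrow> f (r v a) w = \<sigma> a * f v w" using herm_r[of f v a w 1] by (simp add: r_1)
lemma herm_r_r: "herm f \<Longrightarrow> f v (r w b) = f v w * b" using herm_r[of f v 1 w b] by (simp add: r_1 \<sigma>_1)
lemma herm_0_l: "herm f \<Longrightarrow> f 0 w = 0" using herm_add_l[of f 0 0 w] by simp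
lemma herm_0_r: "herm f \<Longrightarrow> f w 0 = 0" using herm_add_r[of f w 0 0] by simp
lemma herm_fmulV_l: "herm f \<Longrightarrow> f (fmulV D a v) w = fmulK D a (f v w)"
  by (simp add: fmulV_def herm_r_l \<sigma>_e fmulK_def)
lemma herm_fmulV_r: "herm f \<Longrightarrow> f v (fmulV D a w) = fmulK D a (f v w)"
  by (simp add: fmulV_def herm_r_r fmulK_def e_central)
lemma herm_sum_r: "herm f \<Longrightarrow> f v (sum g I) = (\<Sum>i\<in>I. f v (g i))"
  by (induction I rule: infinite_finite_induct) (auto simp: herm_0_r herm_add_r)

lemma of_int_eps_B: "of_int (eps D) * x \<in> B \<longleftrightarrow> x \<in> B"
  using eps B_uminus[of x] B_uminus[of "- x"] by auto

lemma herm_B_sym: "herm f \<Longrightarrow> f w v \<in> B \<longleftrightarrow> f v w \<in> B"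
  using herm_sym[of f w v] by (simp add: of_int_eps_B \<sigma>_B_iff)

lemma herm_eq_0_sym: "herm f \<Longrightarrow> f v w = 0 \<Longrightarrow> f w v = 0"
  using herm_sym[of f w v] by (simp add: \<sigma>_0)

lemma surj_e: "base_case D \<Longrightarrow> \<exists>a. x = e a"
  unfolding base_case_def by blast

lemma two_half: "(2 :: 'f) \<noteq> 0 \<Longrightarrow> x / 2 + x / 2 = (x :: 'f)"
  by (simp flip: mult_2_right)

text \<open>The correspondence Q v = f v v, valid because 2 is nonzero in F. Afterwards the
  exceptional case differs from the others only by asking integrality on the diagonal.\<close>

lemma herm_forms_exceptional:
  assumes ex: "exceptional D"
  shows "herm_forms D = {f. herm f \<and> (\<forall>v\<in>L. f v v \<in> B)}"
proof -
  have base: "base_case D" using exceptional_base[OF ex] .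
  have two: "(2 :: 'f) \<noteq> 0" using two_nz base by blast
  have sid: "\<sigma> x = x" for x using base by (simp add: base_case_def)
  have eps1: "eps D = 1" using ex by (simp add: exceptional_def)
  show ?thesis
  proof
    show "herm_forms D \<subseteq> {f. herm f \<and> (\<forall>v\<in>L. f v v \<in> B)}"
    proof
      fix f assume "f \<in> herm_forms D"
      then obtain Q where f: "f = assoc_bilinear D Q" and Q: "quadratic_form D Q" and QL: "Q ` L \<subseteq> A"
        using ex by (auto simp: herm_forms_def)
      have sym: "f v w = f w v" for v w by (simp add: f assoc_bilinear_def add.commute algebra_simps)
      have addl: "f (u + v) w = f u w + f v w" for u v w using Q by (simp add: quadratic_form_def f)
      have scl: "f (r v (e a)) w = e a * f v w" for a v w using Q by (simp add: quadratic_form_def f fmulV_def)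
      have "herm f" unfolding eps_hermitian_def
      proof (intro conjI allI)
        show "f (u + v) w = f u w + f v w" for u v w by (rule addl)
        show "f u (v + w) = f u v + f u w" for u v w using addl[of v w u] sym by metis
        show "f (r v a) (r w b) = \<sigma> a * f v w * b" for v w a b
        proof -
          obtain a' b' where ab: "a = e a'" "b = e b'" using surj_e[OF base] by blast
          have "f (r v a) (r w b) = e a' * f v (r w (e b'))" by (simp add: ab scl)
          also have "f v (r w (e b')) = e b' * f v w" using scl[of w b' v] sym by metis
          also have "e b' * f v w = f v w * e b'" by (rule e_central)
          finally show ?thesis by (simp only: ab \<sigma>_e mult.assoc)
        qed
        show "f w v = of_int (eps D) * \<sigma> (f v w)" for v w using sym by (simp add: eps1 sid)
      qed
      moreover have "f v v \<in> B" if "v \<in> L" for v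
      proof -
        have "v + v = fmulV D 2 v" using fmulV_simps(2)[of 1 1 v] by (simp add: fmulV_simps(4))
        then have "Q (v + v) = 4 * Q v" using Q by (simp add: quadratic_form_def power2_eq_square)
        then have "f v v = e (Q v)" using two_half[OF two, of "Q v"] two by (simp add: f assoc_bilinear_def)
        then show ?thesis using QL that e_in_B by auto
      qed
      ultimately show "f \<in> {f. herm f \<and> (\<forall>v\<in>L. f v v \<in> B)}" by blast
    qed
    show "{f. herm f \<and> (\<forall>v\<in>L. f v v \<in> B)} \<subseteq> herm_forms D"
    proof
      fix f assume "f \<in> {f. herm f \<and> (\<forall>v\<in>L. f v v \<in> B)}"
      then have f: "herm f" and fL: "\<And>v. v \<in> L \<Longrightarrow> f v v \<in> B" by auto
      have "\<forall>v. \<exists>a. f v v = e a" using surj_e[OF base] by blast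
      then obtain Q where Q: "\<And>v. f v v = e (Q v)" by metis
      have sym: "f v w = f w v" for v w using herm_sym[OF f, of v w] by (simp add: eps1 sid)
      have assoc: "assoc_bilinear D Q = f"
      proof (intro ext)
        fix v w
        obtain a where a: "f v w = e a" using surj_e[OF base] by blast
        have "e (Q (v + w)) = f v v + f w v + (f v w + f w w)"
          unfolding Q[symmetric] herm_add_l[OF f] herm_add_r[OF f] by (simp only: add_ac)
        also have "\<dots> = e (Q v + Q w + (a + a))"
          unfolding sym[of w v] a Q by (simp only: e_add add_ac)
        finally have "e (Q (v + w)) = e (Q v + Q w + (a + a))" .
        then have "Q (v + w) = Q v + Q w + (a + a)" by (simp only: e_inj)
        then have "Q (v + w) - Q v - Q w = a * 2" by simp
        then have "(Q (v + w) - Q v - Q w) / 2 = a" using two by simp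
        then show "assoc_bilinear D Q v w = f v w" unfolding assoc_bilinear_def a by (rule arg_cong)
      qed
      have "quadratic_form D Q"
        unfolding quadratic_form_def assoc
      proof (intro conjI allI)
        show "Q (fmulV D a v) = a\<^sup>2 * Q v" for a v
        proof -
          have "e (Q (fmulV D a v)) = f (fmulV D a v) (fmulV D a v)" by (rule Q[symmetric])
          also have "\<dots> = e a * (e a * f v v)" unfolding herm_fmulV_l[OF f] herm_fmulV_r[OF f] fmulK_def ..
          also have "f v v = e (Q v)" by (rule Q)
          also have "e a * (e a * e (Q v)) = e (a\<^sup>2 * Q v)" by (simp add: e_mult power2_eq_square mult.assoc)
          finally show ?thesis by (simp only: e_inj)
        qed
      qed (auto simp: herm_add_l[OF f] herm_fmulV_l[OF f] fmulK_def)
      moreover have "Q ` L \<subseteq> A" using fL Q e_in_B by auto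
      ultimately show "f \<in> herm_forms D" using ex assoc by (auto simp: herm_forms_def)
    qed
  qed
qed

definition HB :: "('v \<Rightarrow> 'v \<Rightarrow> 'k) set" where
  "HB = {f. herm f \<and> (\<forall>v\<in>L. \<forall>w\<in>L. f v w \<in> B)}"

lemma herm_forms_cases:
  "herm_forms D = (if exceptional D then {f. herm f \<and> (\<forall>v\<in>L. f v v \<in> B)} else HB)"
  using herm_forms_exceptional by (auto simp: herm_forms_def HB_def)

lemma herm_forms_herm: "f \<in> herm_forms D \<Longrightarrow> herm f"
  by (auto simp: herm_forms_cases HB_def split: if_splits)

lemma herm_h: "herm h" using form_in herm_forms_herm by blast

lemmas h_add_l = herm_add_l[OF herm_h] and h_add_r = herm_add_r[OF herm_h]
  and h_r_l = herm_r_l[OF herm_h] and h_r_r = herm_r_r[OF herm_h]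
  and h_fmulV_l = herm_fmulV_l[OF herm_h] and h_fmulV_r = herm_fmulV_r[OF herm_h]

lemma h_diff_r: "h v (x - y) = h v x - h v y" using h_add_r[of v "x - y" y] by simp

lemma nondeg_r: "(\<And>v. h v x = h v y) \<Longrightarrow> x = y"
proof -
  assume "\<And>v. h v x = h v y"
  then have "h v (x - y) = 0" for v by (simp add: h_diff_r)
  then have "h (x - y) v = 0" for v using herm_eq_0_sym[OF herm_h] by blast
  then show "x = y" using nondeg[of "x - y"] by simp
qed

text \<open>The Gram map of \<open>h\<close> in the basis \<open>eb\<close>. Nondegeneracy makes it
  injective, hence bijective, which represents forms by endomorphisms; the denominators of its
  inverse measure what is lost integrally.\<close>

definition \<Theta> :: "'v \<Rightarrow> 'v" where "\<Theta> w = (\<Sum>i<n. r (eb i) (h (eb i) w))"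

lemma lin_\<Theta>: "lin \<Theta>"
  by (auto simp: K_linear_def \<Theta>_def h_add_r h_r_r r_add_r r_mult r_sum_l sum.distrib)

lemma \<Theta>_inj:
  assumes "\<Theta> w = 0"
  shows "w = 0"
proof (rule nondeg_r)
  fix v
  have eb0: "h (eb i) w = 0" if "i < n" for i
    using cf_eqI[of 0 "\<lambda>i. h (eb i) w" i] cf_eqI[of 0 "\<lambda>_. 0" i] that assms
    by (simp add: \<Theta>_def r_0_r)
  have "h w v = h w (\<Sum>i<n. r (eb i) (cf v i))" using cf_expand[of v] by simp
  also have "\<dots> = 0" using eb0 herm_eq_0_sym[OF herm_h] by (simp add: herm_sum_r[OF herm_h] h_r_r)
  finally have "h v w = 0" by (rule herm_eq_0_sym[OF herm_h])
  then show "h v w = h v 0" by (simp add: herm_0_r[OF herm_h])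
qed

lemma riesz: "\<exists>x. \<forall>i<n. h (eb i) x = c i"
proof -
  obtain Z where Z: "\<Theta> \<circ> Z = id" using lin_inj_inverse[OF lin_\<Theta> \<Theta>_inj] by blast
  define x where "x = Z (\<Sum>i<n. r (eb i) (c i))"
  have "\<Theta> x = (\<Sum>i<n. r (eb i) (c i))" using fun_cong[OF Z, of "\<Sum>i<n. r (eb i) (c i)"] by (simp add: x_def)
  then have "h (eb i) x = c i" if "i < n" for i
    using cf_eqI[of "\<Theta> x" "\<lambda>i. h (eb i) x" i] cf_eqI[of "\<Theta> x" c i] that by (simp add: \<Theta>_def)
  then show ?thesis by blast
qed

lemma represent:
  assumes "\<And>u v w. g (u + v) w = g u w + g v w" "\<And>u v w. g u (v + w) = g u v + g u w"
    and "\<And>v w a. g (r v a) w = \<sigma> a * g v w" "\<And>v w a. g v (r w a) = g v w * a"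
  shows "\<exists>Y. lin Y \<and> (\<forall>v w. g v w = h v (Y w))"
proof -
  have "\<exists>x. \<forall>v. h v x = g v w" for w
  proof -
    obtain x where x: "\<forall>i<n. h (eb i) x = g (eb i) w" using riesz[of "\<lambda>i. g (eb i) w"] by blast
    have g0: "g 0 w = 0" using assms(1)[of 0 0 w] by simp
    have gsum: "g (sum f I) w = (\<Sum>i\<in>I. g (f i) w)" for f and I :: "nat set"
      by (induction I rule: infinite_finite_induct) (auto simp: g0 assms(1))
    have hsum: "h (sum f I) x = (\<Sum>i\<in>I. h (f i) x)" for f and I :: "nat set"
      by (induction I rule: infinite_finite_induct) (auto simp: herm_0_l[OF herm_h] h_add_l)
    have "h v x = g v w" for v
    proof -
      have "h (\<Sum>i<n. r (eb i) (cf v i)) x = g (\<Sum>i<n. r (eb i) (cf v i)) w"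
        using x by (simp add: hsum gsum h_r_l assms(3))
      then show ?thesis using cf_expand[of v] by simp
    qed
    then show ?thesis by blast
  qed
  then obtain Y where Y: "\<And>w v. h v (Y w) = g v w" by metis
  have "lin Y" unfolding K_linear_def
  proof (intro conjI allI)
    show "Y (v + w) = Y v + Y w" for v w by (rule nondeg_r) (simp add: Y h_add_r assms(2))
    show "Y (r v a) = r (Y v) a" for v a by (rule nondeg_r) (simp add: Y h_r_r assms(4))
  qed
  then show ?thesis using Y by metis
qed

lemma represent_herm: "herm f \<Longrightarrow> \<exists>Y. lin Y \<and> (\<forall>v w. f v w = h v (Y w))"
  by (rule represent) (auto simp: herm_add_l herm_add_r herm_r_l herm_r_r)

abbreviation ad where "ad \<equiv> adj D"

lemma ad_props:
  assumes Y: "lin Y"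
  shows lin_ad: "lin (ad Y)" and h_ad: "h (Y v) w = h v (ad Y w)"
proof -
  obtain Z where Z: "lin Z" "\<And>v w. h (Y v) w = h v (Z w)"
    using represent[of "\<lambda>v w. h (Y v) w"] by (auto simp: lin_add[OF Y] lin_r[OF Y] h_add_l h_add_r h_r_l h_r_r)
  have "ad Y = Z" unfolding adj_def
  proof (rule the_equality)
    fix Z' assume "lin Z' \<and> (\<forall>v w. h (Y v) w = h v (Z' w))"
    then show "Z' = Z" using Z(2) by (intro ext nondeg_r) metis
  qed (use Z in blast)
  then show "lin (ad Y)" "h (Y v) w = h v (ad Y w)" using Z by auto
qed

lemma ad_unique: "lin Y \<Longrightarrow> (\<And>v w. h (Y v) w = h v (Z w)) \<Longrightarrow> ad Y = Z"
  by (intro ext nondeg_r) (metis h_ad)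

lemma h_ad': "lin Y \<Longrightarrow> h v (Y w) = h (ad Y v) w"
  using herm_sym[OF herm_h, of v "Y w"] herm_sym[OF herm_h, of "ad Y v" w] h_ad[of Y w v] by simp

lemma ad_ad: "lin Y \<Longrightarrow> ad (ad Y) = Y"
  by (rule ad_unique) (auto simp: lin_ad h_ad')

lemma ad_comp: "lin Y \<Longrightarrow> lin Z \<Longrightarrow> ad (Y \<circ> Z) = ad Z \<circ> ad Y"
  by (rule ad_unique) (auto simp: lin_comp h_ad)

lemma ad_plus: "lin Y \<Longrightarrow> lin Z \<Longrightarrow> ad (Y + Z) = ad Y + ad Z"
  by (rule ad_unique) (auto simp: lin_plus h_ad h_add_l h_add_r)

lemma ad_minus: "lin Y \<Longrightarrow> lin Z \<Longrightarrow> ad (Y - Z) = ad Y - ad Z"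
  using ad_plus[of "Y - Z" Z] by (simp add: lin_minus)

lemma ad_scE: "lin Y \<Longrightarrow> ad (scE a Y) = scE a (ad Y)"
  by (rule ad_unique) (auto simp: lin_scE h_ad h_fmulV_l h_fmulV_r)

lemma ad_id: "ad id = id" by (rule ad_unique) (auto simp: lin_id)
lemma ad_zero: "ad 0 = 0"
  by (rule ad_unique) (auto simp: lin_zero herm_0_l[OF herm_h] herm_0_r[OF herm_h])

lemma ad_central:
  assumes Y: "lin Y" and a: "\<And>x. a * x = x * a"
  shows "ad (\<lambda>v. r (Y v) a) = (\<lambda>v. r (ad Y v) (\<sigma> a))"
proof (rule ad_unique[OF lin_central[OF Y a]])
  have "\<sigma> a * x = x * \<sigma> a" for x using a[of "\<sigma> x"] by (metis \<sigma>_\<sigma> \<sigma>_mult)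
  then show "h (r (Y v) a) w = h v (r (ad Y w) (\<sigma> a))" for v w
    by (simp add: h_r_l h_r_r h_ad[OF Y])
qed


section \<open>The filtration\<close>

abbreviation M' where "M' \<equiv> endos D"

lemma M'_iff: "Y \<in> M' \<longleftrightarrow> lin Y \<and> (\<forall>v\<in>L. Y v \<in> L)" by (auto simp: endos_def)

lemma M'_iff_basis: "Y \<in> M' \<longleftrightarrow> lin Y \<and> (\<forall>i<n. Y (eb i) \<in> L)"
proof -
  have "Y v \<in> L" if "lin Y" "\<forall>i<n. Y (eb i) \<in> L" "v \<in> L" for v
  proof -
    have "Y (\<Sum>i<n. r (eb i) (cf v i)) \<in> L"
      using that by (auto simp: lin_sum lin_r L_iff[of v] intro!: L_sum L_r)
    then show ?thesis using cf_expand[of v] by simp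
  qed
  then show ?thesis using eb_L by (auto simp: M'_iff)
qed

lemma M'_lin: "Y \<in> M' \<Longrightarrow> lin Y" by (simp add: M'_iff)
lemma M'_comp: "Y \<in> M' \<Longrightarrow> Z \<in> M' \<Longrightarrow> Y \<circ> Z \<in> M'" by (auto simp: M'_iff lin_comp)
lemma M'_id: "id \<in> M'" by (auto simp: M'_iff lin_id)

lemma submod_M': "E.submod M'"
  unfolding E.submod_def
  by (auto simp: M'_iff lin_zero lin_plus lin_scE L_0 L_add V.submodD(3)[OF submod_L])

text \<open>The generators are the elementary endomorphisms that send one basis vector to a
  generator of \<open>L\<close> and the others to 0.\<close>

lemma M'_generated: "\<exists>G. finite G \<and> M' = E.genA G"
proof -
  define \<kappa> where "\<kappa> = (\<lambda>i y. kmap (\<lambda>j. if j = i then y else 0))"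
  define G where "G = (\<lambda>(i, g). \<kappa> i g) ` ({..<n} \<times> GV)"
  have fin: "finite G" using GV(1) by (simp add: G_def)
  have \<kappa>_eb: "\<kappa> i y (eb j) = (if j = i then y else 0)" if "j < n" for i j y
    using that by (simp add: \<kappa>_def kmap_eb)
  have "G \<subseteq> M'"
  proof
    fix Y assume "Y \<in> G"
    then obtain i g where Y: "i < n" "g \<in> GV" "Y = \<kappa> i g" by (auto simp: G_def)
    have "g \<in> L" using V.genA_mem[OF GV(1) Y(2)] GV(2) by simp
    then show "Y \<in> M'" unfolding M'_iff_basis Y(3) using \<kappa>_eb L_0 by (auto simp: \<kappa>_def lin_kmap)
  qed
  then have 1: "E.genA G \<subseteq> M'" by (rule E.genA_subset[OF submod_M'])
  have 2: "M' \<subseteq> E.genA G"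
  proof
    fix Y assume Y: "Y \<in> M'"
    have "\<kappa> i (Y (eb i)) \<in> E.genA G" if i: "i < n" for i
    proof -
      have "Y (eb i) \<in> V.genA GV" using Y i by (simp add: M'_iff_basis GV(2)[symmetric])
      then obtain c where c: "\<forall>g\<in>GV. c g \<in> A" "Y (eb i) = (\<Sum>g\<in>GV. fmulV D (c g) g)"
        unfolding V.genA_def by auto
      have eq: "\<kappa> i (Y (eb i)) = (\<Sum>g\<in>GV. scE (c g) (\<kappa> i g))"
      proof
        fix v
        have "\<kappa> i y v = r y (cf v i)" for y
        proof -
          have "\<kappa> i y v = (\<Sum>j<n. if j = i then r y (cf v j) else 0)"
            unfolding \<kappa>_def kmap_def by (intro sum.cong) (auto simp: r_0_l)
          then show ?thesis using i by simp
        qed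
        then show "\<kappa> i (Y (eb i)) v = (\<Sum>g\<in>GV. scE (c g) (\<kappa> i g)) v"
          by (simp add: sum_fun_apply c(2) r_sum_l r_fmulV)
      qed
      have "scE (c g) (\<kappa> i g) \<in> E.genA G" if "g \<in> GV" for g
        by (rule E.submodD(3)[OF E.submod_genA _ E.genA_mem[OF fin]]) (use c that i in \<open>auto simp: G_def\<close>)
      then show ?thesis unfolding eq by (intro E.submod_sum[OF E.submod_genA])
    qed
    then have "(\<Sum>i<n. \<kappa> i (Y (eb i))) \<in> E.genA G" by (intro E.submod_sum[OF E.submod_genA]) auto
    moreover have "Y = (\<Sum>i<n. \<kappa> i (Y (eb i)))"
    proof (rule lin_ext)
      show "lin Y" using Y by (rule M'_lin)
      show "lin (\<Sum>i<n. \<kappa> i (Y (eb i)))"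
        by (rule lin_sum_maps) (simp add: \<kappa>_def lin_kmap)
      fix j assume j: "j < n"
      show "Y (eb j) = (\<Sum>i<n. \<kappa> i (Y (eb i))) (eb j)"
        using j by (simp add: sum_fun_apply \<kappa>_eb)
    qed
    ultimately show "Y \<in> E.genA G" by simp
  qed
  show ?thesis using fin 1 2 by blast
qed

definition GM :: "('v \<Rightarrow> 'v) set" where "GM = (SOME G. finite G \<and> M' = E.genA G)"

lemma GM: "finite GM" "M' = E.genA GM"
  using someI_ex[OF M'_generated] by (auto simp: GM_def)

lemma pi_power_into_M': "lin Y \<Longrightarrow> \<exists>s. scE (\<pi> ^ s) Y \<in> M'"
proof -
  assume Y: "lin Y"
  have "\<forall>i. \<exists>s. fmulV D (\<pi> ^ s) (Y (eb i)) \<in> L" using pi_power_into_L by blast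
  then obtain s where s: "\<And>i. fmulV D (\<pi> ^ s i) (Y (eb i)) \<in> L" by metis
  have "fmulV D (\<pi> ^ (\<Sum>i<n. s i)) (Y (eb i)) \<in> L" if "i < n" for i
    using V.pi_power_mono[OF submod_L s, of i "\<Sum>i<n. s i"] member_le_sum[of i "{..<n}" s] that by simp
  then have "scE (\<pi> ^ (\<Sum>i<n. s i)) Y \<in> M'" unfolding M'_iff_basis using lin_scE[OF Y] by simp
  then show ?thesis ..
qed

text \<open>\<open>adj\<close> need not preserve \<open>M'\<close>, but on a finitely generated
  lattice it costs at most one fixed power of \<pi>.\<close>

lemma ad_bounded: "\<exists>s. \<forall>Y\<in>M'. scE (\<pi> ^ s) (ad Y) \<in> M'"
  unfolding GM(2)
proof (rule E.genA_uniform[OF GM(1)], unfold GM(2)[symmetric])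
  show "scE (\<pi> ^ s) (ad 0) \<in> M'" for s
  proof -
    have eq: "scE (\<pi> ^ s) (ad 0) = 0" unfolding ad_zero by (simp add: fun_eq_iff)
    show ?thesis unfolding eq by (rule E.submodD(1)[OF submod_M'])
  qed
  show "scE (\<pi> ^ s) (ad (Y + Z)) \<in> M'"
    if "Y \<in> M'" "Z \<in> M'" "scE (\<pi> ^ s) (ad Y) \<in> M'" "scE (\<pi> ^ s) (ad Z) \<in> M'" for s Y Z
  proof -
    have "scE (\<pi> ^ s) (ad (Y + Z)) = scE (\<pi> ^ s) (ad Y) + scE (\<pi> ^ s) (ad Z)"
      using that(1,2) by (simp add: ad_plus M'_lin fun_eq_iff fmulV_simps)
    then show ?thesis using E.submodD(2)[OF submod_M' that(3,4)] by simp
  qed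
  show "scE (\<pi> ^ s) (ad (scE a Y)) \<in> M'" if "Y \<in> M'" "a \<in> A" "scE (\<pi> ^ s) (ad Y) \<in> M'" for s a Y
  proof -
    have "scE (\<pi> ^ s) (ad (scE a Y)) = scE a (scE (\<pi> ^ s) (ad Y))"
      using that(1) by (simp add: ad_scE M'_lin fmulV_simps mult.commute)
    then show ?thesis using E.submodD(3)[OF submod_M' that(2,3)] by simp
  qed
  show "scE (\<pi> ^ s') (ad Y) \<in> M'" if "scE (\<pi> ^ s) (ad Y) \<in> M'" "s \<le> s'" for s s' Y
    by (rule E.pi_power_mono[OF submod_M' that])
  show "\<exists>s. scE (\<pi> ^ s) (ad g) \<in> M'" if "g \<in> GM" for g
    using pi_power_into_M'[OF lin_ad] M'_lin E.genA_mem[OF GM(1) that] GM(2) by blast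
qed

text \<open>Since h(Y x, l) = h(x, ad Y l), stability of the dual lattice under Y says that
  \<open>ad Y\<close> maps \<open>L\<close> into the double dual, which is \<open>L\<close>.\<close>

lemma T_zero_eq: "T_zero D = {Y \<in> M'. ad Y \<in> M'}"
proof -
  have "Y ` dual D L \<subseteq> dual D L \<longleftrightarrow> ad Y \<in> M'" if Y: "Y \<in> M'" for Y
  proof -
    have linY: "lin Y" using Y by (rule M'_lin)
    have "ad Y \<in> M' \<longleftrightarrow> (\<forall>l\<in>L. ad Y l \<in> dual D (dual D L))"
      by (simp add: M'_iff lin_ad[OF linY] dual_dual)
    also have "\<dots> \<longleftrightarrow> (\<forall>l\<in>L. \<forall>x\<in>dual D L. h x (ad Y l) \<in> B)"
      by (auto simp: dual_def herm_B_sym[OF herm_h, of "ad Y _"])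
    also have "\<dots> \<longleftrightarrow> (\<forall>x\<in>dual D L. \<forall>l\<in>L. h (Y x) l \<in> B)"
      using h_ad[OF linY] by auto
    finally show ?thesis by (auto simp: dual_def)
  qed
  then show ?thesis by (auto simp: T_zero_def)
qed

lemma psi_add: "psi D (Y + Z) = psi D Y + psi D Z"
  by (simp add: psi_def fun_eq_iff h_add_l h_add_r)
lemma psi_scE: "psi D (scE a Y) = scH a (psi D Y)"
  by (simp add: psi_def fun_eq_iff h_fmulV_l h_fmulV_r K.scale_right_distrib)
lemma psi_zero: "psi D 0 = 0"
  by (simp add: psi_def fun_eq_iff herm_0_l[OF herm_h] herm_0_r[OF herm_h])
lemma psi_minus: "psi D (Y - Z) = psi D Y - psi D Z"
  using psi_add[of "Y - Z" Z] by simp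
lemma phi_scE: "phi D (scE a Y) = scH (a * a) (phi D Y)"
  by (simp add: phi_def pullback_def fun_eq_iff h_fmulV_l h_fmulV_r)
text \<open>The last term is the polarization of the quadratic map \<open>phi\<close>. Because of
  it, the stages of the filtration have to be closed under adjoints and composition.\<close>

lemma phi_add: "lin U \<Longrightarrow> lin Y \<Longrightarrow> phi D (U + Y) = phi D U + phi D Y + psi D (ad U \<circ> Y)"
  by (simp add: phi_def pullback_def psi_def fun_eq_iff h_add_l h_add_r h_ad[of U] h_ad[of "ad U"] lin_ad ad_ad algebra_simps)
lemma pullback_psi: "lin U \<Longrightarrow> pullback (psi D Z) U = psi D (ad U \<circ> Z \<circ> U)"
  by (simp add: phi_def pullback_def psi_def fun_eq_iff h_ad[of U] h_ad[of "ad U"] lin_ad ad_ad)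

lemma submod_psi: "E.submod T \<Longrightarrow> H.submod (psi D ` T)"
  unfolding H.submod_def
proof (intro conjI ballI)
  assume T: "E.submod T"
  show "0 \<in> psi D ` T" using psi_zero E.submodD(1)[OF T] by (metis image_eqI)
  show "x + y \<in> psi D ` T" if "x \<in> psi D ` T" "y \<in> psi D ` T" for x y
    using that E.submodD(2)[OF T] by (auto simp flip: psi_add)
  show "scH a x \<in> psi D ` T" if "a \<in> A" "x \<in> psi D ` T" for a x
    using that E.submodD(3)[OF T] by (auto simp flip: psi_scE)
qed

definition mm :: nat where "mm = (SOME s. fmulK D (\<pi> ^ s) cc \<in> B)"

lemma mm: "fmulK D (\<pi> ^ mm) cc \<in> B"
  unfolding mm_def by (rule someI_ex) (rule pi_power_into_B)

text \<open>The invariant carried along the filtration. Its last clause is a lower bound that does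
  not depend on the stage; it forces stabilization and gives \<open>psi\<close> a target common to
  all stages.\<close>

definition star_ring :: "('v \<Rightarrow> 'v) set \<Rightarrow> bool" where
  "star_ring T \<longleftrightarrow> E.submod T \<and> T \<subseteq> T_zero D \<and> (\<forall>U\<in>T. \<forall>Y\<in>T. U \<circ> Y \<in> T) \<and>
    (\<forall>U\<in>T. ad U \<in> T) \<and> scE (\<pi> ^ mm) ` T_zero D \<subseteq> T"

lemma T_zero_lin: "Y \<in> T_zero D \<Longrightarrow> lin Y" by (simp add: T_zero_eq M'_iff)

lemma star_ring_T_zero: "star_ring (T_zero D)"
proof -
  have sub: "E.submod (T_zero D)" unfolding E.submod_def
  proof (intro conjI ballI)
    show "0 \<in> T_zero D" using E.submodD(1)[OF submod_M'] by (simp add: T_zero_eq ad_zero)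
    show "x + y \<in> T_zero D" if "x \<in> T_zero D" "y \<in> T_zero D" for x y
      using that E.submodD(2)[OF submod_M'] by (auto simp: T_zero_eq ad_plus M'_lin)
    show "scE a x \<in> T_zero D" if "a \<in> A" "x \<in> T_zero D" for a x
      using that E.submodD(3)[OF submod_M'] by (auto simp: T_zero_eq ad_scE M'_lin)
  qed
  show ?thesis unfolding star_ring_def
    using sub E.submodD(3)[OF sub, of "\<pi> ^ mm"] by (auto simp: T_zero_eq ad_comp ad_ad M'_lin M'_comp)
qed

lemma phi_eq: "lin Y \<Longrightarrow> phi D Y = (\<lambda>v w. h v ((ad Y \<circ> Y) w))"
  by (simp add: phi_def pullback_def fun_eq_iff h_ad)

text \<open>For self-adjoint Z, the form h(v, Z w) would be psi of Z / 2; a central scalar of trace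
  one does the work of 1/2.\<close>

lemma psi_cc:
  assumes Z: "lin Z" "ad Z = Z"
  shows "psi D (\<lambda>v. r (Z v) cc) = (\<lambda>v w. h v (Z w))"
proof -
  have "\<sigma> cc * x + x * cc = x" for x
    using cc(2) cc(1)[of x] by (metis add.commute distrib_right mult_1_left)
  then show ?thesis using h_ad[OF Z(1)] Z(2) by (simp add: psi_def fun_eq_iff h_r_l h_r_r add.commute)
qed

lemma T_zero_central:
  assumes Z: "Z \<in> T_zero D" and b: "b \<in> B" "\<And>x. b * x = x * b"
  shows "(\<lambda>v. r (Z v) b) \<in> T_zero D"
proof -
  have bL: "(\<lambda>v. r (Y v) a) \<in> M'" if "Y \<in> M'" "a \<in> B" "\<And>x. a * x = x * a" for Y a
    using that by (auto simp: M'_iff lin_central L_r)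
  have "\<sigma> b * x = x * \<sigma> b" for x using b(2)[of "\<sigma> x"] by (metis \<sigma>_\<sigma> \<sigma>_mult)
  then show ?thesis
    using Z b \<sigma>_B bL[of Z b] bL[of "ad Z" "\<sigma> b"] by (auto simp: T_zero_eq ad_central M'_lin)
qed

text \<open>phi(U) is h(v, Z w) for the self-adjoint Z = ad U U. Scaling U by \<pi>^mm scales phi by
  \<pi>^(2 mm): one factor makes \<open>cc\<close> integral, the other places the preimage in
  \<pi>^mm \<open>T_zero\<close>.\<close>

lemma phi_pi_mm:
  assumes U: "U \<in> T_zero D"
  shows "phi D (scE (\<pi> ^ mm) U) \<in> psi D ` scE (\<pi> ^ mm) ` T_zero D"
proof -
  define b where "b = fmulK D (\<pi> ^ mm) cc"
  have lX: "lin U" using U by (rule T_zero_lin)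
  have b: "b \<in> B" "\<And>x. b * x = x * b" using mm cc(1) by (auto simp: b_def fmulK_mult)
  define Z where "Z = ad U \<circ> U"
  have Z: "Z \<in> T_zero D" "ad Z = Z" "lin Z"
    using star_ring_T_zero U lX by (auto simp: star_ring_def Z_def ad_comp ad_ad lin_ad lin_comp)
  have bZ: "(\<lambda>v. r (Z v) b) \<in> T_zero D" by (rule T_zero_central[OF Z(1) b])
  have "psi D (scE (\<pi> ^ mm) (\<lambda>v. r (Z v) b)) = scH (\<pi> ^ mm * \<pi> ^ mm) (psi D (\<lambda>v. r (Z v) cc))"
    by (simp add: b_def r_fmulK flip: psi_scE)
  also have "\<dots> = phi D (scE (\<pi> ^ mm) U)"
    unfolding psi_cc[OF Z(3,2)] unfolding phi_scE phi_eq[OF lX] Z_def ..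
  finally have eq: "psi D (scE (\<pi> ^ mm) (\<lambda>v. r (Z v) b)) = phi D (scE (\<pi> ^ mm) U)" .
  show ?thesis
    unfolding eq[symmetric] by (rule imageI[of _ _ "psi D", OF imageI[of _ _ "scE (\<pi> ^ mm)", OF bZ]])
qed

lemma T_filt_Suc: "E.submod (T_filt D k) \<Longrightarrow> T_filt D (Suc k) =
    {Y \<in> T_filt D k. phi D Y \<in> psi D ` T_filt D k \<and> phi D (ad Y) \<in> psi D ` T_filt D k}"
proof -
  assume sub: "E.submod (T_filt D k)"
  show ?thesis
    unfolding T_filt.simps phi_bar_def coset_eq_iff[OF H.submod_subgroup[OF submod_psi[OF sub]]] by simp
qed

text \<open>Sums are controlled by the cross term in \<open>phi_add\<close>, products by pulling
  back a form in the image of \<open>psi\<close>, and the lower bound by \<open>phi_pi_mm\<close>,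
  which works at every stage alike.\<close>

lemma star_ring_T_filt: "star_ring (T_filt D k)"
proof (induction k)
  case 0
  then show ?case using star_ring_T_zero by simp
next
  case (Suc k)
  let ?T = "T_filt D k" and ?T' = "T_filt D (Suc k)"
  have sub: "E.submod ?T" and T0: "?T \<subseteq> T_zero D" and comp: "\<And>U Y. U \<in> ?T \<Longrightarrow> Y \<in> ?T \<Longrightarrow> U \<circ> Y \<in> ?T"
    and ad: "\<And>U. U \<in> ?T \<Longrightarrow> ad U \<in> ?T" and mm: "scE (\<pi> ^ mm) ` T_zero D \<subseteq> ?T"
    using Suc by (auto simp: star_ring_def)
  note psub = submod_psi[OF sub]
  have T': "?T' = {Y \<in> ?T. phi D Y \<in> psi D ` ?T \<and> phi D (ad Y) \<in> psi D ` ?T}" by (rule T_filt_Suc[OF sub])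
  have lin: "lin U" if "U \<in> ?T" for U using that T0 T_zero_lin by blast
  have add_phi: "phi D (U + Y) \<in> psi D ` ?T"
    if "U \<in> ?T" "Y \<in> ?T" "phi D U \<in> psi D ` ?T" "phi D Y \<in> psi D ` ?T" for U Y
    unfolding phi_add[OF lin[OF that(1)] lin[OF that(2)]]
    by (intro H.submodD(2)[OF psub] that imageI comp[OF ad])
  have comp_phi: "phi D (U \<circ> Y) \<in> psi D ` ?T" if "U \<in> ?T" "Y \<in> ?T" and pX: "phi D U \<in> psi D ` ?T" for U Y
  proof -
    obtain Z where Z: "Z \<in> ?T" "phi D U = psi D Z" using pX by blast
    have "phi D (U \<circ> Y) = pullback (phi D U) Y" by (simp add: phi_def pullback_def fun_eq_iff)
    also have "\<dots> = psi D (ad Y \<circ> Z \<circ> Y)" using Z(2) pullback_psi[OF lin[OF that(2)]] by simp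
    finally show ?thesis using comp[OF comp[OF ad[OF that(2)] Z(1)] that(2)] by blast
  qed
  show ?case unfolding star_ring_def
  proof (intro conjI ballI subsetI)
    show "E.submod ?T'" unfolding E.submod_def
    proof (intro conjI ballI)
      have "phi D 0 = 0" by (simp add: phi_def pullback_def fun_eq_iff herm_0_l[OF herm_h])
      then show "0 \<in> ?T'" using E.submodD(1)[OF sub] H.submodD(1)[OF psub] unfolding T' by (simp add: ad_zero)
      show "U + Y \<in> ?T'" if "U \<in> ?T'" "Y \<in> ?T'" for U Y
        using that E.submodD(2)[OF sub] add_phi ad lin unfolding T' by (auto simp: ad_plus)
      show "scE a U \<in> ?T'" if "a \<in> A" "U \<in> ?T'" for a U
        using that E.submodD(3)[OF sub] H.submodD(3)[OF psub, of "a * a"] lin unfolding T'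
        by (auto simp: ad_scE phi_scE)
    qed
    show "U \<in> T_zero D" if "U \<in> ?T'" for U using that T0 unfolding T' by blast
    show "U \<circ> Y \<in> ?T'" if "U \<in> ?T'" "Y \<in> ?T'" for U Y
      using that comp comp_phi ad lin unfolding T' by (auto simp: ad_comp)
    show "ad U \<in> ?T'" if "U \<in> ?T'" for U
      using that ad lin unfolding T' by (auto simp: ad_ad)
    show "Y \<in> ?T'" if Y: "Y \<in> scE (\<pi> ^ mm) ` T_zero D" for Y
    proof -
      obtain U where U: "U \<in> T_zero D" "Y = scE (\<pi> ^ mm) U" using Y by blast
      have aX: "ad U \<in> T_zero D" using U(1) star_ring_T_zero by (auto simp: star_ring_def)
      have "phi D Y \<in> psi D ` ?T" using phi_pi_mm[OF U(1)] mm U(2) by blast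
      moreover have "phi D (ad Y) \<in> psi D ` ?T"
        using phi_pi_mm[OF aX] mm U by (auto simp: ad_scE T_zero_lin)
      ultimately show ?thesis using mm Y unfolding T' by blast
    qed
  qed
qed

lemma T_filt_antimono: "k \<le> l \<Longrightarrow> T_filt D l \<subseteq> T_filt D k"
  by (rule lift_Suc_antimono_le) auto

lemma finite_quot_M': "finite (quot M' (scE (\<pi> ^ s) ` M'))"
  using E.finite_quot_genA[OF GM(1)] GM(2) by simp

lemma pi_M'_T_zero: "\<exists>s. scE (\<pi> ^ s) ` M' \<subseteq> T_zero D"
proof -
  obtain s where s: "\<forall>Y\<in>M'. scE (\<pi> ^ s) (ad Y) \<in> M'" using ad_bounded by blast
  have "scE (\<pi> ^ s) Y \<in> T_zero D" if "Y \<in> M'" for Y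
    using s that E.submodD(3)[OF submod_M' _ that, of "\<pi> ^ s"] by (auto simp: T_zero_eq ad_scE M'_lin)
  then show ?thesis by blast
qed

lemma scE_scE: "scE a ` scE b ` T = scE (a * b) ` T"
  by (simp add: image_image fmulV_simps)

lemma pi_M'_T_filt: "\<exists>s. \<forall>k. scE (\<pi> ^ s) ` M' \<subseteq> T_filt D k"
proof -
  obtain s where s: "scE (\<pi> ^ s) ` M' \<subseteq> T_zero D" using pi_M'_T_zero by blast
  have "scE (\<pi> ^ (mm + s)) ` M' \<subseteq> scE (\<pi> ^ mm) ` T_zero D"
    unfolding power_add scE_scE[symmetric] by (rule image_mono[OF s])
  then show ?thesis using star_ring_T_filt unfolding star_ring_def by blast
qed

text \<open>All stages lie between a fixed \<pi>^s \<open>M'\<close> and \<open>M'\<close>, with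
  finite quotient, so a stage with the fewest cosets of \<pi>^s \<open>M'\<close> cannot shrink any
  further.\<close>

lemma T_filt_stable: "\<exists>a. \<forall>m\<ge>a. T_filt D m = T_filt D a"
proof -
  obtain s where s: "\<And>k. scE (\<pi> ^ s) ` M' \<subseteq> T_filt D k" using pi_M'_T_filt by blast
  let ?N = "scE (\<pi> ^ s) ` M'"
  have N: "add_subgroup ?N" by (intro E.submod_subgroup E.submod_scale_image submod_M')
  have TM: "T_filt D k \<subseteq> M'" for k using star_ring_T_filt[of k] by (auto simp: star_ring_def T_zero_eq)
  have fin: "finite (quot (T_filt D k) ?N)" for k
    by (rule finite_quot_mono[OF N N subset_refl TM finite_quot_M'])
  obtain a where a: "\<And>k. card (quot (T_filt D a) ?N) \<le> card (quot (T_filt D k) ?N)"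
    using arg_min_nat_lemma[of "\<lambda>_. True" 0 "\<lambda>k. card (quot (T_filt D k) ?N)"] by blast
  have "T_filt D m = T_filt D a" if m: "m \<ge> a" for m
  proof
    show sub: "T_filt D m \<subseteq> T_filt D a" by (rule T_filt_antimono[OF m])
    have "quot (T_filt D m) ?N \<subseteq> quot (T_filt D a) ?N" unfolding quot_def by (rule image_mono[OF sub])
    then have eq: "quot (T_filt D m) ?N = quot (T_filt D a) ?N" using card_seteq[OF fin _ a] by blast
    show "T_filt D a \<subseteq> T_filt D m"
    proof
      fix x assume "x \<in> T_filt D a"
      then have "x +o ?N \<in> quot (T_filt D m) ?N" unfolding eq by (auto simp: quot_def)
      then obtain y where y: "y \<in> T_filt D m" "x +o ?N = y +o ?N" by (auto simp: quot_def)
      then have "x - y \<in> T_filt D m" using coset_eq_iff[OF N] s by blast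
      moreover have "E.submod (T_filt D m)" using star_ring_T_filt by (simp add: star_ring_def)
      ultimately have "(x - y) + y \<in> T_filt D m" using E.submodD(2) y(1) by blast
      then show "x \<in> T_filt D m" by simp
    qed
  qed
  then show ?thesis by blast
qed

abbreviation T where "T \<equiv> T_tilde D"
abbreviation HT where "HT \<equiv> H_tilde D"
abbreviation H' where "H' \<equiv> herm_forms D"

lemma T_stable: "m \<ge> alpha D \<Longrightarrow> T_filt D m = T"
  using LeastI_ex[OF T_filt_stable] unfolding alpha_def T_tilde_def by blast

lemma star_ring_T: "star_ring T"
  using star_ring_T_filt by (simp add: T_tilde_def)

lemma submod_T: "E.submod T" and T_sub_T_zero: "T \<subseteq> T_zero D" and T_comp: "U \<in> T \<Longrightarrow> Y \<in> T \<Longrightarrow> U \<circ> Y \<in> T"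
  and T_ad: "U \<in> T \<Longrightarrow> ad U \<in> T"
  using star_ring_T by (auto simp: star_ring_def)

lemma T_sub_M': "T \<subseteq> M'" using T_sub_T_zero by (auto simp: T_zero_eq)
lemma T_lin: "U \<in> T \<Longrightarrow> lin U" using T_sub_M' M'_lin by blast

text \<open>The stage after \<open>alpha\<close> equals the stage \<open>alpha\<close>, so elements
  of \<open>T\<close> satisfy its defining condition.\<close>

lemma phi_T: "U \<in> T \<Longrightarrow> phi D U \<in> HT"
proof -
  assume U: "U \<in> T"
  have "U \<in> T_filt D (Suc (alpha D))" using T_stable[of "Suc (alpha D)"] U by simp
  then have "phi D U \<in> psi D ` T_filt D (alpha D)"
    using T_filt_Suc[of "alpha D"] star_ring_T_filt[of "alpha D"] by (auto simp: star_ring_def)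
  then show ?thesis by (simp add: H_tilde_def T_tilde_def)
qed

lemma submod_HT: "H.submod HT"
  unfolding H_tilde_def by (rule submod_psi[OF submod_T])

text \<open>If Y lies in a stage, psi(Y) is in the image of \<open>psi\<close> on it; when phi(Y) +
  psi(Y) is there too, so is phi(Y), and Y belongs to the next stage. This is how U - 1 enters
  \<open>T\<close> for an approximate isometry U.\<close>

lemma in_T_if:
  assumes U: "U \<in> T_zero D"
    and 1: "\<And>k. phi D U + psi D U \<in> psi D ` T_filt D k"
    and 2: "\<And>k. phi D (ad U) + psi D (ad U) \<in> psi D ` T_filt D k"
  shows "U \<in> T"
proof -
  have "U \<in> T_filt D k" for k
  proof (induction k)
    case (Suc k)
    have sr: "star_ring (T_filt D k)" by (rule star_ring_T_filt)
    then have sub: "E.submod (T_filt D k)" and aX: "ad U \<in> T_filt D k" using Suc by (auto simp: star_ring_def)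
    note psub = submod_psi[OF sub]
    have "phi D U + psi D U - psi D U \<in> psi D ` T_filt D k"
      "phi D (ad U) + psi D (ad U) - psi D (ad U) \<in> psi D ` T_filt D k"
      using H.submodD(5)[OF psub 1] H.submodD(5)[OF psub 2] Suc aX by blast+
    then show ?case using Suc unfolding T_filt_Suc[OF sub] by simp
  qed (use U in simp)
  then show ?thesis by (simp add: T_tilde_def)
qed

end


section \<open>Approximate isometries\<close>

context hermitian
begin

lemma comp_scE: "lin W \<Longrightarrow> W \<circ> scE a Y = scE a (W \<circ> Y)"
  by (simp add: fun_eq_iff lin_fmulV)

lemma comp_plus: "lin W \<Longrightarrow> W \<circ> (Y + Z) = (W \<circ> Y) + (W \<circ> Z)"
  by (simp add: fun_eq_iff lin_add)

lemma comp_minus: "lin W \<Longrightarrow> W \<circ> (Y - Z) = (W \<circ> Y) - (W \<circ> Z)"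
  by (simp add: fun_eq_iff lin_diff)

lemma minus_comp: "((Y :: 'v \<Rightarrow> 'v) - Z) \<circ> (W :: 'v \<Rightarrow> 'v) = (Y \<circ> W) - (Z \<circ> W)"
  by (simp add: fun_eq_iff)

text \<open>The inverse exists on V because 1 + Y is injective: a kernel vector, once scaled into
  \<open>L\<close>, is divisible by every power of \<pi>. Writing the inverse as 1 + W, the equation
  W = - Y - Y W with Y divisible by \<pi> removes the denominators of W one power at a time.
  \<open>R\<close> will be \<open>M'\<close> or \<open>T\<close>.\<close>

lemma near_unit:
  assumes R: "E.submod R" "R \<subseteq> M'" "\<And>Y Z. Y \<in> R \<Longrightarrow> Z \<in> R \<Longrightarrow> Y \<circ> Z \<in> R"
    and full: "scE (\<pi> ^ s) ` M' \<subseteq> R" and Y: "Y \<in> scE \<pi> ` R"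
  shows "\<exists>Z. Z - id \<in> R \<and> lin Z \<and> (id + Y) \<circ> Z = id \<and> Z \<circ> (id + Y) = id"
proof -
  obtain Y0 where Y0: "Y0 \<in> R" "Y = scE \<pi> Y0" using Y by blast
  have linY0: "lin Y0" using Y0 R(2) M'_lin by blast
  have linY: "lin Y" unfolding Y0(2) by (rule lin_scE[OF linY0])
  have lin1: "lin (id + Y)" by (intro lin_plus lin_id linY)
  have inj: "v = 0" if v: "(id + Y) v = 0" for v
  proof -
    obtain t where t: "fmulV D (\<pi> ^ t) v \<in> L" using pi_power_into_L by blast
    define u where "u = fmulV D (\<pi> ^ t) v"
    have "(id + Y) u = 0" unfolding u_def lin_fmulV[OF lin1] v by simp
    then have u: "u = - fmulV D \<pi> (Y0 u)" by (simp add: Y0(2) eq_neg_iff_add_eq_0)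
    have "u \<in> fmulV D (\<pi> ^ j) ` L" for j
    proof (induction j)
      case 0
      then show ?case using t by (simp add: u_def image_iff)
    next
      case (Suc j)
      then obtain l where l: "l \<in> L" "u = fmulV D (\<pi> ^ j) l" by blast
      have "u = - fmulV D \<pi> (Y0 (fmulV D (\<pi> ^ j) l))" using u l(2) by simp
      also have "\<dots> = fmulV D (\<pi> ^ Suc j) (- Y0 l)" by (simp add: lin_fmulV[OF linY0])
      finally have "u = fmulV D (\<pi> ^ Suc j) (- Y0 l)" .
      moreover have "- Y0 l \<in> L" using Y0(1) R(2) l(1) V.submodD(4)[OF submod_L] by (auto simp: M'_iff)
      ultimately show ?case by blast
    qed
    then have "u = 0" using V.genA_separated[OF GV(1)] GV(2) by simp
    then show "v = 0" using pi_nz by (simp add: u_def)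
  qed
  obtain Z where Z: "lin Z" "(id + Y) \<circ> Z = id" "Z \<circ> (id + Y) = id"
    using lin_inj_inverse[OF lin1 inj] by blast
  define W where "W = Z - id"
  have linW: "lin W" unfolding W_def by (intro lin_minus Z lin_id)
  have W: "W = - Y - (Y \<circ> W)"
  proof
    fix v
    have "Z v + Y (Z v) = v" using fun_cong[OF Z(2), of v] by simp
    then show "W v = (- Y - (Y \<circ> W)) v" by (simp add: W_def lin_diff[OF linY] algebra_simps)
  qed
  obtain t where t: "scE (\<pi> ^ t) W \<in> M'" using pi_power_into_M'[OF linW] by blast
  have "scE (\<pi> ^ (s + t)) W \<in> R"
  proof -
    have "scE (\<pi> ^ s) (scE (\<pi> ^ t) W) \<in> R" using full t by blast
    then show ?thesis by (simp add: fmulV_simps power_add)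
  qed
  moreover have "scE (\<pi> ^ j) W \<in> R" if "scE (\<pi> ^ Suc j) W \<in> R" for j
  proof -
    have "scE (\<pi> ^ j) W = - scE (\<pi> ^ Suc j) Y0 - (Y0 \<circ> scE (\<pi> ^ Suc j) W)"
    proof
      fix v
      have "scE (\<pi> ^ j) W v = fmulV D (\<pi> ^ j) ((- Y - (Y \<circ> W)) v)" using W by metis
      then show "scE (\<pi> ^ j) W v = (- scE (\<pi> ^ Suc j) Y0 - (Y0 \<circ> scE (\<pi> ^ Suc j) W)) v"
        by (simp add: Y0(2) lin_fmulV[OF linY0] V.scale_right_diff_distrib mult.commute)
    qed
    moreover have "scE (\<pi> ^ Suc j) Y0 \<in> R" by (rule E.submodD(3)[OF R(1) A_power[OF A_pi] Y0(1)])
    ultimately show ?thesis using E.submodD(4,5)[OF R(1)] R(3)[OF Y0(1) that] by metis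
  qed
  then have "scE (\<pi> ^ j) W \<in> R \<Longrightarrow> scE (\<pi> ^ 0) W \<in> R" for j by (induction j) blast+
  ultimately have "scE (\<pi> ^ 0) W \<in> R" by blast
  then have "W \<in> R" by (simp add: fmulV_simps)
  then show ?thesis using Z by (auto simp: W_def)
qed

definition del :: "('v \<Rightarrow> 'v) \<Rightarrow> 'v \<Rightarrow> 'v \<Rightarrow> 'k" where
  "del U = pullback h U - h"

lemma del_id: "del id = 0" by (simp add: del_def pullback_def fun_eq_iff)

lemma del_1_plus: "lin Y \<Longrightarrow> del (id + Y) = psi D Y + phi D Y"
  by (simp add: del_def pullback_def psi_def phi_def fun_eq_iff h_add_l h_add_r algebra_simps)

lemma del_comp: "del (U \<circ> Z) = pullback (del U) Z + del Z"
  by (simp add: del_def pullback_def fun_eq_iff)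

lemma del_plus: "lin U \<Longrightarrow> lin Y \<Longrightarrow> del (U + Y) = del U + (psi D (ad U \<circ> Y) + phi D Y)"
  using phi_add[of U Y] by (simp add: del_def phi_def)

lemma herm_plus:
  assumes f: "herm f" and g: "herm g"
  shows "herm (f + g)"
  unfolding eps_hermitian_def plus_fun_def
proof (intro conjI allI)
  show "f w v + g w v = of_int (eps D) * \<sigma> (f v w + g v w)" for v w
    using herm_sym[OF f, of w v] herm_sym[OF g, of w v] by (simp add: \<sigma>_add distrib_left)
qed (simp_all add: herm_add_l[OF f] herm_add_l[OF g] herm_add_r[OF f] herm_add_r[OF g]
    herm_r[OF f] herm_r[OF g] distrib_left distrib_right)

lemma herm_zero: "herm 0"
  unfolding eps_hermitian_def zero_fun_def by (simp add: \<sigma>_0)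

lemma herm_scH:
  assumes f: "herm f"
  shows "herm (scH a f)"
  unfolding eps_hermitian_def
proof (intro conjI allI)
  show "fmulK D a (f w v) = of_int (eps D) * \<sigma> (fmulK D a (f v w))" for v w
    using herm_sym[OF f, of w v] by (simp add: \<sigma>_fmulK fmulK_mult)
qed (simp_all add: herm_add_l[OF f] herm_add_r[OF f] herm_r[OF f] K.scale_right_distrib fmulK_mult)

lemma herm_minus: "herm f \<Longrightarrow> herm g \<Longrightarrow> herm (f - g)"
proof -
  assume f: "herm f" and g: "herm g"
  have eq: "f - g = f + scH (- 1) g" by (simp add: fun_eq_iff)
  show ?thesis unfolding eq by (rule herm_plus[OF f herm_scH[OF g]])
qed

lemma herm_pullback:
  assumes f: "herm f" and U: "lin U"
  shows "herm (pullback f U)"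
  unfolding eps_hermitian_def pullback_def
proof (intro conjI allI)
  show "f (U w) (U v) = of_int (eps D) * \<sigma> (f (U v) (U w))" for v w by (rule herm_sym[OF f])
qed (simp_all add: herm_add_l[OF f] herm_add_r[OF f] herm_r[OF f] lin_add[OF U] lin_r[OF U])

lemma herm_del: "lin U \<Longrightarrow> herm (del U)"
  unfolding del_def by (intro herm_minus herm_pullback herm_h)

lemma submod_HB: "H.submod HB"
  unfolding H.submod_def HB_def
  by (auto simp: herm_zero herm_plus herm_scH B_0 B_add K.submodD(3)[OF submod_B])

lemma submod_H': "H.submod H'"
proof (cases "exceptional D")
  case True
  then show ?thesis
    unfolding H.submod_def herm_forms_cases
    by (auto simp: herm_zero herm_plus herm_scH B_0 B_add K.submodD(3)[OF submod_B])
qed (simp add: herm_forms_cases submod_HB)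

lemma pullback_HB: "f \<in> HB \<Longrightarrow> U \<in> M' \<Longrightarrow> pullback f U \<in> HB"
  by (auto simp: HB_def herm_pullback M'_iff) (simp add: pullback_def)

lemma pullback_H': "f \<in> H' \<Longrightarrow> U \<in> M' \<Longrightarrow> pullback f U \<in> H'"
  using pullback_HB by (auto simp: herm_forms_cases herm_pullback M'_iff pullback_def)

lemma phi_M': "U \<in> M' \<Longrightarrow> phi D U \<in> H'"
  unfolding phi_def by (rule pullback_H'[OF form_in])

text \<open>ad U Y need not preserve \<open>L\<close>, yet its image is integral as the polarization
  of \<open>phi\<close>, which maps \<open>M'\<close> into \<open>H'\<close>. The argument covers
  the exceptional case together with the others.\<close>

lemma psi_cross_M': "U \<in> M' \<Longrightarrow> Y \<in> M' \<Longrightarrow> psi D (ad U \<circ> Y) \<in> H'"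
proof -
  assume U: "U \<in> M'" and Y: "Y \<in> M'"
  have "psi D (ad U \<circ> Y) = phi D (U + Y) - phi D U - phi D Y"
    using phi_add[OF M'_lin[OF U] M'_lin[OF Y]] by simp
  then show ?thesis
    using phi_M' U Y E.submodD(2)[OF submod_M' U Y] H.submodD(5)[OF submod_H'] by simp
qed

lemma psi_M': "Y \<in> M' \<Longrightarrow> psi D Y \<in> H'"
  using psi_cross_M'[OF M'_id, of Y] by (simp add: ad_id)

lemma HT_sub_H': "HT \<subseteq> H'"
  using psi_M' T_sub_M' by (auto simp: H_tilde_def)

text \<open>In the exceptional case only diagonal values are known to be integral. Polarization
  gives integrality of 2 f(v, w), and \<pi>^(val 2) absorbs the 2.\<close>

lemma H'_bounded: "\<exists>c. \<forall>f\<in>H'. scH (\<pi> ^ c) f \<in> HB"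
proof (cases "exceptional D")
  case False
  then show ?thesis by (intro exI[of _ 0]) (simp add: herm_forms_cases)
next
  case True
  have base: "base_case D" using exceptional_base[OF True] .
  have two: "(2 :: 'f) \<noteq> 0" using two_nz base by blast
  define c where "c = nat (val D 2)"
  have "scH (\<pi> ^ c) f \<in> HB" if "f \<in> H'" for f
  proof -
    have f: "herm f" "\<And>v. v \<in> L \<Longrightarrow> f v v \<in> B" using that True by (auto simp: herm_forms_cases)
    have sym: "f v w = f w v" for v w
      using herm_sym[OF f(1), of v w] True base by (simp add: exceptional_def base_case_def)
    have "fmulK D (\<pi> ^ c) (f v w) \<in> B" if "v \<in> L" "w \<in> L" for v w
    proof -
      have "f v w + f v w = f (v + w) (v + w) - f v v - f w w"
        using sym[of w v] by (simp add: herm_add_l[OF f(1)] herm_add_r[OF f(1)] algebra_simps)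
      moreover have "fmulK D 2 (f v w) = f v w + f v w"
        using K.scale_left_distrib[of 1 1 "f v w"] by simp
      ultimately have f2: "fmulK D 2 (f v w) \<in> B" using f(2) that L_add B_diff by simp
      have "fmulK D (\<pi> ^ c / 2) (fmulK D 2 (f v w)) \<in> B"
        by (rule K.submodD(3)[OF submod_B val_ring_dvd_pi_power[OF two] f2]) (simp add: c_def)
      then show ?thesis using two by simp
    qed
    then show ?thesis by (auto simp: HB_def herm_scH[OF f(1)])
  qed
  then show ?thesis by blast
qed

text \<open>The part of \<open>T_zero\<close> known to lie in every stage: a form in its image under
  \<open>psi\<close> lies in the image of all stages at once.\<close>

definition T1 :: "('v \<Rightarrow> 'v) set" where "T1 = scE (\<pi> ^ mm) ` T_zero D"

lemma submod_T1: "E.submod T1"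
  unfolding T1_def using star_ring_T_zero by (intro E.submod_scale_image) (simp add: star_ring_def)

lemma T1_sub: "T1 \<subseteq> T_filt D k" "T1 \<subseteq> T"
  using star_ring_T_filt[of k] star_ring_T by (auto simp: T1_def star_ring_def)

lemma psi_T1: "psi D ` T1 \<subseteq> psi D ` T_filt D k" "psi D ` T1 \<subseteq> HT"
  using T1_sub by (auto simp: H_tilde_def)

text \<open>Write f = h(v, Y w) with Y self-adjoint. As the Gram matrix of f is integral, inverting
  \<open>\<Theta>\<close> costs \<pi>^z; entering \<open>T_zero\<close> costs \<pi>^s, making
  \<open>cc\<close> integral costs \<pi>^mm, and the definition of \<open>T1\<close> another
  \<pi>^mm.\<close>

lemma HB_bounded: "\<exists>a. \<forall>f\<in>HB. scH (\<pi> ^ a) f \<in> psi D ` T1"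
proof -
  obtain Z where Z: "lin Z" "Z \<circ> \<Theta> = id" using lin_inj_inverse[OF lin_\<Theta> \<Theta>_inj] by blast
  obtain z where z: "scE (\<pi> ^ z) Z \<in> M'" using pi_power_into_M'[OF Z(1)] by blast
  obtain s where s: "scE (\<pi> ^ s) ` M' \<subseteq> T_zero D" using pi_M'_T_zero by blast
  define b where "b = fmulK D (\<pi> ^ mm) cc"
  have b: "b \<in> B" "\<And>x. b * x = x * b" using mm cc(1) by (auto simp: b_def fmulK_mult)
  have "scH (\<pi> ^ (mm + (mm + (s + z)))) f \<in> psi D ` T1" if f: "f \<in> HB" for f
  proof -
    have hf: "herm f" using f by (simp add: HB_def)
    obtain Y where Y: "lin Y" "\<And>v w. f v w = h v (Y w)" using represent_herm[OF hf] by blast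
    have adY: "ad Y = Y"
    proof (rule ad_unique[OF Y(1)])
      show "h (Y v) w = h v (Y w)" for v w
        using herm_sym[OF herm_h, of "Y v" w] herm_sym[OF hf, of v w] by (simp add: Y(2))
    qed
    have "\<Theta> \<circ> Y \<in> M'" unfolding M'_iff_basis
    proof (intro conjI allI impI)
      show "lin (\<Theta> \<circ> Y)" by (rule lin_comp[OF lin_\<Theta> Y(1)])
      fix j assume j: "j < n"
      have "(\<Theta> \<circ> Y) (eb j) = (\<Sum>i<n. r (eb i) (f (eb i) (eb j)))" by (simp add: \<Theta>_def Y(2))
      then show "(\<Theta> \<circ> Y) (eb j) \<in> L" using f j eb_L by (auto simp: HB_def intro!: L_sum L_r)
    qed
    then have "scE (\<pi> ^ z) Z \<circ> (\<Theta> \<circ> Y) \<in> M'" by (rule M'_comp[OF z])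
    moreover have "scE (\<pi> ^ z) Z \<circ> (\<Theta> \<circ> Y) = scE (\<pi> ^ z) Y"
      using Z(2) by (simp add: fun_eq_iff)
    ultimately have "scE (\<pi> ^ s) (scE (\<pi> ^ z) Y) \<in> T_zero D" using s by auto
    then have "scE (\<pi> ^ (s + z)) Y \<in> T_zero D" by (simp add: fmulV_simps power_add)
    then have 1: "(\<lambda>v. r (scE (\<pi> ^ (s + z)) Y v) b) \<in> T_zero D" by (rule T_zero_central[OF _ b])
    have "psi D (scE (\<pi> ^ mm) (\<lambda>v. r (scE (\<pi> ^ (s + z)) Y v) b)) =
      scH (\<pi> ^ (mm + (mm + (s + z)))) (psi D (\<lambda>v. r (Y v) cc))"
      by (simp add: b_def r_fmulK r_fmulV power_add mult_ac flip: psi_scE)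
    also have "psi D (\<lambda>v. r (Y v) cc) = f" using psi_cc[OF Y(1) adY] Y(2) by (simp add: fun_eq_iff)
    finally have eq: "psi D (scE (\<pi> ^ mm) (\<lambda>v. r (scE (\<pi> ^ (s + z)) Y v) b)) =
      scH (\<pi> ^ (mm + (mm + (s + z)))) f" .
    show ?thesis unfolding eq[symmetric] T1_def
      by (rule imageI[of _ _ "psi D", OF imageI[of _ _ "scE (\<pi> ^ mm)", OF 1]])
  qed
  then show ?thesis by blast
qed

lemma bound_ex: "\<exists>b. (\<forall>f\<in>H'. scH (\<pi> ^ b) f \<in> HB) \<and> (\<forall>f\<in>HB. scH (\<pi> ^ b) f \<in> psi D ` T1)"
proof -
  obtain c a where c: "\<forall>f\<in>H'. scH (\<pi> ^ c) f \<in> HB" and a: "\<forall>f\<in>HB. scH (\<pi> ^ a) f \<in> psi D ` T1"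
    using H'_bounded HB_bounded by blast
  have "scH (\<pi> ^ (a + c)) f \<in> HB" if "f \<in> H'" for f
    using H.pi_power_mono[OF submod_HB, of c f "a + c"] c that by simp
  moreover have "scH (\<pi> ^ (a + c)) f \<in> psi D ` T1" if "f \<in> HB" for f
    using H.pi_power_mono[OF submod_psi[OF submod_T1], of a f "a + c"] a that by simp
  ultimately show ?thesis by blast
qed

text \<open>One exponent for both inclusions, so that \<open>2 * kb\<close> carries all of
  \<open>H'\<close> into the image of \<open>T1\<close>.\<close>

definition kb :: nat where
  "kb = (SOME b. (\<forall>f\<in>H'. scH (\<pi> ^ b) f \<in> HB) \<and> (\<forall>f\<in>HB. scH (\<pi> ^ b) f \<in> psi D ` T1))"

lemma kb: "f \<in> H' \<Longrightarrow> scH (\<pi> ^ kb) f \<in> HB" "f \<in> HB \<Longrightarrow> scH (\<pi> ^ kb) f \<in> psi D ` T1"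
  using someI_ex[OF bound_ex] unfolding kb_def[symmetric] by blast+

lemma scH_scH: "scH a (scH b f) = scH (a * b) f" by simp

lemma kb2: "f \<in> H' \<Longrightarrow> k \<ge> 2 * kb \<Longrightarrow> scH (\<pi> ^ k) f \<in> psi D ` T1"
proof -
  assume f: "f \<in> H'" and k: "k \<ge> 2 * kb"
  have eq: "scH (\<pi> ^ (kb + kb)) f = scH (\<pi> ^ kb) (scH (\<pi> ^ kb) f)" by (simp only: scH_scH power_add)
  have "scH (\<pi> ^ (kb + kb)) f \<in> psi D ` T1" unfolding eq by (rule kb(2)[OF kb(1)[OF f]])
  then show ?thesis by (rule H.pi_power_mono[OF submod_psi[OF submod_T1]]) (use k in simp)
qed

text \<open>The lifts to \<open>M'\<close> of the isometries of \<open>L\<close> modulo \<pi>^k.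
  Invertibility is not imposed; it is derived in \<open>S_unit\<close> once k exceeds
  \<open>2 * kb\<close>.\<close>

definition S :: "nat \<Rightarrow> ('v \<Rightarrow> 'v) set" where
  "S k = {U \<in> M'. del U \<in> scH (\<pi> ^ k) ` H'}"

lemma submod_pi_H': "H.submod (scH (\<pi> ^ k) ` H')"
  by (rule H.submod_scale_image[OF submod_H'])

lemma pullback_pi: "pullback (scH a f) U = scH a (pullback f U)"
  by (intro ext) (simp add: pullback_def)

lemma S_comp: "U \<in> S k \<Longrightarrow> Z \<in> S k \<Longrightarrow> U \<circ> Z \<in> S k"
proof -
  assume U: "U \<in> S k" and Z: "Z \<in> S k"
  then obtain f where f: "f \<in> H'" "del U = scH (\<pi> ^ k) f" and ZM: "Z \<in> M'" by (auto simp: S_def)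
  have "pullback (del U) Z \<in> scH (\<pi> ^ k) ` H'"
    unfolding f(2) pullback_pi using pullback_H'[OF f(1) ZM] by (rule imageI)
  then show ?thesis
    using U Z H.submodD(2)[OF submod_pi_H'] M'_comp by (simp add: S_def del_comp)
qed

lemma S_id: "id \<in> S k"
  using H.submodD(1)[OF submod_pi_H'] by (simp add: S_def M'_id del_id)

lemma S_inverse_mem:
  assumes "U \<in> S k" "Z \<in> M'" "U \<circ> Z = id"
  shows "Z \<in> S k"
proof -
  obtain f where f: "f \<in> H'" "del U = scH (\<pi> ^ k) f" using assms(1) by (auto simp: S_def)
  have "pullback (del U) Z \<in> scH (\<pi> ^ k) ` H'"
    unfolding f(2) pullback_pi using pullback_H'[OF f(1) assms(2)] by (rule imageI)
  moreover have "del Z = - pullback (del U) Z"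
    using del_comp[of U Z] assms(3) del_id by (simp add: eq_neg_iff_add_eq_0 add.commute)
  ultimately show ?thesis using assms(2) H.submodD(4)[OF submod_pi_H'] by (simp add: S_def)
qed

text \<open>Up to \<open>2 * kb\<close> powers of \<pi>, the form f is h(v, E w) with E = Y + ad Y
  for some Y in \<open>T1\<close>, so E is integral. Thus \<open>U\<close> is unitary up to \<pi>^(k
  - 2 kb) as an endomorphism, not only as far as values of forms go.\<close>

lemma S_ad:
  assumes "U \<in> S k" "k \<ge> 2 * kb"
  obtains f E where "f \<in> H'" "del U = scH (\<pi> ^ k) f" "E \<in> M'"
    "\<And>v w. h v (E w) = scH (\<pi> ^ (2 * kb)) f v w" "ad U \<circ> U = id + scE (\<pi> ^ (k - 2 * kb)) E"
proof -
  obtain f where f: "f \<in> H'" "del U = scH (\<pi> ^ k) f" and UM: "U \<in> M'" using assms(1) by (auto simp: S_def)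
  have linU: "lin U" using UM by (rule M'_lin)
  have "scH (\<pi> ^ (2 * kb)) f \<in> psi D ` T1" by (rule kb2[OF f(1) order_refl])
  then obtain Y where Y: "Y \<in> T1" "scH (\<pi> ^ (2 * kb)) f = psi D Y" by (rule imageE) 
  have Y0: "Y \<in> T_zero D" using Y(1) T1_sub(1)[of 0] by auto
  define E where "E = Y + ad Y"
  have EM: "E \<in> M'" unfolding E_def using Y0 by (intro E.submodD(2)[OF submod_M']) (auto simp: T_zero_eq)
  have hE: "h v (E w) = scH (\<pi> ^ (2 * kb)) f v w" for v w
    using fun_cong[OF fun_cong[OF Y(2), of v], of w] h_ad[OF T_zero_lin[OF Y0], of v w]
    by (simp add: E_def h_add_r psi_def)
  have "ad U \<circ> U = id + scE (\<pi> ^ (k - 2 * kb)) E"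
  proof (rule ext, rule nondeg_r)
    fix w v
    have "h v ((ad U \<circ> U) w) = h v w + del U v w"
      using h_ad[OF linU, of v "U w"] by (simp add: del_def pullback_def)
    also have "del U v w = fmulK D (\<pi> ^ (k - 2 * kb)) (h v (E w))"
      unfolding f(2) hE using assms(2) by (simp flip: power_add)
    finally show "h v ((ad U \<circ> U) w) = h v ((id + scE (\<pi> ^ (k - 2 * kb)) E) w)"
      by (simp add: h_add_r h_fmulV_r)
  qed
  then show ?thesis using that f EM hE by blast
qed

text \<open>Modulo \<pi>^(s + 1), two powers W = U^i and U^j are congruent, so W (1 - U^d) is
  divisible by \<pi>^(s + 1), where d = j - i. Since ad W W is invertible by
  \<open>near_unit\<close>, applying \<open>ad W\<close> cancels W at the cost of \<pi>^s. Hence U^d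
  is congruent to 1 modulo \<pi> and a unit, and therefore so is U.\<close>

lemma S_unit:
  assumes U: "U \<in> S k" and k: "k \<ge> 2 * kb + 1"
  shows "\<exists>Z\<in>S k. U \<circ> Z = id \<and> Z \<circ> U = id"
proof -
  note nuM = near_unit[OF submod_M' subset_refl M'_comp, of 0]
  have full0: "scE (\<pi> ^ 0) ` M' \<subseteq> M'" by simp
  have powS: "U ^^ i \<in> S k" for i
  proof (induction i)
    case (Suc i)
    show ?case unfolding funpow.simps(2) by (rule S_comp[OF U Suc])
  qed (simp only: funpow.simps(1) S_id)
  have powM: "U ^^ i \<in> M'" for i using powS by (simp add: S_def)
  obtain s where s: "\<forall>Y\<in>M'. scE (\<pi> ^ s) (ad Y) \<in> M'" using ad_bounded by blast
  let ?N = "scE (\<pi> ^ Suc s) ` M'"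
  have N: "add_subgroup ?N" by (intro E.submod_subgroup E.submod_scale_image submod_M')
  have "\<not> inj (\<lambda>i. (U ^^ i) +o ?N)"
  proof
    assume inj: "inj (\<lambda>i. (U ^^ i) +o ?N)"
    have "range (\<lambda>i. (U ^^ i) +o ?N) \<subseteq> quot M' ?N" using powM by (auto simp: quot_def)
    then have "finite (range (\<lambda>i. (U ^^ i) +o ?N))" using finite_quot_M' finite_subset by blast
    then show False using finite_imageD[OF _ inj] by simp
  qed
  then obtain i j where ij: "i < j" "(U ^^ i) +o ?N = (U ^^ j) +o ?N"
    unfolding inj_def by (metis linorder_neqE_nat)
  then obtain Z0 where Z0: "Z0 \<in> M'" "U ^^ i - U ^^ j = scE (\<pi> ^ Suc s) Z0"
    using coset_eq_iff[OF N] by blast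
  define W where "W = U ^^ i"
  define d where "d = j - i"
  have linW: "lin W" and lin_adW: "lin (ad W)" using powM M'_lin lin_ad by (auto simp: W_def)
  have Wd: "U ^^ j = W \<circ> U ^^ d" using ij(1) by (simp add: W_def d_def flip: funpow_add)
  obtain E where E: "E \<in> M'" "ad W \<circ> W = id + scE (\<pi> ^ (k - 2 * kb)) E"
    using S_ad[OF powS[of i]] k by (metis W_def add_leD1)
  obtain k' where k': "k - 2 * kb = Suc k'" using k by (cases "k - 2 * kb") auto
  have eqE: "scE (\<pi> ^ (k - 2 * kb)) E = scE \<pi> (scE (\<pi> ^ k') E)" by (simp add: k')
  have "scE (\<pi> ^ (k - 2 * kb)) E \<in> scE \<pi> ` M'"
    unfolding eqE
    by (rule imageI[of _ _ "scE \<pi>", OF E.submodD(3)[OF submod_M' A_power[OF A_pi, of k'] E(1)]])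
  from nuM[OF _ _ full0 this] obtain V0 where V0: "V0 - id \<in> M'" "lin V0" "V0 \<circ> (ad W \<circ> W) = id"
    unfolding E(2) by blast
  have V0M: "V0 \<in> M'" using E.submodD(2)[OF submod_M' V0(1) M'_id] by simp
  have Q: "scE (\<pi> ^ s) (ad W) \<circ> Z0 \<in> M'" using s powM Z0(1) by (intro M'_comp) (auto simp: W_def)
  have "ad W \<circ> (W \<circ> (id - U ^^ d)) = ad W \<circ> scE (\<pi> ^ Suc s) Z0"
    using Z0(2) Wd comp_minus[OF linW, of id "U ^^ d"] by (simp add: W_def[symmetric])
  also have "\<dots> = scE \<pi> (scE (\<pi> ^ s) (ad W) \<circ> Z0)"
    by (simp add: fun_eq_iff lin_fmulV[OF lin_adW])
  finally have "V0 \<circ> (ad W \<circ> (W \<circ> (id - U ^^ d))) = V0 \<circ> scE \<pi> (scE (\<pi> ^ s) (ad W) \<circ> Z0)" by simp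
  moreover have "V0 \<circ> (ad W \<circ> (W \<circ> (id - U ^^ d))) = id - U ^^ d"
  proof -
    have "V0 \<circ> (ad W \<circ> (W \<circ> (id - U ^^ d))) = (V0 \<circ> (ad W \<circ> W)) \<circ> (id - U ^^ d)" by (simp only: comp_assoc)
    then show ?thesis using V0(3) by simp
  qed
  ultimately have "id - U ^^ d = scE \<pi> (V0 \<circ> (scE (\<pi> ^ s) (ad W) \<circ> Z0))"
    by (simp only: comp_scE[OF V0(2)])
  then have "id - U ^^ d \<in> scE \<pi> ` M'" using M'_comp[OF V0M Q] by blast
  then have "- (id - U ^^ d) \<in> scE \<pi> ` M'" by (rule E.submodD(4)[OF E.submod_scale_image[OF submod_M']])
  from nuM[OF _ _ full0 this] obtain Z' where Z': "Z' - id \<in> M'" "(U ^^ d) \<circ> Z' = id" "Z' \<circ> (U ^^ d) = id"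
    by auto
  have Z'M: "Z' \<in> M'" using E.submodD(2)[OF submod_M' Z'(1) M'_id] by simp
  obtain d' where d': "d = Suc d'" using ij(1) by (cases d) (auto simp: d_def)
  have 1: "U \<circ> (U ^^ d' \<circ> Z') = id" using Z'(2) by (simp add: d' comp_assoc)
  have 2: "(Z' \<circ> U ^^ d') \<circ> U = id" using Z'(3) by (simp add: d' funpow_swap1 comp_assoc fun_eq_iff)
  have eq: "Z' \<circ> U ^^ d' = U ^^ d' \<circ> Z'"
  proof -
    have "Z' \<circ> U ^^ d' = (Z' \<circ> U ^^ d') \<circ> (U \<circ> (U ^^ d' \<circ> Z'))" by (simp only: 1 comp_id)
    also have "\<dots> = ((Z' \<circ> U ^^ d') \<circ> U) \<circ> (U ^^ d' \<circ> Z')" by (simp only: comp_assoc)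
    also have "\<dots> = U ^^ d' \<circ> Z'" by (simp only: 2 id_comp)
    finally show ?thesis .
  qed
  have "U ^^ d' \<circ> Z' \<in> S k" by (rule S_inverse_mem[OF U M'_comp[OF powM Z'M] 1])
  then show ?thesis using 1 2 eq by metis
qed

text \<open>\<open>in_T_if\<close> is applied to Y = U - 1, for which phi(Y) + psi(Y) is
  \<open>del U\<close>. For the adjoint the analogous form is \<open>del (ad U)\<close>, and its
  smallness is deduced from ad U = (1 + \<pi>^(k - 2 kb) E) U^(-1).\<close>

lemma S_sub_T:
  assumes U: "U \<in> S k" and k: "k \<ge> 2 * kb + 1"
  shows "U - id \<in> T"
proof -
  have UM: "U \<in> M'" using U by (simp add: S_def)
  have linU: "lin U" using UM by (rule M'_lin)
  obtain Z where Z: "Z \<in> S k" "U \<circ> Z = id" "Z \<circ> U = id" using S_unit[OF U k] by blast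
  have ZM: "Z \<in> M'" using Z(1) by (simp add: S_def)
  have k2: "k \<ge> 2 * kb" using k by simp
  obtain f E where f: "f \<in> H'" "del U = scH (\<pi> ^ k) f" and E: "E \<in> M'"
    "\<And>v w. h v (E w) = scH (\<pi> ^ (2 * kb)) f v w" "ad U \<circ> U = id + scE (\<pi> ^ (k - 2 * kb)) E"
    using S_ad[OF U k2] by blast
  have adU: "ad U = (id + scE (\<pi> ^ (k - 2 * kb)) E) \<circ> Z"
    unfolding E(3)[symmetric] using Z(2) by (simp add: comp_assoc)
  have adUM: "ad U \<in> M'"
    unfolding adU using E(1) ZM
    by (intro M'_comp E.submodD(2)[OF submod_M'] M'_id E.submodD(3)[OF submod_M']) auto
  have linY: "lin (U - id)" by (intro lin_minus linU lin_id)
  have adY: "ad (U - id) = ad U - id" by (simp add: ad_minus linU lin_id ad_id)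
  have lin_adY: "lin (ad U - id)" by (intro lin_minus lin_ad linU lin_id)
  have Y0: "U - id \<in> T_zero D"
    unfolding T_zero_eq using E.submodD(5)[OF submod_M' _ M'_id] UM adUM by (simp add: adY)
  show ?thesis
  proof (rule in_T_if[OF Y0])
    fix m
    have "phi D (U - id) + psi D (U - id) = del U"
      using del_1_plus[OF linY] by (simp add: add.commute)
    then show "phi D (U - id) + psi D (U - id) \<in> psi D ` T_filt D m"
      using kb2[OF f(1) k2] psi_T1(1)[of m] f(2) by auto
    \<comment> \<open>\<open>del (ad U)\<close> is \<pi>^k times (v, w) \<mapsto> f(ad U v, Z w),
      which is no pullback of f, so integrality of f on the diagonal would not suffice. Dividing by
      \<pi>^(k - kb) only leaves the factor \<pi>^kb that makes all values of f on \<open>L\<close>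
      integral.\<close>
    define g where "g = scH (inverse (\<pi> ^ (k - kb))) (del (ad U))"
    have del_ad: "del (ad U) = scH (\<pi> ^ (k - kb)) g"
      using pi_nz by (simp add: g_def)
    have "del (ad U) v w = fmulK D (\<pi> ^ (k - 2 * kb)) (fmulK D (\<pi> ^ (2 * kb)) (f (ad U v) (Z w)))" for v w
    proof -
      have "h (ad U v) (ad U w) = h (ad U v) (Z w) + fmulK D (\<pi> ^ (k - 2 * kb)) (h (ad U v) (E (Z w)))"
        using fun_cong[OF adU, of w] by (simp add: h_add_r h_fmulV_r)
      also have "h (ad U v) (Z w) = h v (U (Z w))" using h_ad[OF lin_ad[OF linU], of v "Z w"] ad_ad[OF linU] by simp
      also have "U (Z w) = w" using fun_cong[OF Z(2), of w] by simp
      finally show ?thesis using E(2)[of "ad U v" "Z w"] by (simp add: del_def pullback_def)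
    qed
    also have "fmulK D (\<pi> ^ (k - 2 * kb)) (fmulK D (\<pi> ^ (2 * kb)) x) = fmulK D (\<pi> ^ (k - kb)) (fmulK D (\<pi> ^ kb) x)" for x
      using k2 by (simp flip: power_add)
    finally have gval: "g v w = fmulK D (\<pi> ^ kb) (f (ad U v) (Z w))" for v w
      using pi_nz by (simp add: g_def)
    have "herm g" unfolding g_def by (intro herm_scH herm_del lin_ad linU)
    moreover have "g v w \<in> B" if "v \<in> L" "w \<in> L" for v w
    proof -
      have "ad U v \<in> L" "Z w \<in> L" using that adUM ZM by (auto simp: M'_iff)
      then show ?thesis using kb(1)[OF f(1)] unfolding gval by (auto simp: HB_def)
    qed
    ultimately have "g \<in> HB" by (auto simp: HB_def)
    then have "scH (\<pi> ^ (k - kb)) g \<in> psi D ` T1"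
      by (rule H.pi_power_mono[OF submod_psi[OF submod_T1] kb(2)]) (use k2 in simp)
    then have "del (ad U) \<in> psi D ` T1" by (simp only: del_ad)
    moreover have "phi D (ad (U - id)) + psi D (ad (U - id)) = del (ad U)"
      unfolding adY using del_1_plus[OF lin_adY] by (simp add: add.commute)
    ultimately show "phi D (ad (U - id)) + psi D (ad (U - id)) \<in> psi D ` T_filt D m"
      using psi_T1(1)[of m] by auto
  qed
qed

end


section \<open>Counting points\<close>

context hermitian
begin

text \<open>The map \<open>del\<close> is a cocycle on a group of isometries modulo \<open>Q\<close>; its fibres modulo \<open>P\<close>
  are the right cosets of the subgroup of isometries modulo \<open>P\<close>.\<close>

lemma coset_count:
  assumes lin: "\<And>U. U \<in> \<Gamma> \<Longrightarrow> lin U" and comp: "\<And>U V. U \<in> \<Gamma> \<Longrightarrow> V \<in> \<Gamma> \<Longrightarrow> U \<circ> V \<in> \<Gamma>"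
    and inv: "\<And>U. U \<in> \<Gamma> \<Longrightarrow> \<exists>V\<in>\<Gamma>. U \<circ> V = id \<and> V \<circ> U = id"
    and N: "add_subgroup N" "\<And>Y U. Y \<in> N \<Longrightarrow> U \<in> \<Gamma> \<Longrightarrow> Y \<circ> U \<in> N"
    and P: "add_subgroup P" "\<And>f U. f \<in> P \<Longrightarrow> U \<in> \<Gamma> \<Longrightarrow> pullback f U \<in> P"
    and Q: "\<And>U. U \<in> \<Gamma> \<Longrightarrow> del U \<in> Q"
    and compat: "\<And>U V. U \<in> \<Gamma> \<Longrightarrow> V \<in> \<Gamma> \<Longrightarrow> U - V \<in> N \<Longrightarrow> del U - del V \<in> P"
    and surj: "\<And>f. f \<in> Q \<Longrightarrow> \<exists>U\<in>\<Gamma>. del U - f \<in> P"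
  shows "card (quot \<Gamma> N) = card (quot {U \<in> \<Gamma>. del U \<in> P} N) * card (quot Q P)"
proof -
  have "\<exists>U. U \<in> \<Gamma> \<and> c = del U +o P" if c: "c \<in> quot Q P" for c
  proof -
    obtain f where f: "f \<in> Q" "c = f +o P" using c by (auto simp: quot_def)
    obtain U where "U \<in> \<Gamma>" "del U - f \<in> P" using surj[OF f(1)] by blast
    then show ?thesis using coset_eq_iff[OF P(1)] f(2) by blast
  qed
  then obtain rep where rep: "\<And>c. c \<in> quot Q P \<Longrightarrow> rep c \<in> \<Gamma> \<and> c = del (rep c) +o P" by metis
  have "card ((\<lambda>U. U +o N) ` \<Gamma>) = card ((\<lambda>U. U +o N) ` {U \<in> \<Gamma>. del U \<in> P}) * card (quot Q P)"
  proof (rule card_image_prod(1)[where f = "\<lambda>Y c. Y \<circ> rep c"])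
    show "Y \<circ> rep c \<in> \<Gamma>" if "Y \<in> {U \<in> \<Gamma>. del U \<in> P}" "c \<in> quot Q P" for Y c
      using that rep comp by blast
    fix Y c Y' c'
    assume Y: "Y \<in> {U \<in> \<Gamma>. del U \<in> P}" "Y' \<in> {U \<in> \<Gamma>. del U \<in> P}" and c: "c \<in> quot Q P" "c' \<in> quot Q P"
    note rc = rep[OF c(1)] rep[OF c(2)]
    show "((Y \<circ> rep c) +o N = (Y' \<circ> rep c') +o N) = (Y +o N = Y' +o N \<and> c = c')"
    proof
      assume "(Y \<circ> rep c) +o N = (Y' \<circ> rep c') +o N"
      then have n: "(Y \<circ> rep c) - (Y' \<circ> rep c') \<in> N" using coset_eq_iff[OF N(1)] by blast
      have "del (Y \<circ> rep c) - del (Y' \<circ> rep c') \<in> P"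
        using Y rc comp by (intro compat n) blast+
      moreover have "pullback (del Y) (rep c) \<in> P" "pullback (del Y') (rep c') \<in> P"
        using Y rc P(2) by blast+
      ultimately have "(del (Y \<circ> rep c) - del (Y' \<circ> rep c')) - pullback (del Y) (rep c) + pullback (del Y') (rep c') \<in> P"
        using add_subgroupD(2,4)[OF P(1)] by blast
      then have "del (rep c) - del (rep c') \<in> P" by (simp add: del_comp)
      then have cc': "c = c'" using rc coset_eq_iff[OF P(1)] by metis
      obtain V where V: "V \<in> \<Gamma>" "rep c \<circ> V = id" using inv rc by blast
      have "((Y \<circ> rep c) - (Y' \<circ> rep c')) \<circ> V \<in> N" by (rule N(2)[OF n V(1)])
      also have "((Y \<circ> rep c) - (Y' \<circ> rep c')) \<circ> V = Y - Y'"
        unfolding minus_comp comp_assoc cc'[symmetric] V(2) comp_id ..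
      finally show "Y +o N = Y' +o N \<and> c = c'" using cc' coset_eq_iff[OF N(1)] by blast
    next
      assume a: "Y +o N = Y' +o N \<and> c = c'"
      then have "Y - Y' \<in> N" using coset_eq_iff[OF N(1)] by blast
      then have "(Y - Y') \<circ> rep c \<in> N" using N(2) rc by blast
      then show "(Y \<circ> rep c) +o N = (Y' \<circ> rep c') +o N"
        using a coset_eq_iff[OF N(1)] by (simp add: minus_comp)
    qed
  next
    fix U assume U: "U \<in> \<Gamma>"
    define c where "c = del U +o P"
    have c: "c \<in> quot Q P" using Q[OF U] by (auto simp: quot_def c_def)
    note rc = rep[OF c]
    obtain V where V: "V \<in> \<Gamma>" "rep c \<circ> V = id" "V \<circ> rep c = id" using inv rc by blast
    have "del U - del (rep c) \<in> P" using rc c_def coset_eq_iff[OF P(1)] by metis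
    then have "pullback (del U - del (rep c)) V \<in> P" using P(2) V(1) by blast
    moreover have "pullback (del U - del (rep c)) V = del (U \<circ> V) - del (rep c \<circ> V)"
      unfolding del_comp by (simp add: pullback_def fun_eq_iff)
    ultimately have "del (U \<circ> V) \<in> P" by (simp add: V(2) del_id)
    then have "U \<circ> V \<in> {U \<in> \<Gamma>. del U \<in> P}" using comp[OF U V(1)] by blast
    moreover have "(U \<circ> V \<circ> rep c) +o N = U +o N" using V(3) by (simp add: comp_assoc)
    ultimately show "\<exists>s\<in>{U \<in> \<Gamma>. del U \<in> P}. \<exists>i\<in>quot Q P. (s \<circ> rep i) +o N = U +o N" using c by blast
  qed
  then show ?thesis by (simp add: quot_def)
qed

lemma pi_M'_T: "\<exists>s. scE (\<pi> ^ s) ` M' \<subseteq> T"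
  using pi_M'_T_filt unfolding T_tilde_def by blast

lemma T_unipotent_mult: "U - id \<in> T \<Longrightarrow> Z \<in> T \<Longrightarrow> U \<circ> Z \<in> T" "U - id \<in> T \<Longrightarrow> Z \<in> T \<Longrightarrow> Z \<circ> U \<in> T"
proof -
  assume U: "U - id \<in> T" and Z: "Z \<in> T"
  have "U \<circ> Z = ((U - id) \<circ> Z) + Z" by (simp add: fun_eq_iff)
  then show "U \<circ> Z \<in> T" using E.submodD(2)[OF submod_T T_comp[OF U Z] Z] by simp
  have "Z \<circ> U = (Z \<circ> (U - id)) + Z" using lin_diff[OF T_lin[OF Z]] by (simp add: fun_eq_iff)
  then show "Z \<circ> U \<in> T" using E.submodD(2)[OF submod_T T_comp[OF Z U] Z] by simp
qed

lemma unipotent_lin: "U - id \<in> T \<Longrightarrow> lin U"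
  using lin_plus[OF T_lin lin_id(1), of "U - id"] by simp

lemma unipotent_ad: "U - id \<in> T \<Longrightarrow> ad U - id \<in> T"
  using T_ad[of "U - id"] ad_minus[OF unipotent_lin lin_id(1), of U] by (simp add: ad_id)

lemma unipotent_comp: "U - id \<in> T \<Longrightarrow> V - id \<in> T \<Longrightarrow> (U \<circ> V) - id \<in> T"
proof -
  assume U: "U - id \<in> T" and V: "V - id \<in> T"
  have eq: "(U \<circ> V) - id = ((U - id) \<circ> V) + (V - id)" by (simp add: fun_eq_iff)
  show ?thesis unfolding eq by (rule E.submodD(2)[OF submod_T T_unipotent_mult(2)[OF V U] V])
qed

text \<open>The A-points of the unit group of M: the inverse has to lie in 1 + T as well.\<close>

definition U1 :: "('v \<Rightarrow> 'v) set" where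
  "U1 = {U. U - id \<in> T \<and> (\<exists>Z. Z - id \<in> T \<and> U \<circ> Z = id \<and> Z \<circ> U = id)}"

lemma U1_unipotent: "U \<in> U1 \<Longrightarrow> U - id \<in> T" by (simp add: U1_def)

lemma U1_comp: "U \<in> U1 \<Longrightarrow> V \<in> U1 \<Longrightarrow> U \<circ> V \<in> U1"
proof -
  assume "U \<in> U1" "V \<in> U1"
  then obtain U' V' where *: "U - id \<in> T" "V - id \<in> T" "U' - id \<in> T" "V' - id \<in> T"
    "U \<circ> U' = id" "U' \<circ> U = id" "V \<circ> V' = id" "V' \<circ> V = id" by (auto simp: U1_def)
  have "(U \<circ> V) \<circ> (V' \<circ> U') = U \<circ> (V \<circ> V') \<circ> U'" "(V' \<circ> U') \<circ> (U \<circ> V) = V' \<circ> (U' \<circ> U) \<circ> V"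
    by (simp_all only: comp_assoc)
  then have "(U \<circ> V) \<circ> (V' \<circ> U') = id" "(V' \<circ> U') \<circ> (U \<circ> V) = id" using * by simp_all
  then show ?thesis using unipotent_comp * unfolding U1_def by blast
qed

lemma U1_inverse: "U \<in> U1 \<Longrightarrow> \<exists>V\<in>U1. U \<circ> V = id \<and> V \<circ> U = id"
  unfolding U1_def by blast

lemma U1_near: "Y \<in> scE \<pi> ` T \<Longrightarrow> id + Y \<in> U1"
proof -
  assume Y: "Y \<in> scE \<pi> ` T"
  obtain s where s: "scE (\<pi> ^ s) ` M' \<subseteq> T" using pi_M'_T by blast
  have "Y \<in> T" using Y E.scale_image_subset[OF submod_T A_pi] by blast
  moreover obtain Z where "Z - id \<in> T" "(id + Y) \<circ> Z = id" "Z \<circ> (id + Y) = id"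
    using near_unit[OF submod_T T_sub_M' T_comp s Y] by blast
  ultimately show ?thesis by (auto simp: U1_def)
qed

text \<open>U + Y = U (1 + U^(-1) Y), so membership in \<open>U1\<close> depends only on the class
  modulo \<pi>T.\<close>

lemma U1_add: "U \<in> U1 \<Longrightarrow> Y \<in> scE \<pi> ` T \<Longrightarrow> U + Y \<in> U1"
proof -
  assume U: "U \<in> U1" and Y: "Y \<in> scE \<pi> ` T"
  obtain V where V: "V \<in> U1" "U \<circ> V = id" using U1_inverse[OF U] by blast
  obtain Z where Z: "Z \<in> T" "Y = scE \<pi> Z" using Y by blast
  have linV: "lin V" "lin U" using unipotent_lin U1_unipotent U V(1) by blast+
  have eq: "V \<circ> Y = scE \<pi> (V \<circ> Z)" unfolding Z(2) by (rule comp_scE[OF linV(1)])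
  have "V \<circ> Y \<in> scE \<pi> ` T"
    unfolding eq by (rule imageI[of _ _ "scE \<pi>", OF T_unipotent_mult(1)[OF U1_unipotent[OF V(1)] Z(1)]])
  then have "U \<circ> (id + (V \<circ> Y)) \<in> U1" by (intro U1_comp[OF U] U1_near)
  also have "U \<circ> (id + (V \<circ> Y)) = U + Y"
    unfolding comp_plus[OF linV(2)] comp_assoc[symmetric] V(2) by simp
  finally show ?thesis .
qed

lemma pullback_HT: "f \<in> HT \<Longrightarrow> U - id \<in> T \<Longrightarrow> pullback f U \<in> HT"
proof -
  assume f: "f \<in> HT" and U: "U - id \<in> T"
  then obtain Z where Z: "Z \<in> T" "f = psi D Z" by (auto simp: H_tilde_def)
  have "ad U \<circ> Z \<circ> U \<in> T"
    by (intro T_unipotent_mult(2)[OF U] T_unipotent_mult(1)[OF unipotent_ad[OF U]] Z)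
  then show ?thesis using pullback_psi[OF unipotent_lin[OF U], of Z] Z(2) by (simp add: H_tilde_def)
qed

lemma submod_pi_HT: "H.submod (scH c ` HT)"
  by (rule H.submod_scale_image[OF submod_HT])

lemma submod_pi_T: "E.submod (scE c ` T)"
  by (rule E.submod_scale_image[OF submod_T])

lemma pullback_pi_HT: "f \<in> scH c ` HT \<Longrightarrow> U - id \<in> T \<Longrightarrow> pullback f U \<in> scH c ` HT"
proof -
  assume "f \<in> scH c ` HT" and U: "U - id \<in> T"
  then obtain g where g: "g \<in> HT" "f = scH c g" by blast
  show ?thesis unfolding g(2) pullback_pi by (rule imageI[of _ _ "scH c", OF pullback_HT[OF g(1) U]])
qed

lemma comp_pi_T: "Y \<in> scE c ` T \<Longrightarrow> U - id \<in> T \<Longrightarrow> Y \<circ> U \<in> scE c ` T"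
proof -
  assume "Y \<in> scE c ` T" and U: "U - id \<in> T"
  then obtain Z where Z: "Z \<in> T" "Y = scE c Z" by blast
  have eq: "scE c Z \<circ> U = scE c (Z \<circ> U)" by (simp add: fun_eq_iff)
  show ?thesis unfolding Z(2) eq by (rule imageI[of _ _ "scE c", OF T_unipotent_mult(2)[OF U Z(1)]])
qed

lemma scH_image_mono: "H.submod \<Lambda> \<Longrightarrow> f \<in> \<Lambda> \<Longrightarrow> k \<le> l \<Longrightarrow> scH (\<pi> ^ l) f \<in> scH (\<pi> ^ k) ` \<Lambda>"
proof -
  assume L: "H.submod \<Lambda>" and f: "f \<in> \<Lambda>" and kl: "k \<le> l"
  have eq: "scH (\<pi> ^ l) f = scH (\<pi> ^ k) (scH (\<pi> ^ (l - k)) f)"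
    unfolding scH_scH using kl by (simp flip: power_add)
  show ?thesis
    unfolding eq by (rule imageI[of _ _ "scH (\<pi> ^ k)", OF H.submodD(3)[OF L A_power[OF A_pi] f]])
qed

lemma scE_image_Suc: "E.submod \<Lambda> \<Longrightarrow> j \<ge> 1 \<Longrightarrow> Y \<in> scE (\<pi> ^ j) ` \<Lambda> \<Longrightarrow> Y \<in> scE \<pi> ` \<Lambda>"
proof -
  assume L: "E.submod \<Lambda>" and j: "j \<ge> 1" and "Y \<in> scE (\<pi> ^ j) ` \<Lambda>"
  then obtain Z where Z: "Z \<in> \<Lambda>" "Y = scE (\<pi> ^ j) Z" by blast
  obtain i where "j = Suc i" using j by (cases j) auto
  then have eq: "Y = scE \<pi> (scE (\<pi> ^ i) Z)" unfolding Z(2) by simp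
  show ?thesis
    unfolding eq by (rule imageI[of _ _ "scE \<pi>", OF E.submodD(3)[OF L A_power[OF A_pi] Z(1)]])
qed

lemma del_plus_pi:
  assumes U: "lin U" and Y: "lin Y"
  shows "del (U + scE (\<pi> ^ k) Y) - del U = scH (\<pi> ^ k) (psi D (ad U \<circ> Y)) + scH (\<pi> ^ (k + k)) (phi D Y)"
  unfolding del_plus[OF U lin_scE[OF Y]] comp_scE[OF lin_ad[OF U]] psi_scE phi_scE power_add
  by (rule add_diff_cancel_left')

lemma del_near:
  assumes U: "U - id \<in> T" and d: "V - U \<in> scE (\<pi> ^ k) ` T"
  shows "del V - del U \<in> scH (\<pi> ^ k) ` HT"
proof -
  obtain Y where Y: "Y \<in> T" "V = U + scE (\<pi> ^ k) Y" using d by (auto simp: algebra_simps)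
  have "psi D (ad U \<circ> Y) \<in> HT"
    unfolding H_tilde_def by (intro imageI T_unipotent_mult(1)[OF unipotent_ad[OF U] Y(1)])
  from scH_image_mono[OF submod_HT this order_refl] scH_image_mono[OF submod_HT phi_T[OF Y(1)], of k "k + k"]
  show ?thesis
    unfolding Y(2) del_plus_pi[OF unipotent_lin[OF U] T_lin[OF Y(1)]]
    by (intro H.submodD(2)[OF submod_pi_HT]) simp_all
qed

lemma del_near_M':
  assumes U: "U \<in> M'" and d: "V - U \<in> scE (\<pi> ^ k) ` M'"
  shows "del V - del U \<in> scH (\<pi> ^ k) ` H'"
proof -
  obtain Y where Y: "Y \<in> M'" "V = U + scE (\<pi> ^ k) Y" using d by (auto simp: algebra_simps)
  from scH_image_mono[OF submod_H' psi_cross_M'[OF U Y(1)] order_refl]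
    scH_image_mono[OF submod_H' phi_M'[OF Y(1)], of k "k + k"]
  show ?thesis
    unfolding Y(2) del_plus_pi[OF M'_lin[OF U] M'_lin[OF Y(1)]]
    by (intro H.submodD(2)[OF submod_pi_H']) simp_all
qed

text \<open>For j >= 1, lifts of the points of the smooth model over A / \<pi>^j: in contrast to
  \<open>S\<close>, the form is preserved modulo \<pi>^j \<open>H_tilde\<close> instead of \<pi>^j
  \<open>H'\<close>.\<close>

definition S' :: "nat \<Rightarrow> ('v \<Rightarrow> 'v) set" where
  "S' j = {U \<in> U1. del U \<in> scH (\<pi> ^ j) ` HT}"

lemma S'_comp: "U \<in> S' j \<Longrightarrow> V \<in> S' j \<Longrightarrow> U \<circ> V \<in> S' j"
  using U1_comp pullback_pi_HT[OF _ U1_unipotent] H.submodD(2)[OF submod_pi_HT]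
  by (simp add: S'_def del_comp)

lemma S'_inverse: "U \<in> S' j \<Longrightarrow> \<exists>V\<in>S' j. U \<circ> V = id \<and> V \<circ> U = id"
proof -
  assume U: "U \<in> S' j"
  then obtain V where V: "V \<in> U1" "U \<circ> V = id" "V \<circ> U = id" using U1_inverse by (auto simp: S'_def)
  have "pullback (del U) V \<in> scH (\<pi> ^ j) ` HT"
    using U pullback_pi_HT[OF _ U1_unipotent[OF V(1)]] by (simp add: S'_def)
  moreover have "del V = - pullback (del U) V"
    using del_comp[of U V] V(2) del_id by (simp add: eq_neg_iff_add_eq_0 add.commute)
  ultimately have "V \<in> S' j" using V(1) H.submodD(4)[OF submod_pi_HT] by (simp add: S'_def)
  then show ?thesis using V by blast
qed

lemma id_plus_del:
  assumes Y: "Y \<in> T"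
  shows "del (id + scE (\<pi> ^ j) Y) = scH (\<pi> ^ j) (psi D Y) + scH (\<pi> ^ (j + j)) (phi D Y)"
  using del_plus_pi[OF lin_id(1) T_lin[OF Y], of j] by (simp add: del_id ad_id)

text \<open>The value \<pi>^j psi(Y) is attained by 1 + \<pi>^j Y up to \<pi>^(2 j) phi(Y). As
  phi(Y) lies in \<open>H_tilde\<close> and j >= 1, the error vanishes modulo \<pi>^(j + 1)
  \<open>H_tilde\<close>. This is smoothness of the model in counting form.\<close>

lemma card_S'_step:
  assumes j: "j \<ge> 1"
  shows "card (quot (S' j) (scE (\<pi> ^ Suc j) ` T)) =
    card (quot (S' (Suc j)) (scE (\<pi> ^ Suc j) ` T)) * card (quot (scH (\<pi> ^ j) ` HT) (scH (\<pi> ^ Suc j) ` HT))"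
proof -
  let ?P = "scH (\<pi> ^ Suc j) ` HT"
  have "card (quot (S' j) (scE (\<pi> ^ Suc j) ` T)) =
    card (quot {U \<in> S' j. del U \<in> ?P} (scE (\<pi> ^ Suc j) ` T)) * card (quot (scH (\<pi> ^ j) ` HT) ?P)"
  proof (rule coset_count)
    show "lin U" if "U \<in> S' j" for U using that unipotent_lin U1_unipotent by (auto simp: S'_def)
    show "del U - del V \<in> ?P" if "U \<in> S' j" "V \<in> S' j" "U - V \<in> scE (\<pi> ^ Suc j) ` T" for U V
      using that U1_unipotent by (intro del_near) (auto simp: S'_def)
    fix f assume "f \<in> scH (\<pi> ^ j) ` HT"
    then obtain Y where Y: "Y \<in> T" "f = scH (\<pi> ^ j) (psi D Y)" by (auto simp: H_tilde_def)
    let ?U = "id + scE (\<pi> ^ j) Y"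
    have "scE (\<pi> ^ j) Y \<in> scE (\<pi> ^ j) ` T" by (rule imageI[of _ _ "scE (\<pi> ^ j)", OF Y(1)])
    then have "?U \<in> U1" by (intro U1_near scE_image_Suc[OF submod_T j])
    moreover have "del ?U \<in> scH (\<pi> ^ j) ` HT"
      unfolding id_plus_del[OF Y(1)] using Y(1)
      by (intro H.submodD(2)[OF submod_pi_HT] scH_image_mono[OF submod_HT] phi_T) (auto simp: H_tilde_def)
    moreover have "del ?U - f \<in> ?P"
      unfolding id_plus_del[OF Y(1)] Y(2) using scH_image_mono[OF submod_HT phi_T[OF Y(1)], of "Suc j" "j + j"] j
      by simp
    ultimately show "\<exists>U\<in>S' j. del U - f \<in> ?P" by (auto simp: S'_def)
  qed (use S'_comp S'_inverse E.submod_subgroup[OF submod_pi_T] H.submod_subgroup[OF submod_pi_HT]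
      comp_pi_T pullback_pi_HT U1_unipotent in \<open>auto simp: S'_def\<close>)
  also have "{U \<in> S' j. del U \<in> ?P} = S' (Suc j)"
  proof -
    have "?P \<subseteq> scH (\<pi> ^ j) ` HT" using scH_image_mono[OF submod_HT, of _ j "Suc j"] by auto
    then show ?thesis by (auto simp: S'_def)
  qed
  finally show ?thesis .
qed

lemma S'_add: "j \<ge> 1 \<Longrightarrow> U \<in> S' j \<Longrightarrow> Y \<in> scE (\<pi> ^ j) ` T \<Longrightarrow> U + Y \<in> S' j"
proof -
  assume j: "j \<ge> 1" and U: "U \<in> S' j" and Y: "Y \<in> scE (\<pi> ^ j) ` T"
  have "U + Y \<in> U1" using U scE_image_Suc[OF submod_T j Y] U1_add by (auto simp: S'_def)
  moreover have d: "del (U + Y) - del U \<in> scH (\<pi> ^ j) ` HT"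
    using U U1_unipotent Y by (intro del_near) (auto simp: S'_def)
  have dU: "del U \<in> scH (\<pi> ^ j) ` HT" using U by (simp add: S'_def)
  from d dU have "(del (U + Y) - del U) + del U \<in> scH (\<pi> ^ j) ` HT"
    by (rule H.submodD(2)[OF submod_pi_HT])
  ultimately show ?thesis by (simp add: S'_def)
qed

lemma scE_Suc_image: "scE (\<pi> ^ Suc j) ` \<Lambda> = scE (\<pi> ^ j) ` scE \<pi> ` \<Lambda>"
  unfolding scE_scE by (simp add: mult.commute)

lemma scH_Suc_image: "scH (\<pi> ^ Suc j) ` \<Lambda> = scH (\<pi> ^ j) ` scH \<pi> ` \<Lambda>"
  by (simp add: image_image mult.commute)

lemma pi_pow_nz: "\<pi> ^ j \<noteq> 0" using pi_nz by simp

lemma card_S'_tower: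
  assumes j: "j \<ge> 1"
  shows "card (quot (S' j) (scE (\<pi> ^ Suc j) ` T)) =
    card (quot (S' j) (scE (\<pi> ^ j) ` T)) * card (quot T (scE \<pi> ` T))"
proof -
  have sub: "scE (\<pi> ^ Suc j) ` T \<subseteq> scE (\<pi> ^ j) ` T"
    unfolding scE_Suc_image by (intro image_mono E.scale_image_subset submod_T A_pi)
  have "card (quot (S' j) (scE (\<pi> ^ Suc j) ` T)) =
    card (quot (S' j) (scE (\<pi> ^ j) ` T)) * card (quot (scE (\<pi> ^ j) ` T) (scE (\<pi> ^ Suc j) ` T))"
    by (rule quot_tower(1)[OF E.submod_subgroup[OF submod_pi_T] E.submod_subgroup[OF submod_pi_T] sub])
      (rule S'_add[OF j])
  also have "card (quot (scE (\<pi> ^ j) ` T) (scE (\<pi> ^ Suc j) ` T)) = card (quot T (scE \<pi> ` T))"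
    unfolding scE_Suc_image by (rule E.scale_quot(1)[OF pi_pow_nz submod_pi_T])
  finally show ?thesis .
qed

text \<open>A lattice in the Lie algebra of G.\<close>

definition T0 :: "('v \<Rightarrow> 'v) set" where "T0 = {Y \<in> T. psi D Y = 0}"

lemma submod_T0: "E.submod T0"
proof -
  have "psi D (scE a x) = 0" if "psi D x = 0" for a x unfolding psi_scE that by (simp add: fun_eq_iff)
  then show ?thesis
    using E.submodD[OF submod_T] unfolding E.submod_def T0_def by (auto simp: psi_zero psi_add)
qed

lemma finite_quot_T: "finite (quot T (scE (\<pi> ^ s) ` T))"
proof -
  obtain t where t: "scE (\<pi> ^ t) ` M' \<subseteq> T" using pi_M'_T by blast
  have "scE (\<pi> ^ (s + t)) ` M' \<subseteq> scE (\<pi> ^ s) ` T"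
    unfolding power_add scE_scE[symmetric] by (rule image_mono[OF t])
  then show ?thesis
    by (intro finite_quot_mono[OF _ _ _ T_sub_M' finite_quot_M'[of "s + t"]] E.submod_subgroup submod_pi_T
        E.submod_scale_image submod_M')
qed

lemma finite_quot_HT: "finite (quot HT (scH (\<pi> ^ s) ` HT))"
proof -
  have "quot HT (scH (\<pi> ^ s) ` HT) = (\<lambda>C. \<Union>Y\<in>C. psi D Y +o scH (\<pi> ^ s) ` HT) ` quot T (scE (\<pi> ^ s) ` T)"
  proof -
    have "(\<Union>Z\<in>Y +o scE (\<pi> ^ s) ` T. psi D Z +o scH (\<pi> ^ s) ` HT) = psi D Y +o scH (\<pi> ^ s) ` HT" for Y
    proof -
      have "psi D Z +o scH (\<pi> ^ s) ` HT = psi D Y +o scH (\<pi> ^ s) ` HT" if "Z \<in> Y +o scE (\<pi> ^ s) ` T" for Z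
      proof -
        obtain V where V: "V \<in> T" "Z - Y = scE (\<pi> ^ s) V" using \<open>Z \<in> _\<close> by (auto simp: elt_coset_iff)
        have "psi D Z - psi D Y = scH (\<pi> ^ s) (psi D V)" unfolding psi_minus[symmetric] V(2) psi_scE ..
        then have "psi D Z - psi D Y \<in> scH (\<pi> ^ s) ` HT" using V(1) by (auto simp: H_tilde_def)
        then show ?thesis using coset_eq_iff[OF H.submod_subgroup[OF submod_pi_HT]] by blast
      qed
      moreover have "Y \<in> Y +o scE (\<pi> ^ s) ` T"
        using E.submodD(1)[OF submod_pi_T] by (simp add: elt_coset_iff)
      ultimately show ?thesis by blast
    qed
    then show ?thesis by (simp add: quot_def image_image H_tilde_def)
  qed
  then show ?thesis using finite_quot_T by simp
qed

text \<open>As the kernel of a map into a torsion-free module, \<open>T0\<close> is saturated in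
  \<open>T\<close>; hence the sequence 0 -> T0 -> T -> H_tilde -> 0 stays exact modulo
  \<pi>.\<close>

lemma card_quot_T_split:
  "card (quot T (scE \<pi> ` T)) = card (quot HT (scH \<pi> ` HT)) * card (quot T0 (scE \<pi> ` T0))"
proof -
  \<comment> \<open>The preimage of \<pi> \<open>H_tilde\<close> under \<open>psi\<close>.\<close>
  define M where "M = {Y + Z | Y Z. Y \<in> T0 \<and> Z \<in> scE \<pi> ` T}"
  let ?N = "scE \<pi> ` T"
  have N: "add_subgroup ?N" by (intro E.submod_subgroup submod_pi_T)
  have M: "add_subgroup M"
  proof -
    have "0 + 0 \<in> M" unfolding M_def using E.submodD(1)[OF submod_T0] E.submodD(1)[OF submod_pi_T] by blast
    moreover have "x - y \<in> M" if xy: "x \<in> M" "y \<in> M" for x y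
    proof -
      obtain Y Z Y' Z' where *: "Y \<in> T0" "Z \<in> ?N" "Y' \<in> T0" "Z' \<in> ?N" "x = Y + Z" "y = Y' + Z'"
        using xy unfolding M_def by blast
      have "x - y = (Y - Y') + (Z - Z')" using * by simp
      then show ?thesis unfolding M_def
        using E.submodD(5)[OF submod_T0 *(1,3)] E.submodD(5)[OF submod_pi_T *(2,4)] by blast
    qed
    ultimately show ?thesis by (simp add: add_subgroup_def)
  qed
  have NM: "?N \<subseteq> M"
  proof
    fix Z assume "Z \<in> ?N"
    then have "0 + Z \<in> M" unfolding M_def using E.submodD(1)[OF submod_T0] by blast
    then show "Z \<in> M" by simp
  qed
  have MT: "M \<subseteq> T"
    unfolding M_def T0_def using E.submodD(2)[OF submod_T] E.scale_image_subset[OF submod_T A_pi] by blast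
  have 1: "card (quot T ?N) = card (quot T M) * card (quot M ?N)"
    by (rule quot_tower(1)[OF M N NM]) (use MT E.submodD(2)[OF submod_T] in blast)
  have "card (quot (psi D ` T) (scH \<pi> ` HT)) = card (quot T M)"
  proof (rule quot_image_additive(1)[OF M])
    show "add_subgroup (scH \<pi> ` HT)" by (intro H.submod_subgroup submod_pi_HT)
    fix x y assume xy: "x \<in> T" "y \<in> T"
    show "psi D x - psi D y \<in> scH \<pi> ` HT \<longleftrightarrow> x - y \<in> M"
    proof
      assume "psi D x - psi D y \<in> scH \<pi> ` HT"
      then obtain Z where Z: "Z \<in> T" "psi D (x - y) = scH \<pi> (psi D Z)" by (auto simp: H_tilde_def psi_minus)
      have "psi D ((x - y) - scE \<pi> Z) = psi D (x - y) - scH \<pi> (psi D Z)" unfolding psi_minus psi_scE ..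
      also have "\<dots> = 0" using Z(2) by simp
      finally have "psi D ((x - y) - scE \<pi> Z) = 0" .
      moreover have sZ: "scE \<pi> Z \<in> ?N" by (rule imageI[of _ _ "scE \<pi>", OF Z(1)])
      moreover have "(x - y) - scE \<pi> Z \<in> T"
        using E.submodD(5)[OF submod_T E.submodD(5)[OF submod_T xy]] sZ E.scale_image_subset[OF submod_T A_pi] by blast
      ultimately have "(x - y) - scE \<pi> Z \<in> T0" by (simp add: T0_def)
      then have "((x - y) - scE \<pi> Z) + scE \<pi> Z \<in> M" unfolding M_def using sZ by blast
      then show "x - y \<in> M" by simp
    next
      assume "x - y \<in> M"
      then obtain Y Z where YZ: "Y \<in> T0" "Z \<in> T" "x - y = Y + scE \<pi> Z" unfolding M_def by blast
      have "psi D x - psi D y = scH \<pi> (psi D Z)"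
        unfolding psi_minus[symmetric] YZ(3) psi_add psi_scE using YZ(1) by (simp add: T0_def)
      then show "psi D x - psi D y \<in> scH \<pi> ` HT" using YZ(2) by (auto simp: H_tilde_def)
    qed
  qed
  then have 2: "card (quot T M) = card (quot HT (scH \<pi> ` HT))" by (simp add: H_tilde_def)
  have "quot M ?N = quot T0 ?N"
  proof
    show "quot M ?N \<subseteq> quot T0 ?N"
    proof
      fix C assume "C \<in> quot M ?N"
      then obtain Y Z where "Y \<in> T0" "Z \<in> ?N" "C = (Y + Z) +o ?N" by (auto simp: quot_def M_def)
      moreover from this have "C = Y +o ?N" using coset_eq_iff[OF N] by simp
      ultimately show "C \<in> quot T0 ?N" by (auto simp: quot_def)
    qed
    have "T0 \<subseteq> M"
    proof
      fix Y assume "Y \<in> T0"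
      then have "Y + 0 \<in> M" unfolding M_def using E.submodD(1)[OF submod_pi_T] by blast
      then show "Y \<in> M" by simp
    qed
    then show "quot T0 ?N \<subseteq> quot M ?N" unfolding quot_def by (rule image_mono)
  qed
  \<comment> \<open>Saturation: \<open>T0\<close> meets \<pi>T in \<pi>T0.\<close>
  moreover have "card (quot (id ` T0) ?N) = card (quot T0 (scE \<pi> ` T0))"
  proof (rule quot_image_additive(1)[OF _ N])
    show "add_subgroup (scE \<pi> ` T0)" by (intro E.submod_subgroup E.submod_scale_image submod_T0)
    fix x y assume xy: "x \<in> T0" "y \<in> T0"
    have psi0: "psi D (x - y) = 0" using xy by (simp add: T0_def psi_minus)
    show "id x - id y \<in> ?N \<longleftrightarrow> x - y \<in> scE \<pi> ` T0"
    proof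
      assume "id x - id y \<in> ?N"
      then obtain Z where Z: "Z \<in> T" "x - y = scE \<pi> Z" by auto
      have "scH \<pi> (psi D Z) = 0" using psi0 unfolding Z(2) psi_scE .
      then have "psi D Z = 0" using pi_nz by (simp add: fun_eq_iff)
      then show "x - y \<in> scE \<pi> ` T0" using Z by (auto simp: T0_def)
    qed (auto simp: T0_def)
  qed
  ultimately show ?thesis using 1 2 by simp
qed

lemma T0_basis: "\<exists>Bs. finite Bs \<and> E.independent Bs \<and> Bs \<subseteq> T0 \<and> T0 \<subseteq> E.span Bs"
proof -
  obtain Bs where Bs: "Bs \<subseteq> T0" "E.independent Bs" "T0 \<subseteq> E.span Bs" by (rule E.maximal_independent_subset)
  have "T0 \<subseteq> E.genA GM" using T_sub_M' GM(2) by (auto simp: T0_def)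
  then have "finite Bs" using E.lattice_in_span(1)[OF GM(1) _ Bs(2) _ Bs(3)] Bs(1) by blast
  then show ?thesis using Bs by blast
qed

text \<open>By \<open>psi_kernel_span\<close> a basis of the whole Lie algebra over F; its
  cardinality will turn out to be the dimension of G.\<close>

definition Bs :: "('v \<Rightarrow> 'v) set" where
  "Bs = (SOME Bs. finite Bs \<and> E.independent Bs \<and> Bs \<subseteq> T0 \<and> T0 \<subseteq> E.span Bs)"

lemma Bs: "finite Bs" "E.independent Bs" "Bs \<subseteq> T0" "T0 \<subseteq> E.span Bs"
  using someI_ex[OF T0_basis] unfolding Bs_def[symmetric] by blast+

lemma card_quot_T0: "card (quot T0 (scE \<pi> ` T0)) = q ^ card Bs"
proof -
  have "T0 \<subseteq> E.genA GM" using T_sub_M' GM(2) by (auto simp: T0_def)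
  then obtain s where "scE (\<pi> ^ s) ` T0 \<subseteq> E.genA Bs"
    using E.lattice_in_span(2)[OF GM(1) _ Bs(2) _ Bs(4)] Bs(3) by blast
  then show ?thesis by (rule E.card_quot_lattice[OF submod_T0 Bs(1-3)])
qed

text \<open>\<open>S' j\<close> modulo \<pi>^(j + 1) T is counted twice, by the values of
  \<open>del\<close> and by the classes modulo \<pi>^j T. The index of \<pi> \<open>H_tilde\<close>
  in \<open>H_tilde\<close> occurs in both counts and cancels.\<close>

lemma card_S'_Suc:
  assumes j: "j \<ge> 1"
  shows "card (quot (S' (Suc j)) (scE (\<pi> ^ Suc j) ` T)) = card (quot (S' j) (scE (\<pi> ^ j) ` T)) * q ^ card Bs"
proof -
  let ?h = "card (quot HT (scH \<pi> ` HT))"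
  have "finite (quot HT (scH \<pi> ` HT))" using finite_quot_HT[of 1] by simp
  then have h: "?h > 0" using H.submodD(1)[OF submod_HT] by (auto simp: card_gt_0_iff quot_def)
  have "card (quot (scH (\<pi> ^ j) ` HT) (scH (\<pi> ^ Suc j) ` HT)) = ?h"
    unfolding scH_Suc_image by (rule H.scale_quot(1)[OF pi_pow_nz submod_pi_HT])
  then have "card (quot (S' (Suc j)) (scE (\<pi> ^ Suc j) ` T)) * ?h =
    card (quot (S' j) (scE (\<pi> ^ j) ` T)) * (?h * q ^ card Bs)"
    using card_S'_step[OF j] card_S'_tower[OF j] card_quot_T_split card_quot_T0 by simp
  then have "?h * card (quot (S' (Suc j)) (scE (\<pi> ^ Suc j) ` T)) =
    ?h * (card (quot (S' j) (scE (\<pi> ^ j) ` T)) * q ^ card Bs)" by (simp only: mult_ac)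
  then show ?thesis using h by simp
qed

lemma card_S'_eq:
  "card (quot (S' (Suc j)) (scE (\<pi> ^ Suc j) ` T)) = card (quot (S' 1) (scE \<pi> ` T)) * q ^ (j * card Bs)"
proof (induction j)
  case (Suc j)
  then show ?case using card_S'_Suc[of "Suc j"] by (simp add: power_add mult_ac)
qed simp

text \<open>For f = \<pi>^k f0 the form \<pi>^(2 kb) f0 is psi(Y), so 1 + \<pi>^(k - 2 kb) Y attains
  f up to \<pi>^(2 k - 4 kb) phi(Y). The bound on k makes this error vanish modulo \<pi>^k
  \<open>H_tilde\<close>.\<close>

lemma card_S_fibre:
  assumes k: "k \<ge> 4 * kb + 1"
  shows "card (quot (S k) (scE (\<pi> ^ k) ` T)) = card (quot (S' k) (scE (\<pi> ^ k) ` T)) * card (quot H' HT)"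
proof -
  let ?P = "scH (\<pi> ^ k) ` HT"
  have k2: "k \<ge> 2 * kb + 1" using k by simp
  have SU: "U \<in> U1" if "U \<in> S k" for U
    using S_sub_T[OF that k2] S_unit[OF that k2] S_sub_T[OF _ k2] unfolding U1_def by blast
  have "card (quot (S k) (scE (\<pi> ^ k) ` T)) =
    card (quot {U \<in> S k. del U \<in> ?P} (scE (\<pi> ^ k) ` T)) * card (quot (scH (\<pi> ^ k) ` H') ?P)"
  proof (rule coset_count)
    show "lin U" if "U \<in> S k" for U using that M'_lin by (auto simp: S_def)
    show "\<exists>V\<in>S k. U \<circ> V = id \<and> V \<circ> U = id" if "U \<in> S k" for U by (rule S_unit[OF that k2])
    show "del U - del V \<in> ?P" if "U \<in> S k" "V \<in> S k" "U - V \<in> scE (\<pi> ^ k) ` T" for U V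
      using that U1_unipotent SU by (intro del_near) auto
    show "Y \<circ> U \<in> scE (\<pi> ^ k) ` T" if "Y \<in> scE (\<pi> ^ k) ` T" "U \<in> S k" for Y U
      by (rule comp_pi_T[OF that(1) U1_unipotent[OF SU[OF that(2)]]])
    show "pullback f U \<in> ?P" if "f \<in> ?P" "U \<in> S k" for f U
      by (rule pullback_pi_HT[OF that(1) U1_unipotent[OF SU[OF that(2)]]])
    show "add_subgroup (scE (\<pi> ^ k) ` T)" by (intro E.submod_subgroup submod_pi_T)
    show "add_subgroup ?P" by (intro H.submod_subgroup submod_pi_HT)
    show "U \<circ> V \<in> S k" if "U \<in> S k" "V \<in> S k" for U V by (rule S_comp[OF that])
    show "del U \<in> scH (\<pi> ^ k) ` H'" if "U \<in> S k" for U using that by (simp add: S_def)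
    fix f assume "f \<in> scH (\<pi> ^ k) ` H'"
    then obtain f0 where f0: "f0 \<in> H'" "f = scH (\<pi> ^ k) f0" by blast
    obtain Y where Y: "Y \<in> T1" "scH (\<pi> ^ (2 * kb)) f0 = psi D Y" using kb2[OF f0(1) order_refl] by (rule imageE)
    have YT: "Y \<in> T" using Y(1) T1_sub(2) by blast
    define c where "c = k - 2 * kb"
    have kc: "k = c + 2 * kb" "c + c \<ge> k" using k by (auto simp: c_def)
    have f: "f = scH (\<pi> ^ c) (psi D Y)"
      unfolding f0(2) Y(2)[symmetric] scH_scH kc(1) by (simp add: power_add)
    let ?U = "id + scE (\<pi> ^ c) Y"
    have small: "scH (\<pi> ^ (c + c)) (phi D Y) \<in> ?P"
      by (rule scH_image_mono[OF submod_HT phi_T[OF YT] kc(2)])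
    have d: "del ?U - f \<in> ?P" unfolding id_plus_del[OF YT] f using small by simp
    have "?P \<subseteq> scH (\<pi> ^ k) ` H'" by (rule image_mono[OF HT_sub_H'])
    then have "(del ?U - f) + f \<in> scH (\<pi> ^ k) ` H'"
      using d \<open>f \<in> _\<close> by (intro H.submodD(2)[OF submod_pi_H']) auto
    moreover have "?U \<in> M'"
      using YT T_sub_M' by (intro E.submodD(2)[OF submod_M' M'_id] E.submodD(3)[OF submod_M']) auto
    ultimately have "?U \<in> S k" by (simp add: S_def)
    then show "\<exists>U\<in>S k. del U - f \<in> ?P" using d by blast
  qed
  also have "{U \<in> S k. del U \<in> ?P} = S' k"
  proof -
    have "U1 \<subseteq> M'"
    proof
      fix U assume "U \<in> U1"
      then have "(U - id) + id \<in> M'" using U1_unipotent T_sub_M' by (intro E.submodD(2)[OF submod_M' _ M'_id]) blast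
      then show "U \<in> M'" by simp
    qed
    moreover have "?P \<subseteq> scH (\<pi> ^ k) ` H'" by (rule image_mono[OF HT_sub_H'])
    ultimately show ?thesis using SU by (auto simp: S'_def S_def)
  qed
  also have "card (quot (scH (\<pi> ^ k) ` H') ?P) = card (quot H' HT)"
    by (rule H.scale_quot(1)[OF pi_pow_nz submod_HT])
  finally show ?thesis .
qed

lemma S_add: "U \<in> S k \<Longrightarrow> Y \<in> scE (\<pi> ^ k) ` M' \<Longrightarrow> U + Y \<in> S k"
proof -
  assume U: "U \<in> S k" and Y: "Y \<in> scE (\<pi> ^ k) ` M'"
  have "Y \<in> M'" using Y E.scale_image_subset[OF submod_M' A_power[OF A_pi]] by blast
  then have "U + Y \<in> M'" using U E.submodD(2)[OF submod_M'] by (auto simp: S_def)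
  moreover have d: "del (U + Y) - del U \<in> scH (\<pi> ^ k) ` H'"
    using U Y by (intro del_near_M') (auto simp: S_def)
  have dU: "del U \<in> scH (\<pi> ^ k) ` H'" using U by (simp add: S_def)
  from d dU have "(del (U + Y) - del U) + del U \<in> scH (\<pi> ^ k) ` H'"
    by (rule H.submodD(2)[OF submod_pi_H'])
  ultimately show ?thesis by (simp add: S_def)
qed

lemma card_S_tower:
  "card (quot (S k) (scE (\<pi> ^ k) ` T)) = card (quot (S k) (scE (\<pi> ^ k) ` M')) * card (quot M' T)"
proof -
  have "card (quot (S k) (scE (\<pi> ^ k) ` T)) =
    card (quot (S k) (scE (\<pi> ^ k) ` M')) * card (quot (scE (\<pi> ^ k) ` M') (scE (\<pi> ^ k) ` T))"
    by (rule quot_tower(1)[OF _ _ image_mono[OF T_sub_M'] S_add])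
      (intro E.submod_subgroup E.submod_scale_image submod_M' submod_T)+
  then show ?thesis using E.scale_quot(1)[OF pi_pow_nz submod_T] by simp
qed

text \<open>The recursion for \<open>S'\<close> starts at j = 1, the count over the residue field;
  this accounts for the exponent k - 1.\<close>

theorem card_S_eq:
  assumes k: "k \<ge> 4 * kb + 1"
  shows "card (quot (S k) (scE (\<pi> ^ k) ` M')) * card (quot M' T) =
    card (quot H' HT) * card (quot (S' 1) (scE \<pi> ` T)) * q ^ ((k - 1) * card Bs)"
proof -
  obtain j where j: "k = Suc j" using k by (cases k) auto
  show ?thesis
    using card_S_tower[of k] card_S_fibre[OF k] card_S'_eq[of j] unfolding j by (simp add: mult_ac)
qed

lemma finite_quot_M'_T: "finite (quot M' T)"
proof -
  obtain t where t: "scE (\<pi> ^ t) ` M' \<subseteq> T" using pi_M'_T by blast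
  show ?thesis
    by (rule finite_quot_mono[OF _ _ t subset_refl finite_quot_M'])
      (intro E.submod_subgroup E.submod_scale_image submod_M' submod_T)+
qed

lemma finite_quot_H'_HT: "finite (quot H' HT)"
proof -
  have sub: "scH (\<pi> ^ (2 * kb)) ` H' \<subseteq> HT"
    using kb2[OF _ order_refl] psi_T1(2) by blast
  have "finite (quot (scH (\<pi> ^ (2 * kb)) ` H') (scH (\<pi> ^ (2 * kb)) ` HT))"
    by (rule finite_quot_mono[OF _ _ subset_refl sub finite_quot_HT])
      (intro H.submod_subgroup submod_pi_HT)+
  then show ?thesis using H.scale_quot(2)[OF pi_pow_nz submod_HT] by blast
qed

section \<open>Points of the special fiber\<close>

lemma UN_UN_const:
  assumes "\<And>x y. x \<in> C \<Longrightarrow> y \<in> C' \<Longrightarrow> F x y = c" "C \<noteq> {}" "C' \<noteq> {}"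
  shows "(\<Union>x\<in>C. \<Union>y\<in>C'. F x y) = c"
  using assms by fastforce

text \<open>Beyond independence of representatives, the point is that units over the residue field
  lift to \<open>U1\<close>: if V inverts U modulo \<pi>, then U V and V U lie in 1 + \<pi>T and are
  invertible by \<open>U1_near\<close>, which makes U invertible from both sides.\<close>

lemma special_fiber: "special_fiber_points D = quot (S' 1) (scE \<pi> ` T)"
proof -
  let ?N = "scE \<pi> ` T" and ?P = "scH \<pi> ` HT"
  have N: "add_subgroup ?N" and P: "add_subgroup ?P"
    by (intro E.submod_subgroup submod_pi_T, intro H.submod_subgroup submod_pi_HT)
  have NT: "?N \<subseteq> T" by (rule E.scale_image_subset[OF submod_T A_pi])
  have carrier: "carrier (M_kappa D) = quot (id +o T) ?N" by (simp add: M_kappa_def pi_T_def)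
  have one: "\<one>\<^bsub>M_kappa D\<^esub> = id +o ?N" by (simp add: M_kappa_def pi_T_def)
  have self: "U \<in> U +o ?N" for U :: "'v \<Rightarrow> 'v" using add_subgroupD(1)[OF N] by (simp add: elt_coset_iff)
  have selfP: "f \<in> f +o ?P" for f using add_subgroupD(1)[OF P] by (simp add: elt_coset_iff)
  have unip: "V - id \<in> T" if "V \<in> U +o ?N" "U - id \<in> T" for U V
  proof -
    have "(V - U) + (U - id) \<in> T"
      using that NT by (intro E.submodD(2)[OF submod_T]) (auto simp: elt_coset_iff)
    then show ?thesis by simp
  qed
  have mult: "(U +o ?N) \<otimes>\<^bsub>M_kappa D\<^esub> (V +o ?N) = (U \<circ> V) +o ?N" if U: "U - id \<in> T" and V: "V - id \<in> T" for U V
  proof -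
    have "(U' \<circ> V') +o ?N = (U \<circ> V) +o ?N" if U': "U' \<in> U +o ?N" and V': "V' \<in> V +o ?N" for U' V'
    proof -
      obtain Y where Y: "Y \<in> T" "V' - V = scE \<pi> Y" using V' by (auto simp: elt_coset_iff)
      have linU: "lin U" by (rule unipotent_lin[OF U])
      have "(U' - U) \<circ> V' \<in> ?N" using comp_pi_T[OF _ unip[OF V' V]] U' by (simp add: elt_coset_iff)
      moreover have "U \<circ> (V' - V) \<in> ?N"
        unfolding Y(2) comp_scE[OF linU]
        by (rule imageI[of _ _ "scE \<pi>", OF T_unipotent_mult(1)[OF U Y(1)]])
      ultimately have "((U' - U) \<circ> V') + (U \<circ> (V' - V)) \<in> ?N" by (rule add_subgroupD(4)[OF N])
      also have "((U' - U) \<circ> V') + (U \<circ> (V' - V)) = (U' \<circ> V') - (U \<circ> V)"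
        using lin_diff[OF linU] by (simp add: fun_eq_iff)
      finally show ?thesis using coset_eq_iff[OF N] by blast
    qed
    then have "(\<Union>m\<in>U +o ?N. \<Union>m'\<in>V +o ?N. (m \<circ> m') +o ?N) = (U \<circ> V) +o ?N"
      using self[of U] self[of V] by (intro UN_UN_const) blast+
    then show ?thesis by (simp add: M_kappa_def pi_T_def)
  qed
  have act: "act_kappa D (h +o ?P) (U +o ?N) = pullback h U +o ?P" if U: "U - id \<in> T" for U
  proof -
    have "pullback f V +o ?P = pullback h U +o ?P" if f: "f \<in> h +o ?P" and V: "V \<in> U +o ?N" for f V
    proof -
      have "pullback (f - h) V \<in> ?P" using pullback_pi_HT[OF _ unip[OF V U], of "f - h" \<pi>] f by (simp add: elt_coset_iff)
      moreover have "del V - del U \<in> ?P" using del_near[OF U, of V 1] V by (simp add: elt_coset_iff)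
      ultimately have "pullback (f - h) V + (del V - del U) \<in> ?P" by (rule add_subgroupD(4)[OF P])
      also have "pullback (f - h) V + (del V - del U) = pullback f V - pullback h U"
        by (simp add: del_def pullback_def fun_eq_iff)
      finally show ?thesis using coset_eq_iff[OF P] by blast
    qed
    then have "(\<Union>f\<in>h +o ?P. \<Union>m\<in>U +o ?N. pullback f m +o ?P) = pullback h U +o ?P"
      using selfP[of h] self[of U] by (intro UN_UN_const) blast+
    then show ?thesis by (simp add: act_kappa_def pi_H_def)
  qed
  have units: "U +o ?N \<in> Units (M_kappa D) \<longleftrightarrow> U \<in> U1" if U: "U - id \<in> T" for U
  proof
    assume "U +o ?N \<in> Units (M_kappa D)"
    then obtain C where C: "C \<in> carrier (M_kappa D)" "C \<otimes>\<^bsub>M_kappa D\<^esub> (U +o ?N) = \<one>\<^bsub>M_kappa D\<^esub>"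
      "(U +o ?N) \<otimes>\<^bsub>M_kappa D\<^esub> C = \<one>\<^bsub>M_kappa D\<^esub>" by (auto simp: Units_def)
    obtain V where V: "V - id \<in> T" "C = V +o ?N" using C(1) by (auto simp: carrier quot_def elt_coset_iff)
    have n: "(V \<circ> U) - id \<in> ?N" "(U \<circ> V) - id \<in> ?N"
      using C(2,3) coset_eq_iff[OF N] unfolding V(2) mult[OF V(1) U] mult[OF U V(1)] one by blast+
    have u: "V \<circ> U \<in> U1" "U \<circ> V \<in> U1" using U1_near[OF n(1)] U1_near[OF n(2)] by simp_all
    obtain P1 where P1: "P1 \<in> U1" "P1 \<circ> (V \<circ> U) = id" using U1_inverse[OF u(1)] by blast
    obtain P2 where P2: "P2 \<in> U1" "(U \<circ> V) \<circ> P2 = id" using U1_inverse[OF u(2)] by blast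
    have "P1 \<circ> V = (P1 \<circ> V) \<circ> ((U \<circ> V) \<circ> P2)" using P2(2) by simp
    also have "\<dots> = (P1 \<circ> (V \<circ> U)) \<circ> (V \<circ> P2)" by (simp only: comp_assoc)
    also have "\<dots> = V \<circ> P2" using P1(2) by simp
    finally have eq: "P1 \<circ> V = V \<circ> P2" .
    have "(V \<circ> P2) - id \<in> T" by (rule unipotent_comp[OF V(1) U1_unipotent[OF P2(1)]])
    moreover have "U \<circ> (V \<circ> P2) = id" using P2(2) by (simp only: comp_assoc)
    moreover have "(V \<circ> P2) \<circ> U = id" using P1(2) unfolding eq[symmetric] by (simp only: comp_assoc)
    ultimately show "U \<in> U1" using U unfolding U1_def by blast
  next
    assume "U \<in> U1"
    then obtain V where V: "V \<in> U1" "U \<circ> V = id" "V \<circ> U = id" using U1_inverse by blast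
    have Vu: "V - id \<in> T" by (rule U1_unipotent[OF V(1)])
    have "V +o ?N \<in> carrier (M_kappa D)" "U +o ?N \<in> carrier (M_kappa D)"
      using U Vu by (auto simp: carrier quot_def elt_coset_iff)
    moreover have "(V +o ?N) \<otimes>\<^bsub>M_kappa D\<^esub> (U +o ?N) = \<one>\<^bsub>M_kappa D\<^esub>" "(U +o ?N) \<otimes>\<^bsub>M_kappa D\<^esub> (V +o ?N) = \<one>\<^bsub>M_kappa D\<^esub>"
      unfolding mult[OF Vu U] mult[OF U Vu] one V by simp_all
    ultimately show "U +o ?N \<in> Units (M_kappa D)" unfolding Units_def by blast
  qed
  have del1: "pullback h U +o ?P = h +o ?P \<longleftrightarrow> del U \<in> scH (\<pi> ^ 1) ` HT" for U
    using coset_eq_iff[OF P] by (simp add: del_def)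
  have piH: "pi_H D = ?P" by (simp add: pi_H_def)
  show ?thesis
  proof (intro equalityI subsetI)
    fix C assume C: "C \<in> special_fiber_points D"
    then have "C \<in> carrier (M_kappa D)" by (auto simp: special_fiber_points_def Units_def)
    then obtain U where U: "U - id \<in> T" "C = U +o ?N" by (auto simp: carrier quot_def elt_coset_iff)
    have "U \<in> U1" using C units[OF U(1)] U(2) by (simp add: special_fiber_points_def)
    moreover have "del U \<in> scH (\<pi> ^ 1) ` HT"
      using C act[OF U(1)] unfolding del1[symmetric] U(2) by (simp add: special_fiber_points_def piH)
    ultimately show "C \<in> quot (S' 1) ?N" using U(2) by (auto simp: quot_def S'_def)
  next
    fix C assume "C \<in> quot (S' 1) ?N"
    then obtain U where U: "U \<in> S' 1" "C = U +o ?N" by (auto simp: quot_def)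
    have U1: "U \<in> U1" "U - id \<in> T" "del U \<in> scH (\<pi> ^ 1) ` HT" using U(1) U1_unipotent by (auto simp: S'_def)
    have "act_kappa D (h +o ?P) C = h +o ?P" unfolding U(2) act[OF U1(2)] del1 by (rule U1(3))
    then show "C \<in> special_fiber_points D"
      using units[OF U1(2)] U1(1) U(2) by (simp add: special_fiber_points_def piH)
  qed
qed

end


section \<open>Automorphisms of the lattice modulo a power of the uniformizer\<close>

context hermitian
begin

lemma h_on_L:
  assumes "x \<in> L" "y \<in> L"
  shows "\<not> exceptional D \<Longrightarrow> h x y \<in> B" "exceptional D \<Longrightarrow> h x x \<in> B"
    "exceptional D \<Longrightarrow> h x y + h y x \<in> B"
proof -
  show 1: "\<not> exceptional D \<Longrightarrow> h x y \<in> B"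
    using form_in assms by (simp add: herm_forms_cases HB_def)
  have diag: "h z z \<in> B" if "exceptional D" "z \<in> L" for z
    using form_in that by (simp add: herm_forms_cases)
  show "exceptional D \<Longrightarrow> h x x \<in> B" using diag assms by blast
  assume ex: "exceptional D"
  have "h x y + h y x = h (x + y) (x + y) - h x x - h y y"
    by (simp add: h_add_l h_add_r algebra_simps)
  then show "h x y + h y x \<in> B" using diag[OF ex] assms L_add B_diff by simp
qed

context
  fixes k :: nat
begin

abbreviation Lk where "Lk \<equiv> pi_pow_lat D k"
abbreviation Bk where "Bk \<equiv> pi_pow_B D k"
abbreviation red where "red v \<equiv> v +o Lk"
abbreviation LR where "LR \<equiv> quot L Lk"

lemma Lk_eq: "Lk = fmulV D (\<pi> ^ k) ` L" and Bk_eq: "Bk = fmulK D (\<pi> ^ k) ` B"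
  by (simp_all add: pi_pow_lat_def pi_pow_B_def)

lemma subgroup_Lk: "add_subgroup Lk" and subgroup_Bk: "add_subgroup Bk"
  unfolding Lk_eq Bk_eq
  by (intro V.submod_subgroup V.submod_scale_image submod_L, intro K.submod_subgroup K.submod_scale_image submod_B)

lemma red_eq: "red v = red w \<longleftrightarrow> v - w \<in> Lk"
  by (rule coset_eq_iff[OF subgroup_Lk])

lemma red_mem: "v \<in> red w \<longleftrightarrow> v - w \<in> Lk"
  by (rule elt_coset_iff)

lemma red_self: "v \<in> red v"
  using add_subgroupD(1)[OF subgroup_Lk] by (simp add: red_mem)

lemma Lk_r: "v \<in> Lk \<Longrightarrow> b \<in> B \<Longrightarrow> r v b \<in> Lk"
  unfolding Lk_eq by (auto simp: r_fmulV L_r)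

lemma Lk_map: "U \<in> M' \<Longrightarrow> v \<in> Lk \<Longrightarrow> U v \<in> Lk"
  unfolding Lk_eq by (auto simp: M'_iff lin_fmulV)

lemma Bk_fmulK: "x \<in> B \<Longrightarrow> fmulK D (\<pi> ^ k) x \<in> Bk"
  unfolding Bk_eq by (rule imageI)

text \<open>Reduction modulo \<pi>^k, cut off outside the quotient to match the extensional maps in
  \<open>Aut_mod\<close>. For U in \<open>M'\<close> the union over a coset has only one
  value.\<close>

definition aut :: "('v \<Rightarrow> 'v) \<Rightarrow> 'v set \<Rightarrow> 'v set" where
  "aut U = (\<lambda>C\<in>LR. \<Union>v\<in>C. red (U v))"

lemma aut_red: "U \<in> M' \<Longrightarrow> v \<in> L \<Longrightarrow> aut U (red v) = red (U v)"
proof -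
  assume U: "U \<in> M'" and v: "v \<in> L"
  have "red (U w) = red (U v)" if "w \<in> red v" for w
    using Lk_map[OF U, of "w - v"] that by (simp add: red_mem red_eq lin_diff[OF M'_lin[OF U]])
  then have "(\<Union>w\<in>red v. red (U w)) = red (U v)" using red_self[of v] by blast
  moreover have "red v \<in> LR" using v by (auto simp: quot_def)
  ultimately show ?thesis by (simp add: aut_def)
qed

lemma aut_eq_iff:
  assumes U: "U \<in> M'" and V: "V \<in> M'"
  shows "aut U = aut V \<longleftrightarrow> U - V \<in> scE (\<pi> ^ k) ` M'"
proof -
  have "aut U = aut V \<longleftrightarrow> (\<forall>v\<in>L. red (U v) = red (V v))"
  proof
    assume "aut U = aut V"
    then show "\<forall>v\<in>L. red (U v) = red (V v)" using aut_red[OF U] aut_red[OF V] by metis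
  next
    assume a: "\<forall>v\<in>L. red (U v) = red (V v)"
    show "aut U = aut V"
    proof
      fix C
      show "aut U C = aut V C"
      proof (cases "C \<in> LR")
        case True
        then obtain v where v: "v \<in> L" "C = red v" by (auto simp: quot_def)
        then show ?thesis using aut_red[OF U v(1)] aut_red[OF V v(1)] a by simp
      qed (simp add: aut_def)
    qed
  qed
  also have "\<dots> \<longleftrightarrow> (\<forall>v\<in>L. fmulV D (inverse (\<pi> ^ k)) (U v - V v) \<in> L)"
    unfolding red_eq unfolding Lk_eq V.scale_image_iff[OF pi_pow_nz] ..
  also have "\<dots> \<longleftrightarrow> scE (inverse (\<pi> ^ k)) (U - V) \<in> M'"
    using lin_scE[OF lin_minus[OF M'_lin[OF U] M'_lin[OF V]]] by (simp add: M'_iff)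
  also have "\<dots> \<longleftrightarrow> U - V \<in> scE (\<pi> ^ k) ` M'" by (rule E.scale_image_iff[OF pi_pow_nz, symmetric])
  finally show ?thesis .
qed

definition form_cond :: "('v \<Rightarrow> 'v \<Rightarrow> 'k) \<Rightarrow> bool" where
  "form_cond f \<longleftrightarrow> (if exceptional D then \<forall>v\<in>L. f v v \<in> Bk else \<forall>v\<in>L. \<forall>w\<in>L. f v w \<in> Bk)"

lemma form_cond_iff: "herm f \<Longrightarrow> form_cond f \<longleftrightarrow> f \<in> scH (\<pi> ^ k) ` H'"
proof -
  assume f: "herm f"
  have "f \<in> scH (\<pi> ^ k) ` H' \<longleftrightarrow> scH (inverse (\<pi> ^ k)) f \<in> H'"
    by (rule H.scale_image_iff[OF pi_pow_nz])
  also have "\<dots> \<longleftrightarrow> form_cond f"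
    using herm_scH[OF f] K.scale_image_iff[OF pi_pow_nz]
    by (auto simp: herm_forms_cases HB_def form_cond_def Bk_eq)
  finally show ?thesis ..
qed

text \<open>Both mixed terms carry the factor \<pi>^k. In the exceptional case neither of them need
  be integral alone, so they are kept together as a polarized value.\<close>

lemma form_perturb:
  assumes v: "x \<in> L" "y \<in> L" "x' \<in> red x" "y' \<in> red y"
  shows "\<not> exceptional D \<Longrightarrow> h x' y' - h x y \<in> Bk" "exceptional D \<Longrightarrow> h x' x' - h x x \<in> Bk"
proof -
  obtain l m where l: "l \<in> L" "x' = x + fmulV D (\<pi> ^ k) l" and m: "m \<in> L" "y' = y + fmulV D (\<pi> ^ k) m"
    using v(3,4) unfolding red_mem unfolding Lk_eq by (auto simp: algebra_simps)
  have kA: "\<pi> ^ k \<in> A" by simp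
  have "h x' y' - h x y = fmulK D (\<pi> ^ k) (h l y + h x m + fmulK D (\<pi> ^ k) (h l m))"
    unfolding l(2) m(2) by (simp add: h_add_l h_add_r h_fmulV_l h_fmulV_r K.scale_right_distrib algebra_simps)
  moreover have "h l y + h x m + fmulK D (\<pi> ^ k) (h l m) \<in> B" if "\<not> exceptional D"
    using h_on_L(1) that v l m by (intro B_add K.submodD(3)[OF submod_B kA]) auto
  ultimately show "\<not> exceptional D \<Longrightarrow> h x' y' - h x y \<in> Bk" using Bk_fmulK by simp
  have "h x' x' - h x x = fmulK D (\<pi> ^ k) ((h l x + h x l) + fmulK D (\<pi> ^ k) (h l l))"
    unfolding l(2) by (simp add: h_add_l h_add_r h_fmulV_l h_fmulV_r K.scale_right_distrib algebra_simps)
  moreover have "(h l x + h x l) + fmulK D (\<pi> ^ k) (h l l) \<in> B" if "exceptional D"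
    using h_on_L(3)[OF l(1) v(1) that] h_on_L(2)[OF l(1) l(1) that]
    by (intro B_add[of "h l x + h x l"] K.submodD(3)[OF submod_B kA])
  ultimately show "exceptional D \<Longrightarrow> h x' x' - h x x \<in> Bk" using Bk_fmulK by simp
qed

lemma Aut_mod_iff: "\<theta> \<in> Aut_mod D k \<longleftrightarrow> \<theta> \<in> extensional LR \<and> bij_betw \<theta> LR LR \<and>
    (\<forall>v\<in>L. \<forall>w\<in>L. \<forall>v'\<in>\<theta> (red v). \<forall>w'\<in>\<theta> (red w). \<theta> (red (v + w)) = red (v' + w')) \<and>
    (\<forall>v\<in>L. \<forall>b\<in>B. \<forall>v'\<in>\<theta> (red v). \<theta> (red (r v b)) = red (r v' b)) \<and>
    (if exceptional D then \<forall>v\<in>L. \<forall>v'\<in>\<theta> (red v). h v' v' - h v v \<in> Bk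
     else \<forall>v\<in>L. \<forall>w\<in>L. \<forall>v'\<in>\<theta> (red v). \<forall>w'\<in>\<theta> (red w). h v' w' - h v w \<in> Bk)"
  by (simp add: Aut_mod_def Let_def)

lemma form_cond_del:
  assumes U: "U \<in> M'"
  shows "form_cond (del U) \<longleftrightarrow>
    (if exceptional D then \<forall>v\<in>L. \<forall>v'\<in>red (U v). h v' v' - h v v \<in> Bk
     else \<forall>v\<in>L. \<forall>w\<in>L. \<forall>v'\<in>red (U v). \<forall>w'\<in>red (U w). h v' w' - h v w \<in> Bk)"
proof -
  have UL: "U v \<in> L" if "v \<in> L" for v using U that by (simp add: M'_iff)
  have d: "h x' y' - h v w \<in> Bk \<longleftrightarrow> del U v w \<in> Bk" if "h x' y' - h (U v) (U w) \<in> Bk" for x' y' v w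
  proof -
    have "h x' y' - h v w = (h x' y' - h (U v) (U w)) + del U v w" by (simp add: del_def pullback_def)
    moreover have "del U v w = (h x' y' - h v w) - (h x' y' - h (U v) (U w))" by (simp add: del_def pullback_def)
    ultimately show ?thesis using that add_subgroupD(2,4)[OF subgroup_Bk] by metis
  qed
  show ?thesis
  proof (cases "exceptional D")
    case True
    have "del U v v \<in> Bk \<longleftrightarrow> (\<forall>v'\<in>red (U v). h v' v' - h v v \<in> Bk)" if "v \<in> L" for v
      using d form_perturb(2)[OF UL[OF that] UL[OF that] _ _ True] red_self by blast
    then show ?thesis using True by (simp add: form_cond_def)
  next
    case False
    have "del U v w \<in> Bk \<longleftrightarrow> (\<forall>v'\<in>red (U v). \<forall>w'\<in>red (U w). h v' w' - h v w \<in> Bk)" if "v \<in> L" "w \<in> L" for v w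
      using d form_perturb(1)[OF UL[OF that(1)] UL[OF that(2)] _ _ False] red_self by blast
    then show ?thesis using False by (simp add: form_cond_def)
  qed
qed

text \<open>Bijectivity is where k has to be large; it comes from the inverse in
  \<open>S_unit\<close>.\<close>

lemma aut_in_Aut_mod:
  assumes k: "k \<ge> 2 * kb + 1" and U: "U \<in> S k"
  shows "aut U \<in> Aut_mod D k"
proof -
  have UM: "U \<in> M'" using U by (simp add: S_def)
  have linU: "lin U" by (rule M'_lin[OF UM])
  obtain V where V: "V \<in> S k" "U \<circ> V = id" "V \<circ> U = id" using S_unit[OF U k] by blast
  have VM: "V \<in> M'" using V(1) by (simp add: S_def)
  have into: "aut W C \<in> LR" if W: "W \<in> M'" and C: "C \<in> LR" for W C
  proof -
    obtain v where v: "v \<in> L" "C = red v" using C by (auto simp: quot_def)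
    then have "W v \<in> L" using W by (simp add: M'_iff)
    then show ?thesis using aut_red[OF W v(1)] v(2) by (auto simp: quot_def)
  qed
  have inv: "aut W (aut W' C) = C" if W: "W \<in> M'" "W' \<in> M'" "W \<circ> W' = id" and C: "C \<in> LR" for W W' C
  proof -
    obtain v where v: "v \<in> L" "C = red v" using C by (auto simp: quot_def)
    then have "W' v \<in> L" using W(2) by (simp add: M'_iff)
    moreover have "W (W' v) = v" using fun_cong[OF W(3), of v] by simp
    ultimately show ?thesis using aut_red[OF W(2) v(1)] aut_red[OF W(1)] v(2) by metis
  qed
  have "bij_betw (aut U) LR LR"
    by (rule bij_betw_byWitness[where f' = "aut V"]) (use into inv UM VM V in auto)
  moreover have "form_cond (del U)"
    using form_cond_iff[OF herm_del[OF linU]] U by (simp add: S_def)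
  moreover have "aut U (red (v + w)) = red (v' + w')"
    if "v \<in> L" "w \<in> L" "v' \<in> aut U (red v)" "w' \<in> aut U (red w)" for v w v' w'
  proof -
    have "v' - U v \<in> Lk" "w' - U w \<in> Lk" using that aut_red[OF UM] by (auto simp: red_mem)
    then have "(v' - U v) + (w' - U w) \<in> Lk" by (rule add_subgroupD(4)[OF subgroup_Lk])
    then have "red (v' + w') = red (U (v + w))" by (simp add: red_eq lin_add[OF linU] algebra_simps)
    then show ?thesis using aut_red[OF UM L_add] that by simp
  qed
  moreover have "aut U (red (r v b)) = red (r v' b)" if "v \<in> L" "b \<in> B" "v' \<in> aut U (red v)" for v b v'
  proof -
    have "v' - U v \<in> Lk" using that aut_red[OF UM] by (auto simp: red_mem)
    then have "r (v' - U v) b \<in> Lk" by (rule Lk_r[OF _ that(2)])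
    then have "red (r v' b) = red (U (r v b))" by (simp add: red_eq lin_r[OF linU] r_diff_l)
    then show ?thesis using aut_red[OF UM L_r] that by simp
  qed
  ultimately show ?thesis
    unfolding Aut_mod_iff form_cond_del[OF UM] using aut_red[OF UM]
    by (simp add: aut_def[THEN arg_cong, of "\<lambda>x. x \<in> extensional LR"])
qed

text \<open>\<open>L\<close> is free, so arbitrary lifts of the images of the basis vectors define
  U. Additivity is available only through representatives and is applied one summand at a time to
  show that U induces \<theta>.\<close>

lemma Aut_mod_lift:
  assumes \<theta>: "\<theta> \<in> Aut_mod D k"
  shows "\<exists>U\<in>S k. \<theta> = aut U"
proof -
  note \<theta>' = \<theta>[unfolded Aut_mod_iff]
  have ext: "\<theta> \<in> extensional LR" and bij: "bij_betw \<theta> LR LR" using \<theta>' by blast+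
  have add: "\<theta> (red (v + w)) = red (v' + w')"
    if "v \<in> L" "w \<in> L" "v' \<in> \<theta> (red v)" "w' \<in> \<theta> (red w)" for v w v' w'
    using \<theta>' that by blast
  have sc: "\<theta> (red (r v b)) = red (r v' b)" if "v \<in> L" "b \<in> B" "v' \<in> \<theta> (red v)" for v b v'
    using \<theta>' that by blast
  have rep: "\<exists>l\<in>L. \<theta> (red v) = red l" if "v \<in> L" for v
  proof -
    have "red v \<in> LR" using that by (auto simp: quot_def)
    then have "\<theta> (red v) \<in> LR" using bij by (auto simp: bij_betw_def)
    then show ?thesis by (auto simp: quot_def)
  qed
  have "\<forall>i. \<exists>l. i < n \<longrightarrow> l \<in> L \<and> \<theta> (red (eb i)) = red l" using rep eb_L by blast
  then obtain u where u: "\<And>i. i < n \<Longrightarrow> u i \<in> L \<and> \<theta> (red (eb i)) = red (u i)" by metis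
  define U where "U = kmap u"
  have UM: "U \<in> M'" unfolding M'_iff_basis U_def using u by (auto simp: lin_kmap kmap_eb)
  have partial: "\<theta> (red (\<Sum>i<m. r (eb i) (c i))) = red (\<Sum>i<m. r (u i) (c i)) \<and> (\<Sum>i<m. r (eb i) (c i)) \<in> L"
    if "m \<le> n" "\<And>i. i < n \<Longrightarrow> c i \<in> B" for m c
    using that(1)
  proof (induction m)
    case 0
    obtain l where l: "\<theta> (red 0) = red l" using rep[OF L_0] by blast
    \<comment> \<open>That \<theta> fixes the zero class is extracted from compatibility with the
      scalar 0.\<close>
    have "\<theta> (red (r 0 0)) = red (r l 0)" by (rule sc[OF L_0 B_0]) (unfold l, rule red_self)
    then show ?case by (simp add: r_0_l r_0_r L_0)
  next
    case (Suc m)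
    then have m: "m < n" by simp
    have IH: "\<theta> (red (\<Sum>i<m. r (eb i) (c i))) = red (\<Sum>i<m. r (u i) (c i))" "(\<Sum>i<m. r (eb i) (c i)) \<in> L"
      using Suc by auto
    have cm: "r (eb m) (c m) \<in> L" using L_r eb_L m that(2) by blast
    have "\<theta> (red (r (eb m) (c m))) = red (r (u m) (c m))"
      by (rule sc[OF eb_L[OF m] that(2)[OF m]]) (use u m red_self in auto)
    then have "\<theta> (red ((\<Sum>i<m. r (eb i) (c i)) + r (eb m) (c m))) = red ((\<Sum>i<m. r (u i) (c i)) + r (u m) (c m))"
      by (intro add[OF IH(2) cm]) (simp_all add: IH(1) red_self)
    then show ?case using L_add[OF IH(2) cm] by simp
  qed
  have \<theta>_red: "\<theta> (red v) = red (U v)" if "v \<in> L" for v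
  proof -
    have "\<theta> (red (\<Sum>i<n. r (eb i) (cf v i))) = red (\<Sum>i<n. r (u i) (cf v i))"
      using partial[of n "cf v"] that by (simp add: L_iff)
    then show ?thesis unfolding U_def kmap_def cf_expand[of v, symmetric] .
  qed
  have eq: "\<theta> = aut U"
  proof
    fix C
    show "\<theta> C = aut U C"
    proof (cases "C \<in> LR")
      case True
      then obtain v where "v \<in> L" "C = red v" by (auto simp: quot_def)
      then show ?thesis using \<theta>_red aut_red[OF UM] by simp
    next
      case False
      then show ?thesis using ext by (simp add: extensional_def aut_def)
    qed
  qed
  have "form_cond (del U)"
    unfolding form_cond_del[OF UM] using \<theta>' \<theta>_red by (simp split: if_splits)
  then have "U \<in> S k" using form_cond_iff[OF herm_del[OF M'_lin[OF UM]]] UM by (simp add: S_def)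
  then show ?thesis using eq by blast
qed

lemma card_Aut_mod:
  assumes k: "k \<ge> 2 * kb + 1"
  shows "card (Aut_mod D k) = card (quot (S k) (scE (\<pi> ^ k) ` M'))"
proof -
  have "Aut_mod D k = aut ` S k" using aut_in_Aut_mod[OF k] Aut_mod_lift by blast
  moreover have "card (aut ` S k) = card (quot (S k) (scE (\<pi> ^ k) ` M'))"
    by (rule card_image_quot(1)) (use aut_eq_iff in \<open>auto simp: S_def intro: E.submod_subgroup E.submod_scale_image submod_M'\<close>)
  ultimately show ?thesis by simp
qed

end

lemma card_Aut_mod_eq:
  assumes k: "k \<ge> 4 * kb + 1"
  shows "card (Aut_mod D k) * card (quot M' T) =
    card (quot H' HT) * card (special_fiber_points D) * q ^ ((k - 1) * card Bs)"
  using card_S_eq[OF k] card_Aut_mod[of k] k special_fiber by simp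

end


section \<open>The dimension of the generic fiber\<close>

context vector_space
begin

lemma is_basis_exists:
  assumes "finite G" "span G = UNIV"
  shows "\<exists>bs. is_basis scale bs"
proof -
  obtain B where B: "B \<subseteq> G" "independent B" "G \<subseteq> span B" by (rule maximal_independent_subset)
  have fB: "finite B" using B(1) assms(1) finite_subset by blast
  have spB: "span B = UNIV" using assms(2) span_minimal[OF B(3) subspace_span] by auto
  obtain bs where bs: "set bs = B" "distinct bs" using finite_distinct_list[OF fB] by blast
  have bij: "bij_betw (\<lambda>i. bs ! i) {..<length bs} B"
    using bij_betw_nth[OF bs(2) refl] bs(1) by simp
  have sum: "(\<Sum>i<length bs. scale (u (bs ! i)) (bs ! i)) = (\<Sum>b\<in>B. scale (u b) b)" for u
    by (rule sum.reindex_bij_betw[OF bij])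
  have "\<exists>!cs. length cs = length bs \<and> x = lin_comb scale cs bs" for x
  proof (rule ex_ex1I)
    have "x \<in> range (\<lambda>u. \<Sum>b\<in>B. scale (u b) b)" using span_finite[OF fB] spB by simp
    then obtain u where "x = (\<Sum>b\<in>B. scale (u b) b)" by blast
    then have "x = lin_comb scale (map (\<lambda>b. u b) bs) bs" by (simp add: lin_comb_eq_sum sum)
    then show "\<exists>cs. length cs = length bs \<and> x = lin_comb scale cs bs" by (intro exI[of _ "map u bs"]) simp
  next
    fix cs cs' assume "length cs = length bs \<and> x = lin_comb scale cs bs"
      "length cs' = length bs \<and> x = lin_comb scale cs' bs"
    then have l: "length cs = length bs" "length cs' = length bs"
      and eq: "(\<Sum>i<length bs. scale (cs ! i) (bs ! i)) = (\<Sum>i<length bs. scale (cs' ! i) (bs ! i))"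
      by (auto simp: lin_comb_eq_sum)
    define ix where "ix = inv_into {..<length bs} (\<lambda>i. bs ! i)"
    have ix: "ix (bs ! i) = i" if "i < length bs" for i
      unfolding ix_def by (rule inv_into_f_f) (use bij that in \<open>auto simp: bij_betw_def\<close>)
    have "(\<Sum>b\<in>B. scale (cs ! ix b - cs' ! ix b) b) = (\<Sum>i<length bs. scale (cs ! i - cs' ! i) (bs ! i))"
      unfolding sum[symmetric] by (intro sum.cong refl) (simp add: ix)
    also have "\<dots> = 0" using eq by (simp add: scale_left_diff_distrib sum_subtractf)
    finally have z: "(\<Sum>b\<in>B. scale (cs ! ix b - cs' ! ix b) b) = 0" .
    show "cs = cs'"
    proof (rule nth_equalityI)
      fix i assume i: "i < length cs"
      then have "bs ! i \<in> B" using l bs(1) by auto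
      from independentD[OF B(2) fB subset_refl z this] show "cs ! i = cs' ! i" using ix i l by simp
    qed (use l in simp)
  qed
  then show ?thesis unfolding is_basis_def by blast
qed

end

context hermitian
begin

section \<open>Coordinates and matrices with respect to the auxiliary bases over F\<close>

abbreviation N where "N \<equiv> length (basisV D)"
definition bv where "bv i = basisV D ! i"
definition bk where "bk l = basisK D ! l"
definition vc where "vc v i = coords (fmulV D) (basisV D) v ! i"
definition kc where "kc x l = coords (fmulK D) (basisK D) x ! l"

lemma basisV: "is_basis (fmulV D) (basisV D)"
  unfolding basisV_def by (rule someI_ex[OF V.is_basis_exists[OF GV(1) span_GV]])

lemma basisK: "is_basis (fmulK D) (basisK D)"
  unfolding basisK_def by (rule someI_ex[OF K.is_basis_exists[OF GB(1) span_GB]])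

lemma vc_expand: "v = (\<Sum>i<N. fmulV D (vc v i) (bv i))"
  unfolding vc_def bv_def by (rule coords_expand[OF basisV])
lemma vc_eqI: fixes c shows "v = (\<Sum>i<N. fmulV D (c i) (bv i)) \<Longrightarrow> i < N \<Longrightarrow> vc v i = c i"
  unfolding vc_def bv_def using coords_eqI[OF basisV, where c = c and i = i] by blast
lemma kc_expand: "x = (\<Sum>l<length (basisK D). fmulK D (kc x l) (bk l))"
  unfolding kc_def bk_def by (rule coords_expand[OF basisK])
lemma kc_eqI: fixes c shows "x = (\<Sum>l<length (basisK D). fmulK D (c l) (bk l)) \<Longrightarrow> l < length (basisK D) \<Longrightarrow> kc x l = c l"
  unfolding kc_def bk_def using coords_eqI[OF basisK, where c = c and i = l] by blast

lemma vc_add: "i < N \<Longrightarrow> vc (v + w) i = vc v i + vc w i"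
proof (rule vc_eqI)
  have "v + w = (\<Sum>i<N. fmulV D (vc v i) (bv i)) + (\<Sum>i<N. fmulV D (vc w i) (bv i))" using vc_expand by metis
  then show "v + w = (\<Sum>i<N. fmulV D (vc v i + vc w i) (bv i))" by (simp add: fmulV_simps(2) sum.distrib)
qed

lemma vc_fmulV: "i < N \<Longrightarrow> vc (fmulV D a v) i = a * vc v i"
proof (rule vc_eqI)
  have "fmulV D a v = fmulV D a (\<Sum>i<N. fmulV D (vc v i) (bv i))" using vc_expand by metis
  then show "fmulV D a v = (\<Sum>i<N. fmulV D (a * vc v i) (bv i))" by (simp add: V.scale_sum_right)
qed

lemma vc_bv: "i < N \<Longrightarrow> j < N \<Longrightarrow> vc (bv j) i = (if i = j then 1 else 0)"
proof (rule vc_eqI)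
  assume "j < N"
  have "(\<Sum>i<N. fmulV D (if i = j then 1 else 0) (bv i)) = (\<Sum>i<N. if i = j then bv i else 0)"
    by (intro sum.cong) auto
  then show "bv j = (\<Sum>i<N. fmulV D (if i = j then 1 else 0) (bv i))" using \<open>j < N\<close> by simp
qed

lemma vc_sum: "i < N \<Longrightarrow> vc (\<Sum>j\<in>I. fmulV D (c j) (f j)) i = (\<Sum>j\<in>I. c j * vc (f j) i)"
proof (induction I rule: infinite_finite_induct)
  case (insert j I)
  then show ?case by (simp add: vc_add vc_fmulV)
qed (use vc_fmulV[of i 0 0] in simp_all)

lemma kc_add: "l < length (basisK D) \<Longrightarrow> kc (x + y) l = kc x l + kc y l"
proof (rule kc_eqI)
  have "x + y = (\<Sum>i<length (basisK D). fmulK D (kc x i) (bk i)) + (\<Sum>i<length (basisK D). fmulK D (kc y i) (bk i))"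
    using kc_expand by metis
  then show "x + y = (\<Sum>i<length (basisK D). fmulK D (kc x i + kc y i) (bk i))"
    by (simp add: K.scale_left_distrib sum.distrib)
qed

lemma kc_fmulK: "l < length (basisK D) \<Longrightarrow> kc (fmulK D a x) l = a * kc x l"
proof (rule kc_eqI)
  have "fmulK D a x = fmulK D a (\<Sum>i<length (basisK D). fmulK D (kc x i) (bk i))" using kc_expand by metis
  then show "fmulK D a x = (\<Sum>i<length (basisK D). fmulK D (a * kc x i) (bk i))" by (simp add: K.scale_sum_right)
qed

lemma kc_sum: "l < length (basisK D) \<Longrightarrow> kc (\<Sum>j\<in>I. fmulK D (c j) (f j)) l = (\<Sum>j\<in>I. c j * kc (f j) l)"
proof (induction I rule: infinite_finite_induct)
  case (insert j I)
  then show ?case by (simp add: kc_add kc_fmulK)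
qed (use kc_fmulK[of l 0 0] in simp_all)

lemma kc_zero_imp: "(\<And>l. l < length (basisK D) \<Longrightarrow> kc x l = 0) \<Longrightarrow> x = 0"
  using kc_expand[of x] by simp

text \<open>Linearity over F only, the maps that matrices describe; linearity over K becomes
  commutation with the matrices \<open>rmul_mat\<close>.\<close>

definition Flin :: "('v \<Rightarrow> 'v) \<Rightarrow> bool" where
  "Flin Y \<longleftrightarrow> (\<forall>v w. Y (v + w) = Y v + Y w) \<and> (\<forall>a v. Y (fmulV D a v) = fmulV D a (Y v))"

lemma lin_Flin: "lin Y \<Longrightarrow> Flin Y" by (simp add: Flin_def lin_add lin_fmulV)

lemma Flin_sum: "Flin Y \<Longrightarrow> Y (\<Sum>j\<in>I. fmulV D (c j) (f j)) = (\<Sum>j\<in>I. fmulV D (c j) (Y (f j)))"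
proof (induction I rule: infinite_finite_induct)
  case (insert j I)
  then show ?case by (simp add: Flin_def)
next
  case empty
  then have "Y (fmulV D 0 0) = fmulV D 0 (Y 0)" unfolding Flin_def by blast
  then show ?case by simp
next
  case (infinite I)
  then have "Y (fmulV D 0 0) = fmulV D 0 (Y 0)" unfolding Flin_def by blast
  then show ?case using infinite(1) by simp
qed

definition ent :: "('v \<Rightarrow> 'v) \<Rightarrow> nat \<Rightarrow> nat \<Rightarrow> 'f" where "ent Y a b = vc (Y (bv b)) a"

definition endo :: "(nat \<Rightarrow> nat \<Rightarrow> 'f) \<Rightarrow> 'v \<Rightarrow> 'v" where
  "endo W v = (\<Sum>a<N. \<Sum>b<N. fmulV D (W a b) (fmulV D (vc v b) (bv a)))"

definition unit_endo :: "nat \<Rightarrow> nat \<Rightarrow> 'v \<Rightarrow> 'v" where "unit_endo a b v = fmulV D (vc v b) (bv a)"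

lemma endo_eq: "endo W = (\<Sum>a<N. \<Sum>b<N. scE (W a b) (unit_endo a b))"
  by (rule ext) (simp add: endo_def unit_endo_def sum_fun_apply)

lemma endo_alt: "endo W v = (\<Sum>a<N. fmulV D (\<Sum>b<N. W a b * vc v b) (bv a))"
  by (simp add: endo_def V.scale_sum_left)

lemma Flin_endo: "Flin (endo W)"
  by (auto simp: Flin_def endo_alt vc_add vc_fmulV distrib_left sum.distrib fmulV_simps(2)
      V.scale_sum_right sum_distrib_left mult.left_commute)

lemma endo_bv: "b < N \<Longrightarrow> endo W (bv b) = (\<Sum>a<N. fmulV D (W a b) (bv a))"
proof -
  assume b: "b < N"
  have "(\<Sum>b'<N. W a b' * vc (bv b) b') = W a b" for a
  proof -
    have "(\<Sum>b'<N. W a b' * vc (bv b) b') = (\<Sum>b'<N. if b' = b then W a b' else 0)"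
      using b by (intro sum.cong) (auto simp: vc_bv)
    then show ?thesis using b by simp
  qed
  then show ?thesis by (simp add: endo_alt)
qed

lemma ent_endo: "a < N \<Longrightarrow> b < N \<Longrightarrow> ent (endo W) a b = W a b"
  unfolding ent_def endo_bv by (rule vc_eqI[OF refl])

lemma Flin_ext: "Flin Y \<Longrightarrow> Flin Z \<Longrightarrow> (\<And>b. b < N \<Longrightarrow> Y (bv b) = Z (bv b)) \<Longrightarrow> Y = Z"
proof
  fix v assume YZ: "Flin Y" "Flin Z" "\<And>b. b < N \<Longrightarrow> Y (bv b) = Z (bv b)"
  have "Y (\<Sum>i<N. fmulV D (vc v i) (bv i)) = Z (\<Sum>i<N. fmulV D (vc v i) (bv i))"
    unfolding Flin_sum[OF YZ(1)] Flin_sum[OF YZ(2)] using YZ(3) by simp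
  then show "Y v = Z v" using vc_expand[of v] by simp
qed

lemma endo_ent: "Flin Y \<Longrightarrow> endo (ent Y) = Y"
  by (rule Flin_ext[OF Flin_endo]) (simp_all add: endo_bv ent_def vc_expand[symmetric])

lemma rmul_mat_carrier: "rmul_mat D a \<in> carrier_mat N N" and gram_mat_carrier: "gram_mat D l \<in> carrier_mat N N"
  by (simp_all add: rmul_mat_def gram_mat_def)

lemma rmul_mat_entry: "i < N \<Longrightarrow> j < N \<Longrightarrow> rmul_mat D a $$ (i, j) = vc (r (bv j) a) i"
  by (simp add: rmul_mat_def vc_def bv_def)

lemma gram_mat_entry: "i < N \<Longrightarrow> j < N \<Longrightarrow> gram_mat D l $$ (i, j) = kc (h (bv i) (bv j)) l"
  by (simp add: gram_mat_def kc_def bv_def)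

lemma mat_commutes_ent:
  assumes Y: "Flin Y"
  shows "mat_commutes N (ent Y) (rmul_mat D x) \<longleftrightarrow> (\<forall>b<N. Y (r (bv b) x) = r (Y (bv b)) x)"
proof -
  have 1: "(\<Sum>k<N. ent Y a k * rmul_mat D x $$ (k, b)) = vc (Y (r (bv b) x)) a" if "a < N" "b < N" for a b
  proof -
    have "Y (r (bv b) x) = (\<Sum>k<N. fmulV D (vc (r (bv b) x) k) (Y (bv k)))"
      using Flin_sum[OF Y, of "vc (r (bv b) x)" bv "{..<N}"] vc_expand[of "r (bv b) x"] by simp
    then show ?thesis using that by (simp add: vc_sum rmul_mat_entry ent_def mult.commute)
  qed
  have 2: "(\<Sum>k<N. rmul_mat D x $$ (a, k) * ent Y k b) = vc (r (Y (bv b)) x) a" if "a < N" "b < N" for a b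
  proof -
    have "r (Y (bv b)) x = r (\<Sum>k<N. fmulV D (vc (Y (bv b)) k) (bv k)) x" using vc_expand[of "Y (bv b)"] by simp
    also have "\<dots> = (\<Sum>k<N. fmulV D (vc (Y (bv b)) k) (r (bv k) x))" by (simp add: r_sum_l r_fmulV)
    finally show ?thesis using that by (simp add: vc_sum rmul_mat_entry ent_def mult.commute)
  qed
  have "(\<forall>a<N. vc v a = vc w a) \<longleftrightarrow> v = w" for v w
    using vc_expand[of v] vc_expand[of w] by (metis (no_types, lifting) lessThan_iff sum.cong)
  then show ?thesis unfolding mat_commutes_def using 1 2 by (metis (no_types, lifting))
qed

lemma mat_skew_ent:
  assumes Y: "Flin Y" and l: "l < length (basisK D)"
  shows "mat_skew N c (ent Y) (gram_mat D l) \<longleftrightarrow>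
    (\<forall>a<N. \<forall>b<N. kc (psi D Y (bv a) (bv b) + fmulK D c (h (bv a) (bv b))) l = 0)"
proof -
  have hsum_l: "h (\<Sum>j<m. fmulV D (d j) (f j)) w = (\<Sum>j<m. fmulK D (d j) (h (f j) w))" for m :: nat and d f w
    by (induction m) (auto simp: herm_0_l[OF herm_h] h_add_l h_fmulV_l)
  have hsum_r: "h w (\<Sum>j<m. fmulV D (d j) (f j)) = (\<Sum>j<m. fmulK D (d j) (h w (f j)))" for m :: nat and d f w
    by (induction m) (auto simp: herm_0_r[OF herm_h] h_add_r h_fmulV_r)
  have "(\<Sum>k<N. ent Y k a * gram_mat D l $$ (k, b)) + (\<Sum>k<N. gram_mat D l $$ (a, k) * ent Y k b) +
    c * gram_mat D l $$ (a, b) = kc (psi D Y (bv a) (bv b) + fmulK D c (h (bv a) (bv b))) l" if "a < N" "b < N" for a b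
  proof -
    have 1: "h (Y (bv a)) (bv b) = (\<Sum>k<N. fmulK D (ent Y k a) (h (bv k) (bv b)))"
      using hsum_l[of "vc (Y (bv a))" bv N] vc_expand[of "Y (bv a)"] by (simp add: ent_def)
    have 2: "h (bv a) (Y (bv b)) = (\<Sum>k<N. fmulK D (ent Y k b) (h (bv a) (bv k)))"
      using hsum_r[of "bv a" "vc (Y (bv b))" bv N] vc_expand[of "Y (bv b)"] by (simp add: ent_def)
    show ?thesis unfolding psi_def 1 2 using l that
      by (simp add: kc_add kc_sum kc_fmulK gram_mat_entry mult.commute add.commute)
  qed
  then show ?thesis unfolding mat_skew_def by simp
qed

lemma det_ent_nonzero:
  assumes Y: "Flin Y" and Z: "Flin Z" and YZ: "Y \<circ> Z = id"
  shows "det (mat N N (\<lambda>(a, b). ent Y a b)) \<noteq> 0"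
proof -
  let ?M = "\<lambda>Y. mat N N (\<lambda>(a, b). ent Y a b)"
  have "?M Y * ?M Z = 1\<^sub>m N"
  proof (rule eq_matI)
    fix a b assume "a < dim_row (1\<^sub>m N :: 'f mat)" "b < dim_col (1\<^sub>m N :: 'f mat)"
    then have ab: "a < N" "b < N" by auto
    have "bv b = Y (Z (bv b))" using fun_cong[OF YZ, of "bv b"] by simp
    also have "\<dots> = (\<Sum>k<N. fmulV D (ent Z k b) (Y (bv k)))"
      using Flin_sum[OF Y, of "vc (Z (bv b))" bv "{..<N}"] vc_expand[of "Z (bv b)"] by (simp add: ent_def)
    finally have "vc (bv b) a = vc (\<Sum>k<N. fmulV D (ent Z k b) (Y (bv k))) a" by (rule arg_cong)
    also have "\<dots> = (\<Sum>k<N. ent Z k b * ent Y a k)" unfolding vc_sum[OF ab(1)] ent_def ..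
    finally have "vc (bv b) a = (\<Sum>k<N. ent Z k b * ent Y a k)" .
    then show "(?M Y * ?M Z) $$ (a, b) = 1\<^sub>m N $$ (a, b)"
      using ab by (simp add: scalar_prod_def vc_bv atLeast0LessThan mult.commute)
  qed auto
  then have "det (?M Y) * det (?M Z) = 1" using det_mult[of "?M Y" N "?M Z"] by simp
  then show ?thesis by auto
qed

text \<open>A power of \<pi> moves Y into \<open>T\<close>, hence into \<open>T0\<close>, so
  \<open>Bs\<close> spans the kernel of \<open>psi\<close> on all K-linear maps and not just its
  lattice.\<close>

lemma psi_kernel_span: "lin Y \<Longrightarrow> psi D Y = 0 \<Longrightarrow> Y \<in> E.span Bs"
proof -
  assume Y: "lin Y" and p: "psi D Y = 0"
  obtain s where s: "scE (\<pi> ^ s) Y \<in> M'" using pi_power_into_M'[OF Y] by blast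
  obtain t where t: "scE (\<pi> ^ t) ` M' \<subseteq> T" using pi_M'_T by blast
  have "scE (\<pi> ^ t) (scE (\<pi> ^ s) Y) \<in> T" using t s by blast
  moreover have "psi D (scE (\<pi> ^ t) (scE (\<pi> ^ s) Y)) = 0" unfolding psi_scE p by (simp add: fun_eq_iff)
  ultimately have "scE (\<pi> ^ t) (scE (\<pi> ^ s) Y) \<in> T0" by (simp add: T0_def)
  then have "scE (inverse (\<pi> ^ t * \<pi> ^ s)) (scE (\<pi> ^ t) (scE (\<pi> ^ s) Y)) \<in> E.span Bs"
    by (intro E.span_scale[OF subsetD[OF Bs(4)]])
  moreover have "scE (inverse (\<pi> ^ t * \<pi> ^ s)) (scE (\<pi> ^ t) (scE (\<pi> ^ s) Y)) = Y"
  proof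
    fix v
    have "inverse (\<pi> ^ t * \<pi> ^ s) * (\<pi> ^ t * \<pi> ^ s) = 1" by (rule left_inverse) (simp add: pi_nz)
    then show "scE (inverse (\<pi> ^ t * \<pi> ^ s)) (scE (\<pi> ^ t) (scE (\<pi> ^ s) Y)) v = Y v"
      unfolding V.scale_scale by (simp only: mult.assoc V.scale_one)
  qed
  ultimately show ?thesis by argo
qed

text \<open>The base point of the Cayley parametrization is multiplication by \<open>- cc\<close>:
  its image under \<open>psi\<close> is - h because \<open>cc\<close> has trace one. It is
  invertible, and so is its sum with the identity, which is multiplication by \<sigma>
  \<open>cc\<close>. The directions are the members of \<open>Bs\<close>.\<close>

lemma G_dim_eq: "G_dim D = card Bs"
proof -
  define d where "d = card Bs"
  define M where "M = length (basisK D)"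
  obtain g where g: "bij_betw g {..<d} Bs"
    using ex_bij_betw_nat_finite[OF Bs(1)] by (auto simp: d_def atLeast0LessThan)
  have gB: "g i \<in> Bs" if "i < d" for i using g that by (auto simp: bij_betw_def)
  have gprop: "lin (g i)" "psi D (g i) = 0" if "i < d" for i
    using gB[OF that] Bs(3) T_lin by (auto simp: T0_def)
  interpret vp: vector_space_pair scE "\<lambda>(a :: 'f) (x :: 'f). a * x"
    by unfold_locales (auto simp: algebra_simps)
  \<comment> \<open>The dual functionals are extended to all functions on V so that they can be
    evaluated on matrix units, which need not be K-linear.\<close>
  have "\<exists>\<phi>. Vector_Spaces.linear scE (\<lambda>(a :: 'f) (x :: 'f). a * x) \<phi> \<and> (\<forall>x\<in>Bs. \<phi> x = (if x = g i then 1 else 0))" for i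
    by (rule vp.linear_independent_extend[OF Bs(2)])
  then obtain \<phi> where \<phi>: "\<And>i. Vector_Spaces.linear scE (\<lambda>(a :: 'f) (x :: 'f). a * x) (\<phi> i)"
    "\<And>i x. x \<in> Bs \<Longrightarrow> \<phi> i x = (if x = g i then 1 else 0)" by metis
  have \<phi>g: "\<phi> i (g j) = (if i = j then 1 else 0)" if "i < d" "j < d" for i j
    using \<phi>(2)[OF gB[OF that(2)], of i] g that by (auto simp: bij_betw_def inj_on_def)
  define \<Lambda> where "\<Lambda> = (\<lambda>i a b. \<phi> i (unit_endo a b))"
  have \<phi>endo: "(\<Sum>a<N. \<Sum>b<N. \<Lambda> i a b * W a b) = \<phi> i (endo W)" for i W
  proof -
    interpret l: Vector_Spaces.linear scE "\<lambda>(a :: 'f) (x :: 'f). a * x" "\<phi> i" by (rule \<phi>(1))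
    show ?thesis unfolding endo_eq l.sum l.scale \<Lambda>_def by (simp add: mult.commute)
  qed
  define Y0 where "Y0 = (\<lambda>v. - r v cc)"
  obtain c' where c': "cc * c' = 1" "c' * cc = 1" using cc(3) by blast
  have c'_comm: "c' * x = x * c'" for x
  proof -
    have "c' * x = c' * (x * (cc * c'))" by (simp add: c')
    also have "\<dots> = c' * (cc * x) * c'" by (simp only: cc(1) mult.assoc)
    also have "\<dots> = x * c'" using c'(2) by (simp add: mult.assoc[symmetric])
    finally show ?thesis .
  qed
  have linc: "lin (\<lambda>v. r v x)" if "\<And>y. x * y = y * x" for x using lin_central[OF lin_id(2) that] by simp
  have lin_neg: "lin (\<lambda>v. - r v x)" if "\<And>y. x * y = y * x" for x
    using linc[OF that] unfolding K_linear_def by (simp add: r_uminus_l)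
  have \<sigma>_comm: "\<sigma> x * y = y * \<sigma> x" if "\<And>y. x * y = y * x" for x y
    using that[of "\<sigma> y"] by (metis \<sigma>_\<sigma> \<sigma>_mult)
  have linY0: "lin Y0" unfolding Y0_def by (rule lin_neg) (rule cc(1))
  have Y0_inv: "Y0 \<circ> (\<lambda>v. - r v c') = id"
    by (simp add: Y0_def fun_eq_iff r_uminus_l r_mult[symmetric] c' r_1)
  have Y1: "id + Y0 = (\<lambda>v. r v (\<sigma> cc))"
  proof
    fix v
    have "r v (\<sigma> cc) + r v cc = v" unfolding r_add_r[symmetric] using cc(2) by (simp add: add.commute r_1)
    then show "(id + Y0) v = r v (\<sigma> cc)" by (simp add: Y0_def algebra_simps)
  qed
  have Y1_inv: "(id + Y0) \<circ> (\<lambda>v. r v (\<sigma> c')) = id"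
    unfolding Y1 by (simp add: fun_eq_iff r_mult[symmetric] \<sigma>_mult[symmetric] c' \<sigma>_1 r_1)
  have skew0: "mat_skew N 0 (ent Y) J" if Y: "lin Y" "psi D Y = 0" and J: "J \<in> gram_mat D ` {..<M}" for Y J
  proof -
    obtain l where l: "l < M" "J = gram_mat D l" using J by auto
    have "kc 0 l = 0" using kc_fmulK[of l 0 0] l(1) by (simp add: M_def)
    then show ?thesis
      using Y(2) l mat_skew_ent[OF lin_Flin[OF Y(1)], of l 0] by (simp add: M_def)
  qed
  have comm: "mat_commutes N (ent Y) R" if "lin Y" "R \<in> range (rmul_mat D)" for Y R
    using that mat_commutes_ent[OF lin_Flin[OF that(1)]] lin_r[OF that(1)] by auto
  have "krull_dim (zariski N {g \<in> carrier_mat N N. invertible_mat g \<and>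
      (\<forall>R\<in>map_mat to_ac ` range (rmul_mat D). g * R = R * g) \<and>
      (\<forall>J\<in>map_mat to_ac ` gram_mat D ` {..<M}. transpose_mat g * J * g = J)}) = d"
  proof (rule krull_dim_isometry_group[where W = "\<lambda>i. ent (g i)" and \<Lambda> = \<Lambda> and ?Z0.0 = "ent Y0"])
    show "infinite (UNIV :: 'f set)" by (rule infinite_field)
    show "range (rmul_mat D) \<subseteq> carrier_mat N N" "gram_mat D ` {..<M} \<subseteq> carrier_mat N N"
      using rmul_mat_carrier gram_mat_carrier by auto
    show "mat_commutes N (ent (g i)) R" if "i < d" "R \<in> range (rmul_mat D)" for i R
      by (rule comm[OF gprop(1)[OF that(1)] that(2)])
    show "mat_skew N 0 (ent (g i)) J" if "i < d" "J \<in> gram_mat D ` {..<M}" for i J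
      by (rule skew0[OF gprop[OF that(1)] that(2)])
    show "(\<Sum>a<N. \<Sum>b<N. \<Lambda> i a b * ent (g j) a b) = (if i = j then 1 else 0)" if "i < d" "j < d" for i j
      unfolding \<phi>endo endo_ent[OF lin_Flin[OF gprop(1)[OF that(2)]]] by (rule \<phi>g[OF that])
    show "mat_commutes N (ent Y0) R" if "R \<in> range (rmul_mat D)" for R by (rule comm[OF linY0 that])
    show "mat_skew N 1 (ent Y0) J" if J: "J \<in> gram_mat D ` {..<M}" for J
    proof -
      obtain l where l: "l < M" "J = gram_mat D l" using J by auto
      have "psi D Y0 v w + h v w = 0" for v w
      proof -
        have "h v (r w cc) + h (r v cc) w = h v w"
          unfolding h_r_l h_r_r cc(1)[symmetric] distrib_right[symmetric] cc(2) by simp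
        moreover have "psi D Y0 v w = - (h v (r w cc) + h (r v cc) w)"
          using herm_fmulV_l[OF herm_h, of "-1" "r v cc" w] herm_fmulV_r[OF herm_h, of v "-1" "r w cc"]
          by (simp add: psi_def Y0_def)
        ultimately show ?thesis by simp
      qed
      moreover have "kc 0 l = 0" using kc_fmulK[of l 0 0] l(1) by (simp add: M_def)
      ultimately show ?thesis using l mat_skew_ent[OF lin_Flin[OF linY0], of l 1] by (simp add: M_def)
    qed
    show "det (mat N N (\<lambda>(a, b). ent Y0 a b)) \<noteq> 0"
      by (rule det_ent_nonzero[OF _ _ Y0_inv]) (intro lin_Flin linY0 lin_neg c'_comm)+
    have "mat N N (\<lambda>(a, b). ent Y0 a b) + 1\<^sub>m N = mat N N (\<lambda>(a, b). ent (id + Y0) a b)"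
      by (rule eq_matI) (auto simp: ent_def vc_add vc_bv add.commute)
    moreover have "det (mat N N (\<lambda>(a, b). ent (id + Y0) a b)) \<noteq> 0"
      by (rule det_ent_nonzero[OF _ _ Y1_inv])
        (intro lin_Flin lin_plus lin_id linY0 linc \<sigma>_comm c'_comm)+
    ultimately show "det (mat N N (\<lambda>(a, b). ent Y0 a b) + 1\<^sub>m N) \<noteq> 0" by simp
    fix V :: "nat \<Rightarrow> nat \<Rightarrow> 'f"
    assume Vc: "\<forall>R\<in>range (rmul_mat D). mat_commutes N V R"
      and Vs: "\<forall>J\<in>gram_mat D ` {..<M}. mat_skew N 0 V J"
      and V\<Lambda>: "\<forall>i<d. (\<Sum>a<N. \<Sum>b<N. \<Lambda> i a b * V a b) = 0"
    \<comment> \<open>The homogeneous system puts \<open>endo V\<close> in the Lie algebra, and the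
      functionals read off its coordinates in \<open>Bs\<close>, all of which are zero.\<close>
    define Y where "Y = endo V"
    have Y: "Flin Y" unfolding Y_def by (rule Flin_endo)
    have VY: "V a b = ent Y a b" if "a < N" "b < N" for a b using ent_endo[OF that] by (simp add: Y_def)
    have sums: "(\<Sum>k<N. V a k * f k) = (\<Sum>k<N. ent Y a k * f k)" "(\<Sum>k<N. f k * V k a) = (\<Sum>k<N. f k * ent Y k a)"
      "(\<Sum>k<N. V k a * f k) = (\<Sum>k<N. ent Y k a * f k)" if "a < N" for a f
      using that by (auto intro!: sum.cong simp: VY)
    have cong1: "mat_commutes N V R = mat_commutes N (ent Y) R" for R
      unfolding mat_commutes_def by (simp add: sums)
    have cong2: "mat_skew N c V J = mat_skew N c (ent Y) J" for c J
      unfolding mat_skew_def by (simp add: sums)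
    have linY: "lin Y" unfolding K_linear_def
    proof (intro conjI allI)
      show "Y (v + w) = Y v + Y w" for v w using Y by (simp add: Flin_def)
      fix v x
      have Yb: "Y (r (bv b) x) = r (Y (bv b)) x" if "b < N" for b
        using Vc cong1 mat_commutes_ent[OF Y] that by blast
      have "Y (r v x) = Y (\<Sum>b<N. fmulV D (vc v b) (r (bv b) x))"
        using arg_cong[OF vc_expand[of v], of "\<lambda>v. r v x"] by (simp add: r_sum_l r_fmulV)
      also have "\<dots> = (\<Sum>b<N. fmulV D (vc v b) (r (Y (bv b)) x))" unfolding Flin_sum[OF Y] using Yb by simp
      also have "\<dots> = r (Y (\<Sum>b<N. fmulV D (vc v b) (bv b))) x" unfolding Flin_sum[OF Y] by (simp add: r_sum_l r_fmulV)
      also have "\<dots> = r (Y v) x" by (simp only: vc_expand[symmetric])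
      finally show "Y (r v x) = r (Y v) x" .
    qed
    have psib: "psi D Y (bv a) (bv b) = 0" if "a < N" "b < N" for a b
    proof (rule kc_zero_imp)
      fix l assume l: "l < length (basisK D)"
      then have "mat_skew N 0 (ent Y) (gram_mat D l)" using Vs cong2 by (auto simp: M_def)
      then show "kc (psi D Y (bv a) (bv b)) l = 0" using mat_skew_ent[OF Y l, of 0] that by simp
    qed
    have "psi D Y v w = 0" for v w
    proof -
      have pa: "psi D Y (v + v') w = psi D Y v w + psi D Y v' w" "psi D Y w (v + v') = psi D Y w v + psi D Y w v'"
        "psi D Y (fmulV D a v) w = fmulK D a (psi D Y v w)" "psi D Y w (fmulV D a v) = fmulK D a (psi D Y w v)" for v v' w a
        by (simp_all add: psi_def lin_add[OF linY] lin_fmulV[OF linY] h_add_l h_add_r h_fmulV_l h_fmulV_r K.scale_right_distrib)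
      have p0: "psi D Y 0 w = 0" "psi D Y w 0 = 0" for w
        by (simp_all add: psi_def lin_0[OF linY] herm_0_l[OF herm_h] herm_0_r[OF herm_h])
      have 1: "psi D Y (\<Sum>j<m. fmulV D (c j) (f j)) w = (\<Sum>j<m. fmulK D (c j) (psi D Y (f j) w))" for m :: nat and c f w
        by (induction m) (auto simp: p0 pa)
      have 2: "psi D Y w (\<Sum>j<m. fmulV D (c j) (f j)) = (\<Sum>j<m. fmulK D (c j) (psi D Y w (f j)))" for m :: nat and c f w
        by (induction m) (auto simp: p0 pa)
      have "psi D Y (\<Sum>a<N. fmulV D (vc v a) (bv a)) (\<Sum>b<N. fmulV D (vc w b) (bv b)) = 0"
        unfolding 1 2 using psib by simp
      then show ?thesis by (simp only: vc_expand[symmetric])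
    qed
    then have "psi D Y = 0" by (simp add: fun_eq_iff)
    then have "Y \<in> E.span Bs" by (rule psi_kernel_span[OF linY])
    then obtain u where u: "Y = (\<Sum>x\<in>Bs. scE (u x) x)" using E.span_finite[OF Bs(1)] by auto
    have "u x = 0" if x: "x \<in> Bs" for x
    proof -
      obtain i where i: "i < d" "x = g i" using g x by (auto simp: bij_betw_def)
      interpret l: Vector_Spaces.linear scE "\<lambda>(a :: 'f) (x :: 'f). a * x" "\<phi> i" by (rule \<phi>(1))
      have "\<phi> i Y = (\<Sum>y\<in>Bs. if y = x then u y else 0)"
        unfolding u l.sum l.scale by (intro sum.cong) (auto simp: \<phi>(2) i(2))
      also have "\<dots> = u x" using x Bs(1) by simp
      finally show ?thesis using V\<Lambda> i(1) \<phi>endo by (simp add: Y_def)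
    qed
    then have "Y = 0" unfolding u by (simp add: fun_eq_iff sum_fun_apply)
    then have "ent Y a b = 0" if "a < N" "b < N" for a b using vc_fmulV[of a 0 0] that by (simp add: ent_def)
    then show "\<forall>a<N. \<forall>b<N. V a b = 0" using VY by simp
  qed
  moreover have "{g \<in> carrier_mat N N. invertible_mat g \<and>
      (\<forall>R\<in>map_mat to_ac ` range (rmul_mat D). g * R = R * g) \<and>
      (\<forall>J\<in>map_mat to_ac ` gram_mat D ` {..<M}. transpose_mat g * J * g = J)} = G_bar D"
    by (auto simp: G_bar_def M_def)
  ultimately show ?thesis by (simp add: G_dim_def G_topology_def d_def)
qed

end


section \<open>The local density\<close>

theorem theorem4p3:
  fixes D :: "('f::field, 'k::ring_1, 'v::ab_group_add) herm_data" and n :: nat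
  assumes "hermitian_lattice D n"
    and "\<not> (quaternion_case D \<and> CHAR('f) = 2)"
  shows "finite (quot (endos D) (T_tilde D)) \<and> finite (quot (herm_forms D) (H_tilde D)) \<and>
    convergent (density_seq D) \<and>
    (\<exists>N :: int.
       real (residue_card D) powi N =
         real (card (quot (herm_forms D) (H_tilde D))) / real (card (quot (endos D) (T_tilde D))) \<and>
       local_density D =
         1 / real (G_component_index D) * real (residue_card D) powi N *
         real (residue_card D) powi (- int (G_dim D)) * real (card (special_fiber_points D)))"
proof -
  interpret hermitian D n by unfold_locales (fact assms)+
  let ?q = "real q" and ?M = "card (quot M' T)" and ?H = "card (quot H' HT)"
  let ?lim = "?q powi (- int (G_dim D)) * (real ?H / real ?M * real (card (special_fiber_points D)))"
  have q0: "?q \<noteq> 0" using q_gt_1 by simp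
  \<comment> \<open>Both indices are powers of q, so the exponent N = b - a is an integer.\<close>
  obtain a where a: "?M = q ^ a"
    using E.card_quot_power[OF submod_M' submod_T T_sub_M' finite_quot_M'_T] by blast
  obtain b where b: "?H = q ^ b"
    using H.card_quot_power[OF submod_H' submod_HT HT_sub_H' finite_quot_H'_HT] by blast
  have M0: "real ?M \<noteq> 0" using a q0 by simp
  have const: "density_seq D k = ?lim" if k: "k \<ge> 4 * kb + 1" for k
  proof -
    obtain j where j: "k = Suc j" using k by (cases k) auto
    have "real (card (Aut_mod D k)) * real ?M = real ?H * real (card (special_fiber_points D)) * ?q ^ (j * G_dim D)"
      using arg_cong[OF card_Aut_mod_eq[OF k], of real] by (simp add: j G_dim_eq)
    then have "real (card (Aut_mod D k)) = ?q ^ (j * G_dim D) * (real ?H / real ?M * real (card (special_fiber_points D)))"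
      using M0 by (simp add: field_simps)
    \<comment> \<open>The count carries q^((k - 1) d) and the normalization q^(- k d), where d is
      the dimension; the difference is the factor q^(- d) of the formula.\<close>
    moreover have "?q powi (- (int k * int (G_dim D))) * ?q ^ (j * G_dim D) = ?q powi (- int (G_dim D))"
    proof -
      have "?q powi (- (int k * int (G_dim D))) * ?q powi (int (j * G_dim D)) =
        ?q powi (- (int k * int (G_dim D)) + int (j * G_dim D))"
        by (rule power_int_add[symmetric]) (use q0 in simp)
      also have "- (int k * int (G_dim D)) + int (j * G_dim D) = - int (G_dim D)"
        by (simp add: j algebra_simps)
      finally show ?thesis by (simp only: power_int_of_nat)
    qed
    ultimately show ?thesis unfolding density_seq_def by (simp add: mult.assoc[symmetric])
  qed
  have "eventually (\<lambda>k. density_seq D k = ?lim) sequentially"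
    unfolding eventually_sequentially using const by blast
  then have tendsto: "density_seq D \<longlonglongrightarrow> ?lim" by (rule tendsto_eventually)
  have "?q powi (int b - int a) = real ?H / real ?M"
    using q0 by (simp add: a b power_int_diff)
  moreover have "local_density D = 1 / real (G_component_index D) * ?q powi (int b - int a) *
    ?q powi (- int (G_dim D)) * real (card (special_fiber_points D))"
    unfolding local_density_def limI[OF tendsto] calculation by simp
  ultimately show ?thesis
    using finite_quot_M'_T finite_quot_H'_HT tendsto by (auto simp: convergent_def)
qed


end
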